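(* Let $k_1,k_2,h\in\mathrm{Supp}_{BV}(Q)$ and let $F,G\in\mathcal S(L_2(Q))$ with corresponding measures $f,g\in\mathcal M(L_2(Q))$. Assume that $h^2=k_1k_2$ $m_L^2$-a.e. on $Q$. For $j\in\{1,2\}$ let $\mathbf s(h,k_j)$ be a function in $\mathrm{Supp}_{BV}(Q)$ with $\mathbf s(h,k_j)^2=h^2+k_j^2$ $m_L^2$-a.e. on $Q$. Then, for all nonzero real $q$, $$\Big(T_{q,\mathbf s(h,k_1)/\sqrt2}^{(1)}(F)*T_{q,\mathbf s(h,k_2)/\sqrt2}^{(1)}(G)\Big)_{-q}^{(k_1,k_2)}(y)=T_{q,h}^{(1)}\Big(F\Big(\frac{\cdot}{\sqrt2}\Big)G\Big(\frac{\cdot}{\sqrt2}\Big)\Big)(y)$$ for s-a.e. $y\in C_0(Q)$. In particular, $$\Big(T_{q,h}^{(1)}(F)*T_{q,h}^{(1)}(G)\Big)_{-q}^{(h,h)}(y)=T_{q,h}^{(1)}\Big(F\Big(\frac{\cdot}{\sqrt2}\Big)G\Big(\frac{\cdot}{\sqrt2}\Big)\Big)(y)$$ for s-a.e. $y\in C_0(Q)$.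
   Context: Fix $S,T>0$, let $Q=[0,S]\times[0,T]$, $m_L^2$ = Lebesgue measure on $Q$, and $L_2(Q)$ the real Hilbert space with inner product $(\cdot,\cdot)_2$ and norm $\|\cdot\|_2$. $C_0(Q)$ is the space of real continuous $x$ on $Q$ with $x(s,0)=x(0,t)=0$, with (completed) Yeh--Wiener measure $m_{\mathrm y}$, i.e. the centered Gaussian measure with $\int x(s,t)x(s',t')\,dm_{\mathrm y}(x)=\min(s,s')\min(t,t')$. A set $E$ is scale-invariant measurable if $\rho E$ is measurable for every $\rho>0$, a scale-invariant measurable set $N$ is scale-invariant null if $m_{\mathrm y}(\rho N)=0$ for every $\rho>0$; "s-a.e." means off a scale-invariant null set. A functional $F$ is scale-invariant measurable if it is defined on a scale-invariant measurable set and $F(\rho\,\cdot)$ is measurable for every $\rho>0$. PWZ integral: fix a complete orthonormal set $\{\phi_n\}$ of $L_2(Q)$ consisting of functions of bounded variation (Hardy--Krause sense); for $v\in L_2(Q)$, $\langle v,x\rangle=\lim_{n}\int_Q\sum_{j=1}^n(v,\phi_j)_2\phi_j\,dx$ where the limit exists (it exists for s-a.e. $x$ and is essentially independent of $\{\phi_n\}$). $\mathrm{Supp}_{BV}(Q)$ is the set of real functions $h$ on $Q$ of bounded variation (Hardy--Krause sense) with $h\neq0$ $m_L^2$-a.e. For such $h$, $\mathcal Y_h(x;s,t)=\langle\chi_{[0,s]\times[0,t]}h,x\rangle$; its sample paths $\mathcal Y_h(x;\cdot,\cdot)$ lie in $C_0(Q)$. $\mathcal M(L_2(Q))$ is the space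 of complex countably additive Borel measures on $L_2(Q)$. $\mathcal S(L_2(Q))$ is the set of functionals $F$ on $C_0(Q)$ of the form $F(x)=\int_{L_2(Q)}\exp\{i\langle u,x\rangle\}df(u)$ for s-a.e. $x$, for some $f\in\mathcal M(L_2(Q))$. Evaluation along Gaussian paths uses this formula together with $\langle u,\mathcal Y_h(x;\cdot,\cdot)\rangle=\langle uh,x\rangle$, i.e. for real $b,c$, $F(by+c\mathcal Y_h(x;\cdot,\cdot))=\int\exp\{ib\langle u,y\rangle+ic\langle uh,x\rangle\}df(u)$. $F(\cdot/\sqrt2)G(\cdot/\sqrt2)$ denotes the functional $x\mapsto F(x/\sqrt2)G(x/\sqrt2)$. Transform: let $\mathbb C_+=\{\mathrm{Re}\,\lambda>0\}$ and $h\in\mathrm{Supp}_{BV}(Q)$. $T_{\lambda,h}(F)(y)$, $\lambda\in\mathbb C_+$, is the analytic continuation to $\mathbb C_+$ (if it exists) of $\lambda\mapsto\int_{C_0(Q)}F(y+\lambda^{-1/2}\mathcal Y_h(x;\cdot,\cdot))dm_{\mathrm y}(x)$, $\lambda>0$. For real $q\ne0$, $T_{q,h}^{(1)}(F)(y)=\lim_{\lambda\to-iq,\,\lambda\in\mathbb C_+}T_{\lambda,h}(F)(y)$ for s-a.e. $y$, whenever this limit exists. For $F\in\mathcal S(L_2(Q))$ it exists and belongs to $\mathcal S(L_2(Q))$. Convolution product: for $k_1,k_2\in\mathrm{Supp}_{BV}(Q)$ and real $q\neq0$, $(F*G)_q^{(k_1,k_2)}(y)$ is the limit as $\lambda\to-iq$,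 $\lambda\in\mathbb C_+$, of the analytic continuation to $\mathbb C_+$ of $$\lambda\mapsto\int_{C_0(Q)}F\Big(\tfrac{y+\lambda^{-1/2}\mathcal Y_{k_1}(x;\cdot,\cdot)}{\sqrt2}\Big)G\Big(\tfrac{y-\lambda^{-1/2}\mathcal Y_{k_2}(x;\cdot,\cdot)}{\sqrt2}\Big)dm_{\mathrm y}(x),\quad\lambda>0,$$ if it exists. For $F,G\in\mathcal S(L_2(Q))$ this product exists for s-a.e. $y$ and belongs to $\mathcal S(L_2(Q))$. *)

theory Defs
  imports "HOL-Probability.Probability"
begin

section \<open>The rectangle and its real \<open>L\<^sub>2\<close> space\<close>

text \<open>The positive parameters \<open>S\<close> and \<open>T\<close> are the side lengths of the rectangle.\<close>

definition rect :: "real \<Rightarrow> real \<Rightarrow> (real \<times> real) set" where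
  "rect S T = {0..S} \<times> {0..T}"

abbreviation leb :: "real \<Rightarrow> real \<Rightarrow> (real \<times> real) measure" where
  "leb S T \<equiv> lebesgue_on (rect S T)"

text \<open>
  Elements of \<open>L\<^sub>2\<close> are represented by square integrable functions, so \<open>L2_norm\<close> is only a
  seminorm on \<open>L2_set\<close>, vanishing exactly on the functions that are zero almost everywhere (values
  outside the rectangle play no role). Every open set of the seminorm topology is a union of classes
  of almost everywhere equal functions; hence so is every set of the sigma-algebra \<open>L2_borel\<close>, and
  measures on \<open>L2_borel\<close> are the same thing as Borel measures on the Hilbert space of classes.
\<close>

definition L2_set :: "real \<Rightarrow> real \<Rightarrow> (real \<times> real \<Rightarrow> real) set" where
  "L2_set S T = {u. u \<in> borel_measurable (leb S T) \<and> integrable (leb S T) (\<lambda>p. (u p)\<^sup>2)}"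

definition L2_inner :: "real \<Rightarrow> real \<Rightarrow> (real \<times> real \<Rightarrow> real) \<Rightarrow> (real \<times> real \<Rightarrow> real) \<Rightarrow> real" where
  "L2_inner S T u v = (LINT p|leb S T. u p * v p)"

definition L2_norm :: "real \<Rightarrow> real \<Rightarrow> (real \<times> real \<Rightarrow> real) \<Rightarrow> real" where
  "L2_norm S T u = sqrt (L2_inner S T u u)"

definition L2_open :: "real \<Rightarrow> real \<Rightarrow> (real \<times> real \<Rightarrow> real) set \<Rightarrow> bool" where
  "L2_open S T U \<longleftrightarrow> U \<subseteq> L2_set S T \<and>
     (\<forall>u\<in>U. \<exists>r>0. \<forall>v\<in>L2_set S T. L2_norm S T (\<lambda>p. v p - u p) < r \<longrightarrow> v \<in> U)"

definition L2_borel :: "real \<Rightarrow> real \<Rightarrow> (real \<times> real \<Rightarrow> real) measure" where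
  "L2_borel S T = sigma (L2_set S T) {U. L2_open S T U}"


section \<open>Complex measures\<close>

text \<open>
  A complex measure on the measurable space \<open>M\<close> (whose own measure is irrelevant) is a countably
  additive set function; only its values on \<open>sets M\<close> matter. Convergence of the constant sequence
  of empty sets forces the value \<open>0\<close> at the empty set.
\<close>

definition complex_measure :: "'a measure \<Rightarrow> ('a set \<Rightarrow> complex) \<Rightarrow> bool" where
  "complex_measure M f \<longleftrightarrow>
     (\<forall>A. range A \<subseteq> sets M \<longrightarrow> disjoint_family A \<longrightarrow> (\<lambda>n::nat. f (A n)) sums f (\<Union>n. A n))"

text \<open>
  Positive part of the Jordan decomposition of a real signed measure; \<open>ennreal\<close> truncates
  negative values to \<open>0\<close>, which is also the contribution of the empty set.
\<close>

definition jordan_pos :: "'a measure \<Rightarrow> ('a set \<Rightarrow> real) \<Rightarrow> 'a measure" where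
  "jordan_pos M \<nu> =
     measure_of (space M) (sets M) (\<lambda>A. SUP B\<in>{B \<in> sets M. B \<subseteq> A}. ennreal (\<nu> B))"

definition cm_integral :: "'a measure \<Rightarrow> ('a set \<Rightarrow> complex) \<Rightarrow> ('a \<Rightarrow> complex) \<Rightarrow> complex" where
  "cm_integral M f \<psi> =
     ((LINT u|jordan_pos M (\<lambda>A. Re (f A)). \<psi> u) - (LINT u|jordan_pos M (\<lambda>A. - Re (f A)). \<psi> u))
     + \<i> * ((LINT u|jordan_pos M (\<lambda>A. Im (f A)). \<psi> u) - (LINT u|jordan_pos M (\<lambda>A. - Im (f A)). \<psi> u))"


section \<open>Functions of bounded variation on the rectangle\<close>

definition grid :: "real \<Rightarrow> nat \<Rightarrow> (nat \<Rightarrow> real) \<Rightarrow> bool" where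
  "grid c m a \<longleftrightarrow> a 0 = 0 \<and> a m = c \<and> (\<forall>i<m. a i < a (Suc i))"

definition rect_incr :: "(real \<times> real \<Rightarrow> real) \<Rightarrow> (nat \<Rightarrow> real) \<Rightarrow> (nat \<Rightarrow> real) \<Rightarrow> nat \<Rightarrow> nat \<Rightarrow> real" where
  "rect_incr x a b i j =
     x (a (Suc i), b (Suc j)) - x (a i, b (Suc j)) - x (a (Suc i), b j) + x (a i, b j)"

definition bv1 :: "real \<Rightarrow> (real \<Rightarrow> real) \<Rightarrow> bool" where
  "bv1 c w \<longleftrightarrow> (\<exists>B. \<forall>m a. grid c m a \<longrightarrow> (\<Sum>i<m. \<bar>w (a (Suc i)) - w (a i)\<bar>) \<le> B)"

text \<open>
  Hardy--Krause bounded variation: finite Vitali variation, and sections of bounded variation.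
  (Given the former, one section in each direction suffices for all of them.)
\<close>

definition bv_HK :: "real \<Rightarrow> real \<Rightarrow> (real \<times> real \<Rightarrow> real) \<Rightarrow> bool" where
  "bv_HK S T w \<longleftrightarrow>
     (\<exists>B. \<forall>m n a b. grid S m a \<longrightarrow> grid T n b \<longrightarrow>
        (\<Sum>i<m. \<Sum>j<n. \<bar>rect_incr w a b i j\<bar>) \<le> B) \<and>
     (\<forall>t\<in>{0..T}. bv1 S (\<lambda>s. w (s, t))) \<and>
     (\<forall>s\<in>{0..S}. bv1 T (\<lambda>t. w (s, t)))"

definition Supp_BV :: "real \<Rightarrow> real \<Rightarrow> (real \<times> real \<Rightarrow> real) set" where
  "Supp_BV S T = {h. bv_HK S T h \<and> (AE p in leb S T. h p \<noteq> 0)}"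


section \<open>Yeh--Wiener space\<close>

text \<open>
  Paths live on the rectangle; they are extended by \<open>0\<close> to the plane so that a path is determined
  by its values on the rectangle and \<open>C0\<close> is closed under the pointwise vector space operations.
\<close>

definition C0 :: "real \<Rightarrow> real \<Rightarrow> (real \<times> real \<Rightarrow> real) set" where
  "C0 S T = {x. continuous_on (rect S T) x \<and> (\<forall>s\<in>{0..S}. x (s, 0) = 0) \<and>
               (\<forall>t\<in>{0..T}. x (0, t) = 0) \<and> (\<forall>p. p \<notin> rect S T \<longrightarrow> x p = 0)}"

text \<open>Centered normal law, possibly degenerate.\<close>

definition centered_normal :: "real measure \<Rightarrow> bool" where
  "centered_normal N \<longleftrightarrow>
     N = return borel 0 \<or> (\<exists>\<sigma>>0. N = density lborel (\<lambda>r. ennreal (normal_density 0 \<sigma> r)))"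

text \<open>
  \<open>yeh_wiener S T m\<close>: \<open>m\<close> is the completion of the centered Gaussian measure \<open>W\<close> on \<open>C0\<close>, with
  the sigma-algebra generated by the point evaluations, whose covariance is the product of minima.
\<close>

definition yeh_wiener :: "real \<Rightarrow> real \<Rightarrow> (real \<times> real \<Rightarrow> real) measure \<Rightarrow> bool" where
  "yeh_wiener S T m \<longleftrightarrow> (\<exists>W.
     m = completion W \<and> prob_space W \<and> space W = C0 S T \<and>
     sets W = sets (restrict_space (Pi\<^sub>M UNIV (\<lambda>_. borel)) (C0 S T)) \<and>
     (\<forall>I a. finite I \<longrightarrow> I \<subseteq> rect S T \<longrightarrow>
        centered_normal (distr W borel (\<lambda>x. \<Sum>p\<in>I. a p * x p))) \<and>
     (\<forall>s\<in>{0..S}. \<forall>t\<in>{0..T}. \<forall>s'\<in>{0..S}. \<forall>t'\<in>{0..T}.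
        (LINT x|W. x (s, t) * x (s', t')) = min s s' * min t t'))"

definition scale_null :: "(real \<times> real \<Rightarrow> real) measure \<Rightarrow> (real \<times> real \<Rightarrow> real) set \<Rightarrow> bool" where
  "scale_null m N \<longleftrightarrow> (\<forall>\<rho>>0. (\<lambda>x p. \<rho> * x p) ` N \<in> null_sets m)"

definition sae :: "(real \<times> real \<Rightarrow> real) measure \<Rightarrow> ((real \<times> real \<Rightarrow> real) \<Rightarrow> bool) \<Rightarrow> bool" where
  "sae m P \<longleftrightarrow> (\<exists>N. scale_null m N \<and> (\<forall>x\<in>space m - N. P x))"


section \<open>The Paley--Wiener--Zygmund integral\<close>

text \<open>
  Double Riemann--Stieltjes integral. The tags form a grid \<open>(\<xi> i, \<eta> j)\<close>. This is essential: with
  tags chosen independently in each cell the integral of a smooth function against a Yeh--Wiener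
  path in general does not exist, whereas with gridded tags summation by parts gives existence for
  every integrand of Hardy--Krause bounded variation and every continuous integrator.
\<close>

definition has_RS_integral ::
  "real \<Rightarrow> real \<Rightarrow> (real \<times> real \<Rightarrow> real) \<Rightarrow> (real \<times> real \<Rightarrow> real) \<Rightarrow> real \<Rightarrow> bool" where
  "has_RS_integral S T w x I \<longleftrightarrow>
     (\<forall>\<epsilon>>0. \<exists>\<delta>>0. \<forall>m n a b \<xi> \<eta>.
        grid S m a \<longrightarrow> grid T n b \<longrightarrow>
        (\<forall>i<m. a (Suc i) - a i < \<delta> \<and> \<xi> i \<in> {a i..a (Suc i)}) \<longrightarrow>
        (\<forall>j<n. b (Suc j) - b j < \<delta> \<and> \<eta> j \<in> {b j..b (Suc j)}) \<longrightarrow>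
        \<bar>(\<Sum>i<m. \<Sum>j<n. w (\<xi> i, \<eta> j) * rect_incr x a b i j) - I\<bar> < \<epsilon>)"

definition RS_integral ::
  "real \<Rightarrow> real \<Rightarrow> (real \<times> real \<Rightarrow> real) \<Rightarrow> (real \<times> real \<Rightarrow> real) \<Rightarrow> real" where
  "RS_integral S T w x = (THE I. has_RS_integral S T w x I)"

definition bv_complete_orthonormal :: "real \<Rightarrow> real \<Rightarrow> (nat \<Rightarrow> real \<times> real \<Rightarrow> real) \<Rightarrow> bool" where
  "bv_complete_orthonormal S T \<phi> \<longleftrightarrow>
     (\<forall>n. \<phi> n \<in> L2_set S T \<and> bv_HK S T (\<phi> n)) \<and>
     (\<forall>i j. L2_inner S T (\<phi> i) (\<phi> j) = (if i = j then 1 else 0)) \<and>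
     (\<forall>u\<in>L2_set S T. (\<forall>n. L2_inner S T u (\<phi> n) = 0) \<longrightarrow> L2_norm S T u = 0)"

text \<open>Where the limit does not exist, the integral is given the value \<open>0\<close>.\<close>

definition pwz ::
  "real \<Rightarrow> real \<Rightarrow> (nat \<Rightarrow> real \<times> real \<Rightarrow> real) \<Rightarrow>
   (real \<times> real \<Rightarrow> real) \<Rightarrow> (real \<times> real \<Rightarrow> real) \<Rightarrow> real" where
  "pwz S T \<phi> v x =
     (let X = (\<lambda>n. RS_integral S T (\<lambda>p. \<Sum>j<n. L2_inner S T v (\<phi> j) * \<phi> j p) x)
      in if convergent X then lim X else 0)"


section \<open>The class of Fourier--Stieltjes functionals\<close>

text \<open>
  From here on \<open>\<phi>\<close> is the orthonormal set defining the PWZ integral and \<open>m\<close> the completed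
  Yeh--Wiener measure. A functional is a function on paths that matters only s-a.e. on \<open>C0\<close>.
  \<open>represents S T \<phi> m f F\<close>: \<open>f\<close> is a measure corresponding to \<open>F\<close>.
\<close>

definition represents ::
  "real \<Rightarrow> real \<Rightarrow> (nat \<Rightarrow> real \<times> real \<Rightarrow> real) \<Rightarrow> (real \<times> real \<Rightarrow> real) measure \<Rightarrow>
   ((real \<times> real \<Rightarrow> real) set \<Rightarrow> complex) \<Rightarrow> ((real \<times> real \<Rightarrow> real) \<Rightarrow> complex) \<Rightarrow> bool" where
  "represents S T \<phi> m f F \<longleftrightarrow>
     complex_measure (L2_borel S T) f \<and>
     sae m (\<lambda>x. F x = cm_integral (L2_borel S T) f (\<lambda>u. exp (\<i> * of_real (pwz S T \<phi> u x))))"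

definition S_class ::
  "real \<Rightarrow> real \<Rightarrow> (nat \<Rightarrow> real \<times> real \<Rightarrow> real) \<Rightarrow> (real \<times> real \<Rightarrow> real) measure \<Rightarrow>
   ((real \<times> real \<Rightarrow> real) \<Rightarrow> complex) set" where
  "S_class S T \<phi> m = {F. \<exists>f. represents S T \<phi> m f F}"

text \<open>
  The corresponding measure is unique as a function on \<open>sets (L2_borel S T)\<close>, so that the choice
  made here does not influence any integral.
\<close>

definition S_measure ::
  "real \<Rightarrow> real \<Rightarrow> (nat \<Rightarrow> real \<times> real \<Rightarrow> real) \<Rightarrow> (real \<times> real \<Rightarrow> real) measure \<Rightarrow>
   ((real \<times> real \<Rightarrow> real) \<Rightarrow> complex) \<Rightarrow> ((real \<times> real \<Rightarrow> real) set \<Rightarrow> complex)" where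
  "S_measure S T \<phi> m F = (SOME f. represents S T \<phi> m f F)"

text \<open>
  \<open>eval_path S T \<phi> m F b y c h x\<close> is the value of \<open>F\<close> at the path \<open>b y + c Y\<^sub>h(x)\<close>, where \<open>Y\<^sub>h(x)\<close>
  is the Gaussian path \<open>(s, t) \<mapsto> pwz (\<chi> h) x\<close> with \<open>\<chi>\<close> the indicator of \<open>[0, s] \<times> [0, t]\<close>.
  The law of \<open>Y\<^sub>h\<close> is in general singular to all scalings of the Yeh--Wiener measure, so a functional
  given only s-a.e. has no pointwise value along such paths. By definition the value is obtained
  from the Fourier representation of \<open>F\<close> and the rule \<open>pwz u (Y\<^sub>h(x)) = pwz (u h) x\<close>.
\<close>

definition eval_path ::
  "real \<Rightarrow> real \<Rightarrow> (nat \<Rightarrow> real \<times> real \<Rightarrow> real) \<Rightarrow> (real \<times> real \<Rightarrow> real) measure \<Rightarrow>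
   ((real \<times> real \<Rightarrow> real) \<Rightarrow> complex) \<Rightarrow> real \<Rightarrow> (real \<times> real \<Rightarrow> real) \<Rightarrow>
   real \<Rightarrow> (real \<times> real \<Rightarrow> real) \<Rightarrow> (real \<times> real \<Rightarrow> real) \<Rightarrow> complex" where
  "eval_path S T \<phi> m F b y c h x =
     cm_integral (L2_borel S T) (S_measure S T \<phi> m F)
       (\<lambda>u. exp (\<i> * of_real b * of_real (pwz S T \<phi> u y)
              + \<i> * of_real c * of_real (pwz S T \<phi> (\<lambda>p. u p * h p) x)))"


section \<open>Transform and convolution product\<close>

text \<open>
  \<open>analytic_limit m J q L\<close>: for all real \<open>l > 0\<close> the functional \<open>J l\<close> is integrable; its integral
  as a function of \<open>l\<close> has an analytic continuation to the right half plane; and this continuation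
  tends to \<open>L\<close> at the boundary point \<open>- i q\<close>.
\<close>

definition analytic_limit ::
  "(real \<times> real \<Rightarrow> real) measure \<Rightarrow> (real \<Rightarrow> (real \<times> real \<Rightarrow> real) \<Rightarrow> complex) \<Rightarrow>
   real \<Rightarrow> complex \<Rightarrow> bool" where
  "analytic_limit m J q L \<longleftrightarrow>
     (\<exists>K. K holomorphic_on {z. Re z > 0} \<and>
          (\<forall>l>0. integrable m (J l) \<and> K (of_real l) = (LINT x|m. J l x)) \<and>
          (K \<longlongrightarrow> L) (at (- \<i> * of_real q) within {z. Re z > 0}))"

text \<open>
  Evaluation along Gaussian paths is only meaningful for functionals in \<open>S_class\<close>, whence the
  membership conditions.
\<close>

definition has_transform ::
  "real \<Rightarrow> real \<Rightarrow> (nat \<Rightarrow> real \<times> real \<Rightarrow> real) \<Rightarrow> (real \<times> real \<Rightarrow> real) measure \<Rightarrow>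
   real \<Rightarrow> (real \<times> real \<Rightarrow> real) \<Rightarrow> ((real \<times> real \<Rightarrow> real) \<Rightarrow> complex) \<Rightarrow>
   (real \<times> real \<Rightarrow> real) \<Rightarrow> complex \<Rightarrow> bool" where
  "has_transform S T \<phi> m q h F y L \<longleftrightarrow>
     F \<in> S_class S T \<phi> m \<and>
     analytic_limit m (\<lambda>l x. eval_path S T \<phi> m F 1 y (l powr (-1/2)) h x) q L"

definition transform ::
  "real \<Rightarrow> real \<Rightarrow> (nat \<Rightarrow> real \<times> real \<Rightarrow> real) \<Rightarrow> (real \<times> real \<Rightarrow> real) measure \<Rightarrow>
   real \<Rightarrow> (real \<times> real \<Rightarrow> real) \<Rightarrow> ((real \<times> real \<Rightarrow> real) \<Rightarrow> complex) \<Rightarrow>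
   (real \<times> real \<Rightarrow> real) \<Rightarrow> complex" where
  "transform S T \<phi> m q h F y = (THE L. has_transform S T \<phi> m q h F y L)"

definition transform_exists ::
  "real \<Rightarrow> real \<Rightarrow> (nat \<Rightarrow> real \<times> real \<Rightarrow> real) \<Rightarrow> (real \<times> real \<Rightarrow> real) measure \<Rightarrow>
   real \<Rightarrow> (real \<times> real \<Rightarrow> real) \<Rightarrow> ((real \<times> real \<Rightarrow> real) \<Rightarrow> complex) \<Rightarrow>
   (real \<times> real \<Rightarrow> real) \<Rightarrow> bool" where
  "transform_exists S T \<phi> m q h F y \<longleftrightarrow> (\<exists>L. has_transform S T \<phi> m q h F y L)"

definition has_conv_product ::
  "real \<Rightarrow> real \<Rightarrow> (nat \<Rightarrow> real \<times> real \<Rightarrow> real) \<Rightarrow> (real \<times> real \<Rightarrow> real) measure \<Rightarrow>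
   real \<Rightarrow> (real \<times> real \<Rightarrow> real) \<Rightarrow> (real \<times> real \<Rightarrow> real) \<Rightarrow>
   ((real \<times> real \<Rightarrow> real) \<Rightarrow> complex) \<Rightarrow> ((real \<times> real \<Rightarrow> real) \<Rightarrow> complex) \<Rightarrow>
   (real \<times> real \<Rightarrow> real) \<Rightarrow> complex \<Rightarrow> bool" where
  "has_conv_product S T \<phi> m q k1 k2 F G y L \<longleftrightarrow>
     F \<in> S_class S T \<phi> m \<and> G \<in> S_class S T \<phi> m \<and>
     analytic_limit m
       (\<lambda>l x. eval_path S T \<phi> m F (1 / sqrt 2) y (l powr (-1/2) / sqrt 2) k1 x *
              eval_path S T \<phi> m G (1 / sqrt 2) y (- (l powr (-1/2)) / sqrt 2) k2 x) q L"

definition conv_product ::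
  "real \<Rightarrow> real \<Rightarrow> (nat \<Rightarrow> real \<times> real \<Rightarrow> real) \<Rightarrow> (real \<times> real \<Rightarrow> real) measure \<Rightarrow>
   real \<Rightarrow> (real \<times> real \<Rightarrow> real) \<Rightarrow> (real \<times> real \<Rightarrow> real) \<Rightarrow>
   ((real \<times> real \<Rightarrow> real) \<Rightarrow> complex) \<Rightarrow> ((real \<times> real \<Rightarrow> real) \<Rightarrow> complex) \<Rightarrow>
   (real \<times> real \<Rightarrow> real) \<Rightarrow> complex" where
  "conv_product S T \<phi> m q k1 k2 F G y = (THE L. has_conv_product S T \<phi> m q k1 k2 F G y L)"

definition conv_product_exists ::
  "real \<Rightarrow> real \<Rightarrow> (nat \<Rightarrow> real \<times> real \<Rightarrow> real) \<Rightarrow> (real \<times> real \<Rightarrow> real) measure \<Rightarrow>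
   real \<Rightarrow> (real \<times> real \<Rightarrow> real) \<Rightarrow> (real \<times> real \<Rightarrow> real) \<Rightarrow>
   ((real \<times> real \<Rightarrow> real) \<Rightarrow> complex) \<Rightarrow> ((real \<times> real \<Rightarrow> real) \<Rightarrow> complex) \<Rightarrow>
   (real \<times> real \<Rightarrow> real) \<Rightarrow> bool" where
  "conv_product_exists S T \<phi> m q k1 k2 F G y \<longleftrightarrow> (\<exists>L. has_conv_product S T \<phi> m q k1 k2 F G y L)"

definition scaled_product ::
  "((real \<times> real \<Rightarrow> real) \<Rightarrow> complex) \<Rightarrow> ((real \<times> real \<Rightarrow> real) \<Rightarrow> complex) \<Rightarrow>
   ((real \<times> real \<Rightarrow> real) \<Rightarrow> complex)" where
  "scaled_product F G = (\<lambda>x. F (\<lambda>p. x p / sqrt 2) * G (\<lambda>p. x p / sqrt 2))"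

end

theory Submission
  imports Defs "HOL-Complex_Analysis.Complex_Analysis"
begin

text \<open>
  Along the basis the Riemann--Stieltjes integrals are independent standard normal variables under
  the Yeh--Wiener measure, so by Kolmogorov's inequality and Parseval's identity the PWZ integral of
  \<open>v\<close> exists almost everywhere and is normal with variance \<open>\<parallel>v\<parallel>\<^sup>2\<close>. If \<open>F\<close> and \<open>G\<close> are the Fourier
  transforms of \<open>f\<close> and \<open>g\<close>, Fubini's theorem therefore gives the analytic continuations explicitly: the
  transform of \<open>F\<close> at \<open>- i q\<close> corresponds to the measure \<open>exp (- i \<parallel>u h\<parallel>\<^sup>2 / (2 q)) f(du)\<close>, and in the
  convolution product the pair \<open>(u, v)\<close> acquires the weight \<open>exp (- i \<parallel>u k\<^sub>1 - v k\<^sub>2\<parallel>\<^sup>2 / (4 q))\<close>. As the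
  convolution is taken at \<open>- q\<close>, the relations between \<open>h\<close>, \<open>k\<^sub>j\<close> and \<open>s(h, k\<^sub>j)\<close> make the quadratic
  exponents of both sides equal to \<open>- i \<parallel>(u + v) h\<parallel>\<^sup>2 / (4 q)\<close>. The transform is defined through an
  arbitrary representing measure, hence the argument also needs the uniqueness of that measure.
\<close>

section \<open>Densities of complex measures\<close>

text \<open>A functional is known only up to scale-invariant null sets, while its values along
  Gaussian paths come from a representing measure picked by \<open>SOME\<close>. All computations
  therefore use an arbitrary description of the functional: a complex density on an auxiliary finite
  measure space together with a map into \<open>L2\<close>. Uniqueness makes the choice irrelevant.
  The auxiliary space pays off for products, which simply live on the product of two such spaces.
  Two facts make Fubini's theorem applicable. The Borel sets of \<open>L2\<close> are generated by
  countably many coefficients, so the PWZ integral is jointly measurable in the function and the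
  path; and all exponentials have modulus 1. The PWZ integral is additive only where the defining
  series converge. For almost every path this holds for almost every function. Besides the null sets
  that come with the functionals, this is the source of exceptional paths; convergence is invariant
  under scaling of the path, which upgrades a.e. to s-a.e. Independence of the Gaussian coordinates
  is used as an orthogonality relation, derived from characteristic functions by the same Fourier
  uniqueness argument that identifies representing measures.\<close>

definition cadd :: "'a measure \<Rightarrow> ('a set \<Rightarrow> 'b::real_normed_vector) \<Rightarrow> bool" where
  "cadd M f \<longleftrightarrow>
     (\<forall>A. range A \<subseteq> sets M \<longrightarrow> disjoint_family A \<longrightarrow> (\<lambda>n::nat. f (A n)) sums f (\<Union>n. A n))"

text \<open>\<open>cadd\<close> allows values in any normed space, so that a complex measure, its
  real and imaginary parts and their negatives are treated alike.\<close>

lemma complex_measure_cadd: "complex_measure M f \<longleftrightarrow> cadd M f"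
  by (simp add: complex_measure_def cadd_def)

lemma cadd_sums:
  "cadd M f \<Longrightarrow> (\<And>n::nat. A n \<in> sets M) \<Longrightarrow> disjoint_family A \<Longrightarrow> (\<lambda>n. f (A n)) sums f (\<Union>n. A n)"
  by (auto simp: cadd_def)

lemma cadd_empty:
  assumes "cadd M f" shows "f {} = 0"
proof -
  have "(\<lambda>n::nat. f {}) sums f (\<Union>n::nat. {})"
    using assms by (intro cadd_sums[of M]) (auto simp: disjoint_family_on_def)
  then have "summable (\<lambda>n::nat. f {})" by (rule sums_summable)
  then show ?thesis by (simp add: summable_const_iff)
qed

lemma cadd_Un:
  assumes f: "cadd M f" and A: "A \<in> sets M" "B \<in> sets M" "A \<inter> B = {}"
  shows "f (A \<union> B) = f A + f B"
proof -
  define C where "C = (\<lambda>n::nat. if n = 0 then A else if n = 1 then B else {})"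
  have "(\<lambda>n. f (C n)) sums f (\<Union>n. C n)"
    using A by (intro cadd_sums[OF f]) (auto simp: C_def disjoint_family_on_def)
  moreover have "(\<Union>n. C n) = A \<union> B" by (auto simp: C_def split: if_splits)
  moreover have "(\<lambda>n. f (C n)) sums (\<Sum>n\<in>{0,1}. f (C n))"
    by (intro sums_finite) (auto simp: C_def cadd_empty[OF f])
  ultimately show ?thesis using sums_unique2 by (fastforce simp: C_def)
qed

lemma cadd_Diff:
  assumes f: "cadd M f" and A: "A \<in> sets M" "B \<in> sets M" "B \<subseteq> A"
  shows "f (A - B) = f A - f B"
  using cadd_Un[OF f, of "A - B" B] A by (simp add: Un_absorb2 Diff_Int_distrib2)

lemma cadd_minus: "cadd M f \<Longrightarrow> cadd M (\<lambda>A. - f A)"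
  by (auto simp: cadd_def intro: sums_minus)

lemma cadd_diff: "cadd M f \<Longrightarrow> cadd M g \<Longrightarrow> cadd M (\<lambda>A. f A - g A)"
  by (auto simp: cadd_def intro: sums_diff)

lemma cadd_Re: "cadd M f \<Longrightarrow> cadd M (\<lambda>A. Re (f A))"
  by (auto simp: cadd_def intro: sums_Re)

lemma cadd_Im: "cadd M f \<Longrightarrow> cadd M (\<lambda>A. Im (f A))"
  by (auto simp: cadd_def intro: sums_Im)

lemma space_jordan_pos [simp]: "space (jordan_pos M \<mu>) = space M"
  by (simp add: jordan_pos_def space_measure_of sets.space_closed)

lemma sets_jordan_pos [simp, measurable_cong]: "sets (jordan_pos M \<mu>) = sets M"
  by (simp add: jordan_pos_def sets_measure_of sets.space_closed sets.sigma_sets_eq)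

section \<open>The positive part of a real signed measure\<close>

context
  fixes M :: "'a measure" and \<mu> :: "'a set \<Rightarrow> real"
  assumes \<mu>: "cadd M \<mu>"
begin

text \<open>The set function from which \<open>jordan_pos\<close> is built. Superadditivity gives
  one half of its countable additivity, cutting a subset along the disjoint family gives the
  other.\<close>

definition pv :: "'a set \<Rightarrow> ennreal" where
  "pv A = (SUP B\<in>{B \<in> sets M. B \<subseteq> A}. ennreal (\<mu> B))"

lemma pv_upper: "B \<in> sets M \<Longrightarrow> B \<subseteq> A \<Longrightarrow> ennreal (\<mu> B) \<le> pv A"
  unfolding pv_def by (rule SUP_upper) auto

lemma pv_mono: "A \<subseteq> A' \<Longrightarrow> pv A \<le> pv A'"
  unfolding pv_def by (rule SUP_subset_mono) auto

text \<open>If both values are nonnegative, \<open>C \<union> D\<close> competes for the supremum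
  over \<open>A \<union> A'\<close>. If one is negative, \<open>ennreal\<close> truncates it to 0
  and the other set alone is a competitor.\<close>

lemma pv_super:
  assumes "A \<in> sets M" "A' \<in> sets M" "A \<inter> A' = {}"
  shows "pv A + pv A' \<le> pv (A \<union> A')"
proof -
  have 1: "ennreal (\<mu> C) + ennreal (\<mu> D) \<le> pv (A \<union> A')"
    if "C \<in> sets M" "C \<subseteq> A" "D \<in> sets M" "D \<subseteq> A'" for C D
  proof (cases "\<mu> C \<ge> 0 \<and> \<mu> D \<ge> 0")
    case True
    have "\<mu> (C \<union> D) = \<mu> C + \<mu> D" using that assms by (intro cadd_Un[OF \<mu>]) auto
    then have "ennreal (\<mu> C) + ennreal (\<mu> D) = ennreal (\<mu> (C \<union> D))"
      using True by simp
    then show ?thesis using pv_upper[of "C \<union> D" "A \<union> A'"] that by auto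
  next
    case False
    then have "ennreal (\<mu> C) = 0 \<or> ennreal (\<mu> D) = 0" by (auto simp: ennreal_neg)
    then show ?thesis using pv_upper[of C "A \<union> A'"] pv_upper[of D "A \<union> A'"] that
      by (metis add_0 add_0_right le_supI1 le_supI2)
  qed
  have 2: "ennreal (\<mu> C) + pv A' \<le> pv (A \<union> A')" if "C \<in> sets M" "C \<subseteq> A" for C
  proof -
    have "ennreal (\<mu> C) + pv A' = (SUP D\<in>{B \<in> sets M. B \<subseteq> A'}. ennreal (\<mu> C) + ennreal (\<mu> D))"
      unfolding pv_def by (rule ennreal_SUP_add_right) auto
    also have "\<dots> \<le> pv (A \<union> A')" using that 1 by (intro SUP_least) auto
    finally show ?thesis .
  qed
  have "pv A + pv A' = (SUP C\<in>{B \<in> sets M. B \<subseteq> A}. ennreal (\<mu> C) + pv A')"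
    unfolding pv_def[of A] by (rule ennreal_SUP_add_left[symmetric]) auto
  also have "\<dots> \<le> pv (A \<union> A')" using 2 by (intro SUP_least) auto
  finally show ?thesis .
qed

lemma pv_sum:
  assumes "\<And>i::nat. A i \<in> sets M" "disjoint_family A"
  shows "(\<Sum>i<n. pv (A i)) \<le> pv (\<Union>i<n. A i)"
proof (induction n)
  case (Suc n)
  have "(\<Union>i<n. A i) \<inter> A n = {}"
    using assms(2) by (auto simp: disjoint_family_on_def) (metis IntI empty_iff less_irrefl)
  then have "pv (\<Union>i<n. A i) + pv (A n) \<le> pv ((\<Union>i<n. A i) \<union> A n)"
    using assms(1) by (intro pv_super) auto
  also have "(\<Union>i<n. A i) \<union> A n = (\<Union>i<Suc n. A i)" by (auto simp: less_Suc_eq)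
  finally show ?case using Suc by (auto intro: order_trans[OF add_mono])
qed simp

lemma pv_countably_additive: "countably_additive (sets M) pv"
proof (rule countably_additiveI)
  fix A :: "nat \<Rightarrow> 'a set" assume A: "range A \<subseteq> sets M" "disjoint_family A" "(\<Union>i. A i) \<in> sets M"
  have "(\<Sum>i. pv (A i)) \<le> pv (\<Union>i. A i)"
  proof (rule suminf_le_const)
    fix n
    have "(\<Sum>i<n. pv (A i)) \<le> pv (\<Union>i<n. A i)" using A by (intro pv_sum) auto
    also have "\<dots> \<le> pv (\<Union>i. A i)" by (intro pv_mono) auto
    finally show "(\<Sum>i<n. pv (A i)) \<le> pv (\<Union>i. A i)" .
  qed simp
  moreover have "pv (\<Union>i. A i) \<le> (\<Sum>i. pv (A i))"
  proof -
    have "ennreal (\<mu> B) \<le> (\<Sum>i. pv (A i))" if B: "B \<in> sets M" "B \<subseteq> (\<Union>i. A i)" for B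
    proof -
      have "(\<lambda>n. \<mu> (B \<inter> A n)) sums \<mu> (\<Union>n. B \<inter> A n)"
        using A B by (intro cadd_sums[OF \<mu>]) (auto simp: disjoint_family_on_def)
      also have "(\<Union>n. B \<inter> A n) = B" using B by auto
      finally have "(\<lambda>n. ennreal (\<Sum>i<n. \<mu> (B \<inter> A i))) \<longlonglongrightarrow> ennreal (\<mu> B)"
        unfolding sums_def by (rule tendsto_ennrealI)
      then show ?thesis
      proof (rule LIMSEQ_le_const2, intro exI allI impI)
        fix n
        \<comment> \<open>\<open>ennreal\<close> is additive on nonnegative terms only, so each term
          is first replaced by its positive part.\<close>
        have "ennreal (\<Sum>i<n. \<mu> (B \<inter> A i)) \<le> ennreal (\<Sum>i<n. max 0 (\<mu> (B \<inter> A i)))"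
          by (intro ennreal_leI sum_mono) auto
        also have "\<dots> = (\<Sum>i<n. ennreal (max 0 (\<mu> (B \<inter> A i))))" by (subst sum_ennreal) auto
        also have "\<dots> \<le> (\<Sum>i<n. pv (A i))"
        proof (rule sum_mono)
          fix i
          show "ennreal (max 0 (\<mu> (B \<inter> A i))) \<le> pv (A i)"
            using pv_upper[of "B \<inter> A i" "A i"] A B by (auto simp: max_def)
        qed
        also have "\<dots> \<le> (\<Sum>i. pv (A i))" by (rule sum_le_suminf) auto
        finally show "ennreal (\<Sum>i<n. \<mu> (B \<inter> A i)) \<le> (\<Sum>i. pv (A i))" .
      qed
    qed
    then show ?thesis unfolding pv_def[of "\<Union>i. A i"] by (auto intro: SUP_least)
  qed
  ultimately show "(\<Sum>i. pv (A i)) = pv (\<Union>i. A i)" by (rule antisym)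
qed

lemma emeasure_jordan_pos:
  assumes "A \<in> sets M" shows "emeasure (jordan_pos M \<mu>) A = pv A"
proof (rule emeasure_measure_of)
  show "jordan_pos M \<mu> = measure_of (space M) (sets M) pv"
    by (simp add: jordan_pos_def pv_def[abs_def])
  have "pv {} = 0" by (simp add: pv_def cadd_empty[OF \<mu>] Collect_conv_if cong: conj_cong)
  then show "positive (sets (jordan_pos M \<mu>)) pv" by (simp add: positive_def)
qed (use assms pv_countably_additive sets.space_closed in auto)

text \<open>Choose \<open>B\<close> inside \<open>E\<close> with
  \<open>\<mu> B > \<bar>\<mu> E\<bar> + 1\<close>. Then
  \<open>\<mu> (E - B) = \<mu> E - \<mu> B\<close> is below -1, so both pieces are large in modulus.
  By additivity one of them has infinite \<open>pv\<close>; it is kept and the other one is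
  removed.\<close>

lemma pv_split_infinite:
  assumes E: "E \<in> sets M" "pv E = \<infinity>"
  shows "\<exists>E'\<in>sets M. E' \<subseteq> E \<and> pv E' = \<infinity> \<and> \<bar>\<mu> (E - E')\<bar> > 1"
proof -
  have "ennreal (\<bar>\<mu> E\<bar> + 1) < pv E" using E by simp
  then obtain B where B: "B \<in> sets M" "B \<subseteq> E" "ennreal (\<bar>\<mu> E\<bar> + 1) < ennreal (\<mu> B)"
    unfolding pv_def less_SUP_iff by auto
  then have b: "\<mu> B > \<bar>\<mu> E\<bar> + 1" by (metis ennreal_leI not_less)
  have d: "\<mu> (E - B) = \<mu> E - \<mu> B" using B E by (intro cadd_Diff[OF \<mu>]) auto
  have "pv E = pv B + pv (E - B)"
    using plus_emeasure[of B "jordan_pos M \<mu>" "E - B"] B E(1)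
    by (simp add: emeasure_jordan_pos Un_absorb1 Int_Diff)
  then consider "pv B = \<infinity>" | "pv (E - B) = \<infinity>"
    using E by (metis ennreal_add_eq_top infinity_ennreal_def)
  then show ?thesis
  proof cases
    case 1
    then show ?thesis using B b d by (intro bexI[of _ B]) auto
  next
    case 2
    have "E - (E - B) = B" using B by auto
    then show ?thesis using 2 B b E by (intro bexI[of _ "E - B"]) auto
  qed
qed

text \<open>Otherwise repeated splitting yields disjoint sets on which \<open>\<bar>\<mu>\<bar>\<close> exceeds \<open>1\<close>.\<close>

lemma finite_measure_jordan_pos: "finite_measure (jordan_pos M \<mu>)"
proof
  show "emeasure (jordan_pos M \<mu>) (space (jordan_pos M \<mu>)) \<noteq> \<infinity>"
  proof
    assume inf: "emeasure (jordan_pos M \<mu>) (space (jordan_pos M \<mu>)) = \<infinity>"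
    have "\<exists>E. \<forall>n::nat. (E n \<in> sets M \<and> pv (E n) = \<infinity>) \<and> (E (Suc n) \<subseteq> E n \<and> \<bar>\<mu> (E n - E (Suc n))\<bar> > 1)"
    proof (rule dependent_nat_choice)
      show "\<exists>E. E \<in> sets M \<and> pv E = \<infinity>"
        using inf emeasure_jordan_pos[of "space M"] by auto
    qed (use pv_split_infinite in blast)
    then obtain E where E: "\<And>n. E n \<in> sets M" "\<And>n. E (Suc n) \<subseteq> E n"
      "\<And>n::nat. \<bar>\<mu> (E n - E (Suc n))\<bar> > 1" by blast
    have "decseq E" using E(2) by (auto intro: decseq_SucI)
    then have "disjoint_family (\<lambda>n. E n - E (Suc n))"
      unfolding disjoint_family_on_def
      by (auto simp: decseq_def neq_iff) (metis Suc_leI subsetD)+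
    then have "(\<lambda>n. \<mu> (E n - E (Suc n))) sums \<mu> (\<Union>n. E n - E (Suc n))"
      using E by (intro cadd_sums[OF \<mu>]) auto
    then have "(\<lambda>n. \<mu> (E n - E (Suc n))) \<longlonglongrightarrow> 0"
      by (intro summable_LIMSEQ_zero sums_summable)
    then have "eventually (\<lambda>n. \<bar>\<mu> (E n - E (Suc n))\<bar> < 1) sequentially"
      using order_tendstoD(2)[OF tendsto_rabs_zero, of _ sequentially 1] by auto
    then show False using E(3) by (auto simp: eventually_sequentially) (meson less_asym order_refl)
  qed
qed

end

text \<open>For \<open>B \<subseteq> A\<close> one has
  \<open>\<nu> B = \<nu> A - \<nu> (A - B)\<close>, and \<open>- \<nu> (A - B)\<close> is at most
  the positive part of \<open>- \<nu>\<close> on \<open>A\<close>. The supremum over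
  \<open>B\<close> gives one inequality; the same argument for \<open>- \<nu>\<close> gives the
  other.\<close>

lemma jordan_decomposition:
  fixes \<mu> :: "'a set \<Rightarrow> real"
  assumes \<mu>: "cadd M \<mu>" and A: "A \<in> sets M"
  shows "\<mu> A = measure (jordan_pos M \<mu>) A - measure (jordan_pos M (\<lambda>A. - \<mu> A)) A"
proof -
  have le: "measure (jordan_pos M \<nu>) A \<le> \<nu> A + measure (jordan_pos M (\<lambda>A. - \<nu> A)) A"
    if \<nu>: "cadd M \<nu>" for \<nu>
  proof -
    interpret P: finite_measure "jordan_pos M \<nu>" by (rule finite_measure_jordan_pos[OF \<nu>])
    have \<nu>': "cadd M (\<lambda>A. - \<nu> A)" by (rule cadd_minus[OF \<nu>])
    interpret N: finite_measure "jordan_pos M (\<lambda>A. - \<nu> A)"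
      by (rule finite_measure_jordan_pos[OF \<nu>'])
    let ?n = "measure (jordan_pos M (\<lambda>A. - \<nu> A)) A"
    have n: "- \<nu> B \<le> ?n" if "B \<in> sets M" "B \<subseteq> A" for B
      using pv_upper[OF \<nu>' that] A
      by (auto simp: emeasure_jordan_pos[OF \<nu>', symmetric] N.emeasure_eq_measure ennreal_le_iff2
          intro: order_trans[OF _ measure_nonneg])
    have "pv M \<nu> A \<le> ennreal (\<nu> A + ?n)"
      unfolding pv_def[OF \<nu>]
    proof (rule SUP_least, rule ennreal_leI)
      fix B assume B: "B \<in> {B \<in> sets M. B \<subseteq> A}"
      show "\<nu> B \<le> \<nu> A + ?n" using n[of "A - B"] cadd_Diff[OF \<nu> A, of B] B A by auto
    qed
    then have "ennreal (measure (jordan_pos M \<nu>) A) \<le> ennreal (\<nu> A + ?n)"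
      using A by (simp add: emeasure_jordan_pos[OF \<nu>, symmetric] P.emeasure_eq_measure)
    moreover have "\<nu> A + ?n \<ge> 0" using n[of A] A by auto
    ultimately show ?thesis by simp
  qed
  show ?thesis using le[OF \<mu>] le[OF cadd_minus[OF \<mu>]] by simp
qed

text \<open>Radon-Nikodym with respect to the sum of the first \<open>n\<close> measures, which
  dominates each of them. It puts the four Jordan parts of a complex measure on one finite
  measure.\<close>

lemma ex_dominating_density:
  fixes P :: "nat \<Rightarrow> 'a measure"
  assumes fin: "\<And>k. finite_measure (P k)" and sets: "\<And>k. sets (P k) = sets M"
  shows "\<exists>\<nu> d. finite_measure \<nu> \<and> sets \<nu> = sets M \<and>
     (\<forall>k<n. d k \<in> borel_measurable M \<and> (\<forall>x. 0 \<le> d k x) \<and> P k = density \<nu> (\<lambda>x. ennreal (d k x)))"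
proof -
  define e where "e = (\<lambda>A. \<Sum>k<n. emeasure (P k) A)"
  define \<nu> where "\<nu> = measure_of (space M) (sets M) e"
  have sp: "space (P k) = space M" for k using sets_eq_imp_space_eq[OF sets] .
  have sets_\<nu> [simp]: "sets \<nu> = sets M"
    by (simp add: \<nu>_def sets_measure_of sets.space_closed sets.sigma_sets_eq)
  then have sp_\<nu>: "space \<nu> = space M" by (rule sets_eq_imp_space_eq)
  have em: "emeasure \<nu> A = e A" if "A \<in> sets M" for A
  proof (rule emeasure_measure_of[OF \<nu>_def sets.space_closed])
    show "positive (sets \<nu>) e" by (simp add: positive_def e_def)
    show "countably_additive (sets \<nu>) e"
    proof (rule countably_additiveI)
      fix A :: "nat \<Rightarrow> 'a set" assume A: "range A \<subseteq> sets \<nu>" "disjoint_family A" "(\<Union>i. A i) \<in> sets \<nu>"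
      have "(\<Sum>i. e (A i)) = (\<Sum>k<n. \<Sum>i. emeasure (P k) (A i))"
        unfolding e_def by (rule suminf_sum) simp
      also have "\<dots> = e (\<Union>i. A i)"
        unfolding e_def using A sets by (intro sum.cong refl suminf_emeasure) auto
      finally show "(\<Sum>i. e (A i)) = e (\<Union>i. A i)" .
    qed
  qed (use that in simp)
  have f\<nu>: "finite_measure \<nu>"
  proof
    have "emeasure (P k) (space M) \<noteq> \<infinity>" for k
      using finite_measure.emeasure_finite[OF fin, of k "space M"] by simp
    then show "emeasure \<nu> (space \<nu>) \<noteq> \<infinity>"
      unfolding sp_\<nu> by (simp add: em e_def)
  qed
  interpret finite_measure \<nu> by fact
  have "\<exists>d. d \<in> borel_measurable M \<and> (\<forall>x. 0 \<le> d x) \<and> P k = density \<nu> (\<lambda>x. ennreal (d x))"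
    if k: "k < n" for k
  proof -
    have ac: "absolutely_continuous \<nu> (P k)"
      unfolding absolutely_continuous_def
    proof
      fix A assume "A \<in> null_sets \<nu>"
      then have A: "A \<in> sets M" "e A = 0" by (auto simp: null_sets_def em)
      then have "emeasure (P k) A = 0" using k by (simp add: e_def)
      then show "A \<in> null_sets (P k)" using A sets by (auto simp: null_sets_def)
    qed
    have s: "sets (P k) = sets \<nu>" using sets by simp
    obtain D where D: "D \<in> borel_measurable \<nu>" "AE x in \<nu>. RN_deriv \<nu> (P k) x = ennreal (D x)"
      "\<And>x. 0 \<le> D x"
      using real_RN_deriv[OF fin ac s] by metis
    have "P k = density \<nu> (RN_deriv \<nu> (P k))" by (rule density_RN_deriv[OF ac s, symmetric])
    also have "\<dots> = density \<nu> (\<lambda>x. ennreal (D x))"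
      using D by (intro density_cong) auto
    finally show ?thesis using D by (auto simp: measurable_cong_sets[OF sets_\<nu> refl])
  qed
  then obtain d where "\<forall>k<n. d k \<in> borel_measurable M \<and> (\<forall>x. 0 \<le> d k x) \<and> P k = density \<nu> (\<lambda>x. ennreal (d k x))"
    by metis
  with f\<nu> sets_\<nu> show ?thesis by blast
qed

section \<open>Integrals of bounded functions against a complex measure\<close>

definition bmeas :: "'a measure \<Rightarrow> ('a \<Rightarrow> complex) \<Rightarrow> bool" where
  "bmeas M \<psi> \<longleftrightarrow> \<psi> \<in> borel_measurable M \<and> (\<exists>C. \<forall>u\<in>space M. norm (\<psi> u) \<le> C)"

lemma integrable_bmeas_mult:
  fixes \<theta> :: "'b \<Rightarrow> complex"
  assumes "bmeas M \<psi>" "\<pi> \<in> Q \<rightarrow>\<^sub>M M" "integrable Q \<theta>"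
  shows "integrable Q (\<lambda>x. \<psi> (\<pi> x) * \<theta> x)"
proof -
  obtain C where C: "\<And>u. u \<in> space M \<Longrightarrow> norm (\<psi> u) \<le> C" and [measurable]: "\<psi> \<in> borel_measurable M"
    using assms(1) unfolding bmeas_def by blast
  note [measurable] = assms(2) borel_measurable_integrable[OF assms(3)]
  show ?thesis
  proof (rule Bochner_Integration.integrable_bound[of Q "\<lambda>x. C * norm (\<theta> x)"])
    show "AE x in Q. norm (\<psi> (\<pi> x) * \<theta> x) \<le> norm (C * norm (\<theta> x))"
    proof (rule AE_I2)
      fix x assume "x \<in> space Q"
      then have "norm (\<psi> (\<pi> x)) \<le> C" using C measurable_space[OF assms(2)] by blast
      then show "norm (\<psi> (\<pi> x) * \<theta> x) \<le> norm (C * norm (\<theta> x))"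
        by (auto simp: norm_mult abs_mult intro!: mult_right_mono)
    qed
  qed (use assms(3) in auto)
qed

text \<open>Turns \<open>cm_integral\<close> into one Bochner integral with a complex density, which
  makes dominated convergence and Fubini's theorem available.\<close>

theorem complex_measure_density:
  assumes f: "complex_measure M f"
  shows "\<exists>\<nu> \<theta>. finite_measure \<nu> \<and> sets \<nu> = sets M \<and> integrable \<nu> \<theta> \<and>
     (\<forall>A\<in>sets M. f A = (LINT u|\<nu>. indicator A u * \<theta> u)) \<and>
     (\<forall>\<psi>. bmeas M \<psi> \<longrightarrow> cm_integral M f \<psi> = (LINT u|\<nu>. \<psi> u * \<theta> u))"
proof -
  have cr: "cadd M (\<lambda>A. Re (f A))" "cadd M (\<lambda>A. - Re (f A))"
    and ci: "cadd M (\<lambda>A. Im (f A))" "cadd M (\<lambda>A. - Im (f A))"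
    using f by (auto simp: complex_measure_cadd intro: cadd_Re cadd_Im cadd_minus)
  define P where "P k = (if k = 0 then jordan_pos M (\<lambda>A. Re (f A)) else if k = 1 then jordan_pos M (\<lambda>A. - Re (f A))
     else if k = 2 then jordan_pos M (\<lambda>A. Im (f A)) else jordan_pos M (\<lambda>A. - Im (f A)))" for k :: nat
  have fin: "finite_measure (P k)" and sets_P: "sets (P k) = sets M" for k
    using cr ci by (auto simp: P_def finite_measure_jordan_pos)
  obtain \<nu> d where \<nu>: "finite_measure \<nu>" "sets \<nu> = sets M"
    and d: "\<And>k. k < 4 \<Longrightarrow> d k \<in> borel_measurable M" "\<And>k x. k < 4 \<Longrightarrow> 0 \<le> d k x"
      "\<And>k. k < 4 \<Longrightarrow> P k = density \<nu> (\<lambda>x. ennreal (d k x))"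
    using ex_dominating_density[of P M 4, OF fin sets_P] by blast
  interpret finite_measure \<nu> by fact
  note sets_\<nu> [measurable_cong] = \<nu>(2)
  have sp: "space \<nu> = space M" using \<nu>(2) by (rule sets_eq_imp_space_eq)
  have dm: "d k \<in> borel_measurable \<nu>" if "k < 4" for k
    using d(1)[OF that] by (simp add: measurable_cong_sets[OF \<nu>(2) refl])
  have P_int: "(LINT u|P k. \<psi> u) = (LINT u|\<nu>. d k u *\<^sub>R \<psi> u)"
    if "k < 4" "\<psi> \<in> borel_measurable M" for k and \<psi> :: "'a \<Rightarrow> complex"
    unfolding d(3)[OF that(1)] using that dm d(2) sets_\<nu>
    by (intro integral_density) (auto simp: measurable_cong_sets[OF \<nu>(2) refl])
  have d_int: "integrable \<nu> (d k)" if k: "k < 4" for k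
  proof (rule integrableI_nonneg)
    have "(\<integral>\<^sup>+x. ennreal (d k x) \<partial>\<nu>) = emeasure (P k) (space M)"
      unfolding d(3)[OF k] using dm[OF k]
      by (subst emeasure_density) (auto simp: sp[symmetric] intro!: nn_integral_cong)
    then show "(\<integral>\<^sup>+x. ennreal (d k x) \<partial>\<nu>) < \<infinity>"
      using finite_measure.emeasure_finite[OF fin, of k "space M"] by (simp add: less_top)
  qed (use dm d(2) k in auto)
  \<comment> \<open>Signs and the factor \<open>\<i>\<close> copy the combination of the four Jordan
    parts in \<open>cm_integral\<close>.\<close>
  define \<theta> where "\<theta> u = of_real (d 0 u) - of_real (d 1 u) + \<i> * (of_real (d 2 u) - of_real (d 3 u))" for u
  have \<theta>: "integrable \<nu> \<theta>"
    unfolding \<theta>_def using d_int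
    by (intro Bochner_Integration.integrable_add Bochner_Integration.integrable_diff integrable_mult_right integrable_of_real) auto
  have cm: "cm_integral M f \<psi> = (LINT u|\<nu>. \<psi> u * \<theta> u)" if \<psi>: "bmeas M \<psi>" for \<psi>
  proof -
    have m: "\<psi> \<in> borel_measurable M" using \<psi> by (simp add: bmeas_def)
    have i: "integrable \<nu> (\<lambda>u. d k u *\<^sub>R \<psi> u)" if "k < 4" for k
      using integrable_bmeas_mult[OF \<psi> measurable_ident_sets[OF \<nu>(2)] integrable_of_real[OF d_int[OF that]]]
      by (simp add: scaleR_conv_of_real mult.commute)
    have "cm_integral M f \<psi> = ((LINT u|P 0. \<psi> u) - (LINT u|P 1. \<psi> u))
      + \<i> * ((LINT u|P 2. \<psi> u) - (LINT u|P 3. \<psi> u))"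
      by (simp add: cm_integral_def P_def)
    also have "\<dots> = (LINT u|\<nu>. (d 0 u *\<^sub>R \<psi> u - d 1 u *\<^sub>R \<psi> u) + \<i> * (d 2 u *\<^sub>R \<psi> u - d 3 u *\<^sub>R \<psi> u))"
      using i m by (simp add: P_int)
    also have "\<dots> = (LINT u|\<nu>. \<psi> u * \<theta> u)"
      by (intro Bochner_Integration.integral_cong) (auto simp: \<theta>_def scaleR_conv_of_real algebra_simps)
    finally show ?thesis .
  qed
  have fA: "f A = (LINT u|\<nu>. indicator A u * \<theta> u)" if A: "A \<in> sets M" for A
  proof -
    have "bmeas M (indicator A)" using A by (auto simp: bmeas_def indicator_def intro!: exI[of _ 1])
    from cm[OF this] have "(LINT u|\<nu>. indicator A u * \<theta> u) = cm_integral M f (indicator A)" ..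
    also have "\<dots> = ((LINT u|P 0. indicator A u) - (LINT u|P 1. indicator A u))
      + \<i> * ((LINT u|P 2. indicator A u) - (LINT u|P 3. indicator A u))"
      by (simp add: cm_integral_def P_def)
    also have "\<dots> = of_real (measure (P 0) A - measure (P 1) A) + \<i> * of_real (measure (P 2) A - measure (P 3) A)"
    proof -
      have "(LINT u|P k. indicator A u) = complex_of_real (measure (P k) A)" for k
      proof -
        have "(LINT u|P k. indicator A u) = (LINT u|P k. complex_of_real (indicator A u))"
          by (intro Bochner_Integration.integral_cong) (auto simp: indicator_def)
        also have "\<dots> = complex_of_real (measure (P k) A)"
          using A sets_P sets.sets_into_space[OF A] sets_eq_imp_space_eq[OF sets_P, of k]
          by (simp only: integral_complex_of_real) (simp add: Int_absorb1 Int_absorb2)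
        finally show ?thesis .
      qed
      then show ?thesis by simp
    qed
    also have "\<dots> = of_real (Re (f A)) + \<i> * of_real (Im (f A))"
      using jordan_decomposition[OF cr(1) A] jordan_decomposition[OF ci(1) A] by (simp add: P_def)
    also have "\<dots> = f A" by (simp add: complex_eq_iff)
    finally show ?thesis ..
  qed
  show ?thesis using \<nu> \<theta> cm fA by blast
qed

text \<open>Linear functionals that are continuous under bounded pointwise convergence: they are determined
  by their values on indicators.\<close>

definition bc_lin :: "'a measure \<Rightarrow> (('a \<Rightarrow> complex) \<Rightarrow> complex) \<Rightarrow> bool" where
  "bc_lin M \<Lambda> \<longleftrightarrow>
     (\<forall>\<psi> \<eta>. bmeas M \<psi> \<longrightarrow> bmeas M \<eta> \<longrightarrow> \<Lambda> (\<lambda>u. \<psi> u + \<eta> u) = \<Lambda> \<psi> + \<Lambda> \<eta>) \<and>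
     (\<forall>c \<psi>. bmeas M \<psi> \<longrightarrow> \<Lambda> (\<lambda>u. c * \<psi> u) = c * \<Lambda> \<psi>) \<and>
     (\<forall>\<psi>s \<psi> C. (\<forall>n::nat. \<psi>s n \<in> borel_measurable M) \<longrightarrow> (\<forall>n. \<forall>u\<in>space M. norm (\<psi>s n u) \<le> C) \<longrightarrow>
        (\<forall>u\<in>space M. (\<lambda>n. \<psi>s n u) \<longlonglongrightarrow> \<psi> u) \<longrightarrow> (\<lambda>n. \<Lambda> (\<psi>s n)) \<longlonglongrightarrow> \<Lambda> \<psi>)"

lemma bc_linD_add: "bc_lin M \<Lambda> \<Longrightarrow> bmeas M \<psi> \<Longrightarrow> bmeas M \<eta> \<Longrightarrow> \<Lambda> (\<lambda>u. \<psi> u + \<eta> u) = \<Lambda> \<psi> + \<Lambda> \<eta>"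
  and bc_linD_mult: "bc_lin M \<Lambda> \<Longrightarrow> bmeas M \<psi> \<Longrightarrow> \<Lambda> (\<lambda>u. c * \<psi> u) = c * \<Lambda> \<psi>"
  and bc_linD_lim: "bc_lin M \<Lambda> \<Longrightarrow> (\<And>n::nat. \<psi>s n \<in> borel_measurable M) \<Longrightarrow>
      (\<And>n u. u \<in> space M \<Longrightarrow> norm (\<psi>s n u) \<le> C) \<Longrightarrow>
      (\<And>u. u \<in> space M \<Longrightarrow> (\<lambda>n. \<psi>s n u) \<longlonglongrightarrow> \<psi> u) \<Longrightarrow> (\<lambda>n. \<Lambda> (\<psi>s n)) \<longlonglongrightarrow> \<Lambda> \<psi>"
  unfolding bc_lin_def by blast+

lemma bc_lin_integral:
  fixes M :: "'a measure"
  assumes \<pi>[measurable]: "\<pi> \<in> Q \<rightarrow>\<^sub>M M" and \<theta>: "integrable Q \<theta>"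
  shows "bc_lin M (\<lambda>\<psi>. LINT x|Q. \<psi> (\<pi> x) * \<theta> x)"
  unfolding bc_lin_def
proof (intro conjI allI impI)
  fix \<psi> \<eta> assume "bmeas M \<psi>" "bmeas M \<eta>"
  then show "(LINT x|Q. (\<psi> (\<pi> x) + \<eta> (\<pi> x)) * \<theta> x) = (LINT x|Q. \<psi> (\<pi> x) * \<theta> x) + (LINT x|Q. \<eta> (\<pi> x) * \<theta> x)"
    using integrable_bmeas_mult[OF _ \<pi> \<theta>] by (simp add: distrib_right)
next
  fix c \<psi>
  show "(LINT x|Q. c * \<psi> (\<pi> x) * \<theta> x) = c * (LINT x|Q. \<psi> (\<pi> x) * \<theta> x)"
    by (simp add: mult.assoc)
next
  fix \<psi>s and \<psi> :: "'a \<Rightarrow> complex" and C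
  assume m[rule_format]: "\<forall>n::nat. \<psi>s n \<in> borel_measurable M"
    and b: "\<forall>n. \<forall>u\<in>space M. norm (\<psi>s n u) \<le> C" and l: "\<forall>u\<in>space M. (\<lambda>n. \<psi>s n u) \<longlonglongrightarrow> \<psi> u"
  have [measurable]: "\<psi> \<in> borel_measurable M"
    by (rule borel_measurable_LIMSEQ_metric[OF m]) (use l in auto)
  note [measurable] = m borel_measurable_integrable[OF \<theta>]
  show "(\<lambda>n. LINT x|Q. \<psi>s n (\<pi> x) * \<theta> x) \<longlonglongrightarrow> (LINT x|Q. \<psi> (\<pi> x) * \<theta> x)"
  proof (rule integral_dominated_convergence[where w = "\<lambda>x. C * norm (\<theta> x)"])
    show "AE x in Q. (\<lambda>n. \<psi>s n (\<pi> x) * \<theta> x) \<longlonglongrightarrow> \<psi> (\<pi> x) * \<theta> x"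
      using l measurable_space[OF \<pi>] by (intro AE_I2 tendsto_intros) auto
    show "AE x in Q. norm (\<psi>s n (\<pi> x) * \<theta> x) \<le> C * norm (\<theta> x)" for n
      using b measurable_space[OF \<pi>] by (intro AE_I2) (auto simp: norm_mult intro!: mult_right_mono)
  qed (use \<theta> in auto)
qed

lemma bc_lin_diff:
  fixes M :: "'a measure"
  assumes "bc_lin M \<Lambda>" "bc_lin M \<Lambda>'" shows "bc_lin M (\<lambda>\<psi>. \<Lambda> \<psi> - \<Lambda>' \<psi>)"
  unfolding bc_lin_def
proof (intro conjI allI impI)
  fix \<psi>s and \<psi> :: "'a \<Rightarrow> complex" and C
  assume "\<forall>n::nat. \<psi>s n \<in> borel_measurable M" "\<forall>n. \<forall>u\<in>space M. norm (\<psi>s n u) \<le> C"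
    "\<forall>u\<in>space M. (\<lambda>n. \<psi>s n u) \<longlonglongrightarrow> \<psi> u"
  then show "(\<lambda>n. \<Lambda> (\<psi>s n) - \<Lambda>' (\<psi>s n)) \<longlonglongrightarrow> \<Lambda> \<psi> - \<Lambda>' \<psi>"
    by (intro tendsto_diff bc_linD_lim[OF assms(1), where C = C] bc_linD_lim[OF assms(2), where C = C]) auto
qed (use assms in \<open>auto simp: bc_linD_add bc_linD_mult algebra_simps\<close>)

lemma bmeas_indicator: "A \<in> sets M \<Longrightarrow> bmeas M (indicator A)"
  by (auto simp: bmeas_def indicator_def intro!: exI[of _ 1])

lemma bmeas_const: "bmeas M (\<lambda>_. c)" by (auto simp: bmeas_def)

lemma bmeas_add: "bmeas M \<psi> \<Longrightarrow> bmeas M \<eta> \<Longrightarrow> bmeas M (\<lambda>u. \<psi> u + \<eta> u)"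
  unfolding bmeas_def by (blast intro: borel_measurable_add norm_triangle_mono)

lemma bmeas_cmult: "bmeas M \<psi> \<Longrightarrow> bmeas M (\<lambda>u. c * \<psi> u)"
proof -
  assume "bmeas M \<psi>"
  then obtain C where "\<psi> \<in> borel_measurable M" "\<And>u. u \<in> space M \<Longrightarrow> norm (\<psi> u) \<le> C"
    unfolding bmeas_def by blast
  then show ?thesis unfolding bmeas_def
    by (intro conjI exI[of _ "norm c * C"]) (auto simp: norm_mult intro!: mult_left_mono)
qed

lemma bmeas_sum: "finite K \<Longrightarrow> (\<And>k. k \<in> K \<Longrightarrow> bmeas M (\<psi> k)) \<Longrightarrow> bmeas M (\<lambda>u. \<Sum>k\<in>K. \<psi> k u)"
  by (induction K rule: finite_induct) (auto intro: bmeas_add bmeas_const)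

lemma bc_lin_zero: "bc_lin M \<Lambda> \<Longrightarrow> \<Lambda> (\<lambda>_. 0) = 0"
  using bc_linD_mult[of M \<Lambda> "\<lambda>_. 0" 0] bmeas_const[of M 0] by simp

lemma bc_lin_sum:
  assumes \<Lambda>: "bc_lin M \<Lambda>"
  shows "finite K \<Longrightarrow> (\<And>k. k \<in> K \<Longrightarrow> bmeas M (\<psi> k)) \<Longrightarrow> \<Lambda> (\<lambda>u. \<Sum>k\<in>K. \<psi> k u) = (\<Sum>k\<in>K. \<Lambda> (\<psi> k))"
  by (induction K rule: finite_induct) (auto simp: bc_lin_zero[OF \<Lambda>] bc_linD_add[OF \<Lambda>] bmeas_sum)

text \<open>Linearity settles simple functions. A general \<open>\<psi>\<close> is a pointwise limit
  of simple functions under the uniform bound \<open>2 * C\<close>.\<close>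

lemma bc_lin_eqI:
  assumes \<Lambda>: "bc_lin M \<Lambda>" "bc_lin M \<Lambda>'"
    and eq: "\<And>A. A \<in> sets M \<Longrightarrow> \<Lambda> (indicator A) = \<Lambda>' (indicator A)" and \<psi>: "bmeas M \<psi>"
  shows "\<Lambda> \<psi> = \<Lambda>' \<psi>"
proof -
  \<comment> \<open>\<open>L\<close> acts on functions on the whole type. Bounded convergence of a
    constant sequence shows that values outside \<open>space M\<close> do not influence it.\<close>
  have cong: "L \<psi> = L \<eta>" if L: "bc_lin M L" and m: "bmeas M \<psi>" and "\<And>u. u \<in> space M \<Longrightarrow> \<psi> u = \<eta> u" for L \<psi> \<eta>
  proof -
    obtain C where "\<psi> \<in> borel_measurable M" "\<And>u. u \<in> space M \<Longrightarrow> norm (\<psi> u) \<le> C"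
      using m unfolding bmeas_def by blast
    then have "(\<lambda>n::nat. L \<psi>) \<longlonglongrightarrow> L \<eta>"
      using that by (intro bc_linD_lim[OF L, where C = C]) auto
    then show ?thesis by (simp add: LIMSEQ_const_iff)
  qed
  obtain C where \<psi>m: "\<psi> \<in> borel_measurable M" and C: "\<And>u. u \<in> space M \<Longrightarrow> norm (\<psi> u) \<le> C"
    using \<psi> unfolding bmeas_def by blast
  obtain s where s: "\<And>i. simple_function M (s i)" "\<And>u. u \<in> space M \<Longrightarrow> (\<lambda>i. s i u) \<longlonglongrightarrow> \<psi> u"
    "\<And>i u. u \<in> space M \<Longrightarrow> dist (s i u) 0 \<le> 2 * dist (\<psi> u) 0"
    using borel_measurable_implies_sequence_metric[OF \<psi>m, of 0] by blast
  have sb: "norm (s i u) \<le> 2 * C" if "u \<in> space M" for i u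
    using s(3)[OF that, of i] C[OF that] by simp
  have sm: "s i \<in> borel_measurable M" for i using s(1) by (rule borel_measurable_simple_function)
  have "\<Lambda> (s i) = \<Lambda>' (s i)" for i
  proof -
    let ?A = "\<lambda>y. s i -` {y} \<inter> space M"
    have fin: "finite (s i ` space M)" using s(1)[of i] by (simp add: simple_function_def)
    have A: "?A y \<in> sets M" if "y \<in> s i ` space M" for y
      using s(1)[of i] that by (auto simp: simple_function_def)
    have rep: "s i u = (\<Sum>y\<in>s i ` space M. y * indicator (?A y) u)" if "u \<in> space M" for u
      using that fin by (subst sum.remove[of _ "s i u"]) (auto simp: indicator_def intro!: sum.neutral)
    have L: "L (s i) = (\<Sum>y\<in>s i ` space M. y * L (indicator (?A y)))" if L: "bc_lin M L" for L
    proof -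
      have "bmeas M (s i)" using sm sb by (auto simp: bmeas_def)
      then have "L (s i) = L (\<lambda>u. \<Sum>y\<in>s i ` space M. y * indicator (?A y) u)"
        by (rule cong[OF L _ rep])
      also have "\<dots> = (\<Sum>y\<in>s i ` space M. L (\<lambda>u. y * indicator (?A y) u))"
        using A by (intro bc_lin_sum[OF L fin] bmeas_cmult bmeas_indicator)
      also have "\<dots> = (\<Sum>y\<in>s i ` space M. y * L (indicator (?A y)))"
        using A by (intro sum.cong refl bc_linD_mult[OF L] bmeas_indicator)
      finally show ?thesis .
    qed
    show ?thesis unfolding L[OF \<Lambda>(1)] L[OF \<Lambda>(2)] using A eq by (intro sum.cong) auto
  qed
  moreover have "(\<lambda>i. \<Lambda> (s i)) \<longlonglongrightarrow> \<Lambda> \<psi>" "(\<lambda>i. \<Lambda>' (s i)) \<longlonglongrightarrow> \<Lambda>' \<psi>"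
    using sm sb s(2) by (auto intro!: bc_linD_lim[OF \<Lambda>(1), where C = "2*C"] bc_linD_lim[OF \<Lambda>(2), where C = "2*C"])
  ultimately show ?thesis using LIMSEQ_unique by auto
qed

text \<open>The image under \<open>\<pi>\<close> of the complex measure with density
  \<open>\<theta>\<close>. Products and weights can be handled on the convenient space
  \<open>Q\<close> and are transported to \<open>M\<close> by this lemma.\<close>

lemma complex_measure_pushforward:
  fixes \<theta> :: "'b \<Rightarrow> complex"
  assumes \<pi>[measurable]: "\<pi> \<in> Q \<rightarrow>\<^sub>M M" and \<theta>: "integrable Q \<theta>"
  shows "complex_measure M (\<lambda>A. LINT x|Q. indicator A (\<pi> x) * \<theta> x)"
  unfolding complex_measure_def
proof (intro allI impI)
  fix A :: "nat \<Rightarrow> 'a set" assume A: "range A \<subseteq> sets M" "disjoint_family A"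
  have bm: "bmeas M (indicator (A n))" for n using A by (intro bmeas_indicator) auto
  have eq: "(\<Sum>i<n. indicator (A i) u) = (indicator (\<Union>i<n. A i) u :: complex)" for n u
    using A(2) by (intro indicator_UN_disjoint[symmetric]) (auto simp: disjoint_family_on_def)
  have "(\<lambda>n. LINT x|Q. (\<Sum>i<n. indicator (A i) (\<pi> x)) * \<theta> x) \<longlonglongrightarrow> (LINT x|Q. indicator (\<Union>n. A n) (\<pi> x) * \<theta> x)"
  proof (rule bc_linD_lim[OF bc_lin_integral[OF \<pi> \<theta>], where C = 1])
    show "(\<lambda>u. \<Sum>i<n. indicator (A i) u :: complex) \<in> borel_measurable M" for n
      using bmeas_sum[of "{..<n}" M "\<lambda>i. indicator (A i)"] bm by (auto simp: bmeas_def)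
    show "norm (\<Sum>i<n. indicator (A i) u :: complex) \<le> 1" for n u
      unfolding eq by (auto simp: indicator_def)
    show "(\<lambda>n. \<Sum>i<n. indicator (A i) u :: complex) \<longlonglongrightarrow> indicator (\<Union>n. A n) u" for u
      unfolding eq by (rule LIMSEQ_indicator_UN)
  qed
  moreover have "(LINT x|Q. (\<Sum>i<n. indicator (A i) (\<pi> x)) * \<theta> x) = (\<Sum>i<n. LINT x|Q. indicator (A i) (\<pi> x) * \<theta> x)" for n
    using bc_lin_sum[OF bc_lin_integral[OF \<pi> \<theta>], of "{..<n}" "\<lambda>i. indicator (A i)"] bm by simp
  ultimately show "(\<lambda>n. LINT x|Q. indicator (A n) (\<pi> x) * \<theta> x) sums (LINT x|Q. indicator (\<Union>n. A n) (\<pi> x) * \<theta> x)"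
    by (simp add: sums_def)
qed

lemma bc_lin_cm_integral:
  assumes f: "complex_measure M f"
  obtains \<Lambda> where "bc_lin M \<Lambda>" "\<And>\<psi>. bmeas M \<psi> \<Longrightarrow> cm_integral M f \<psi> = \<Lambda> \<psi>"
    "\<And>A. A \<in> sets M \<Longrightarrow> \<Lambda> (indicator A) = f A"
proof -
  obtain \<nu> \<theta> where *: "sets \<nu> = sets M" "integrable \<nu> \<theta>" "\<forall>A\<in>sets M. f A = (LINT u|\<nu>. indicator A u * \<theta> u)"
     "\<forall>\<psi>. bmeas M \<psi> \<longrightarrow> cm_integral M f \<psi> = (LINT u|\<nu>. \<psi> u * \<theta> u)"
    using complex_measure_density[OF f] by blast
  show ?thesis
    by (rule that[of "\<lambda>\<psi>. LINT u|\<nu>. \<psi> u * \<theta> u"])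
       (use * bc_lin_integral[OF measurable_ident_sets[OF *(1)] *(2)] in auto)
qed

text \<open>\<open>f\<close> is prescribed on sets only; both sides are continuous under bounded
  convergence and agree on indicators.\<close>

theorem cm_integral_pushforward:
  fixes \<theta> :: "'b \<Rightarrow> complex"
  assumes \<pi>: "\<pi> \<in> Q \<rightarrow>\<^sub>M M" and \<theta>: "integrable Q \<theta>" and f: "complex_measure M f"
    and fA: "\<And>A. A \<in> sets M \<Longrightarrow> f A = (LINT x|Q. indicator A (\<pi> x) * \<theta> x)" and \<psi>: "bmeas M \<psi>"
  shows "cm_integral M f \<psi> = (LINT x|Q. \<psi> (\<pi> x) * \<theta> x)"
proof -
  obtain \<Lambda> where L: "bc_lin M \<Lambda>" "\<And>\<psi>. bmeas M \<psi> \<Longrightarrow> cm_integral M f \<psi> = \<Lambda> \<psi>"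
    "\<And>A. A \<in> sets M \<Longrightarrow> \<Lambda> (indicator A) = f A"
    using bc_lin_cm_integral[OF f] by metis
  show ?thesis
    using bc_lin_eqI[OF L(1) bc_lin_integral[OF \<pi> \<theta>] _ \<psi>] L fA \<psi> by simp
qed

theorem cm_integral_diff:
  assumes f: "complex_measure M f" and g: "complex_measure M g" and \<psi>: "bmeas M \<psi>"
  shows "cm_integral M (\<lambda>A. f A - g A) \<psi> = cm_integral M f \<psi> - cm_integral M g \<psi>"
proof -
  have d: "complex_measure M (\<lambda>A. f A - g A)"
    using f g by (simp add: complex_measure_cadd cadd_diff)
  obtain Lf where Lf: "bc_lin M Lf" "\<And>\<psi>. bmeas M \<psi> \<Longrightarrow> cm_integral M f \<psi> = Lf \<psi>"
    "\<And>A. A \<in> sets M \<Longrightarrow> Lf (indicator A) = f A"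
    using bc_lin_cm_integral[OF f] by metis
  obtain Lg where Lg: "bc_lin M Lg" "\<And>\<psi>. bmeas M \<psi> \<Longrightarrow> cm_integral M g \<psi> = Lg \<psi>"
    "\<And>A. A \<in> sets M \<Longrightarrow> Lg (indicator A) = g A"
    using bc_lin_cm_integral[OF g] by metis
  obtain Ld where Ld: "bc_lin M Ld" "\<And>\<psi>. bmeas M \<psi> \<Longrightarrow> cm_integral M (\<lambda>A. f A - g A) \<psi> = Ld \<psi>"
    "\<And>A. A \<in> sets M \<Longrightarrow> Ld (indicator A) = f A - g A"
    using bc_lin_cm_integral[OF d] by metis
  show ?thesis
    using bc_lin_eqI[OF Ld(1) bc_lin_diff[OF Lf(1) Lg(1)] _ \<psi>] Lf Lg Ld \<psi> by simp
qed

text \<open>\<open>jordan_pos\<close> evaluates its set function on \<open>sets M\<close> only.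
  Together with uniqueness this neutralises the choice in \<open>S_measure\<close>.\<close>

lemma cm_integral_cong:
  assumes "\<And>A. A \<in> sets M \<Longrightarrow> f A = g A"
  shows "cm_integral M f \<psi> = cm_integral M g \<psi>"
proof -
  have "jordan_pos M (\<lambda>A. r (f A)) = jordan_pos M (\<lambda>A. r (g A))" for r :: "complex \<Rightarrow> real"
    unfolding jordan_pos_def using assms
    by (intro measure_of_eq sets.space_closed) (auto simp: sets.sigma_sets_eq intro!: SUP_cong)
  from this[of Re] this[of "\<lambda>z. - Re z"] this[of Im] this[of "\<lambda>z. - Im z"]
  show ?thesis by (simp add: cm_integral_def)
qed

section \<open>Functions of bounded variation\<close>

lemma grid_strictify:
  assumes "\<And>i. i < m \<Longrightarrow> \<xi> i \<le> \<xi> (Suc i)" "\<xi> 0 = (0::real)"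
  shows "\<exists>k a. grid (\<xi> m) k a \<and>
     (\<forall>\<psi>::real \<Rightarrow> real \<Rightarrow> real. (\<forall>c. \<psi> c c = 0) \<longrightarrow>
        (\<Sum>i<m. \<psi> (\<xi> i) (\<xi> (Suc i))) = (\<Sum>i<k. \<psi> (a i) (a (Suc i))))"
  using assms(1)
proof (induction m)
  case 0
  show ?case using assms(2) by (intro exI[of _ 0] exI[of _ "\<lambda>_. 0"]) (auto simp: grid_def)
next
  case (Suc m)
  then obtain k a where a: "grid (\<xi> m) k a"
    "\<And>\<psi>::real \<Rightarrow> real \<Rightarrow> real. (\<forall>c. \<psi> c c = 0) \<Longrightarrow>
        (\<Sum>i<m. \<psi> (\<xi> i) (\<xi> (Suc i))) = (\<Sum>i<k. \<psi> (a i) (a (Suc i)))"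
    by (metis less_Suc_eq)
  show ?case
  proof (cases "\<xi> m = \<xi> (Suc m)")
    case True
    then show ?thesis using a by (intro exI[of _ k] exI[of _ a]) auto
  next
    case False
    then have lt: "\<xi> m < \<xi> (Suc m)" using Suc.prems[of m] by auto
    define a' where "a' = a(Suc k := \<xi> (Suc m))"
    have "grid (\<xi> (Suc m)) (Suc k) a'"
      using a(1) lt by (auto simp: grid_def a'_def less_Suc_eq)
    moreover have "(\<Sum>i<Suc m. \<psi> (\<xi> i) (\<xi> (Suc i))) = (\<Sum>i<Suc k. \<psi> (a' i) (a' (Suc i)))"
      if "\<forall>c. \<psi> c c = 0" for \<psi> :: "real \<Rightarrow> real \<Rightarrow> real"
    proof -
      have "(\<Sum>i<k. \<psi> (a' i) (a' (Suc i))) = (\<Sum>i<k. \<psi> (a i) (a (Suc i)))"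
        by (intro sum.cong) (auto simp: a'_def)
      then show ?thesis using a(2)[of \<psi>] that a(1) by (simp add: a'_def grid_def)
    qed
    ultimately show ?thesis by blast
  qed
qed

text \<open>The tags of a partition may coincide and need not include the endpoints 0 and
  \<open>c\<close>; variation has to be bounded along such sequences as well.\<close>

definition wgrid :: "real \<Rightarrow> nat \<Rightarrow> (nat \<Rightarrow> real) \<Rightarrow> bool" where
  "wgrid c m \<xi> \<longleftrightarrow> (\<forall>i\<le>m. \<xi> i \<in> {0..c}) \<and> (\<forall>i<m. \<xi> i \<le> \<xi> (Suc i))"

text \<open>Additional points can only increase a sum of nonnegative terms, so the sequence is
  completed by both endpoints and then made strict.\<close>

lemma wgrid_extend:
  assumes "wgrid c m \<xi>"
  shows "\<exists>k a. grid c k a \<and>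
     (\<forall>\<psi>::real \<Rightarrow> real \<Rightarrow> real. (\<forall>c. \<psi> c c = 0) \<longrightarrow> (\<forall>c d. \<psi> c d \<ge> 0) \<longrightarrow>
        (\<Sum>i<m. \<psi> (\<xi> i) (\<xi> (Suc i))) \<le> (\<Sum>i<k. \<psi> (a i) (a (Suc i))))"
proof -
  \<comment> \<open>The sequence 0, \<open>\<xi> 0\<close>, ..., \<open>\<xi> m\<close>,
    \<open>c\<close>, which has \<open>Suc (Suc m)\<close> steps.\<close>
  define \<eta> where "\<eta> i = (case i of 0 \<Rightarrow> 0 | Suc j \<Rightarrow> if j \<le> m then \<xi> j else c)" for i
  have "\<eta> i \<le> \<eta> (Suc i)" if "i < Suc (Suc m)" for i
    using assms that by (auto simp: \<eta>_def wgrid_def split: nat.splits)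
  from grid_strictify[of "Suc (Suc m)" \<eta>, OF this]
  obtain k a where a: "grid c k a"
    "\<And>\<psi>::real \<Rightarrow> real \<Rightarrow> real. (\<forall>c. \<psi> c c = 0) \<Longrightarrow>
        (\<Sum>i<Suc (Suc m). \<psi> (\<eta> i) (\<eta> (Suc i))) = (\<Sum>i<k. \<psi> (a i) (a (Suc i)))"
    by (auto simp: \<eta>_def)
  have "(\<Sum>i<m. \<psi> (\<xi> i) (\<xi> (Suc i))) \<le> (\<Sum>i<k. \<psi> (a i) (a (Suc i)))"
    if z: "\<forall>c. \<psi> c c = 0" "\<forall>c d. \<psi> c d \<ge> 0" for \<psi> :: "real \<Rightarrow> real \<Rightarrow> real"
  proof -
    have "(\<Sum>i<m. \<psi> (\<xi> i) (\<xi> (Suc i))) = (\<Sum>i<m. \<psi> (\<eta> (Suc i)) (\<eta> (Suc (Suc i))))"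
      by (intro sum.cong) (auto simp: \<eta>_def)
    also have "\<dots> \<le> (\<Sum>i<Suc m. \<psi> (\<eta> (Suc i)) (\<eta> (Suc (Suc i))))" using z by simp
    also have "\<dots> \<le> (\<Sum>i<Suc (Suc m). \<psi> (\<eta> i) (\<eta> (Suc i)))"
      unfolding sum.lessThan_Suc_shift[of _ "Suc m"] using z by simp
    finally show ?thesis using a(2)[of \<psi>] z(1) by simp
  qed
  with a(1) show ?thesis by blast
qed

definition incr :: "(real \<times> real \<Rightarrow> real) \<Rightarrow> real \<Rightarrow> real \<Rightarrow> real \<Rightarrow> real \<Rightarrow> real" where
  "incr x s s' t t' = x (s', t') - x (s, t') - x (s', t) + x (s, t)"

lemma rect_incr_incr: "rect_incr x a b i j = incr x (a i) (a (Suc i)) (b j) (b (Suc j))"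
  by (simp add: rect_incr_def incr_def)

text \<open>A quantitative form of \<open>bv_HK\<close>: the same constant bounds the Vitali
  variation, every section and the function itself. \<open>bv_HK\<close> grants each section a bound
  of its own.\<close>

definition bvB :: "real \<Rightarrow> real \<Rightarrow> (real \<times> real \<Rightarrow> real) \<Rightarrow> real \<Rightarrow> bool" where
  "bvB S T w B \<longleftrightarrow> 0 \<le> B \<and>
     (\<forall>m n \<xi> \<eta>. wgrid S m \<xi> \<longrightarrow> wgrid T n \<eta> \<longrightarrow>
        (\<Sum>i<m. \<Sum>j<n. \<bar>incr w (\<xi> i) (\<xi> (Suc i)) (\<eta> j) (\<eta> (Suc j))\<bar>) \<le> B) \<and>
     (\<forall>m \<xi>. \<forall>t\<in>{0..T}. wgrid S m \<xi> \<longrightarrow> (\<Sum>i<m. \<bar>w (\<xi> (Suc i), t) - w (\<xi> i, t)\<bar>) \<le> B) \<and>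
     (\<forall>n \<eta>. \<forall>s\<in>{0..S}. wgrid T n \<eta> \<longrightarrow> (\<Sum>j<n. \<bar>w (s, \<eta> (Suc j)) - w (s, \<eta> j)\<bar>) \<le> B) \<and>
     (\<forall>p\<in>rect S T. \<bar>w p\<bar> \<le> B)"

lemma bvB_vitali: "bvB S T w B \<Longrightarrow> wgrid S m \<xi> \<Longrightarrow> wgrid T n \<eta> \<Longrightarrow>
        (\<Sum>i<m. \<Sum>j<n. \<bar>incr w (\<xi> i) (\<xi> (Suc i)) (\<eta> j) (\<eta> (Suc j))\<bar>) \<le> B"
  and bvB_sec1: "bvB S T w B \<Longrightarrow> wgrid S m \<xi> \<Longrightarrow> t \<in> {0..T} \<Longrightarrow> (\<Sum>i<m. \<bar>w (\<xi> (Suc i), t) - w (\<xi> i, t)\<bar>) \<le> B"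
  and bvB_sec2: "bvB S T w B \<Longrightarrow> wgrid T n \<eta> \<Longrightarrow> s \<in> {0..S} \<Longrightarrow> (\<Sum>j<n. \<bar>w (s, \<eta> (Suc j)) - w (s, \<eta> j)\<bar>) \<le> B"
  and bvB_bound: "bvB S T w B \<Longrightarrow> p \<in> rect S T \<Longrightarrow> \<bar>w p\<bar> \<le> B"
  and bvB_nonneg: "bvB S T w B \<Longrightarrow> 0 \<le> B"
  by (auto simp: bvB_def)

lemma bv1_wgrid:
  assumes "bv1 c w"
  shows "\<exists>B\<ge>0. \<forall>m \<xi>. wgrid c m \<xi> \<longrightarrow> (\<Sum>i<m. \<bar>w (\<xi> (Suc i)) - w (\<xi> i)\<bar>) \<le> B"
proof -
  obtain B where B: "\<And>m a. grid c m a \<Longrightarrow> (\<Sum>i<m. \<bar>w (a (Suc i)) - w (a i)\<bar>) \<le> B"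
    using assms unfolding bv1_def by blast
  show ?thesis
  proof (intro exI[of _ "\<bar>B\<bar>"] conjI allI impI)
    fix m \<xi> assume "wgrid c m \<xi>"
    from wgrid_extend[OF this] obtain k a where a: "grid c k a"
      "\<And>\<psi>::real \<Rightarrow> real \<Rightarrow> real. (\<forall>c. \<psi> c c = 0) \<Longrightarrow> (\<forall>c d. \<psi> c d \<ge> 0) \<Longrightarrow>
        (\<Sum>i<m. \<psi> (\<xi> i) (\<xi> (Suc i))) \<le> (\<Sum>i<k. \<psi> (a i) (a (Suc i)))" by blast
    show "(\<Sum>i<m. \<bar>w (\<xi> (Suc i)) - w (\<xi> i)\<bar>) \<le> \<bar>B\<bar>"
      using a(2)[of "\<lambda>c d. \<bar>w d - w c\<bar>"] B[OF a(1)] by simp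
  qed simp
qed

text \<open>The increments of a section at height \<open>t\<close> differ from those at height 0 by
  rectangular increments over the single strip from 0 to \<open>t\<close>. The Vitali variation
  therefore makes the bounds on the sections uniform.\<close>

lemma bv_HK_bvB:
  assumes bv: "bv_HK S T w" and ST: "S \<ge> 0" "T \<ge> 0"
  shows "\<exists>B. bvB S T w B"
proof -
  obtain V where V: "\<And>m n a b. grid S m a \<Longrightarrow> grid T n b \<Longrightarrow> (\<Sum>i<m. \<Sum>j<n. \<bar>rect_incr w a b i j\<bar>) \<le> V"
    using bv unfolding bv_HK_def by blast
  have V': "(\<Sum>i<m. \<Sum>j<n. \<bar>incr w (\<xi> i) (\<xi> (Suc i)) (\<eta> j) (\<eta> (Suc j))\<bar>) \<le> \<bar>V\<bar>"
    if xi: "wgrid S m \<xi>" and eta: "wgrid T n \<eta>" for m n \<xi> \<eta>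
  proof -
    obtain k a where a: "grid S k a"
      "\<And>\<psi>::real \<Rightarrow> real \<Rightarrow> real. (\<forall>c. \<psi> c c = 0) \<Longrightarrow> (\<forall>c d. \<psi> c d \<ge> 0) \<Longrightarrow>
        (\<Sum>i<m. \<psi> (\<xi> i) (\<xi> (Suc i))) \<le> (\<Sum>i<k. \<psi> (a i) (a (Suc i)))"
      using wgrid_extend[OF xi] by blast
    obtain l b where b: "grid T l b"
      "\<And>\<psi>::real \<Rightarrow> real \<Rightarrow> real. (\<forall>c. \<psi> c c = 0) \<Longrightarrow> (\<forall>c d. \<psi> c d \<ge> 0) \<Longrightarrow>
        (\<Sum>i<n. \<psi> (\<eta> i) (\<eta> (Suc i))) \<le> (\<Sum>i<l. \<psi> (b i) (b (Suc i)))"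
      using wgrid_extend[OF eta] by blast
    have "(\<Sum>i<m. \<Sum>j<n. \<bar>incr w (\<xi> i) (\<xi> (Suc i)) (\<eta> j) (\<eta> (Suc j))\<bar>)
      \<le> (\<Sum>i<k. \<Sum>j<n. \<bar>incr w (a i) (a (Suc i)) (\<eta> j) (\<eta> (Suc j))\<bar>)"
      using a(2)[of "\<lambda>c d. \<Sum>j<n. \<bar>incr w c d (\<eta> j) (\<eta> (Suc j))\<bar>"]
      by (auto simp: incr_def intro: sum_nonneg)
    also have "\<dots> \<le> (\<Sum>i<k. \<Sum>j<l. \<bar>incr w (a i) (a (Suc i)) (b j) (b (Suc j))\<bar>)"
      using b(2)[of "\<lambda>c d. \<bar>incr w (a i) (a (Suc i)) c d\<bar>" for i]
      by (intro sum_mono) (auto simp: incr_def)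
    also have "\<dots> \<le> V" using V[OF a(1) b(1)] by (simp add: rect_incr_incr)
    finally show ?thesis by simp
  qed
  have "bv1 S (\<lambda>s. w (s, 0))" "bv1 T (\<lambda>t. w (0, t))" using bv ST unfolding bv_HK_def by auto
  from bv1_wgrid[OF this(1)] bv1_wgrid[OF this(2)] obtain B1 B2 where B: "B1 \<ge> 0" "B2 \<ge> 0"
    and B1: "\<And>m \<xi>. wgrid S m \<xi> \<Longrightarrow> (\<Sum>i<m. \<bar>w (\<xi> (Suc i), 0) - w (\<xi> i, 0)\<bar>) \<le> B1"
    and B2: "\<And>m \<xi>. wgrid T m \<xi> \<Longrightarrow> (\<Sum>i<m. \<bar>w (0, \<xi> (Suc i)) - w (0, \<xi> i)\<bar>) \<le> B2"
    by blast
  have s1: "(\<Sum>i<m. \<bar>w (\<xi> (Suc i), t) - w (\<xi> i, t)\<bar>) \<le> B1 + \<bar>V\<bar>"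
    if xi: "wgrid S m \<xi>" and t: "t \<in> {0..T}" for m \<xi> t
  proof -
    have "(\<Sum>i<m. \<bar>w (\<xi> (Suc i), t) - w (\<xi> i, t)\<bar>)
      \<le> (\<Sum>i<m. \<bar>w (\<xi> (Suc i), 0) - w (\<xi> i, 0)\<bar> + \<bar>incr w (\<xi> i) (\<xi> (Suc i)) 0 t\<bar>)"
      by (intro sum_mono) (simp add: incr_def)
    moreover have "wgrid T 1 (\<lambda>j. if j = 0 then 0 else t)" using t by (auto simp: wgrid_def)
    ultimately show ?thesis using V'[OF xi, of 1 "\<lambda>j. if j = 0 then 0 else t"] B1[OF xi]
      by (simp add: sum.distrib)
  qed
  have s2: "(\<Sum>i<m. \<bar>w (s, \<xi> (Suc i)) - w (s, \<xi> i)\<bar>) \<le> B2 + \<bar>V\<bar>"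
    if xi: "wgrid T m \<xi>" and t: "s \<in> {0..S}" for m \<xi> s
  proof -
    have "(\<Sum>i<m. \<bar>w (s, \<xi> (Suc i)) - w (s, \<xi> i)\<bar>)
      \<le> (\<Sum>i<m. \<bar>w (0, \<xi> (Suc i)) - w (0, \<xi> i)\<bar> + \<bar>incr w 0 s (\<xi> i) (\<xi> (Suc i))\<bar>)"
      by (intro sum_mono) (simp add: incr_def)
    moreover have "wgrid S 1 (\<lambda>j. if j = 0 then 0 else s)" using t by (auto simp: wgrid_def)
    ultimately show ?thesis using V'[OF _ xi, of 1 "\<lambda>j. if j = 0 then 0 else s"] B2[OF xi]
      by (simp add: sum.distrib)
  qed
  have bd: "\<bar>w (s, t)\<bar> \<le> \<bar>w (0, 0)\<bar> + B1 + B2 + 2 * \<bar>V\<bar>" if st: "s \<in> {0..S}" "t \<in> {0..T}" for s t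
  proof -
    have "wgrid S 1 (\<lambda>j. if j = 0 then 0 else s)" "wgrid T 1 (\<lambda>j. if j = 0 then 0 else t)"
      using st by (auto simp: wgrid_def)
    from s1[OF this(1), of t] s2[OF this(2), of 0] show ?thesis using st ST by simp
  qed
  have "bvB S T w (\<bar>w (0, 0)\<bar> + B1 + B2 + 2 * \<bar>V\<bar>)"
    unfolding bvB_def using B s1 s2 bd V'
    by (auto simp: rect_def intro: order_trans[OF V'] order_trans[OF s1] order_trans[OF s2])
  then show ?thesis by blast
qed

section \<open>Summation by parts for Riemann-Stieltjes sums\<close>

lemma grid_mono:
  assumes "grid C k c" "i \<le> j" "j \<le> k" shows "c i \<le> c j"
  using assms(2,3)
proof (induction j)
  case (Suc j)
  have "c j < c (Suc j)" using assms(1) Suc.prems by (auto simp: grid_def)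
  then show ?case using Suc by (cases "i = Suc j") auto
qed simp

lemma grid_mem: "grid C k c \<Longrightarrow> i \<le> k \<Longrightarrow> c i \<in> {0..C}"
  using grid_mono[of C k c 0 i] grid_mono[of C k c i k] by (auto simp: grid_def)

text \<open>Abel summation: the increments pass from \<open>x\<close> to \<open>w\<close>, and only
  the size of \<open>x\<close> and the variation of \<open>w\<close> remain.\<close>

lemma abel_bound:
  fixes w x :: "nat \<Rightarrow> real"
  assumes "\<And>i. i \<le> Suc m \<Longrightarrow> \<bar>x i\<bar> \<le> e"
  shows "\<bar>\<Sum>i<Suc m. w i * (x (Suc i) - x i)\<bar> \<le> e * (\<bar>w m\<bar> + \<bar>w 0\<bar> + (\<Sum>i<m. \<bar>w (Suc i) - w i\<bar>))"
proof -
  have id: "(\<Sum>i<Suc m. w i * (x (Suc i) - x i))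
     = w m * x (Suc m) - w 0 * x 0 - (\<Sum>i<m. (w (Suc i) - w i) * x (Suc i))"
    by (induction m) (auto simp: algebra_simps)
  have "\<bar>\<Sum>i<m. (w (Suc i) - w i) * x (Suc i)\<bar> \<le> (\<Sum>i<m. \<bar>w (Suc i) - w i\<bar> * e)"
    using assms by (intro order_trans[OF sum_abs] sum_mono) (auto simp: abs_mult intro!: mult_left_mono)
  moreover have "\<bar>w m * x (Suc m)\<bar> \<le> e * \<bar>w m\<bar>" "\<bar>w 0 * x 0\<bar> \<le> e * \<bar>w 0\<bar>"
    using assms[of "Suc m"] assms[of 0] by (auto simp: abs_mult mult.commute[of e] intro!: mult_left_mono)
  ultimately have "\<bar>w m * x (Suc m) - w 0 * x 0 - (\<Sum>i<m. (w (Suc i) - w i) * x (Suc i))\<bar>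
    \<le> e * \<bar>w m\<bar> + e * \<bar>w 0\<bar> + (\<Sum>i<m. \<bar>w (Suc i) - w i\<bar> * e)" by linarith
  then show ?thesis unfolding id distrib_left sum_distrib_left by (simp only: mult.commute[of e])
qed

text \<open>Summation by parts in both variables moves the increments from \<open>x\<close> to \<open>w\<close>.\<close>

lemma RS_sum_bound:
  assumes w: "bvB S T w B" and xi: "\<And>i. i < m \<Longrightarrow> \<xi> i \<in> {a i..a (Suc i)}"
    and eta: "\<And>j. j < n \<Longrightarrow> \<eta> j \<in> {b j..b (Suc j)}"
    and a: "grid S m a" and b: "grid T n b" and x: "\<And>p. p \<in> rect S T \<Longrightarrow> \<bar>x p\<bar> \<le> e"
  shows "\<bar>\<Sum>i<m. \<Sum>j<n. w (\<xi> i, \<eta> j) * rect_incr x a b i j\<bar> \<le> 9 * B * e"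
proof -
  have ST: "S \<ge> 0" "T \<ge> 0" using grid_mem[OF a, of 0] grid_mem[OF b, of 0] by auto
  have e: "e \<ge> 0" using x[of "(0,0)"] ST by (auto simp: rect_def)
  have B0: "B \<ge> 0" using w by (rule bvB_nonneg)
  show ?thesis
  proof (cases "m = 0 \<or> n = 0")
    case True
    then show ?thesis using e B0 by auto
  next
    case False
    then obtain m' n' where mn: "m = Suc m'" "n = Suc n'" by (metis not0_implies_Suc)
    \<comment> \<open>There are \<open>m\<close> cells and \<open>m\<close> tags, hence
      \<open>m' = m - 1\<close> steps from tag to tag.\<close>
    have gx: "wgrid S m' \<xi>"
      unfolding wgrid_def
    proof (intro conjI allI impI)
      fix i assume "i \<le> m'"
      then show "\<xi> i \<in> {0..S}"
        using xi[of i] grid_mem[OF a, of i] grid_mem[OF a, of "Suc i"] mn by auto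
    next
      fix i assume "i < m'"
      then show "\<xi> i \<le> \<xi> (Suc i)" using xi[of i] xi[of "Suc i"] mn by auto
    qed
    have gy: "wgrid T n' \<eta>"
      unfolding wgrid_def
    proof (intro conjI allI impI)
      fix i assume "i \<le> n'"
      then show "\<eta> i \<in> {0..T}"
        using eta[of i] grid_mem[OF b, of i] grid_mem[OF b, of "Suc i"] mn by auto
    next
      fix i assume "i < n'"
      then show "\<eta> i \<le> \<eta> (Suc i)" using eta[of i] eta[of "Suc i"] mn by auto
    qed
    \<comment> \<open>The inner sum in the first variable. The row of tags and the row of grid
      points are separate indices, so that the summation by parts in the second variable can move
      one of them at a time.\<close>
    define U where "U j' j = (\<Sum>i<m. w (\<xi> i, \<eta> j') * (x (a (Suc i), b j) - x (a i, b j)))" for j' j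
    have xin: "\<xi> i \<in> {0..S}" if "i \<le> m'" for i using gx that by (auto simp: wgrid_def)
    have yin: "\<eta> i \<in> {0..T}" if "i \<le> n'" for i using gy that by (auto simp: wgrid_def)
    have bb: "\<bar>w (\<xi> i, \<eta> j)\<bar> \<le> B" if "i \<le> m'" "j \<le> n'" for i j
      using xin[OF that(1)] yin[OF that(2)] by (intro bvB_bound[OF w]) (auto simp: rect_def)
    have xb: "\<bar>x (a i, b j)\<bar> \<le> e" if "i \<le> m" "j \<le> n" for i j
      using grid_mem[OF a that(1)] grid_mem[OF b that(2)] by (intro x) (auto simp: rect_def)
    have U: "\<bar>U j' j\<bar> \<le> e * (3 * B)" if "j' \<le> n'" "j \<le> n" for j' j
    proof -
      have "\<bar>U j' j\<bar> \<le> e * (\<bar>w (\<xi> m', \<eta> j')\<bar> + \<bar>w (\<xi> 0, \<eta> j')\<bar> + (\<Sum>i<m'. \<bar>w (\<xi> (Suc i), \<eta> j') - w (\<xi> i, \<eta> j')\<bar>))"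
        unfolding U_def mn using xb that mn by (intro abel_bound) auto
      also have "\<dots> \<le> e * (3 * B)"
        using bb[of m' j'] bb[of 0 j'] bvB_sec1[OF w gx yin[OF that(1)]] that e by (intro mult_left_mono) auto
      finally show ?thesis .
    qed
    have D: "\<bar>U (Suc j) (Suc j) - U j (Suc j)\<bar> \<le> e * (\<bar>w (\<xi> m', \<eta> (Suc j)) - w (\<xi> m', \<eta> j)\<bar> + \<bar>w (\<xi> 0, \<eta> (Suc j)) - w (\<xi> 0, \<eta> j)\<bar>
       + (\<Sum>i<m'. \<bar>incr w (\<xi> i) (\<xi> (Suc i)) (\<eta> j) (\<eta> (Suc j))\<bar>))" if "j < n'" for j
    proof -
      have "U (Suc j) (Suc j) - U j (Suc j)
        = (\<Sum>i<m. (w (\<xi> i, \<eta> (Suc j)) - w (\<xi> i, \<eta> j)) * (x (a (Suc i), b (Suc j)) - x (a i, b (Suc j))))"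
        unfolding U_def by (simp add: sum_subtractf[symmetric] algebra_simps)
      moreover have "\<bar>\<dots>\<bar> \<le> e * (\<bar>w (\<xi> m', \<eta> (Suc j)) - w (\<xi> m', \<eta> j)\<bar> + \<bar>w (\<xi> 0, \<eta> (Suc j)) - w (\<xi> 0, \<eta> j)\<bar>
       + (\<Sum>i<m'. \<bar>(w (\<xi> (Suc i), \<eta> (Suc j)) - w (\<xi> (Suc i), \<eta> j)) - (w (\<xi> i, \<eta> (Suc j)) - w (\<xi> i, \<eta> j))\<bar>))"
        unfolding mn using xb that mn by (intro abel_bound) auto
      ultimately show ?thesis by (simp add: incr_def algebra_simps)
    qed
    have "(\<Sum>i<m. \<Sum>j<n. w (\<xi> i, \<eta> j) * rect_incr x a b i j) = (\<Sum>j<n. U j (Suc j) - U j j)"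
      unfolding U_def
      by (subst sum.swap) (simp add: sum_subtractf[symmetric] rect_incr_def algebra_simps)
    also have "\<dots> = U n' (Suc n') - U 0 0 - (\<Sum>j<n'. U (Suc j) (Suc j) - U j (Suc j))"
      unfolding mn by (induction n') auto
    finally have "\<bar>\<Sum>i<m. \<Sum>j<n. w (\<xi> i, \<eta> j) * rect_incr x a b i j\<bar>
      \<le> \<bar>U n' (Suc n')\<bar> + \<bar>U 0 0\<bar> + (\<Sum>j<n'. \<bar>U (Suc j) (Suc j) - U j (Suc j)\<bar>)"
      using sum_abs[of "\<lambda>j. U (Suc j) (Suc j) - U j (Suc j)" "{..<n'}"] by linarith
    \<comment> \<open>The two boundary terms and the sum over \<open>j\<close> cost
      \<open>3 * B * e\<close> each: two end values and one variation. This is the origin of the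
      constant 9.\<close>
    also have "\<dots> \<le> e * (3 * B) + e * (3 * B) + e * (3 * B)"
    proof (intro add_mono U)
      have sw: "(\<Sum>j<n'. \<Sum>i<m'. \<bar>incr w (\<xi> i) (\<xi> (Suc i)) (\<eta> j) (\<eta> (Suc j))\<bar>) =
        (\<Sum>i<m'. \<Sum>j<n'. \<bar>incr w (\<xi> i) (\<xi> (Suc i)) (\<eta> j) (\<eta> (Suc j))\<bar>)" by (rule sum.swap)
      have "(\<Sum>j<n'. \<bar>U (Suc j) (Suc j) - U j (Suc j)\<bar>)
       \<le> (\<Sum>j<n'. e * (\<bar>w (\<xi> m', \<eta> (Suc j)) - w (\<xi> m', \<eta> j)\<bar> + \<bar>w (\<xi> 0, \<eta> (Suc j)) - w (\<xi> 0, \<eta> j)\<bar>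
       + (\<Sum>i<m'. \<bar>incr w (\<xi> i) (\<xi> (Suc i)) (\<eta> j) (\<eta> (Suc j))\<bar>)))"
        by (intro sum_mono D) auto
      also have "\<dots> = e * ((\<Sum>j<n'. \<bar>w (\<xi> m', \<eta> (Suc j)) - w (\<xi> m', \<eta> j)\<bar>) + (\<Sum>j<n'. \<bar>w (\<xi> 0, \<eta> (Suc j)) - w (\<xi> 0, \<eta> j)\<bar>)
       + (\<Sum>i<m'. \<Sum>j<n'. \<bar>incr w (\<xi> i) (\<xi> (Suc i)) (\<eta> j) (\<eta> (Suc j))\<bar>))"
        by (simp only: sw sum_distrib_left[symmetric] sum.distrib)
      also have "\<dots> \<le> e * (B + B + B)"
        using e gx gy xin by (intro mult_left_mono add_mono bvB_sec2[OF w] bvB_vitali[OF w]) auto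
      finally show "(\<Sum>j<n'. \<bar>U (Suc j) (Suc j) - U j (Suc j)\<bar>) \<le> e * (3 * B)" by simp
    qed (auto simp: mn)
    finally show ?thesis by (simp add: algebra_simps)
  qed
qed

text \<open>The height \<open>t i\<close> may change from step to step. Each difference at height
  \<open>t i\<close> is the difference at height 0 plus the rectangular increments below
  \<open>t i\<close>. Along the sorted list of all heights these increments belong to a single
  Vitali sum.\<close>

lemma sup_variation_bound:
  assumes w: "bvB S T w B" and T: "T \<ge> 0" and xi: "wgrid S m \<xi>" and t: "\<And>i. i < m \<Longrightarrow> t i \<in> {0..T}"
  shows "(\<Sum>i<m. \<bar>w (\<xi> (Suc i), t i) - w (\<xi> i, t i)\<bar>) \<le> 2 * B"
proof -
  \<comment> \<open>The reference height 0 is added, so that the sorted list starts there.\<close>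
  define A where "A = insert 0 (t ` {..<m})"
  have A: "finite A" "A \<noteq> {}" "A \<subseteq> {0..T}" using t T by (auto simp: A_def)
  define l where "l = sorted_list_of_set A"
  define n where "n = length l - 1"
  have l: "set l = A" "sorted l" "l \<noteq> []" using A by (auto simp: l_def)
  have g: "wgrid T n ((!) l)"
    unfolding wgrid_def
  proof (intro conjI allI impI)
    fix j assume "j \<le> n"
    then have "j < length l" using l(3) by (cases l) (auto simp: n_def)
    then have "l ! j \<in> A" using l(1) nth_mem by blast
    then show "l ! j \<in> {0..T}" using A by blast
  next
    fix j assume "j < n"
    then show "l ! j \<le> l ! Suc j" using l(2) by (auto simp: n_def sorted_nth_mono)
  qed
  have l0: "l ! 0 = 0"
  proof -
    have "0 \<in> set l" unfolding l(1) A_def by blast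
    then obtain j where j: "j < length l" "l ! j = 0" by (auto simp: in_set_conv_nth)
    have "l ! 0 \<in> A" using l(1,3) nth_mem[of 0 l] by auto
    then have "l ! 0 \<ge> 0" using A by auto
    moreover have "l ! 0 \<le> l ! j" using l(2) j by (intro sorted_nth_mono) auto
    ultimately show ?thesis using j by simp
  qed
  have "\<bar>w (\<xi> (Suc i), t i) - w (\<xi> i, t i)\<bar> \<le> \<bar>w (\<xi> (Suc i), 0) - w (\<xi> i, 0)\<bar>
     + (\<Sum>j<n. \<bar>incr w (\<xi> i) (\<xi> (Suc i)) (l ! j) (l ! Suc j)\<bar>)" if i: "i < m" for i
  proof -
    obtain k where k: "k < length l" "l ! k = t i"
    proof -
      have "t i \<in> set l" using i unfolding l(1) A_def by blast
      then show ?thesis using that by (auto simp: in_set_conv_nth)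
    qed
    have "(\<Sum>j<k. incr w (\<xi> i) (\<xi> (Suc i)) (l ! j) (l ! Suc j)) = incr w (\<xi> i) (\<xi> (Suc i)) (l ! 0) (l ! k)" for k
      by (induction k) (auto simp: incr_def)
    from this[of k] have "\<bar>incr w (\<xi> i) (\<xi> (Suc i)) 0 (t i)\<bar> \<le> (\<Sum>j<k. \<bar>incr w (\<xi> i) (\<xi> (Suc i)) (l ! j) (l ! Suc j)\<bar>)"
      unfolding l0 k(2) by (metis sum_abs)
    also have "\<dots> \<le> (\<Sum>j<n. \<bar>incr w (\<xi> i) (\<xi> (Suc i)) (l ! j) (l ! Suc j)\<bar>)"
      using k by (intro sum_mono2) (auto simp: n_def)
    finally show ?thesis by (simp add: incr_def)
  qed
  then have "(\<Sum>i<m. \<bar>w (\<xi> (Suc i), t i) - w (\<xi> i, t i)\<bar>) \<le> (\<Sum>i<m. \<bar>w (\<xi> (Suc i), 0) - w (\<xi> i, 0)\<bar>)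
     + (\<Sum>i<m. \<Sum>j<n. \<bar>incr w (\<xi> i) (\<xi> (Suc i)) (l ! j) (l ! Suc j)\<bar>)"
    unfolding sum.distrib[symmetric] by (intro sum_mono) auto
  also have "\<dots> \<le> B + B" using T by (intro add_mono bvB_sec1[OF w xi] bvB_vitali[OF w xi g]) auto
  finally show ?thesis by simp
qed

text \<open>Regard \<open>w\<close> as a function of \<open>s\<close> with values in the bounded functions of \<open>t\<close>, with the
  supremum norm: it has bounded variation, and its variation function \<open>V\<close> controls it.\<close>

lemma variation_function:
  assumes w: "bvB S T w B" and ST: "S \<ge> 0" "T \<ge> 0"
  shows "\<exists>V. mono_on {0..S} V \<and> (\<forall>s\<in>{0..S}. \<forall>s'\<in>{0..S}. \<forall>t\<in>{0..T}. \<bar>w (s', t) - w (s, t)\<bar> \<le> \<bar>V s' - V s\<bar>)"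
proof -
  \<comment> \<open>The heights are free in every step; this is how the supremum over
    \<open>t\<close> enters the variation on \<open>{0..s}\<close>.\<close>
  define X where "X s = {v. \<exists>m \<xi> t. wgrid s m \<xi> \<and> (\<forall>i<m. t i \<in> {0..T}) \<and>
      v = (\<Sum>i<m. \<bar>w (\<xi> (Suc i), t i) - w (\<xi> i, t i)\<bar>)}" for s
  define V where "V s = Sup (X s)" for s
  have wg: "wgrid s m \<xi> \<Longrightarrow> s \<le> s' \<Longrightarrow> wgrid s' m \<xi>" for s s' m \<xi> unfolding wgrid_def by force
  have bdd: "bdd_above (X s)" if "s \<in> {0..S}" for s
    unfolding X_def using sup_variation_bound[OF w ST(2) wg] that by (intro bdd_aboveI[of _ "2*B"]) force
  have ne: "0 \<in> X s" if "s \<in> {0..S}" for s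
    unfolding X_def using that by (auto intro!: exI[of _ "0::nat"] exI[of _ "\<lambda>_. 0::real"] simp: wgrid_def)
  have step: "V s + \<bar>w (s', t) - w (s, t)\<bar> \<le> V s'"
    if s: "s \<in> {0..S}" "s' \<in> {0..S}" "s \<le> s'" and t: "t \<in> {0..T}" for s s' t
  proof -
    have "v \<le> V s' - \<bar>w (s', t) - w (s, t)\<bar>" if v: "v \<in> X s" for v
    proof -
      obtain m \<xi> u where m: "wgrid s m \<xi>" "\<forall>i<m. u i \<in> {0..T}"
        "v = (\<Sum>i<m. \<bar>w (\<xi> (Suc i), u i) - w (\<xi> i, u i)\<bar>)" using v unfolding X_def by blast
      \<comment> \<open>Appends a step from the last point to \<open>s\<close>, which can only add
        to the sum, and then the step from \<open>s\<close> to \<open>s'\<close>, measured at height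
        \<open>t\<close>.\<close>
      define \<xi>' where "\<xi>' i = (if i \<le> m then \<xi> i else if i = Suc m then s else s')" for i
      define u' where "u' i = (if i < m then u i else t)" for i
      have "wgrid s' (Suc (Suc m)) \<xi>'"
        using m(1) s by (auto simp: wgrid_def \<xi>'_def le_Suc_eq less_Suc_eq)
      moreover have "\<forall>i<Suc (Suc m). u' i \<in> {0..T}" using m(2) t by (auto simp: u'_def)
      ultimately have "(\<Sum>i<Suc (Suc m). \<bar>w (\<xi>' (Suc i), u' i) - w (\<xi>' i, u' i)\<bar>) \<in> X s'"
        unfolding X_def by blast
      then have "(\<Sum>i<Suc (Suc m). \<bar>w (\<xi>' (Suc i), u' i) - w (\<xi>' i, u' i)\<bar>) \<le> V s'"
        unfolding V_def using bdd s by (intro cSup_upper) auto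
      moreover have "(\<Sum>i<m. \<bar>w (\<xi>' (Suc i), u' i) - w (\<xi>' i, u' i)\<bar>) = v"
        unfolding m(3) by (intro sum.cong) (auto simp: \<xi>'_def u'_def)
      ultimately show ?thesis by (simp add: \<xi>'_def u'_def)
    qed
    then have "V s \<le> V s' - \<bar>w (s', t) - w (s, t)\<bar>"
      unfolding V_def[of s] using ne[OF s(1)] by (intro cSup_least) blast+
    then show ?thesis by simp
  qed
  have "mono_on {0..S} V"
  proof (rule mono_onI)
    fix r s assume "r \<in> {0..S}" "s \<in> {0..S}" "r \<le> s"
    then show "V r \<le> V s" using step[of r s 0] ST by auto
  qed
  moreover have "\<bar>w (s', t) - w (s, t)\<bar> \<le> \<bar>V s' - V s\<bar>" if "s \<in> {0..S}" "s' \<in> {0..S}" "t \<in> {0..T}" for s s' t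
    using step[of s s' t] step[of s' s t] that by (cases "s \<le> s'") auto
  ultimately show ?thesis by blast
qed

lemma bvB_swap: "bvB S T w B \<Longrightarrow> bvB T S (\<lambda>(t, s). w (s, t)) B"
  unfolding bvB_def
proof (intro conjI; (elim conjE)?)
  assume *: "\<forall>m n \<xi> \<eta>. wgrid S m \<xi> \<longrightarrow> wgrid T n \<eta> \<longrightarrow>
        (\<Sum>i<m. \<Sum>j<n. \<bar>incr w (\<xi> i) (\<xi> (Suc i)) (\<eta> j) (\<eta> (Suc j))\<bar>) \<le> B"
  have "incr (\<lambda>(t, s). w (s, t)) s s' t t' = incr w t t' s s'" for s s' t t' by (simp add: incr_def)
  then show "\<forall>m n \<xi> \<eta>. wgrid T m \<xi> \<longrightarrow> wgrid S n \<eta> \<longrightarrow>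
        (\<Sum>i<m. \<Sum>j<n. \<bar>incr (\<lambda>(t, s). w (s, t)) (\<xi> i) (\<xi> (Suc i)) (\<eta> j) (\<eta> (Suc j))\<bar>) \<le> B"
    using * by (subst sum.swap) simp
qed (auto simp: rect_def)

text \<open>The variation functions in both directions are monotone, so each has only countably many
  discontinuities. Their increments together dominate those of \<open>w\<close>, which makes
  \<open>w\<close> jointly continuous at the remaining points, relative to the rectangle.\<close>

lemma bvB_continuity:
  assumes w: "bvB S T w B" and ST: "S \<ge> 0" "T \<ge> 0"
  shows "\<exists>D D'. countable D \<and> countable D' \<and>
    (\<forall>p X. fst p \<notin> D \<longrightarrow> snd p \<notin> D' \<longrightarrow> p \<in> rect S T \<longrightarrow> (\<forall>n::nat. X n \<in> rect S T) \<longrightarrow> X \<longlonglongrightarrow> p \<longrightarrow> (\<lambda>n. w (X n)) \<longlonglongrightarrow> w p)"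
proof -
  obtain V where V: "mono_on {0..S} V"
    "\<And>s s' t. s \<in> {0..S} \<Longrightarrow> s' \<in> {0..S} \<Longrightarrow> t \<in> {0..T} \<Longrightarrow> \<bar>w (s', t) - w (s, t)\<bar> \<le> \<bar>V s' - V s\<bar>"
    using variation_function[OF w ST] by blast
  obtain U where U: "mono_on {0..T} U"
    "\<And>s s' t. s \<in> {0..T} \<Longrightarrow> s' \<in> {0..T} \<Longrightarrow> t \<in> {0..S} \<Longrightarrow> \<bar>w (t, s') - w (t, s)\<bar> \<le> \<bar>U s' - U s\<bar>"
    using variation_function[OF bvB_swap[OF w] ST(2,1)] by auto
  define D where "D = {a\<in>{0..S}. \<not> continuous (at a within {0..S}) V}"
  define D' where "D' = {a\<in>{0..T}. \<not> continuous (at a within {0..T}) U}"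
  have "(\<lambda>n. w (X n)) \<longlonglongrightarrow> w p"
    if p: "fst p \<notin> D" "snd p \<notin> D'" "p \<in> rect S T" and X: "\<forall>n. X n \<in> rect S T" "X \<longlonglongrightarrow> p" for p and X :: "nat \<Rightarrow> _"
  proof -
    have Xin: "fst (X n) \<in> {0..S}" "snd (X n) \<in> {0..T}" for n using X(1) by (auto simp: rect_def mem_Times_iff)
    have pin: "fst p \<in> {0..S}" "snd p \<in> {0..T}" using p by (auto simp: rect_def mem_Times_iff)
    have "(\<lambda>n. V (fst (X n))) \<longlonglongrightarrow> V (fst p)"
      using p(1) pin Xin tendsto_fst[OF X(2)] unfolding D_def continuous_within_sequentially
      by (auto simp: o_def)
    then have 1: "(\<lambda>n. \<bar>V (fst (X n)) - V (fst p)\<bar>) \<longlonglongrightarrow> 0"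
      by (simp add: LIM_zero tendsto_rabs_zero)
    have "(\<lambda>n. U (snd (X n))) \<longlonglongrightarrow> U (snd p)"
      using p(2) pin Xin tendsto_snd[OF X(2)] unfolding D'_def continuous_within_sequentially
      by (auto simp: o_def)
    then have 2: "(\<lambda>n. \<bar>U (snd (X n)) - U (snd p)\<bar>) \<longlonglongrightarrow> 0"
      by (simp add: LIM_zero tendsto_rabs_zero)
    have "norm (w (X n) - w p) \<le> \<bar>V (fst (X n)) - V (fst p)\<bar> + \<bar>U (snd (X n)) - U (snd p)\<bar>" for n
      using V(2)[OF pin(1) Xin(1)[of n] Xin(2)[of n]] U(2)[OF pin(2) Xin(2) pin(1), of n] by simp
    then have "(\<lambda>n. w (X n) - w p) \<longlonglongrightarrow> 0"
      by (intro Lim_null_comparison[OF _ tendsto_add_zero[OF 1 2]]) auto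
    then show ?thesis by (simp add: LIM_zero_iff)
  qed
  moreover have "countable D" "countable D'"
    unfolding D_def D'_def by (rule mono_on_ctble_discont[OF V(1)], rule mono_on_ctble_discont[OF U(1)])
  ultimately show ?thesis by blast
qed

section \<open>Existence of the Riemann--Stieltjes integral\<close>

lemma rect_sets [measurable]: "rect S T \<in> sets borel"
  unfolding rect_def by (intro borel_closed closed_Times) auto

lemma rect_lmeasurable: "rect S T \<in> sets lebesgue"
  using rect_sets by (metis sets_completionI_sets sets_lborel)

lemma AE_lebI: "AE p in lborel. p \<in> rect S T \<longrightarrow> P p \<Longrightarrow> AE p in leb S T. P p"
  using rect_lmeasurable by (subst AE_restrict_space_iff) (auto intro: AE_completion)

lemma borel_measurable_leb: "f \<in> borel_measurable borel \<Longrightarrow> f \<in> borel_measurable (leb S T)"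
  by (intro measurable_restrict_space1 measurable_completion) simp

lemma integral_leb:
  fixes f :: "real \<times> real \<Rightarrow> real"
  assumes f: "f \<in> borel_measurable borel"
  shows "(LINT p|leb S T. f p) = (LINT p|lborel. indicator (rect S T) p * f p)"
  using rect_lmeasurable f by (subst integral_restrict_space) (auto simp: integral_completion)

lemma finite_measure_leb: "finite_measure (leb S T)"
proof
  have "rect S T \<in> lmeasurable"
    unfolding rect_def by (intro lmeasurable_compact compact_Times) auto
  then show "emeasure (leb S T) (space (leb S T)) \<noteq> \<infinity>"
    using rect_lmeasurable by (simp add: emeasure_restrict_space fmeasurable_def less_top)
qed

lemma integrable_leb_bounded:
  fixes f :: "_ \<Rightarrow> real"
  assumes "f \<in> borel_measurable (leb S T)" "\<And>p. p \<in> rect S T \<Longrightarrow> \<bar>f p\<bar> \<le> B"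
  shows "integrable (leb S T) f"
proof (rule finite_measure.integrable_const_bound[OF finite_measure_leb])
  show "AE p in leb S T. norm (f p) \<le> B" using assms(2) by (intro AE_I2) auto
qed (rule assms(1))

lemma lborel_product_integral:
  fixes \<alpha> \<beta> :: "real \<Rightarrow> real"
  assumes a: "integrable lborel \<alpha>" and b: "integrable lborel \<beta>"
  shows "integrable lborel (\<lambda>p. \<alpha> (fst p) * \<beta> (snd p))"
    and "(LINT p|lborel. \<alpha> (fst p) * \<beta> (snd p)) = (LINT s|lborel. \<alpha> s) * (LINT t|lborel. \<beta> t)"
proof -
  have [measurable]: "\<alpha> \<in> borel_measurable borel" "\<beta> \<in> borel_measurable borel"
    using a b by auto
  have i: "integrable (lborel \<Otimes>\<^sub>M lborel) (\<lambda>p. \<alpha> (fst p) * \<beta> (snd p))"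
    using a b by (intro lborel_pair.Fubini_integrable) (auto simp: abs_mult)
  then show "integrable lborel (\<lambda>p. \<alpha> (fst p) * \<beta> (snd p))" by (simp add: lborel_prod)
  show "(LINT p|lborel. \<alpha> (fst p) * \<beta> (snd p)) = (LINT s|lborel. \<alpha> s) * (LINT t|lborel. \<beta> t)"
    using lborel_pair.integral_fst'[OF i] by (simp add: lborel_prod)
qed

section \<open>Tagged grids and uniform Riemann-Stieltjes sums\<close>

definition tag_grid :: "real \<Rightarrow> real \<Rightarrow> nat \<Rightarrow> (nat \<Rightarrow> real) \<Rightarrow> (nat \<Rightarrow> real) \<Rightarrow> bool" where
  "tag_grid c \<delta> m a \<xi> \<longleftrightarrow> grid c m a \<and> (\<forall>i<m. a (Suc i) - a i < \<delta> \<and> \<xi> i \<in> {a i..a (Suc i)})"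

lemma tag_grid_mono: "tag_grid c \<delta> m a \<xi> \<Longrightarrow> \<delta> \<le> \<delta>' \<Longrightarrow> tag_grid c \<delta>' m a \<xi>"
  by (force simp: tag_grid_def)

definition RS_sum :: "(real \<times> real \<Rightarrow> real) \<Rightarrow> (real \<times> real \<Rightarrow> real) \<Rightarrow> nat \<Rightarrow> nat \<Rightarrow>
    (nat \<Rightarrow> real) \<Rightarrow> (nat \<Rightarrow> real) \<Rightarrow> (nat \<Rightarrow> real) \<Rightarrow> (nat \<Rightarrow> real) \<Rightarrow> real" where
  "RS_sum w x m n a b \<xi> \<eta> = (\<Sum>i<m. \<Sum>j<n. w (\<xi> i, \<eta> j) * rect_incr x a b i j)"

lemma has_RS_iff: "has_RS_integral S T w x I \<longleftrightarrow>
    (\<forall>\<epsilon>>0. \<exists>\<delta>>0. \<forall>m n a b \<xi> \<eta>. tag_grid S \<delta> m a \<xi> \<longrightarrow> tag_grid T \<delta> n b \<eta> \<longrightarrow>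
       \<bar>RS_sum w x m n a b \<xi> \<eta> - I\<bar> < \<epsilon>)"
  unfolding has_RS_integral_def tag_grid_def RS_sum_def by (simp only: imp_conjL) meson

definition ugrid :: "real \<Rightarrow> nat \<Rightarrow> nat \<Rightarrow> real" where
  "ugrid c k i = c * real i / real (Suc k)"

text \<open>The cells have length \<open>c / real (Suc k)\<close>; the numerator
  \<open>c + 1\<close> makes the mesh condition of \<open>tag_grid\<close> strict.\<close>

lemma ugrid: assumes "c > 0" shows "tag_grid c ((c + 1) / real (Suc k)) (Suc k) (ugrid c k) (ugrid c k)"
proof -
  have d: "ugrid c k (Suc i) = ugrid c k i + c / real (Suc k)" for i
    by (simp add: ugrid_def add_divide_distrib[symmetric] algebra_simps)
  have "c / real (Suc k) > 0" "c / real (Suc k) < (c + 1) / real (Suc k)"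
    using assms by (auto simp: divide_strict_right_mono)
  moreover have "ugrid c k 0 = 0" "ugrid c k (Suc k) = c" by (auto simp: ugrid_def)
  ultimately show ?thesis unfolding tag_grid_def grid_def d by auto
qed

lemma mesh_tendsto: "(\<lambda>k. (c + 1) / real (Suc k)) \<longlonglongrightarrow> 0"
  by (rule LIMSEQ_Suc[OF lim_const_over_n])

lemma eventually_ugrid:
  assumes "c > 0" "\<delta> > 0"
  shows "eventually (\<lambda>k. tag_grid c \<delta> (Suc k) (ugrid c k) (ugrid c k)) sequentially"
  using order_tendstoD(2)[OF mesh_tendsto[of c] assms(2)]
  by eventually_elim (rule tag_grid_mono[OF ugrid[OF assms(1)]], simp)

text \<open>A fixed sequence of sums, linear in the path. It yields uniqueness of the integral, and
  later its measurability and its law.\<close>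

definition uRS :: "real \<Rightarrow> real \<Rightarrow> (real \<times> real \<Rightarrow> real) \<Rightarrow> (real \<times> real \<Rightarrow> real) \<Rightarrow> nat \<Rightarrow> real" where
  "uRS S T w x k = RS_sum w x (Suc k) (Suc k) (ugrid S k) (ugrid T k) (ugrid S k) (ugrid T k)"

lemma has_RS_uRS:
  assumes ST: "S > 0" "T > 0" and I: "has_RS_integral S T w x I"
  shows "(\<lambda>k. uRS S T w x k) \<longlonglongrightarrow> I"
proof (rule tendstoI)
  fix \<epsilon> :: real assume "\<epsilon> > 0"
  with I obtain \<delta> where d: "\<delta> > 0" "\<And>m n a b \<xi> \<eta>. tag_grid S \<delta> m a \<xi> \<Longrightarrow> tag_grid T \<delta> n b \<eta> \<Longrightarrow>
       \<bar>RS_sum w x m n a b \<xi> \<eta> - I\<bar> < \<epsilon>" unfolding has_RS_iff by blast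
  show "eventually (\<lambda>k. dist (uRS S T w x k) I < \<epsilon>) sequentially"
    using eventually_ugrid[OF ST(1) d(1)] eventually_ugrid[OF ST(2) d(1)]
    by eventually_elim (auto simp: uRS_def dist_real_def intro: d(2))
qed

lemma has_RS_unique:
  assumes "S > 0" "T > 0" "has_RS_integral S T w x I" "has_RS_integral S T w x J"
  shows "I = J"
  using has_RS_uRS[OF assms(1,2,3)] has_RS_uRS[OF assms(1,2,4)] by (rule LIMSEQ_unique)

lemma RS_integral_eqI:
  assumes "S > 0" "T > 0" "has_RS_integral S T w x I" shows "RS_integral S T w x = I"
  unfolding RS_integral_def using has_RS_unique[OF assms(1,2) _ assms(3)] assms(3) by (intro the_equality)

text \<open>The value of the integral is not known in advance: for each \<open>\<epsilon>\<close> a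
  different \<open>I\<close> may be close to all fine sums. This makes the uniform sums a Cauchy
  sequence, and their limit is the integral.\<close>

lemma RS_approx_exists:
  assumes ST: "S > 0" "T > 0"
    and ap: "\<And>\<epsilon>. \<epsilon> > 0 \<Longrightarrow> \<exists>I. \<exists>\<delta>>0. \<forall>m n a b \<xi> \<eta>. tag_grid S \<delta> m a \<xi> \<longrightarrow> tag_grid T \<delta> n b \<eta> \<longrightarrow>
       \<bar>RS_sum w x m n a b \<xi> \<eta> - I\<bar> < \<epsilon>"
  shows "\<exists>I. has_RS_integral S T w x I"
proof -
  have "Cauchy (\<lambda>k. uRS S T w x k)"
  proof (rule metric_CauchyI)
    fix \<epsilon> :: real assume "\<epsilon> > 0"
    then obtain I \<delta> where d: "\<delta> > 0" "\<And>m n a b \<xi> \<eta>. tag_grid S \<delta> m a \<xi> \<Longrightarrow> tag_grid T \<delta> n b \<eta> \<Longrightarrow>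
       \<bar>RS_sum w x m n a b \<xi> \<eta> - I\<bar> < \<epsilon> / 2" using ap[OF half_gt_zero[OF \<open>\<epsilon> > 0\<close>]] by metis
    have "eventually (\<lambda>k. \<bar>uRS S T w x k - I\<bar> < \<epsilon> / 2) sequentially"
      using eventually_ugrid[OF ST(1) d(1)] eventually_ugrid[OF ST(2) d(1)]
      unfolding uRS_def by eventually_elim (rule d(2))
    then obtain N where "\<And>k. k \<ge> N \<Longrightarrow> \<bar>uRS S T w x k - I\<bar> < \<epsilon> / 2" by (auto simp: eventually_sequentially)
    then have "dist (uRS S T w x m) (uRS S T w x n) < \<epsilon>" if "m \<ge> N" "n \<ge> N" for m n
      using that dist_triangle_half_l[of "uRS S T w x m" I \<epsilon> "uRS S T w x n"] by (auto simp: dist_real_def)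
    then show "\<exists>M. \<forall>m\<ge>M. \<forall>n\<ge>M. dist (uRS S T w x m) (uRS S T w x n) < \<epsilon>" by blast
  qed
  then obtain I where I: "(\<lambda>k. uRS S T w x k) \<longlonglongrightarrow> I" by (auto simp: Cauchy_convergent_iff convergent_def)
  have "has_RS_integral S T w x I"
    unfolding has_RS_iff
  proof (intro allI impI)
    fix \<epsilon> :: real assume "\<epsilon> > 0"
    then obtain J \<delta> where d: "\<delta> > 0" "\<And>m n a b \<xi> \<eta>. tag_grid S \<delta> m a \<xi> \<Longrightarrow> tag_grid T \<delta> n b \<eta> \<Longrightarrow>
       \<bar>RS_sum w x m n a b \<xi> \<eta> - J\<bar> < \<epsilon> / 2" using ap[OF half_gt_zero[OF \<open>\<epsilon> > 0\<close>]] by metis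
    have "eventually (\<lambda>k. \<bar>uRS S T w x k - J\<bar> < \<epsilon> / 2) sequentially"
      using eventually_ugrid[OF ST(1) d(1)] eventually_ugrid[OF ST(2) d(1)]
      unfolding uRS_def by eventually_elim (rule d(2))
    then have "eventually (\<lambda>k. \<bar>uRS S T w x k - J\<bar> \<le> \<epsilon> / 2) sequentially"
      by eventually_elim simp
    then have "\<bar>I - J\<bar> \<le> \<epsilon> / 2"
      by (intro tendsto_upperbound[OF tendsto_rabs[OF tendsto_diff[OF I tendsto_const]]]) auto
    then have "\<bar>RS_sum w x m n a b \<xi> \<eta> - I\<bar> < \<epsilon>"
      if "tag_grid S \<delta> m a \<xi>" "tag_grid T \<delta> n b \<eta>" for m n a b \<xi> \<eta>
      using d(2)[OF that] by linarith
    then show "\<exists>\<delta>>0. \<forall>m n a b \<xi> \<eta>. tag_grid S \<delta> m a \<xi> \<longrightarrow> tag_grid T \<delta> n b \<eta> \<longrightarrow>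
       \<bar>RS_sum w x m n a b \<xi> \<eta> - I\<bar> < \<epsilon>"
      using d(1) by blast
  qed
  then show ?thesis by blast
qed

text \<open>The relation between the sums is a hypothesis, so that one lemma covers additivity in
  the integrand and in the integrator. The same device is used in
  \<open>has_RS_cmult\<close>.\<close>

lemma has_RS_add:
  assumes I: "has_RS_integral S T w x I" and J: "has_RS_integral S T v y J"
    and eq: "\<And>m n a b \<xi> \<eta>. RS_sum u z m n a b \<xi> \<eta> = RS_sum w x m n a b \<xi> \<eta> + RS_sum v y m n a b \<xi> \<eta>"
  shows "has_RS_integral S T u z (I + J)"
  unfolding has_RS_iff
proof (intro allI impI)
  fix \<epsilon> :: real assume "\<epsilon> > 0"
  then have e: "\<epsilon> / 2 > 0" by simp
  obtain \<delta> where d: "\<delta> > 0" "\<And>m n a b \<xi> \<eta>. tag_grid S \<delta> m a \<xi> \<Longrightarrow> tag_grid T \<delta> n b \<eta> \<Longrightarrow>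
       \<bar>RS_sum w x m n a b \<xi> \<eta> - I\<bar> < \<epsilon> / 2" using I e unfolding has_RS_iff by meson
  obtain \<delta>' where d': "\<delta>' > 0" "\<And>m n a b \<xi> \<eta>. tag_grid S \<delta>' m a \<xi> \<Longrightarrow> tag_grid T \<delta>' n b \<eta> \<Longrightarrow>
       \<bar>RS_sum v y m n a b \<xi> \<eta> - J\<bar> < \<epsilon> / 2" using J e unfolding has_RS_iff by meson
  show "\<exists>\<delta>>0. \<forall>m n a b \<xi> \<eta>. tag_grid S \<delta> m a \<xi> \<longrightarrow> tag_grid T \<delta> n b \<eta> \<longrightarrow>
       \<bar>RS_sum u z m n a b \<xi> \<eta> - (I + J)\<bar> < \<epsilon>"
  proof (intro exI[of _ "min \<delta> \<delta>'"] conjI allI impI)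
    fix m n a b \<xi> \<eta> assume g: "tag_grid S (min \<delta> \<delta>') m a \<xi>" "tag_grid T (min \<delta> \<delta>') n b \<eta>"
    have "\<bar>RS_sum w x m n a b \<xi> \<eta> - I\<bar> < \<epsilon> / 2" using g by (intro d) (auto elim: tag_grid_mono)
    moreover have "\<bar>RS_sum v y m n a b \<xi> \<eta> - J\<bar> < \<epsilon> / 2" using g by (intro d') (auto elim: tag_grid_mono)
    ultimately show "\<bar>RS_sum u z m n a b \<xi> \<eta> - (I + J)\<bar> < \<epsilon>" unfolding eq by linarith
  qed (use d d' in auto)
qed

lemma has_RS_cmult:
  assumes I: "has_RS_integral S T w x I"
    and eq: "\<And>m n a b \<xi> \<eta>. RS_sum u z m n a b \<xi> \<eta> = c * RS_sum w x m n a b \<xi> \<eta>"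
  shows "has_RS_integral S T u z (c * I)"
  unfolding has_RS_iff
proof (intro allI impI)
  fix \<epsilon> :: real assume "\<epsilon> > 0"
  then have e: "\<epsilon> / (\<bar>c\<bar> + 1) > 0" by (intro divide_pos_pos) auto
  then obtain \<delta> where d: "\<delta> > 0" "\<And>m n a b \<xi> \<eta>. tag_grid S \<delta> m a \<xi> \<Longrightarrow> tag_grid T \<delta> n b \<eta> \<Longrightarrow>
       \<bar>RS_sum w x m n a b \<xi> \<eta> - I\<bar> < \<epsilon> / (\<bar>c\<bar> + 1)" using I unfolding has_RS_iff by meson
  show "\<exists>\<delta>>0. \<forall>m n a b \<xi> \<eta>. tag_grid S \<delta> m a \<xi> \<longrightarrow> tag_grid T \<delta> n b \<eta> \<longrightarrow>
       \<bar>RS_sum u z m n a b \<xi> \<eta> - c * I\<bar> < \<epsilon>"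
  proof (intro exI[of _ \<delta>] conjI allI impI)
    fix m n a b \<xi> \<eta> assume g: "tag_grid S \<delta> m a \<xi>" "tag_grid T \<delta> n b \<eta>"
    have "\<bar>RS_sum u z m n a b \<xi> \<eta> - c * I\<bar> = \<bar>c\<bar> * \<bar>RS_sum w x m n a b \<xi> \<eta> - I\<bar>"
      unfolding eq by (simp add: abs_mult[symmetric] algebra_simps)
    also have "\<dots> \<le> \<bar>c\<bar> * (\<epsilon> / (\<bar>c\<bar> + 1))" using d(2)[OF g] by (intro mult_left_mono) auto
    also have "\<dots> < \<epsilon>" using \<open>\<epsilon> > 0\<close> by (simp add: field_simps)
    finally show "\<bar>RS_sum u z m n a b \<xi> \<eta> - c * I\<bar> < \<epsilon>" .
  qed (use d in auto)
qed

section \<open>Step functions attached to a tagged grid\<close>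

definition cell :: "(nat \<Rightarrow> real) \<Rightarrow> nat \<Rightarrow> real set" where
  "cell a i = {a i<..a (Suc i)}"

lemma cell_ex: assumes "grid c m a" "s \<in> {0<..c}" shows "\<exists>i<m. s \<in> cell a i"
proof -
  have ex: "\<exists>i. s \<le> a i" using assms by (auto simp: grid_def)
  define i where "i = (LEAST i. s \<le> a i)"
  have i: "s \<le> a i" unfolding i_def by (rule LeastI_ex[OF ex])
  have "i \<noteq> 0"
  proof
    assume "i = 0"
    then show False using i assms by (simp add: grid_def)
  qed
  then obtain j where j: "i = Suc j" by (cases i) auto
  then have "\<not> s \<le> a j" unfolding i_def using not_less_Least[of j] by (metis i_def lessI)
  moreover have "i \<le> m" unfolding i_def using assms by (intro Least_le) (auto simp: grid_def)
  ultimately show ?thesis using i j by (auto simp: cell_def intro!: exI[of _ j])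
qed

lemma cell_disjoint:
  assumes "grid c m a" "i < m" "j < m" "s \<in> cell a i" "s \<in> cell a j" shows "i = j"
proof (rule ccontr)
  assume "i \<noteq> j"
  then consider "Suc i \<le> j" | "Suc j \<le> i" by linarith
  then show False
    using grid_mono[OF assms(1), of "Suc i" j] grid_mono[OF assms(1), of "Suc j" i] assms
    by cases (auto simp: cell_def)
qed

text \<open>\<open>RS_sum\<close> integrates this function against the increments of
  \<open>x\<close>. The cells are open on the left and omit the axes, where the value is 0.\<close>

definition stepf :: "(real \<times> real \<Rightarrow> real) \<Rightarrow> nat \<Rightarrow> nat \<Rightarrow> (nat \<Rightarrow> real) \<Rightarrow> (nat \<Rightarrow> real) \<Rightarrow>
   (nat \<Rightarrow> real) \<Rightarrow> (nat \<Rightarrow> real) \<Rightarrow> real \<times> real \<Rightarrow> real" where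
  "stepf w m n a b \<xi> \<eta> p = (\<Sum>i<m. \<Sum>j<n. w (\<xi> i, \<eta> j) * (indicator (cell a i) (fst p) * indicator (cell b j) (snd p)))"

lemma cell_sets [measurable]: "cell a i \<in> sets borel" by (simp add: cell_def)

lemma stepf_measurable [measurable]: "stepf w m n a b \<xi> \<eta> \<in> borel_measurable borel"
  unfolding stepf_def borel_prod[symmetric] by measurable

lemma stepf_eval:
  assumes "grid S m a" "grid T n b" "i < m" "j < n" "fst p \<in> cell a i" "snd p \<in> cell b j"
  shows "stepf w m n a b \<xi> \<eta> p = w (\<xi> i, \<eta> j)"
proof -
  have "stepf w m n a b \<xi> \<eta> p = (\<Sum>i'<m. \<Sum>j'<n. if j' = j then if i' = i then w (\<xi> i, \<eta> j) else 0 else 0)"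
    unfolding stepf_def
  proof (intro sum.cong refl)
    fix i' j' assume "i' \<in> {..<m}" "j' \<in> {..<n}"
    then have "fst p \<in> cell a i' \<longleftrightarrow> i' = i" "snd p \<in> cell b j' \<longleftrightarrow> j' = j"
      using cell_disjoint[OF assms(1) _ assms(3) _ assms(5), of i'] cell_disjoint[OF assms(2) _ assms(4) _ assms(6), of j'] assms(5,6)
      by (metis lessThan_iff)+
    then show "w (\<xi> i', \<eta> j') * (indicator (cell a i') (fst p) * indicator (cell b j') (snd p)) =
      (if j' = j then if i' = i then w (\<xi> i, \<eta> j) else 0 else 0)" by (auto simp: indicator_def)
  qed
  then show ?thesis using assms by simp
qed

lemma stepf_cases:
  assumes g: "grid S m a" "grid T n b" and p: "p \<in> rect S T"
  obtains "fst p = 0 \<or> snd p = 0" "stepf w m n a b \<xi> \<eta> p = 0"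
  | i j where "i < m" "j < n" "fst p \<in> cell a i" "snd p \<in> cell b j" "stepf w m n a b \<xi> \<eta> p = w (\<xi> i, \<eta> j)"
proof (cases "fst p = 0 \<or> snd p = 0")
  case True
  have "fst p \<notin> cell a i" if "fst p = 0" "i < m" for i
    using grid_mem[OF g(1), of i] that by (auto simp: cell_def)
  moreover have "snd p \<notin> cell b j" if "snd p = 0" "j < n" for j
    using grid_mem[OF g(2), of j] that by (auto simp: cell_def)
  ultimately have "stepf w m n a b \<xi> \<eta> p = 0"
    unfolding stepf_def using True by (intro sum.neutral ballI) (auto simp: indicator_def)
  then show ?thesis using that True by blast
next
  case False
  then have "fst p \<in> {0<..S}" "snd p \<in> {0<..T}" using p by (auto simp: rect_def mem_Times_iff)
  then show ?thesis using cell_ex[OF g(1)] cell_ex[OF g(2)] stepf_eval[OF g] that by metis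
qed

lemma tag_mem: "tag_grid c \<delta> m a \<xi> \<Longrightarrow> i < m \<Longrightarrow> \<xi> i \<in> {0..c}"
  using grid_mem[of c m a i] grid_mem[of c m a "Suc i"] unfolding tag_grid_def by fastforce

lemma stepf_bound:
  assumes w: "bvB S T w B" and g: "tag_grid S \<delta> m a \<xi>" "tag_grid T \<delta>' n b \<eta>" and p: "p \<in> rect S T"
  shows "\<bar>stepf w m n a b \<xi> \<eta> p\<bar> \<le> B"
proof -
  have g': "grid S m a" "grid T n b" using g by (auto simp: tag_grid_def)
  show ?thesis
  proof (cases rule: stepf_cases[OF g' p, of w \<xi> \<eta>])
    case 1
    then show ?thesis using bvB_nonneg[OF w] by simp
  next
    case (2 i j)
    then show ?thesis using tag_mem[OF g(1), of i] tag_mem[OF g(2), of j] bvB_bound[OF w] by (auto simp: rect_def)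
  qed
qed

lemma AE_avoid_lines:
  assumes "countable D" "countable D'"
  shows "AE p in leb S T. fst p \<notin> D \<and> snd p \<notin> D'"
proof -
  have "emeasure lborel D = 0" "emeasure lborel D' = 0"
    using assms by (auto intro: emeasure_lborel_countable)
  moreover have [measurable]: "D \<in> sets borel" "D' \<in> sets borel"
    using assms by (auto intro: sets.countable simp: borel_closed)
  ultimately have "emeasure (lborel \<Otimes>\<^sub>M lborel) (D \<times> UNIV) = 0" "emeasure (lborel \<Otimes>\<^sub>M lborel) (UNIV \<times> D') = 0"
    by (auto simp: lborel.emeasure_pair_measure_Times)
  then have "D \<times> UNIV \<in> null_sets lborel" "UNIV \<times> D' \<in> null_sets lborel"
    by (auto simp: null_sets_def lborel_prod borel_prod[symmetric])
  then have "AE p in lborel. p \<notin> D \<times> UNIV" "AE p in lborel. p \<notin> UNIV \<times> D'"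
    by (auto intro: AE_not_in)
  then have "AE p in lborel. fst p \<notin> D \<and> snd p \<notin> D'"
    by eventually_elim (auto simp: mem_Times_iff)
  then show ?thesis by (intro AE_lebI) auto
qed

text \<open>The tag that determines the value at \<open>p\<close> lies within
  \<open>\<delta> k\<close> of \<open>p\<close> in each coordinate. Hence there is convergence
  wherever \<open>w\<close> is continuous, that is off countably many lines.\<close>

lemma stepf_AE_tendsto:
  assumes w: "bvB S T w B" and ST: "S > 0" "T > 0"
    and g: "\<And>k::nat. tag_grid S (\<delta> k) (m k) (a k) (\<xi> k)" "\<And>k. tag_grid T (\<delta> k) (n k) (b k) (\<eta> k)"
    and d: "\<delta> \<longlonglongrightarrow> 0"
  shows "AE p in leb S T. (\<lambda>k. stepf w (m k) (n k) (a k) (b k) (\<xi> k) (\<eta> k) p) \<longlonglongrightarrow> w p"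
proof -
  obtain D D' where D: "countable D" "countable D'"
    "\<And>p X. fst p \<notin> D \<Longrightarrow> snd p \<notin> D' \<Longrightarrow> p \<in> rect S T \<Longrightarrow> (\<And>n::nat. X n \<in> rect S T) \<Longrightarrow> X \<longlonglongrightarrow> p \<Longrightarrow> (\<lambda>n. w (X n)) \<longlonglongrightarrow> w p"
    using bvB_continuity[OF w] ST by (metis less_imp_le)
  \<comment> \<open>The axes are excluded too, so that \<open>p\<close> lies in a cell of every
    grid.\<close>
  have "AE p in leb S T. fst p \<notin> insert 0 D \<and> snd p \<notin> insert 0 D'"
    using D by (intro AE_avoid_lines) auto
  moreover have "AE p in leb S T. p \<in> rect S T" by (rule AE_I2) simp
  ultimately show ?thesis
  proof eventually_elim
    case (elim p)
    have "\<exists>q. q \<in> rect S T \<and> stepf w (m k) (n k) (a k) (b k) (\<xi> k) (\<eta> k) p = w q \<and>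
      \<bar>fst q - fst p\<bar> \<le> \<delta> k \<and> \<bar>snd q - snd p\<bar> \<le> \<delta> k" for k
    proof -
      have g': "grid S (m k) (a k)" "grid T (n k) (b k)" using g[of k] by (auto simp: tag_grid_def)
      show ?thesis
      proof (cases rule: stepf_cases[OF g' elim(2), of w "\<xi> k" "\<eta> k"])
        case 1 then show ?thesis using elim by simp
      next
        case (2 i j)
        have "\<xi> k i \<in> {a k i..a k (Suc i)}" "a k (Suc i) - a k i < \<delta> k"
          "\<eta> k j \<in> {b k j..b k (Suc j)}" "b k (Suc j) - b k j < \<delta> k"
          using g[of k] 2 by (auto simp: tag_grid_def)
        then show ?thesis
          using 2 tag_mem[OF g(1), of i] tag_mem[OF g(2), of j]
          by (intro exI[of _ "(\<xi> k i, \<eta> k j)"]) (auto simp: rect_def cell_def)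
      qed
    qed
    then obtain q where q: "\<And>k. q k \<in> rect S T" "\<And>k. stepf w (m k) (n k) (a k) (b k) (\<xi> k) (\<eta> k) p = w (q k)"
      "\<And>k. \<bar>fst (q k) - fst p\<bar> \<le> \<delta> k" "\<And>k. \<bar>snd (q k) - snd p\<bar> \<le> \<delta> k" by metis
    have "(\<lambda>k. fst (q k) - fst p) \<longlonglongrightarrow> 0" "(\<lambda>k. snd (q k) - snd p) \<longlonglongrightarrow> 0"
      using q(3,4) by (auto intro!: Lim_null_comparison[OF _ d])
    then have "(\<lambda>k. (fst (q k), snd (q k))) \<longlonglongrightarrow> (fst p, snd p)"
      by (intro tendsto_Pair) (auto simp: LIM_zero_iff)
    then have "q \<longlonglongrightarrow> p" by simp
    then show ?case unfolding q(2) using elim q(1) by (intro D(3)) auto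
  qed
qed

text \<open>An almost everywhere limit of Borel step functions; completeness of Lebesgue measure
  takes care of the exceptional lines.\<close>

lemma bvB_measurable:
  assumes w: "bvB S T w B" and ST: "S > 0" "T > 0"
  shows "w \<in> borel_measurable (leb S T)"
proof -
  define s where "s k = stepf w (Suc k) (Suc k) (ugrid S k) (ugrid T k) (ugrid S k) (ugrid T k)" for k
  define d where "d k = (S + T + 1) / real (Suc k)" for k
  have "AE p in leb S T. (\<lambda>k. s k p) \<longlonglongrightarrow> w p"
    unfolding s_def
  proof (rule stepf_AE_tendsto[OF w ST, of d])
    show "tag_grid S (d k) (Suc k) (ugrid S k) (ugrid S k)" "tag_grid T (d k) (Suc k) (ugrid T k) (ugrid T k)" for k
      using ST by (auto simp: d_def intro!: tag_grid_mono[OF ugrid] divide_right_mono)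
    show "d \<longlonglongrightarrow> 0" unfolding d_def using mesh_tendsto[of "S + T"] .
  qed
  then have ae: "AE p in lebesgue. p \<in> rect S T \<longrightarrow> (\<lambda>k. s k p) \<longlonglongrightarrow> w p"
    using rect_lmeasurable by (subst (asm) AE_restrict_space_iff) auto
  define v where "v p = (if p \<in> rect S T then lim (\<lambda>k. s k p) else 0)" for p
  have [measurable]: "s k \<in> borel_measurable borel" for k unfolding s_def by measurable
  have "v \<in> borel_measurable borel" unfolding v_def by measurable
  then have "v \<in> borel_measurable lebesgue" by (intro measurable_completion) simp
  moreover have "AE p in lebesgue. v p = (if p \<in> rect S T then w p else 0)"
    using ae by eventually_elim (auto simp: v_def limI)
  ultimately have "(\<lambda>p. if p \<in> rect S T then w p else 0) \<in> borel_measurable lebesgue"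
    by (rule borel_measurable_AE)
  then show ?thesis using rect_lmeasurable by (simp add: borel_measurable_if)
qed

text \<open>The first limit evaluates integrals with smooth integrators, where \<open>h\<close> is
  the mixed derivative. The second is the convergence of variances in the Gaussian law.\<close>

lemma stepf_integral_tendsto:
  assumes w: "bvB S T w B" and ST: "S > 0" "T > 0"
    and g: "\<And>k::nat. tag_grid S (\<delta> k) (m k) (a k) (\<xi> k)" "\<And>k. tag_grid T (\<delta> k) (n k) (b k) (\<eta> k)"
    and d: "\<delta> \<longlonglongrightarrow> 0" and h: "h \<in> borel_measurable borel" "\<And>p. p \<in> rect S T \<Longrightarrow> \<bar>h p\<bar> \<le> C"
  shows "(\<lambda>k. LINT p|leb S T. stepf w (m k) (n k) (a k) (b k) (\<xi> k) (\<eta> k) p * h p) \<longlonglongrightarrow> (LINT p|leb S T. w p * h p)"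
    and "(\<lambda>k. LINT p|leb S T. (stepf w (m k) (n k) (a k) (b k) (\<xi> k) (\<eta> k) p)\<^sup>2) \<longlonglongrightarrow> (LINT p|leb S T. (w p)\<^sup>2)"
proof -
  interpret finite_measure "leb S T" by (rule finite_measure_leb)
  note [measurable] = bvB_measurable[OF w ST] borel_measurable_leb[OF h(1)] borel_measurable_leb[OF stepf_measurable]
  have B: "\<bar>stepf w (m k) (n k) (a k) (b k) (\<xi> k) (\<eta> k) p\<bar> \<le> B" if "p \<in> rect S T" for k p
    by (rule stepf_bound[OF w g that])
  note ae = stepf_AE_tendsto[OF w ST g d]
  show "(\<lambda>k. LINT p|leb S T. stepf w (m k) (n k) (a k) (b k) (\<xi> k) (\<eta> k) p * h p) \<longlonglongrightarrow> (LINT p|leb S T. w p * h p)"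
  proof (rule integral_dominated_convergence[where w = "\<lambda>_. B * C"])
    show "AE p in leb S T. (\<lambda>k. stepf w (m k) (n k) (a k) (b k) (\<xi> k) (\<eta> k) p * h p) \<longlonglongrightarrow> w p * h p"
      using ae by eventually_elim (intro tendsto_intros)
    show "AE p in leb S T. norm (stepf w (m k) (n k) (a k) (b k) (\<xi> k) (\<eta> k) p * h p) \<le> B * C" for k
      using B h(2) bvB_nonneg[OF w] by (intro AE_I2) (auto simp: abs_mult intro!: mult_mono)
  qed auto
  show "(\<lambda>k. LINT p|leb S T. (stepf w (m k) (n k) (a k) (b k) (\<xi> k) (\<eta> k) p)\<^sup>2) \<longlonglongrightarrow> (LINT p|leb S T. (w p)\<^sup>2)"
  proof (rule integral_dominated_convergence[where w = "\<lambda>_. B\<^sup>2"])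
    show "AE p in leb S T. (\<lambda>k. (stepf w (m k) (n k) (a k) (b k) (\<xi> k) (\<eta> k) p)\<^sup>2) \<longlonglongrightarrow> (w p)\<^sup>2"
      using ae by eventually_elim (intro tendsto_intros)
    show "AE p in leb S T. norm ((stepf w (m k) (n k) (a k) (b k) (\<xi> k) (\<eta> k) p)\<^sup>2) \<le> B\<^sup>2" for k
      using B by (intro AE_I2) (auto simp: abs_le_square_iff[symmetric] intro: order_trans[OF _ abs_ge_self])
  qed auto
qed

section \<open>Polynomial integrators\<close>

lemma integral_monomial_Ioc:
  assumes "a \<le> b"
  shows "integrable lborel (\<lambda>s. indicator {a<..b} s * (real k * s ^ (k - 1)))"
    and "(LINT s|lborel. indicator {a<..b} s * (real k * s ^ (k - 1))) = b ^ k - a ^ k"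
proof -
  have i: "integrable lborel (\<lambda>s. indicator {a..b} s * (real k * s ^ (k - 1)))"
    using borel_integrable_atLeastAtMost[of a b "\<lambda>s. real k * s ^ (k - 1)"]
    by (simp add: mult_ac)
  have ae: "AE s in lborel. indicator {a..b} s * (real k * s ^ (k - 1)) = indicator {a<..b} s * (real k * s ^ (k - 1))"
    using AE_lborel_singleton[of a] by eventually_elim (auto simp: indicator_def)
  show "integrable lborel (\<lambda>s. indicator {a<..b} s * (real k * s ^ (k - 1)))"
    by (rule integrable_cong_AE_imp[OF i _ ae]) measurable
  have "(LINT s|lborel. indicator {a<..b} s * (real k * s ^ (k - 1))) = (LINT s|lborel. indicator {a..b} s * (real k * s ^ (k - 1)))"
  proof (rule integral_cong_AE)
    show "AE s in lborel. indicator {a<..b} s * (real k * s ^ (k - 1)) = indicator {a..b} s * (real k * s ^ (k - 1))"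
      using ae by eventually_elim (rule sym)
  qed measurable
  also have "\<dots> = b ^ k - a ^ k"
  proof (cases k)
    case (Suc j)
    have "(LINT s|lborel. indicator {a..b} s * (real k * s ^ (k - 1))) = (LINT s|lborel. real k * (s ^ j * indicator {a..b} s))"
      by (simp add: Suc mult_ac)
    also have "\<dots> = b ^ k - a ^ k"
      using integral_power[OF assms, of j] by (simp add: Suc del: of_nat_Suc)
    finally show ?thesis .
  qed simp
  finally show "(LINT s|lborel. indicator {a<..b} s * (real k * s ^ (k - 1))) = b ^ k - a ^ k" .
qed

text \<open>The rectangular increment of a product is the product of two one-dimensional increments,
  each an integral of a derivative. For \<open>k = 0\<close> the truncated exponent
  \<open>k - 1\<close> is harmless, since the factor \<open>real k\<close> vanishes.\<close>

lemma RS_sum_monomial: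
  assumes g: "grid S m a" "grid T n b"
  shows "RS_sum w (\<lambda>p. c * (fst p ^ k * snd p ^ l)) m n a b \<xi> \<eta> =
    (LINT p|leb S T. stepf w m n a b \<xi> \<eta> p * (c * ((real k * fst p ^ (k - 1)) * (real l * snd p ^ (l - 1)))))"
proof -
  have [measurable]: "fst \<in> borel_measurable (borel :: (real \<times> real) measure)" "snd \<in> borel_measurable (borel :: (real \<times> real) measure)"
    by (auto simp: borel_prod[symmetric])
  define \<alpha> where "\<alpha> i s = indicator (cell a i) s * (real k * s ^ (k - 1))" for i s
  define \<beta> where "\<beta> j s = indicator (cell b j) s * (real l * s ^ (l - 1))" for j s
  have am: "a i \<le> a (Suc i)" if "i < m" for i using g that by (auto simp: grid_def less_imp_le)
  have bm: "b i \<le> b (Suc i)" if "i < n" for i using g that by (auto simp: grid_def less_imp_le)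
  have ai: "integrable lborel (\<alpha> i)" "integral\<^sup>L lborel (\<alpha> i) = a (Suc i) ^ k - a i ^ k" if "i < m" for i
    unfolding \<alpha>_def cell_def using integral_monomial_Ioc[OF am[OF that]] by auto
  have bi: "integrable lborel (\<beta> i)" "integral\<^sup>L lborel (\<beta> i) = b (Suc i) ^ l - b i ^ l" if "i < n" for i
    unfolding \<beta>_def cell_def using integral_monomial_Ioc[OF bm[OF that]] by auto
  have "(LINT p|leb S T. stepf w m n a b \<xi> \<eta> p * (c * ((real k * fst p ^ (k - 1)) * (real l * snd p ^ (l - 1)))))
    = (LINT p|lborel. indicator (rect S T) p * (stepf w m n a b \<xi> \<eta> p * (c * ((real k * fst p ^ (k - 1)) * (real l * snd p ^ (l - 1))))))"
    by (rule integral_leb) measurable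
  also have "\<dots> = (LINT p|lborel. (\<Sum>i<m. \<Sum>j<n. (c * w (\<xi> i, \<eta> j)) * (\<alpha> i (fst p) * \<beta> j (snd p))))"
  proof (rule Bochner_Integration.integral_cong[OF refl])
    fix p :: "real \<times> real"
    have r: "indicator (rect S T) p * (indicator (cell a i) (fst p) * indicator (cell b j) (snd p))
       = (indicator (cell a i) (fst p) * indicator (cell b j) (snd p) :: real)" if "i < m" "j < n" for i j
      using grid_mem[OF g(1), of i] grid_mem[OF g(1), of "Suc i"] grid_mem[OF g(2), of j] grid_mem[OF g(2), of "Suc j"] that
      by (auto simp: indicator_def cell_def rect_def mem_Times_iff)
    have "indicator (rect S T) p * (stepf w m n a b \<xi> \<eta> p * (c * ((real k * fst p ^ (k - 1)) * (real l * snd p ^ (l - 1)))))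
      = (\<Sum>i<m. \<Sum>j<n. (indicator (rect S T) p * (indicator (cell a i) (fst p) * indicator (cell b j) (snd p))) *
          (w (\<xi> i, \<eta> j) * (c * ((real k * fst p ^ (k - 1)) * (real l * snd p ^ (l - 1))))))"
      unfolding stepf_def sum_distrib_left sum_distrib_right by (intro sum.cong refl) (simp only: mult_ac)
    also have "\<dots> = (\<Sum>i<m. \<Sum>j<n. (c * w (\<xi> i, \<eta> j)) * (\<alpha> i (fst p) * \<beta> j (snd p)))"
      by (intro sum.cong refl) (simp add: r \<alpha>_def \<beta>_def mult_ac)
    finally show "indicator (rect S T) p * (stepf w m n a b \<xi> \<eta> p * (c * ((real k * fst p ^ (k - 1)) * (real l * snd p ^ (l - 1)))))
      = (\<Sum>i<m. \<Sum>j<n. (c * w (\<xi> i, \<eta> j)) * (\<alpha> i (fst p) * \<beta> j (snd p)))" .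
  qed
  also have "\<dots> = (\<Sum>i<m. \<Sum>j<n. (c * w (\<xi> i, \<eta> j)) * (LINT p|lborel. \<alpha> i (fst p) * \<beta> j (snd p)))"
    using lborel_product_integral(1)[OF ai(1) bi(1)]
    by (subst Bochner_Integration.integral_sum) (auto intro!: sum.cong simp: Bochner_Integration.integral_sum)
  also have "\<dots> = (\<Sum>i<m. \<Sum>j<n. w (\<xi> i, \<eta> j) * (c * ((a (Suc i) ^ k - a i ^ k) * (b (Suc j) ^ l - b j ^ l))))"
    by (intro sum.cong refl) (simp add: lborel_product_integral(2)[OF ai(1) bi(1)] ai(2) bi(2))
  also have "\<dots> = RS_sum w (\<lambda>p. c * (fst p ^ k * snd p ^ l)) m n a b \<xi> \<eta>"
    unfolding RS_sum_def rect_incr_def by (intro sum.cong refl) (simp add: algebra_simps)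
  finally show ?thesis ..
qed

text \<open>Indirectly: grids of mesh below \<open>1 / Suc k\<close> that violate the claim would
  form a sequence, and dominated convergence along a sequence contradicts them.\<close>

lemma has_RS_monomial:
  assumes w: "bvB S T w B" and ST: "S > 0" "T > 0"
  shows "has_RS_integral S T w (\<lambda>p. c * (fst p ^ k * snd p ^ l))
     (LINT p|leb S T. w p * (c * ((real k * fst p ^ (k - 1)) * (real l * snd p ^ (l - 1)))))"
    (is "has_RS_integral S T w ?x (LINT p|leb S T. w p * ?h p)")
proof (rule ccontr)
  assume "\<not> has_RS_integral S T w ?x (LINT p|leb S T. w p * ?h p)"
  then obtain \<epsilon> where e: "\<epsilon> > 0" "\<And>\<delta>. \<delta> > 0 \<Longrightarrow> \<exists>m n a b \<xi> \<eta>. tag_grid S \<delta> m a \<xi> \<and> tag_grid T \<delta> n b \<eta> \<and>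
      \<not> \<bar>RS_sum w ?x m n a b \<xi> \<eta> - (LINT p|leb S T. w p * ?h p)\<bar> < \<epsilon>"
    unfolding has_RS_iff by meson
  have "\<forall>k::nat. \<exists>m n a b \<xi> \<eta>. tag_grid S (1 / Suc k) m a \<xi> \<and> tag_grid T (1 / Suc k) n b \<eta> \<and>
      \<not> \<bar>RS_sum w ?x m n a b \<xi> \<eta> - (LINT p|leb S T. w p * ?h p)\<bar> < \<epsilon>"
    using e(2) by simp
  then obtain m n a b \<xi> \<eta> where g: "\<And>k::nat. tag_grid S (1 / Suc k) (m k) (a k) (\<xi> k)"
    "\<And>k. tag_grid T (1 / Suc k) (n k) (b k) (\<eta> k)"
    and ge: "\<And>k. \<not> \<bar>RS_sum w ?x (m k) (n k) (a k) (b k) (\<xi> k) (\<eta> k) - (LINT p|leb S T. w p * ?h p)\<bar> < \<epsilon>"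
    unfolding choice_iff by blast
  have [measurable]: "fst \<in> borel_measurable (borel :: (real \<times> real) measure)" "snd \<in> borel_measurable (borel :: (real \<times> real) measure)"
    by (auto simp: borel_prod[symmetric])
  have "(\<lambda>k. LINT p|leb S T. stepf w (m k) (n k) (a k) (b k) (\<xi> k) (\<eta> k) p * ?h p) \<longlonglongrightarrow> (LINT p|leb S T. w p * ?h p)"
  proof (rule stepf_integral_tendsto(1)[OF w ST g])
    show "(\<lambda>k. 1 / real (Suc k)) \<longlonglongrightarrow> 0" using mesh_tendsto[of 0] by simp
    show "\<bar>?h p\<bar> \<le> \<bar>c\<bar> * ((real k * S ^ (k - 1)) * (real l * T ^ (l - 1)))" if "p \<in> rect S T" for p
    proof -
      have "\<bar>real k * fst p ^ (k - 1)\<bar> \<le> real k * S ^ (k - 1)" "\<bar>real l * snd p ^ (l - 1)\<bar> \<le> real l * T ^ (l - 1)"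
        using that by (auto simp: rect_def abs_mult power_abs intro!: mult_left_mono power_mono)
      then show ?thesis using ST unfolding abs_mult[of c] abs_mult[of "real k * fst p ^ (k - 1)"]
        by (intro mult_left_mono mult_mono) auto
    qed
  qed measurable
  then have "(\<lambda>j. RS_sum w ?x (m j) (n j) (a j) (b j) (\<xi> j) (\<eta> j)) \<longlonglongrightarrow> (LINT p|leb S T. w p * ?h p)"
    using g by (subst RS_sum_monomial[where S = S and T = T]) (auto simp: tag_grid_def)
  then have "eventually (\<lambda>k. \<bar>RS_sum w ?x (m k) (n k) (a k) (b k) (\<xi> k) (\<eta> k) - (LINT p|leb S T. w p * ?h p)\<bar> < \<epsilon>) sequentially"
    using e(1) by (auto simp: tendsto_iff dist_real_def)
  then show False using ge by (auto simp: eventually_sequentially)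
qed

text \<open>Sums of monomials, the form in which linearity of the Riemann-Stieltjes integral
  applies. Closure under products connects it with the polynomial functions of the Stone-Weierstrass
  theorem.\<close>

inductive poly2 :: "(real \<times> real \<Rightarrow> real) \<Rightarrow> bool" where
  poly2_monomial: "poly2 (\<lambda>p. c * (fst p ^ k * snd p ^ l))"
| poly2_add: "poly2 f \<Longrightarrow> poly2 g \<Longrightarrow> poly2 (\<lambda>p. f p + g p)"

lemma poly2_mult: assumes "poly2 f" "poly2 g" shows "poly2 (\<lambda>p. f p * g p)"
  using assms
proof (induction f rule: poly2.induct)
  case (poly2_monomial c k l)
  then show ?case
  proof (induction g rule: poly2.induct)
    case (poly2_monomial c' k' l')
    have "(\<lambda>p::real\<times>real. (c * c') * (fst p ^ (k + k') * snd p ^ (l + l')))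
       = (\<lambda>p. c * (fst p ^ k * snd p ^ l) * (c' * (fst p ^ k' * snd p ^ l')))"
      by (simp add: fun_eq_iff power_add algebra_simps)
    then show ?case using poly2.poly2_monomial[of "c * c'" "k + k'" "l + l'"] by simp
  next
    case (poly2_add f g)
    then show ?case using poly2.poly2_add by (simp add: distrib_left)
  qed
next
  case (poly2_add f g)
  then show ?case using poly2.poly2_add by (simp add: distrib_right)
qed

lemma poly2_polynomial: "real_polynomial_function f \<Longrightarrow> poly2 f"
proof (induction f rule: real_polynomial_function.induct)
  case (linear f)
  interpret bounded_linear f by fact
  have eq: "f p = fst p * f (1, 0) + snd p * f (0, 1)" for p
  proof -
    have "p = fst p *\<^sub>R (1, 0) + snd p *\<^sub>R (0, 1)" by (cases p) simp
    then have "f p = f (fst p *\<^sub>R (1, 0) + snd p *\<^sub>R (0, 1))" by (rule arg_cong)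
    also have "\<dots> = fst p *\<^sub>R f (1, 0) + snd p *\<^sub>R f (0, 1)" by (simp only: add scaleR)
    finally show ?thesis by simp
  qed
  have "f = (\<lambda>p. f (1, 0) * (fst p ^ 1 * snd p ^ 0) + f (0, 1) * (fst p ^ 0 * snd p ^ 1))"
    by (rule ext, subst eq) (simp only: power_one_right power_0 mult_1_left mult_1_right mult.commute)
  moreover have "poly2 (\<lambda>p. f (1, 0) * (fst p ^ 1 * snd p ^ 0) + f (0, 1) * (fst p ^ 0 * snd p ^ 1))"
    by (intro poly2_add poly2_monomial)
  ultimately show ?case by (simp only:)
next
  case (const c)
  show ?case using poly2_monomial[of c 0 0] by simp
qed (auto intro: poly2_add poly2_mult)

lemma RS_sum_add_integrator: "RS_sum w (\<lambda>p. x p + y p) m n a b \<xi> \<eta> = RS_sum w x m n a b \<xi> \<eta> + RS_sum w y m n a b \<xi> \<eta>"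
  unfolding RS_sum_def rect_incr_def by (simp add: sum.distrib[symmetric] algebra_simps)

lemma RS_sum_cmult_integrator: "RS_sum w (\<lambda>p. c * x p) m n a b \<xi> \<eta> = c * RS_sum w x m n a b \<xi> \<eta>"
  unfolding RS_sum_def rect_incr_def by (simp add: sum_distrib_left algebra_simps)

lemma RS_sum_add: "RS_sum (\<lambda>p. w p + v p) x m n a b \<xi> \<eta> = RS_sum w x m n a b \<xi> \<eta> + RS_sum v x m n a b \<xi> \<eta>"
  unfolding RS_sum_def by (simp add: sum.distrib[symmetric] algebra_simps)

lemma RS_sum_cmult: "RS_sum (\<lambda>p. c * w p) x m n a b \<xi> \<eta> = c * RS_sum w x m n a b \<xi> \<eta>"
  unfolding RS_sum_def by (simp add: sum_distrib_left algebra_simps)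

lemma has_RS_poly2:
  assumes w: "bvB S T w B" and ST: "S > 0" "T > 0" and x: "poly2 x"
  shows "\<exists>I. has_RS_integral S T w x I"
  using x
proof (induction x rule: poly2.induct)
  case (poly2_monomial c k l)
  then show ?case using has_RS_monomial[OF w ST] by blast
next
  case (poly2_add f g)
  then show ?case using has_RS_add[OF _ _ RS_sum_add_integrator] by blast
qed

text \<open>By \<open>RS_sum_bound\<close> the sums depend continuously on the integrator, uniformly in the grid, so it is
  enough to treat polynomials, for which they are integrals of step functions.\<close>

theorem has_RS_integral_exists:
  assumes w: "bvB S T w B" and ST: "S > 0" "T > 0" and x: "continuous_on (rect S T) x"
  shows "\<exists>I. has_RS_integral S T w x I"
proof (rule RS_approx_exists[OF ST])
  fix \<epsilon> :: real assume e: "\<epsilon> > 0"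
  have B: "B \<ge> 0" by (rule bvB_nonneg[OF w])
  \<comment> \<open>\<open>9 * B\<close> is the constant of \<open>RS_sum_bound\<close>; adding 1
    keeps the denominator positive when \<open>B = 0\<close>.\<close>
  define e' where "e' = \<epsilon> / (2 * (9 * B + 1))"
  have e': "e' > 0" using e B by (simp add: e'_def)
  have "compact (rect S T)" unfolding rect_def by (intro compact_Times) auto
  from Stone_Weierstrass_real_polynomial_function[OF this x e'] obtain y where
    y: "real_polynomial_function y" "\<And>p. p \<in> rect S T \<Longrightarrow> \<bar>x p - y p\<bar> < e'" by metis
  obtain I where "has_RS_integral S T w y I" using has_RS_poly2[OF w ST poly2_polynomial[OF y(1)]] by blast
  then obtain \<delta> where d: "\<delta> > 0" "\<And>m n a b \<xi> \<eta>. tag_grid S \<delta> m a \<xi> \<Longrightarrow> tag_grid T \<delta> n b \<eta> \<Longrightarrow>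
       \<bar>RS_sum w y m n a b \<xi> \<eta> - I\<bar> < \<epsilon> / 2" using e unfolding has_RS_iff by (meson half_gt_zero)
  have "\<bar>RS_sum w x m n a b \<xi> \<eta> - I\<bar> < \<epsilon>" if g: "tag_grid S \<delta> m a \<xi>" "tag_grid T \<delta> n b \<eta>" for m n a b \<xi> \<eta>
  proof -
    have "RS_sum w x m n a b \<xi> \<eta> = RS_sum w (\<lambda>p. x p - y p) m n a b \<xi> \<eta> + RS_sum w y m n a b \<xi> \<eta>"
      unfolding RS_sum_add_integrator[symmetric] by simp
    moreover have "\<bar>RS_sum w (\<lambda>p. x p - y p) m n a b \<xi> \<eta>\<bar> \<le> 9 * B * e'"
      unfolding RS_sum_def using g y(2) by (intro RS_sum_bound[OF w]) (auto simp: tag_grid_def less_imp_le)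
    moreover have "9 * B * e' \<le> \<epsilon> / 2" using e B unfolding e'_def by (simp add: field_simps)
    ultimately show ?thesis using d(2)[OF g] by linarith
  qed
  with d(1) show "\<exists>I. \<exists>\<delta>>0. \<forall>m n a b \<xi> \<eta>. tag_grid S \<delta> m a \<xi> \<longrightarrow> tag_grid T \<delta> n b \<eta> \<longrightarrow>
       \<bar>RS_sum w x m n a b \<xi> \<eta> - I\<bar> < \<epsilon>" by blast
qed

lemma fatou_real:
  fixes f :: "nat \<Rightarrow> 'a \<Rightarrow> real"
  assumes f: "\<And>k. integrable M (f k)" "\<And>k x. x \<in> space M \<Longrightarrow> 0 \<le> f k x"
    and g: "g \<in> borel_measurable M" "AE x in M. (\<lambda>k. f k x) \<longlonglongrightarrow> g x" and C: "\<And>k. (LINT x|M. f k x) \<le> C"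
  shows "integrable M g" "(LINT x|M. g x) \<le> C"
proof -
  have [measurable]: "f k \<in> borel_measurable M" for k using f by auto
  have C0: "0 \<le> C" using C[of 0] f(2) by (intro order_trans[OF Bochner_Integration.integral_nonneg C[of 0]]) auto
  have nn: "AE x in M. 0 \<le> g x"
    using g(2) AE_space
  proof eventually_elim
    case (elim x)
    then show ?case using f(2) by (intro LIMSEQ_le_const[OF elim(1)]) auto
  qed
  have "(\<integral>\<^sup>+x. ennreal (g x) \<partial>M) = (\<integral>\<^sup>+x. liminf (\<lambda>k. ennreal (f k x)) \<partial>M)"
  proof (rule nn_integral_cong_AE)
    show "AE x in M. ennreal (g x) = liminf (\<lambda>k. ennreal (f k x))"
      using g(2)
    proof eventually_elim
      case (elim x)
      then have "(\<lambda>k. ennreal (f k x)) \<longlonglongrightarrow> ennreal (g x)" by (rule tendsto_ennrealI)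
      then show ?case using lim_imp_Liminf[OF trivial_limit_sequentially] by metis
    qed
  qed
  also have "\<dots> \<le> liminf (\<lambda>k. \<integral>\<^sup>+x. ennreal (f k x) \<partial>M)"
    by (rule nn_integral_liminf) measurable
  also have "\<dots> \<le> ennreal C"
  proof (rule Liminf_le)
    show "\<forall>\<^sub>F k in sequentially. (\<integral>\<^sup>+x. ennreal (f k x) \<partial>M) \<le> ennreal C"
      using f C by (intro always_eventually allI) (subst nn_integral_eq_integral, auto intro: ennreal_leI)
  qed simp
  finally have le: "(\<integral>\<^sup>+x. ennreal (g x) \<partial>M) \<le> ennreal C" .
  show i: "integrable M g"
    using le g(1) nn by (intro integrableI_nonneg) (auto simp: less_top[symmetric] top_unique intro: le_less_trans)
  have "ennreal (LINT x|M. g x) \<le> ennreal C"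
    using le nn_integral_eq_integral[OF i nn] by simp
  then show "(LINT x|M. g x) \<le> C" using C0 by simp
qed

section \<open>Square integrable functions\<close>

text \<open>\<open>L2_set\<close> over an arbitrary measure: the same calculus serves the rectangle
  and the path space.\<close>

definition sqi :: "'a measure \<Rightarrow> ('a \<Rightarrow> real) \<Rightarrow> bool" where
  "sqi M u \<longleftrightarrow> u \<in> borel_measurable M \<and> integrable M (\<lambda>p. (u p)\<^sup>2)"

definition ip :: "'a measure \<Rightarrow> ('a \<Rightarrow> real) \<Rightarrow> ('a \<Rightarrow> real) \<Rightarrow> real" where
  "ip M u v = (LINT p|M. u p * v p)"

lemma sqiD [dest]: "sqi M u \<Longrightarrow> u \<in> borel_measurable M" "sqi M u \<Longrightarrow> integrable M (\<lambda>p. (u p)\<^sup>2)"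
  by (auto simp: sqi_def)

lemma sqi_mult_integrable:
  assumes "sqi M u" "sqi M v" shows "integrable M (\<lambda>p. u p * v p)"
proof (rule Bochner_Integration.integrable_bound[of M "\<lambda>p. (u p)\<^sup>2 + (v p)\<^sup>2"])
  show "AE p in M. norm (u p * v p) \<le> norm ((u p)\<^sup>2 + (v p)\<^sup>2)"
  proof (rule AE_I2)
    fix p
    have "2 * (\<bar>u p\<bar> * \<bar>v p\<bar>) \<le> (u p)\<^sup>2 + (v p)\<^sup>2"
      using sum_squares_bound[of "\<bar>u p\<bar>" "\<bar>v p\<bar>"] by simp
    moreover have "0 \<le> \<bar>u p\<bar> * \<bar>v p\<bar>" by simp
    ultimately show "norm (u p * v p) \<le> norm ((u p)\<^sup>2 + (v p)\<^sup>2)"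
      by (simp only: real_norm_def abs_mult)
  qed
qed (use assms in \<open>auto intro!: borel_measurable_times\<close>)

lemma sqi_add [intro]: assumes "sqi M u" "sqi M v" shows "sqi M (\<lambda>p. u p + v p)"
proof -
  note [measurable] = sqiD(1)[OF assms(1)] sqiD(1)[OF assms(2)]
  have "integrable M (\<lambda>p. (u p)\<^sup>2 + (v p)\<^sup>2 + 2 * (u p * v p))"
    using assms sqi_mult_integrable[OF assms] by (intro Bochner_Integration.integrable_add) auto
  then show ?thesis by (simp add: sqi_def power2_sum mult.assoc)
qed

lemma sqi_cmult [intro]: "sqi M u \<Longrightarrow> sqi M (\<lambda>p. c * u p)"
  by (auto simp: sqi_def power_mult_distrib)

lemma sqi_uminus [intro]: "sqi M u \<Longrightarrow> sqi M (\<lambda>p. - u p)"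
  by (auto simp: sqi_def)

lemma sqi_diff [intro]: "sqi M u \<Longrightarrow> sqi M v \<Longrightarrow> sqi M (\<lambda>p. u p - v p)"
  using sqi_add[of M u "\<lambda>p. - v p"] by auto

lemma sqi_zero [intro, simp]: "sqi M (\<lambda>_. 0)" by (auto simp: sqi_def)

lemma sqi_sum [intro]: "finite K \<Longrightarrow> (\<And>k. k \<in> K \<Longrightarrow> sqi M (u k)) \<Longrightarrow> sqi M (\<lambda>p. \<Sum>k\<in>K. u k p)"
  by (induction K rule: finite_induct) auto

lemma ip_commute: "ip M u v = ip M v u" by (simp add: ip_def mult.commute)

lemma ip_add: "sqi M u \<Longrightarrow> sqi M v \<Longrightarrow> sqi M w \<Longrightarrow> ip M (\<lambda>p. u p + v p) w = ip M u w + ip M v w"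
  by (simp add: ip_def distrib_right sqi_mult_integrable)

lemma ip_diff: "sqi M u \<Longrightarrow> sqi M v \<Longrightarrow> sqi M w \<Longrightarrow> ip M (\<lambda>p. u p - v p) w = ip M u w - ip M v w"
  by (simp add: ip_def left_diff_distrib sqi_mult_integrable)

lemma ip_cmult: "ip M (\<lambda>p. c * u p) w = c * ip M u w"
  by (simp add: ip_def mult.assoc)

lemma ip_sum: "finite K \<Longrightarrow> (\<And>k. k \<in> K \<Longrightarrow> sqi M (u k)) \<Longrightarrow> sqi M w \<Longrightarrow>
    ip M (\<lambda>p. \<Sum>k\<in>K. u k p) w = (\<Sum>k\<in>K. ip M (u k) w)"
  by (simp add: ip_def sum_distrib_right sqi_mult_integrable)

lemma ip_self_nonneg: "0 \<le> ip M u u" by (simp add: ip_def)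

lemma ip_self: "ip M u u = (LINT p|M. (u p)\<^sup>2)" by (simp add: ip_def power2_eq_square)

lemma ip_diff_self:
  assumes "sqi M u" "sqi M v"
  shows "ip M (\<lambda>p. u p - v p) (\<lambda>p. u p - v p) = ip M u u - 2 * ip M u v + ip M v v"
proof -
  have d: "sqi M (\<lambda>p. u p - v p)" using assms by auto
  have "ip M (\<lambda>p. u p - v p) (\<lambda>p. u p - v p) = ip M (\<lambda>p. u p - v p) u - ip M (\<lambda>p. u p - v p) v"
    using ip_diff[OF assms d] by (simp add: ip_commute)
  then show ?thesis using assms by (simp add: ip_diff ip_commute[of M v u])
qed

lemma ip_add_self:
  assumes "sqi M u" "sqi M v"
  shows "ip M (\<lambda>p. u p + v p) (\<lambda>p. u p + v p) = ip M u u + 2 * ip M u v + ip M v v"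
proof -
  have d: "sqi M (\<lambda>p. u p + v p)" using assms by auto
  have "ip M (\<lambda>p. u p + v p) (\<lambda>p. u p + v p) = ip M (\<lambda>p. u p + v p) u + ip M (\<lambda>p. u p + v p) v"
    using ip_add[OF assms d] by (simp add: ip_commute)
  then show ?thesis using assms by (simp add: ip_add ip_commute[of M v u])
qed

lemma ip_sum_le: assumes "sqi M u" "sqi M v"
  shows "ip M (\<lambda>p. u p + v p) (\<lambda>p. u p + v p) \<le> 2 * ip M u u + 2 * ip M v v"
proof -
  have "0 \<le> ip M (\<lambda>p. u p - v p) (\<lambda>p. u p - v p)" by (rule ip_self_nonneg)
  then show ?thesis using assms by (simp add: ip_diff_self ip_add_self)
qed

text \<open>Cauchy-Schwarz against a unit vector: the squared distance from \<open>u\<close> to its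
  projection is nonnegative.\<close>

lemma ip_unit_le:
  assumes "sqi M u" "sqi M v" "ip M v v = 1" shows "(ip M u v)\<^sup>2 \<le> ip M u u"
proof -
  have "0 \<le> ip M (\<lambda>p. u p - ip M u v * v p) (\<lambda>p. u p - ip M u v * v p)" by (rule ip_self_nonneg)
  also have "\<dots> = ip M u u - 2 * ip M u (\<lambda>p. ip M u v * v p) + ip M (\<lambda>p. ip M u v * v p) (\<lambda>p. ip M u v * v p)"
    using assms by (intro ip_diff_self) auto
  also have "ip M u (\<lambda>p. ip M u v * v p) = (ip M u v)\<^sup>2"
    by (subst ip_commute) (simp add: ip_cmult ip_commute[of M v u] power2_eq_square)
  also have "ip M (\<lambda>p. ip M u v * v p) (\<lambda>p. ip M u v * v p) = (ip M u v)\<^sup>2 * ip M v v"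
    by (simp add: ip_cmult) (subst ip_commute, simp add: ip_cmult power2_eq_square)
  finally show ?thesis using assms(3) by simp
qed

lemma ip_self_zero_AE: assumes "sqi M u" "ip M u u = 0" shows "AE p in M. u p = 0"
proof -
  have "AE p in M. (u p)\<^sup>2 = 0"
    using integral_nonneg_eq_0_iff_AE[of M "\<lambda>p. (u p)\<^sup>2"] assms by (auto simp: ip_self)
  then show ?thesis by simp
qed

section \<open>Orthonormal expansions\<close>

locale l2_basis = finite_measure M for M :: "'a measure" +
  fixes \<phi> :: "nat \<Rightarrow> 'a \<Rightarrow> real"
  assumes basis_sqi: "\<And>n. sqi M (\<phi> n)"
    and orthonormal: "\<And>i j. ip M (\<phi> i) (\<phi> j) = (if i = j then 1 else 0)"
    and complete: "\<And>u. sqi M u \<Longrightarrow> (\<And>n. ip M u (\<phi> n) = 0) \<Longrightarrow> ip M u u = 0"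
begin

lemma basis_unit: "ip M (\<phi> j) (\<phi> j) = 1"
  using orthonormal[of j j] by simp

definition cf :: "('a \<Rightarrow> real) \<Rightarrow> nat \<Rightarrow> real" where "cf u n = ip M u (\<phi> n)"

definition comb :: "(nat \<Rightarrow> real) \<Rightarrow> nat \<Rightarrow> 'a \<Rightarrow> real" where "comb a n p = (\<Sum>j<n. a j * \<phi> j p)"

lemma comb_sqi: "sqi M (comb a n)"
  unfolding comb_def[abs_def] using basis_sqi by (intro sqi_sum) auto

lemma cf_add: "sqi M u \<Longrightarrow> sqi M v \<Longrightarrow> cf (\<lambda>p. u p + v p) n = cf u n + cf v n"
  and cf_diff: "sqi M u \<Longrightarrow> sqi M v \<Longrightarrow> cf (\<lambda>p. u p - v p) n = cf u n - cf v n"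
  and cf_cmult: "cf (\<lambda>p. c * u p) n = c * cf u n"
  by (auto simp: cf_def ip_add ip_diff ip_cmult basis_sqi)

lemma ip_comb: "sqi M u \<Longrightarrow> ip M (comb a n) u = (\<Sum>j<n. a j * cf u j)"
  unfolding comb_def[abs_def] using basis_sqi
  by (subst ip_sum) (auto simp: ip_cmult cf_def ip_commute[of M u])

lemma cf_comb: "cf (comb a n) k = (if k < n then a k else 0)"
proof -
  have "cf (comb a n) k = (\<Sum>j<n. a j * cf (\<phi> k) j)" unfolding cf_def[of "comb a n"] by (rule ip_comb[OF basis_sqi])
  also have "\<dots> = (\<Sum>j<n. if j = k then a k else 0)" by (intro sum.cong) (auto simp: cf_def orthonormal)
  finally show ?thesis by simp
qed

lemma ip_comb_comb: "ip M (comb a n) (comb a n) = (\<Sum>j<n. (a j)\<^sup>2)"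
  by (simp add: ip_comb comb_sqi cf_comb power2_eq_square)

lemma ip_diff_comb:
  assumes "sqi M u" shows "ip M (\<lambda>p. u p - comb (cf u) n p) (\<lambda>p. u p - comb (cf u) n p) = ip M u u - (\<Sum>j<n. (cf u j)\<^sup>2)"
proof -
  have "ip M u (comb (cf u) n) = (\<Sum>j<n. (cf u j)\<^sup>2)"
    unfolding ip_commute[of M u] ip_comb[OF assms] by (simp only: power2_eq_square)
  then show ?thesis unfolding ip_diff_self[OF assms comb_sqi] ip_comb_comb by simp
qed

lemma bessel: "sqi M u \<Longrightarrow> (\<Sum>j<n. (cf u j)\<^sup>2) \<le> ip M u u"
  using ip_self_nonneg[of M "\<lambda>p. u p - comb (cf u) n p"] by (simp add: ip_diff_comb)

lemma summable_cf: assumes "sqi M u" shows "summable (\<lambda>j. (cf u j)\<^sup>2)"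
  by (rule summableI_nonneg_bounded[where x = "ip M u u"]) (use bessel[OF assms] in auto)

text \<open>Integrates \<open>\<bar>u p\<bar> \<le> e + (u p)\<^sup>2 / e\<close>. On a finite
  measure this turns Cauchy sequences in the square norm into Cauchy sequences in mean.\<close>

lemma sq_bound_L1:
  assumes "sqi M u" "e > 0" shows "(LINT p|M. norm (u p)) \<le> e * measure M (space M) + ip M u u / e"
proof -
  note [measurable] = sqiD(1)[OF assms(1)]
  have le: "norm (u p) \<le> e + (u p)\<^sup>2 / e" for p
  proof -
    have "2 * \<bar>u p\<bar> * e \<le> (u p)\<^sup>2 + e\<^sup>2" using sum_squares_bound[of "\<bar>u p\<bar>" e] by simp
    then have "\<bar>u p\<bar> * e \<le> (u p)\<^sup>2 + e\<^sup>2" using mult_nonneg_nonneg[of "\<bar>u p\<bar>" e] assms(2) by linarith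
    then show ?thesis using assms(2) by (simp add: field_simps power2_eq_square)
  qed
  have "(LINT p|M. norm (u p)) \<le> (LINT p|M. e + (u p)\<^sup>2 / e)"
  proof (rule integral_mono)
    show "integrable M (\<lambda>p. norm (u p))"
      by (rule Bochner_Integration.integrable_bound[of M "\<lambda>p. e + (u p)\<^sup>2 / e"])
         (use assms le in \<open>auto intro!: AE_I2 order_trans[OF _ abs_ge_self]\<close>)
  qed (use assms le in auto)
  then show ?thesis using assms by (auto simp: ip_self mult.commute)
qed

lemma sqi_integrable: assumes "sqi M u" shows "integrable M u"
proof (rule Bochner_Integration.integrable_bound[of M "\<lambda>p. 1 + (u p)\<^sup>2"])
  show "AE p in M. norm (u p) \<le> norm (1 + (u p)\<^sup>2)"
  proof (rule AE_I2)
    fix p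
    have "2 * \<bar>u p\<bar> \<le> 1 + (u p)\<^sup>2" using sum_squares_bound[of 1 "\<bar>u p\<bar>"] by simp
    then show "norm (u p) \<le> norm (1 + (u p)\<^sup>2)" by simp
  qed
qed (use assms in auto)

text \<open>The Riesz-Fischer argument. The partial sums are Cauchy in mean, so a subsequence
  converges almost everywhere to some \<open>w\<close>; Fatou's lemma bounds the squared distance
  from \<open>w\<close> to \<open>s n\<close> by the tail \<open>t n\<close>. Since \<open>w\<close>
  has the same coefficients as \<open>u\<close>, completeness identifies the two.\<close>

theorem expansion_tendsto:
  assumes u: "sqi M u"
  shows "(\<lambda>n. ip M (\<lambda>p. u p - comb (cf u) n p) (\<lambda>p. u p - comb (cf u) n p)) \<longlonglongrightarrow> 0"
proof -
  define s where "s = comb (cf u)"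
  define t where "t n = (\<Sum>j. (cf u j)\<^sup>2) - (\<Sum>j<n. (cf u j)\<^sup>2)" for n
  note sm = summable_cf[OF u]
  have t: "t \<longlonglongrightarrow> 0"
    unfolding t_def using tendsto_diff[OF tendsto_const[of "\<Sum>j. (cf u j)\<^sup>2"] summable_LIMSEQ[OF sm]] by simp
  have tanti: "(\<Sum>j<m. (cf u j)\<^sup>2) - (\<Sum>j<n. (cf u j)\<^sup>2) \<le> t n" for m n
    unfolding t_def using sum_le_suminf[OF sm, of "{..<m}"] by simp
  have s_sqi: "sqi M (s n)" for n unfolding s_def by (rule comb_sqi)
  note [measurable] = sqiD(1)[OF s_sqi] sqiD(1)[OF u]
  have dist_le: "ip M (\<lambda>p. s m p - s n p) (\<lambda>p. s m p - s n p) = (\<Sum>j<m. (cf u j)\<^sup>2) - (\<Sum>j<n. (cf u j)\<^sup>2)"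
    if "n \<le> m" for m n
  proof -
    have "ip M (s m) (s n) = (\<Sum>j<n. (cf u j)\<^sup>2)"
      unfolding s_def using that
      by (subst ip_commute) (simp add: ip_comb[OF comb_sqi] cf_comb power2_eq_square)
    moreover have "ip M (s k) (s k) = (\<Sum>j<k. (cf u j)\<^sup>2)" for k unfolding s_def by (rule ip_comb_comb)
    ultimately show ?thesis by (subst ip_diff_self[OF s_sqi s_sqi]) simp
  qed
  have dist_t: "ip M (\<lambda>p. s m p - s n p) (\<lambda>p. s m p - s n p) \<le> t (min m n)" for m n
  proof (cases "n \<le> m")
    case True
    then show ?thesis using dist_le[OF True] tanti[of m n] True by (simp only: min_absorb2)
  next
    case False
    have "ip M (\<lambda>p. s m p - s n p) (\<lambda>p. s m p - s n p) = ip M (\<lambda>p. s n p - s m p) (\<lambda>p. s n p - s m p)"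
      unfolding ip_self by (simp add: power2_commute)
    then show ?thesis using dist_le[of m n] tanti[of n m] False by (simp only: min_absorb1 nat_le_linear not_le less_imp_le)
  qed
  have "\<exists>N. \<forall>i\<ge>N. \<forall>j\<ge>N. (LINT x|M. norm (s i x - s j x)) < e" if e: "e > 0" for e
  proof -
    define \<mu> where "\<mu> = measure M (space M) + 1"
    have mu: "\<mu> > 0" "measure M (space M) < \<mu>" unfolding \<mu>_def by (auto simp: add_nonneg_pos)
    define e' where "e' = e / (2 * \<mu>)"
    have e': "e' > 0" using e mu by (simp add: e'_def)
    have "eventually (\<lambda>n. t n < e' * e / 2) sequentially"
      using order_tendstoD(2)[OF t, of "e' * e / 2"] e e' by simp
    then obtain N where N: "\<And>n. n \<ge> N \<Longrightarrow> t n < e' * e / 2" by (auto simp: eventually_sequentially)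
    have "(LINT x|M. norm (s i x - s j x)) < e" if "i \<ge> N" "j \<ge> N" for i j
    proof -
      have "(LINT x|M. norm (s i x - s j x)) \<le> e' * measure M (space M) + ip M (\<lambda>p. s i p - s j p) (\<lambda>p. s i p - s j p) / e'"
        using s_sqi e' by (intro sq_bound_L1) auto
      also have "ip M (\<lambda>p. s i p - s j p) (\<lambda>p. s i p - s j p) / e' < e / 2"
        using dist_t[of i j] N[of "min i j"] that e' by (simp add: field_simps min_def split: if_splits)
      also have "e' * measure M (space M) \<le> e' * \<mu>" using e' mu by (intro mult_left_mono) auto
      also have "e' * \<mu> = e / 2" using mu by (simp add: e'_def)
      finally show ?thesis by simp
    qed
    then show ?thesis by blast
  qed
  then obtain r where r: "strict_mono r" "AE x in M. Cauchy (\<lambda>i. s (r i) x)"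
    using cauchy_L1_AE_cauchy_subseq[of M s] sqi_integrable[OF s_sqi] by metis
  define w where "w x = lim (\<lambda>i. s (r i) x)" for x
  have wm[measurable]: "w \<in> borel_measurable M" unfolding w_def by measurable
  have lim: "AE x in M. (\<lambda>i. s (r i) x) \<longlonglongrightarrow> w x"
    using r(2) by eventually_elim (simp add: w_def Cauchy_convergent_iff convergent_LIMSEQ_iff)
  have rn: "r i \<ge> i" for i using r(1) by (rule seq_suble)
  have tpos: "t n \<ge> 0" for n using tanti[of n n] by simp
  have tdec: "t m \<le> t n" if "n \<le> m" for m n
    unfolding t_def using that by (intro diff_left_mono sum_mono2) auto
  have W: "integrable M (\<lambda>x. (w x - s n x)\<^sup>2)" "(LINT x|M. (w x - s n x)\<^sup>2) \<le> t n" for n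
  proof -
    \<comment> \<open>The shift by \<open>n\<close> keeps the subsequence index at least
      \<open>n\<close>, so that \<open>t n\<close> bounds every term in Fatou's lemma.\<close>
    have 1: "integrable M (\<lambda>x. (s (r (i + n)) x - s n x)\<^sup>2)" for i
      using sqi_diff[OF s_sqi s_sqi, of "r (i + n)" n] by auto
    have 2: "AE x in M. (\<lambda>i. (s (r (i + n)) x - s n x)\<^sup>2) \<longlonglongrightarrow> (w x - s n x)\<^sup>2"
      using lim by eventually_elim (intro tendsto_intros LIMSEQ_ignore_initial_segment)
    have 3: "(LINT x|M. (s (r (i + n)) x - s n x)\<^sup>2) \<le> t n" for i
    proof -
      have "min (r (i + n)) n = n" using rn[of "i + n"] by simp
      then show ?thesis using dist_t[of "r (i + n)" n] by (simp add: ip_self)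
    qed
    have 4: "(\<lambda>x. (w x - s n x)\<^sup>2) \<in> borel_measurable M" by measurable
    show "integrable M (\<lambda>x. (w x - s n x)\<^sup>2)" by (rule fatou_real(1)[OF 1 _ 4 2 3]) simp
    show "(LINT x|M. (w x - s n x)\<^sup>2) \<le> t n" by (rule fatou_real(2)[OF 1 _ 4 2 3]) simp
  qed
  have ws: "sqi M (\<lambda>x. w x - s n x)" for n using W(1) by (auto simp: sqi_def)
  have w_sqi: "sqi M w" using sqi_add[OF ws[of 0] s_sqi[of 0]] by simp
  have "cf w k = cf u k" for k
  proof -
    have "(cf w k - cf u k)\<^sup>2 \<le> t n" if "n > k" for n
    proof -
      have "cf w k - cf u k = cf (\<lambda>x. w x - s n x) k"
        using that by (simp add: cf_diff[OF w_sqi s_sqi]) (simp add: s_def cf_comb)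
      moreover have "(cf (\<lambda>x. w x - s n x) k)\<^sup>2 \<le> ip M (\<lambda>x. w x - s n x) (\<lambda>x. w x - s n x)"
        unfolding cf_def by (intro ip_unit_le ws basis_sqi basis_unit)
      ultimately show ?thesis using W(2)[of n] by (simp add: ip_self)
    qed
    then have "(cf w k - cf u k)\<^sup>2 \<le> 0"
      by (intro LIMSEQ_le_const[OF t] exI[of _ "Suc k"]) auto
    then show ?thesis by simp
  qed
  then have "ip M (\<lambda>x. u x - w x) (\<lambda>x. u x - w x) = 0"
    using u w_sqi by (intro complete) (auto simp: cf_def ip_diff basis_sqi)
  then have ae: "AE x in M. u x - w x = 0" using u w_sqi by (intro ip_self_zero_AE) auto
  have "ip M (\<lambda>p. u p - s n p) (\<lambda>p. u p - s n p) \<le> t n" for n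
  proof -
    have "ip M (\<lambda>p. u p - s n p) (\<lambda>p. u p - s n p) = (LINT x|M. (w x - s n x)\<^sup>2)"
      unfolding ip_self
    proof (rule integral_cong_AE)
      show "AE x in M. (u x - s n x)\<^sup>2 = (w x - s n x)\<^sup>2" using ae by eventually_elim simp
    qed measurable
    then show ?thesis using W(2) by simp
  qed
  then show ?thesis unfolding s_def
    by (intro tendsto_sandwich[OF _ _ tendsto_const t] always_eventually allI ip_self_nonneg)
qed

lemma parseval: assumes u: "sqi M u" shows "(\<lambda>j. (cf u j)\<^sup>2) sums ip M u u"
proof -
  have "(\<lambda>n. ip M u u - (\<Sum>j<n. (cf u j)\<^sup>2)) \<longlonglongrightarrow> 0"
    using expansion_tendsto[OF u] by (simp add: ip_diff_comb[OF u])
  from tendsto_diff[OF tendsto_const[of "ip M u u"] this] show ?thesis by (simp add: sums_def)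
qed

end


lemma sqi_mult_bounded:
  assumes u: "sqi M u" and h: "h \<in> borel_measurable M" "\<And>p. p \<in> space M \<Longrightarrow> \<bar>h p\<bar> \<le> C"
  shows "sqi M (\<lambda>p. u p * h p)" "ip M (\<lambda>p. u p * h p) (\<lambda>p. u p * h p) \<le> C\<^sup>2 * ip M u u"
proof -
  note [measurable] = sqiD(1)[OF u] h(1)
  have le: "(u p * h p)\<^sup>2 \<le> C\<^sup>2 * (u p)\<^sup>2" if "p \<in> space M" for p
  proof -
    have "(h p)\<^sup>2 \<le> C\<^sup>2" using h(2)[OF that] by (metis abs_le_square_iff abs_ge_zero abs_of_nonneg order_trans)
    then have "(u p)\<^sup>2 * (h p)\<^sup>2 \<le> (u p)\<^sup>2 * C\<^sup>2" by (rule mult_left_mono) simp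
    then show ?thesis by (simp only: power_mult_distrib mult.commute)
  qed
  have i: "integrable M (\<lambda>p. (u p * h p)\<^sup>2)"
    by (rule Bochner_Integration.integrable_bound[of M "\<lambda>p. C\<^sup>2 * (u p)\<^sup>2"])
       (use u le in \<open>auto intro!: AE_I2\<close>)
  then show "sqi M (\<lambda>p. u p * h p)" by (simp add: sqi_def)
  show "ip M (\<lambda>p. u p * h p) (\<lambda>p. u p * h p) \<le> C\<^sup>2 * ip M u u"
    unfolding ip_self integral_mult_right_zero[symmetric] using i u le by (intro integral_mono) auto
qed

section \<open>The Borel sets of \<open>L\<^sub>2\<close> are generated by the Fourier coefficients\<close>

lemma L2_set_iff: "u \<in> L2_set S T \<longleftrightarrow> sqi (leb S T) u" by (simp add: L2_set_def sqi_def)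

lemma L2_inner_ip: "L2_inner S T u v = ip (leb S T) u v" by (simp add: L2_inner_def ip_def)

lemma L2_norm_less: "r > 0 \<Longrightarrow> L2_norm S T u < r \<longleftrightarrow> ip (leb S T) u u < r\<^sup>2"
  unfolding L2_norm_def L2_inner_ip
  by (metis abs_of_pos real_sqrt_abs real_sqrt_less_iff)

lemma space_L2_borel [simp]: "space (L2_borel S T) = L2_set S T"
  unfolding L2_borel_def by (intro space_measure_of) (auto simp: L2_open_def)

lemma L2_open_sets: "L2_open S T U \<Longrightarrow> U \<in> sets (L2_borel S T)"
  unfolding L2_borel_def by (auto simp: sets_measure_of_conv L2_open_def)

lemma L2_measurable_continuous:
  fixes F :: "_ \<Rightarrow> real"
  assumes "\<And>u e. sqi (leb S T) u \<Longrightarrow> e > 0 \<Longrightarrow>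
     \<exists>r>0. \<forall>v. sqi (leb S T) v \<longrightarrow> ip (leb S T) (\<lambda>p. v p - u p) (\<lambda>p. v p - u p) < r\<^sup>2 \<longrightarrow> \<bar>F v - F u\<bar> < e"
  shows "F \<in> borel_measurable (L2_borel S T)"
proof (rule borel_measurableI)
  fix A :: "real set" assume A: "open A"
  show "F -` A \<inter> space (L2_borel S T) \<in> sets (L2_borel S T)"
  proof (rule L2_open_sets, unfold L2_open_def, intro conjI ballI)
    fix u assume u: "u \<in> F -` A \<inter> space (L2_borel S T)"
    then obtain e where e: "e > 0" "\<And>y. dist y (F u) < e \<Longrightarrow> y \<in> A"
      using A unfolding open_dist by auto
    have "sqi (leb S T) u" using u by (simp add: L2_set_iff)
    from assms[OF this e(1)] obtain r where
      r: "r > 0" "\<And>v. sqi (leb S T) v \<Longrightarrow> ip (leb S T) (\<lambda>p. v p - u p) (\<lambda>p. v p - u p) < r\<^sup>2 \<Longrightarrow> \<bar>F v - F u\<bar> < e"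
      by blast
    then show "\<exists>r>0. \<forall>v\<in>L2_set S T. L2_norm S T (\<lambda>p. v p - u p) < r \<longrightarrow> v \<in> F -` A \<inter> space (L2_borel S T)"
      using e(2) by (intro exI[of _ r]) (auto simp: L2_norm_less L2_set_iff dist_real_def)
  qed auto
qed

locale l2_rect =
  fixes S T :: real and \<phi> :: "nat \<Rightarrow> real \<times> real \<Rightarrow> real"
  assumes S: "S > 0" and T: "T > 0" and basis: "bv_complete_orthonormal S T \<phi>"
begin

abbreviation "\<mu> \<equiv> leb S T"

sublocale l2_basis \<mu> \<phi>
proof (intro l2_basis.intro l2_basis_axioms.intro finite_measure_leb)
  show "sqi \<mu> (\<phi> n)" "ip \<mu> (\<phi> i) (\<phi> j) = (if i = j then 1 else 0)" for n i j
    using basis by (auto simp: bv_complete_orthonormal_def L2_set_iff L2_inner_ip)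
  show "ip \<mu> u u = 0" if "sqi \<mu> u" "\<And>n. ip \<mu> u (\<phi> n) = 0" for u
    using basis that ip_self_nonneg[of \<mu> u]
    by (auto simp: bv_complete_orthonormal_def L2_set_iff L2_inner_ip L2_norm_def)
qed

text \<open>Multiplication by a bounded function and taking a coefficient are Lipschitz in the
  \<open>L2\<close> seminorm, hence the composition is continuous.\<close>

lemma measurable_cf_mult:
  assumes h: "h \<in> borel_measurable \<mu>" "\<And>p. p \<in> rect S T \<Longrightarrow> \<bar>h p\<bar> \<le> C"
  shows "(\<lambda>u. cf (\<lambda>p. u p * h p) j) \<in> borel_measurable (L2_borel S T)"
proof (rule L2_measurable_continuous)
  fix u e assume u: "sqi \<mu> u" and e: "e > (0::real)"
  have h2: "\<And>p. p \<in> space \<mu> \<Longrightarrow> \<bar>h p\<bar> \<le> C" using h(2) by simp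
  define r where "r = e / (\<bar>C\<bar> + 1)"
  have r: "r > 0" using e by (simp add: r_def)
  have "\<bar>cf (\<lambda>p. v p * h p) j - cf (\<lambda>p. u p * h p) j\<bar> < e"
    if v: "sqi \<mu> v" and d: "ip \<mu> (\<lambda>p. v p - u p) (\<lambda>p. v p - u p) < r\<^sup>2" for v
  proof -
    have s: "sqi \<mu> (\<lambda>p. v p - u p)" using u v by auto
    have "cf (\<lambda>p. v p * h p) j - cf (\<lambda>p. u p * h p) j = cf (\<lambda>p. (v p - u p) * h p) j"
      using cf_diff[OF sqi_mult_bounded(1)[OF v h(1) h2] sqi_mult_bounded(1)[OF u h(1) h2]]
      by (simp add: left_diff_distrib)
    moreover have "(cf (\<lambda>p. (v p - u p) * h p) j)\<^sup>2 \<le> ip \<mu> (\<lambda>p. (v p - u p) * h p) (\<lambda>p. (v p - u p) * h p)"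
      unfolding cf_def by (intro ip_unit_le sqi_mult_bounded(1)[OF s h(1) h2] basis_sqi basis_unit)
    moreover have "\<dots> \<le> C\<^sup>2 * ip \<mu> (\<lambda>p. v p - u p) (\<lambda>p. v p - u p)"
      by (rule sqi_mult_bounded(2)[OF s h(1) h2])
    moreover have "\<dots> \<le> (\<bar>C\<bar> + 1)\<^sup>2 * ip \<mu> (\<lambda>p. v p - u p) (\<lambda>p. v p - u p)"
      by (intro mult_right_mono ip_self_nonneg) (auto simp: abs_le_square_iff[symmetric])
    moreover have "\<dots> < (\<bar>C\<bar> + 1)\<^sup>2 * r\<^sup>2" using d by (intro mult_strict_left_mono) auto
    moreover have "(\<bar>C\<bar> + 1)\<^sup>2 * r\<^sup>2 = e\<^sup>2" by (simp add: r_def power_mult_distrib[symmetric])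
    ultimately have "(cf (\<lambda>p. v p * h p) j - cf (\<lambda>p. u p * h p) j)\<^sup>2 < e\<^sup>2" by simp
    then have "\<bar>cf (\<lambda>p. v p * h p) j - cf (\<lambda>p. u p * h p) j\<bar>\<^sup>2 < e\<^sup>2" by (simp only: power2_abs)
    then show ?thesis using e by (rule power2_less_imp_less[OF _ less_imp_le])
  qed
  then show "\<exists>r>0. \<forall>v. sqi \<mu> v \<longrightarrow> ip \<mu> (\<lambda>p. v p - u p) (\<lambda>p. v p - u p) < r\<^sup>2 \<longrightarrow>
      \<bar>cf (\<lambda>p. v p * h p) j - cf (\<lambda>p. u p * h p) j\<bar> < e"
    using r by blast
qed

lemma measurable_cf [measurable]: "(\<lambda>u. cf u j) \<in> borel_measurable (L2_borel S T)"
  using measurable_cf_mult[of "\<lambda>_. 1" 1] by simp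

abbreviation coords :: "(real \<times> real \<Rightarrow> real) measure" where
  "coords \<equiv> vimage_algebra (L2_set S T) cf (Pi\<^sub>M UNIV (\<lambda>_. borel))"

lemma measurable_cf_coords: "(\<lambda>u. cf u j) \<in> borel_measurable coords"
proof -
  have "cf \<in> coords \<rightarrow>\<^sub>M Pi\<^sub>M UNIV (\<lambda>_. borel)"
    by (intro measurable_vimage_algebra1) (auto simp: space_PiM)
  from measurable_compose[OF this measurable_component_singleton[of j UNIV]] show ?thesis by simp
qed

text \<open>Parseval's identity writes the squared distance as a countable sum of squared
  differences of coefficients.\<close>

lemma ball_coords:
  assumes d: "sqi \<mu> d"
  shows "{v \<in> L2_set S T. ip \<mu> (\<lambda>p. v p - d p) (\<lambda>p. v p - d p) < e} \<in> sets coords"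
proof -
  have "(\<lambda>v. \<Sum>j. (cf v j - cf d j)\<^sup>2) \<in> borel_measurable coords"
    by (intro borel_measurable_suminf borel_measurable_power borel_measurable_diff measurable_cf_coords borel_measurable_const)
  then have "{v \<in> space coords. (\<Sum>j. (cf v j - cf d j)\<^sup>2) < e} \<in> sets coords"
    by measurable
  also have "{v \<in> space coords. (\<Sum>j. (cf v j - cf d j)\<^sup>2) < e} =
     {v \<in> L2_set S T. ip \<mu> (\<lambda>p. v p - d p) (\<lambda>p. v p - d p) < e}"
    using parseval[OF sqi_diff[OF _ d]] by (auto simp: L2_set_iff cf_diff d sums_iff)
  finally show ?thesis .
qed

definition ratcomb :: "rat list \<Rightarrow> real \<times> real \<Rightarrow> real" where
  "ratcomb q = comb (\<lambda>j. of_rat (q ! j)) (length q)"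

lemma ratcomb_dense:
  assumes u: "sqi \<mu> u" and e: "e > 0"
  shows "\<exists>q. ip \<mu> (\<lambda>p. u p - ratcomb q p) (\<lambda>p. u p - ratcomb q p) < e"
proof -
  have "eventually (\<lambda>n. ip \<mu> (\<lambda>p. u p - comb (cf u) n p) (\<lambda>p. u p - comb (cf u) n p) < e / 4) sequentially"
    using order_tendstoD(2)[OF expansion_tendsto[OF u], of "e / 4"] e by simp
  then obtain n where n: "ip \<mu> (\<lambda>p. u p - comb (cf u) n p) (\<lambda>p. u p - comb (cf u) n p) < e / 4"
    by (auto simp: eventually_sequentially)
  \<comment> \<open>The \<open>n\<close> squared errors add up to less than \<open>e / 4\<close>.
    Together with the truncation error \<open>e / 4\<close>, and doubled by
    \<open>ip_sum_le\<close>, this stays below \<open>e\<close>. The summand 1 covers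
    \<open>n = 0\<close>.\<close>
  define \<eta> where "\<eta> = sqrt (e / (4 * (real n + 1)))"
  have eta: "\<eta> > 0" "\<eta>\<^sup>2 = e / (4 * (real n + 1))" using e by (auto simp: \<eta>_def)
  have "\<forall>j. \<exists>r::rat. \<bar>cf u j - of_rat r\<bar> < \<eta>"
  proof
    fix j
    obtain r where "cf u j < of_rat r" "of_rat r < cf u j + \<eta>"
      using of_rat_dense[of "cf u j" "cf u j + \<eta>"] eta by auto
    then show "\<exists>r::rat. \<bar>cf u j - of_rat r\<bar> < \<eta>" by (intro exI[of _ r]) auto
  qed
  then obtain r where r: "\<And>j. \<bar>cf u j - of_rat (r j)\<bar> < \<eta>" by metis
  define q where "q = map r [0..<n]"
  have q: "ratcomb q = comb (\<lambda>j. of_rat (r j)) n"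
    unfolding ratcomb_def comb_def[abs_def] q_def by (auto intro!: sum.cong)
  have "(\<lambda>p. comb (cf u) n p - ratcomb q p) = comb (\<lambda>j. cf u j - of_rat (r j)) n"
    by (simp add: fun_eq_iff q comb_def sum_subtractf left_diff_distrib)
  then have "ip \<mu> (\<lambda>p. comb (cf u) n p - ratcomb q p) (\<lambda>p. comb (cf u) n p - ratcomb q p)
     = (\<Sum>j<n. (cf u j - of_rat (r j))\<^sup>2)" by (simp add: ip_comb_comb)
  also have "\<dots> \<le> (\<Sum>j<n. \<eta>\<^sup>2)"
    using r eta(1) by (intro sum_mono) (metis abs_le_square_iff abs_of_pos less_imp_le)
  also have "\<dots> < e / 4" using e by (simp add: eta(2) field_simps)
  finally have 2: "ip \<mu> (\<lambda>p. comb (cf u) n p - ratcomb q p) (\<lambda>p. comb (cf u) n p - ratcomb q p) < e / 4" .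
  have "ip \<mu> (\<lambda>p. u p - ratcomb q p) (\<lambda>p. u p - ratcomb q p)
     = ip \<mu> (\<lambda>p. (u p - comb (cf u) n p) + (comb (cf u) n p - ratcomb q p)) (\<lambda>p. (u p - comb (cf u) n p) + (comb (cf u) n p - ratcomb q p))"
    by simp
  also have "\<dots> \<le> 2 * ip \<mu> (\<lambda>p. u p - comb (cf u) n p) (\<lambda>p. u p - comb (cf u) n p)
     + 2 * ip \<mu> (\<lambda>p. comb (cf u) n p - ratcomb q p) (\<lambda>p. comb (cf u) n p - ratcomb q p)"
    using u comb_sqi by (intro ip_sum_le) (auto simp: ratcomb_def)
  finally show ?thesis using n 2 by (intro exI[of _ q]) linarith
qed

text \<open>Separability: an open set is a countable union of balls around rational combinations,
  and these balls belong to \<open>coords\<close>. Measurability of maps into \<open>L2\<close> can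
  then be tested on coefficients, and Fourier uniqueness needs only finite sets of
  coefficients.\<close>

theorem sets_L2_borel: "sets (L2_borel S T) = sets coords"
proof
  show "sets coords \<subseteq> sets (L2_borel S T)"
  proof (rule sets_image_in_sets)
    show "cf \<in> L2_borel S T \<rightarrow>\<^sub>M Pi\<^sub>M UNIV (\<lambda>_. borel)"
      using measurable_cf by (intro measurable_PiM_single') auto
  qed simp
  have "U \<in> sets coords" if U: "L2_open S T U" for U
  proof -
    define B where "B q k = {v \<in> L2_set S T. ip \<mu> (\<lambda>p. v p - ratcomb q p) (\<lambda>p. v p - ratcomb q p) < 1 / real (Suc k)}" for q k
    define I where "I = {(q, k). B q k \<subseteq> U}"
    have "U = (\<Union>(q, k)\<in>I. B q k)"
    proof (intro equalityI subsetI)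
      fix u assume uU: "u \<in> U"
      then have u: "sqi \<mu> u" using U by (auto simp: L2_open_def L2_set_iff)
      obtain r where r: "r > 0" "\<And>v. sqi \<mu> v \<Longrightarrow> ip \<mu> (\<lambda>p. v p - u p) (\<lambda>p. v p - u p) < r\<^sup>2 \<Longrightarrow> v \<in> U"
        using U uU unfolding L2_open_def by (metis L2_norm_less L2_set_iff)
      \<comment> \<open>A quarter, because \<open>ip_sum_le\<close> doubles each of the two squared
        distances that lead from \<open>v\<close> to \<open>u\<close>.\<close>
      obtain k where k: "1 / real (Suc k) < r\<^sup>2 / 4"
        using r(1) nat_approx_posE[of "r\<^sup>2 / 4"] by auto
      obtain q where q: "ip \<mu> (\<lambda>p. u p - ratcomb q p) (\<lambda>p. u p - ratcomb q p) < 1 / real (Suc k)"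
        using ratcomb_dense[OF u, of "1 / real (Suc k)"] by auto
      have "v \<in> U" if v: "v \<in> B q k" for v
      proof (rule r(2))
        show vs: "sqi \<mu> v" using v by (auto simp: B_def L2_set_iff)
        have "ip \<mu> (\<lambda>p. v p - u p) (\<lambda>p. v p - u p)
           = ip \<mu> (\<lambda>p. (v p - ratcomb q p) + (ratcomb q p - u p)) (\<lambda>p. (v p - ratcomb q p) + (ratcomb q p - u p))" by simp
        also have "\<dots> \<le> 2 * ip \<mu> (\<lambda>p. v p - ratcomb q p) (\<lambda>p. v p - ratcomb q p)
           + 2 * ip \<mu> (\<lambda>p. ratcomb q p - u p) (\<lambda>p. ratcomb q p - u p)"
          using u vs comb_sqi by (intro ip_sum_le) (auto simp: ratcomb_def)
        also have "ip \<mu> (\<lambda>p. ratcomb q p - u p) (\<lambda>p. ratcomb q p - u p) = ip \<mu> (\<lambda>p. u p - ratcomb q p) (\<lambda>p. u p - ratcomb q p)"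
          unfolding ip_self by (simp add: power2_commute)
        finally show "ip \<mu> (\<lambda>p. v p - u p) (\<lambda>p. v p - u p) < r\<^sup>2"
          using q k v by (simp add: B_def)
      qed
      then have "(q, k) \<in> I" by (auto simp: I_def)
      moreover have "u \<in> B q k" using u q by (simp add: B_def L2_set_iff)
      ultimately show "u \<in> (\<Union>(q, k)\<in>I. B q k)" by blast
    qed (auto simp: I_def)
    moreover have "(\<Union>(q, k)\<in>I. B q k) \<in> sets coords"
    proof (rule sets.countable_UN'')
      show "(case x of (q, k) \<Rightarrow> B q k) \<in> sets coords" if "x \<in> I" for x
        unfolding B_def by (cases x) (auto simp: ratcomb_def intro: ball_coords comb_sqi)
    qed auto
    ultimately show ?thesis by simp
  qed
  then show "sets (L2_borel S T) \<subseteq> sets coords"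
    using sets.sigma_sets_subset[of "{U. L2_open S T U}" coords]
    by (auto simp: L2_borel_def sets_measure_of_conv L2_open_def)
qed

lemma measurable_L2_borelI:
  assumes "\<And>x. x \<in> space N \<Longrightarrow> sqi \<mu> (f x)" "\<And>j. (\<lambda>x. cf (f x) j) \<in> borel_measurable N"
  shows "f \<in> N \<rightarrow>\<^sub>M L2_borel S T"
proof -
  have "f \<in> N \<rightarrow>\<^sub>M coords"
    using assms by (intro measurable_vimage_algebra2 measurable_PiM_single') (auto simp: L2_set_iff)
  then show ?thesis using measurable_cong_sets[OF refl sets_L2_borel] by blast
qed

lemma measurable_ip_L2:
  assumes "\<And>x. x \<in> space N \<Longrightarrow> sqi \<mu> (f x)" "\<And>j. (\<lambda>x. cf (f x) j) \<in> borel_measurable N"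
  shows "(\<lambda>x. ip \<mu> (f x) (f x)) \<in> borel_measurable N"
proof -
  have "(\<lambda>x. \<Sum>j. (cf (f x) j)\<^sup>2) \<in> borel_measurable N"
    by (intro borel_measurable_suminf borel_measurable_power assms(2))
  moreover have "(\<Sum>j. (cf (f x) j)\<^sup>2) = ip \<mu> (f x) (f x)" if "x \<in> space N" for x
    using parseval[OF assms(1)[OF that]] by (simp add: sums_iff)
  ultimately show ?thesis by (simp cong: measurable_cong)
qed

end

section \<open>Uniqueness of Fourier transforms\<close>

lemma integrable_iexp_mult:
  fixes \<theta> :: "'a \<Rightarrow> complex"
  assumes "integrable M \<theta>" "X \<in> borel_measurable M"
  shows "integrable M (\<lambda>x. \<theta> x * iexp (X x))"
proof (rule Bochner_Integration.integrable_bound[OF assms(1)])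
  note [measurable] = assms(2) borel_measurable_integrable[OF assms(1)]
  show "(\<lambda>x. \<theta> x * iexp (X x)) \<in> borel_measurable M" by measurable
qed (auto simp: norm_mult)

lemma integrable_indicator_mult:
  fixes \<theta> :: "'a \<Rightarrow> complex"
  assumes "integrable M \<theta>" "A \<in> sets M"
  shows "integrable M (\<lambda>x. \<theta> x * indicator A x)"
proof (rule Bochner_Integration.integrable_bound[OF assms(1)])
  note [measurable] = assms(2) borel_measurable_integrable[OF assms(1)]
  show "(\<lambda>x. \<theta> x * indicator A x) \<in> borel_measurable M" by measurable
qed (auto simp: norm_mult indicator_def)

text \<open>The positive and the negative part of \<open>\<theta>\<close> have equal transforms, at
  0 in particular equal mass \<open>c\<close>. After division by \<open>c\<close> their images under
  \<open>X\<close> are probability laws on the line, to which Levy's uniqueness theorem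
  applies.\<close>

lemma fourier_uniqueness_real:
  fixes \<theta> :: "'a \<Rightarrow> real"
  assumes \<theta>: "integrable M \<theta>" and X: "X \<in> borel_measurable M"
    and zero: "\<And>t. (LINT x|M. complex_of_real (\<theta> x) * iexp (t * X x)) = 0"
  shows "(LINT x|M. \<theta> x * indicator {..b} (X x)) = 0"
proof -
  note [measurable] = X borel_measurable_integrable[OF \<theta>]
  define p where "p x = max 0 (\<theta> x)" for x
  define n where "n x = max 0 (- \<theta> x)" for x
  have [measurable]: "p \<in> borel_measurable M" "n \<in> borel_measurable M" by (auto simp: p_def[abs_def] n_def[abs_def])
  have pi: "integrable M p" and ni: "integrable M n"
    unfolding p_def[abs_def] n_def[abs_def] using \<theta> by (auto intro!: integrable_max)
  have pn: "0 \<le> p x" "0 \<le> n x" "\<theta> x = p x - n x" for x by (auto simp: p_def n_def)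
  have int: "integrable M (\<lambda>x. complex_of_real (f x) * iexp (t * X x))" if "integrable M f" for f t
    using that by (intro integrable_iexp_mult) auto
  have eq: "(LINT x|M. complex_of_real (p x) * iexp (t * X x)) = (LINT x|M. complex_of_real (n x) * iexp (t * X x))" for t
  proof -
    have "0 = (LINT x|M. complex_of_real (p x) * iexp (t * X x) - complex_of_real (n x) * iexp (t * X x))"
      unfolding zero[of t, symmetric] by (intro Bochner_Integration.integral_cong) (auto simp: pn(3) left_diff_distrib)
    then show ?thesis using int[OF pi] int[OF ni] by simp
  qed
  define c where "c = (LINT x|M. p x)"
  have c: "c = (LINT x|M. n x)" using eq[of 0] by (simp add: c_def)
  have c0: "c \<ge> 0" unfolding c_def using pn by (intro Bochner_Integration.integral_nonneg) auto
  show ?thesis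
  \<comment> \<open>Normalisation is impossible for \<open>c = 0\<close>, but then both parts vanish
    almost everywhere.\<close>
  proof (cases "c = 0")
    case True
    have "AE x in M. p x = 0"
      using integral_nonneg_eq_0_iff_AE[OF pi] pn True c_def by auto
    moreover have "AE x in M. n x = 0"
      using integral_nonneg_eq_0_iff_AE[OF ni] pn True c by auto
    ultimately have "AE x in M. \<theta> x * indicator {..b} (X x) = 0"
      by eventually_elim (simp add: pn(3))
    then show ?thesis by (intro integral_eq_zero_AE)
  next
    case False
    with c0 have cpos: "c > 0" by simp
    define D where "D f = distr (density M (\<lambda>x. ennreal (f x / c))) borel X" for f
    have D: "real_distribution (D f)" "char (D f) t = (LINT x|M. complex_of_real (f x) * iexp (t * X x)) / c"
      "(LINT x|M. f x * indicator {..b} (X x)) = c * measure (D f) {..b}"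
      if f: "integrable M f" "\<And>x. 0 \<le> f x" "(LINT x|M. f x) = c" for f t
    proof -
      have [measurable]: "f \<in> borel_measurable M" using f by auto
      have "emeasure (density M (\<lambda>x. ennreal (f x / c))) (space M) = (\<integral>\<^sup>+x. ennreal (f x / c) \<partial>M)"
        by (subst emeasure_density) (auto intro!: nn_integral_cong)
      also have "\<dots> = ennreal (LINT x|M. f x / c)"
        using f cpos by (intro nn_integral_eq_integral) auto
      also have "\<dots> = 1" using f cpos by simp
      finally have ps: "prob_space (density M (\<lambda>x. ennreal (f x / c)))" by (intro prob_spaceI) simp
      show rd: "real_distribution (D f)"
        unfolding D_def by (intro prob_space.real_distribution_distr[OF ps]) simp
      have "char (D f) t = (LINT x|density M (\<lambda>x. ennreal (f x / c)). iexp (t * X x))"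
        unfolding char_def D_def by (subst integral_distr) auto
      also have "\<dots> = (LINT x|M. (f x / c) *\<^sub>R iexp (t * X x))"
        using f cpos by (subst integral_density) auto
      also have "\<dots> = (LINT x|M. (complex_of_real (f x) * iexp (t * X x)) / c)"
        by (simp add: scaleR_conv_of_real)
      finally show "char (D f) t = (LINT x|M. complex_of_real (f x) * iexp (t * X x)) / c" by simp
      interpret real_distribution "D f" by fact
      have "measure (D f) {..b} = (LINT x|D f. indicator {..b} x)" by simp
      also have "\<dots> = (LINT x|density M (\<lambda>x. ennreal (f x / c)). indicator {..b} (X x))"
        unfolding D_def by (subst integral_distr) auto
      also have "\<dots> = (LINT x|M. (f x / c) *\<^sub>R indicator {..b} (X x))"
        using f cpos by (subst integral_density) auto
      also have "\<dots> = (LINT x|M. f x * indicator {..b} (X x)) / c"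
        by simp
      finally show "(LINT x|M. f x * indicator {..b} (X x)) = c * measure (D f) {..b}" using cpos by simp
    qed
    have "char (D p) = char (D n)"
      using D(2)[OF pi pn(1)] D(2)[OF ni pn(2)] c eq by (simp add: fun_eq_iff c_def)
    then have "D p = D n"
      using D(1)[OF pi pn(1)] D(1)[OF ni pn(2)] c by (intro Levy_uniqueness) (auto simp: c_def)
    then have "(LINT x|M. p x * indicator {..b} (X x)) = (LINT x|M. n x * indicator {..b} (X x))"
      using D(3)[OF pi pn(1)] D(3)[OF ni pn(2)] c by (simp add: c_def)
    moreover have "integrable M (\<lambda>x. f x * indicator {..b} (X x))" if "integrable M f" for f :: "'a \<Rightarrow> real"
      using that by (intro Bochner_Integration.integrable_bound[OF that]) (auto simp: indicator_def)
    ultimately have "(LINT x|M. p x * indicator {..b} (X x) - n x * indicator {..b} (X x)) = 0"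
      using pi ni by simp
    then show ?thesis by (simp add: pn(3) left_diff_distrib)
  qed
qed

text \<open>The transform of \<open>cnj \<theta>\<close> at \<open>t\<close> is the conjugate of
  that of \<open>\<theta>\<close> at \<open>- t\<close>, so it vanishes too. This separates real and
  imaginary part.\<close>

lemma fourier_uniqueness_1:
  fixes \<theta> :: "'a \<Rightarrow> complex"
  assumes \<theta>: "integrable M \<theta>" and X: "X \<in> borel_measurable M"
    and zero: "\<And>t. (LINT x|M. \<theta> x * iexp (t * X x)) = 0"
  shows "(LINT x|M. \<theta> x * indicator {..b} (X x)) = 0"
proof -
  have i: "integrable M (\<lambda>x. \<theta> x * iexp (t * X x))" "integrable M (\<lambda>x. cnj (\<theta> x) * iexp (t * X x))" for t
  proof -
    have m: "(\<lambda>x. t * X x) \<in> borel_measurable M" using X by simp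
    show "integrable M (\<lambda>x. \<theta> x * iexp (t * X x))" by (rule integrable_iexp_mult[OF \<theta> m])
    show "integrable M (\<lambda>x. cnj (\<theta> x) * iexp (t * X x))"
      using \<theta> by (intro integrable_iexp_mult[OF _ m]) simp
  qed
  have cz: "(LINT x|M. cnj (\<theta> x) * iexp (t * X x)) = 0" for t
  proof -
    have "(LINT x|M. cnj (\<theta> x) * iexp (t * X x)) = (LINT x|M. cnj (\<theta> x * iexp (- t * X x)))"
      by (simp add: exp_cnj)
    also have "\<dots> = cnj (LINT x|M. \<theta> x * iexp (- t * X x))" by (rule Bochner_Integration.integral_cnj)
    finally show ?thesis using zero[of "- t"] by simp
  qed
  have re: "(LINT x|M. complex_of_real (Re (\<theta> x)) * iexp (t * X x)) = 0" for t
  proof -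
    have "complex_of_real (Re (\<theta> x)) * iexp (t * X x) = (\<theta> x * iexp (t * X x) + cnj (\<theta> x) * iexp (t * X x)) / 2" for x
      using complex_add_cnj[of "\<theta> x"] by (simp add: distrib_right[symmetric])
    then have "(LINT x|M. complex_of_real (Re (\<theta> x)) * iexp (t * X x))
      = (LINT x|M. (\<theta> x * iexp (t * X x) + cnj (\<theta> x) * iexp (t * X x)) / 2)" by (simp only:)
    also have "\<dots> = ((LINT x|M. \<theta> x * iexp (t * X x)) + (LINT x|M. cnj (\<theta> x) * iexp (t * X x))) / 2"
      unfolding integral_divide_zero by (subst Bochner_Integration.integral_add[OF i]) simp
    finally show ?thesis unfolding zero cz by simp
  qed
  have im: "(LINT x|M. complex_of_real (Im (\<theta> x)) * iexp (t * X x)) = 0" for t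
  proof -
    have "complex_of_real (Im (\<theta> x)) * iexp (t * X x) = (\<theta> x * iexp (t * X x) - cnj (\<theta> x) * iexp (t * X x)) / (2 * \<i>)" for x
    proof -
      have "complex_of_real (Im (\<theta> x)) = (\<theta> x - cnj (\<theta> x)) / (2 * \<i>)" unfolding complex_diff_cnj by (simp add: complex_eq_iff)
      then show ?thesis by (simp only: left_diff_distrib times_divide_eq_left)
    qed
    then have "(LINT x|M. complex_of_real (Im (\<theta> x)) * iexp (t * X x))
      = (LINT x|M. (\<theta> x * iexp (t * X x) - cnj (\<theta> x) * iexp (t * X x)) / (2 * \<i>))" by (simp only:)
    also have "\<dots> = ((LINT x|M. \<theta> x * iexp (t * X x)) - (LINT x|M. cnj (\<theta> x) * iexp (t * X x))) / (2 * \<i>)"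
      unfolding integral_divide_zero by (subst Bochner_Integration.integral_diff[OF i]) simp
    finally show ?thesis unfolding zero cz by simp
  qed
  have "(LINT x|M. Re (\<theta> x) * indicator {..b} (X x)) = 0" "(LINT x|M. Im (\<theta> x) * indicator {..b} (X x)) = 0"
    using re im \<theta> X by (auto intro!: fourier_uniqueness_real)
  moreover have i: "integrable M (\<lambda>x. \<theta> x * indicator {..b} (X x))"
  proof -
    note [measurable] = X
    have "X -` {..b} \<inter> space M \<in> sets M" by measurable
    from integrable_indicator_mult[OF \<theta> this] show ?thesis
      by (rule Bochner_Integration.integrable_cong[THEN iffD1, rotated -1]) (auto simp: indicator_def)
  qed
  moreover have "Re (\<theta> x * indicator {..b} (X x)) = Re (\<theta> x) * indicator {..b} (X x)"
    "Im (\<theta> x * indicator {..b} (X x)) = Im (\<theta> x) * indicator {..b} (X x)" for x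
    by (auto simp: indicator_def)
  ultimately show ?thesis
    using integral_Re[OF i] integral_Im[OF i] by (simp add: complex_eq_iff)
qed

text \<open>One variable at a time: with the other exponentials absorbed into the density, the
  one-dimensional lemma exchanges the exponential in \<open>X k\<close> for an indicator.\<close>

lemma fourier_uniqueness_finite:
  fixes \<theta> :: "'a \<Rightarrow> complex"
  assumes J: "finite J" and X: "\<And>j. j \<in> J \<Longrightarrow> X j \<in> borel_measurable M"
    and \<theta>: "integrable M \<theta>" and zero: "\<And>a. (LINT x|M. \<theta> x * iexp (\<Sum>j\<in>J. a j * X j x)) = 0"
  shows "(LINT x|M. \<theta> x * (\<Prod>j\<in>J. indicator {..b j} (X j x))) = 0"
  using assms
proof (induction J arbitrary: \<theta> rule: finite_induct)
  case empty
  then show ?case by simp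
next
  case (insert k J)
  have Xk[measurable]: "X k \<in> borel_measurable M" using insert.prems by simp
  define \<theta>' where "\<theta>' x = \<theta> x * indicator {..b k} (X k x)" for x
  have "X k -` {..b k} \<inter> space M \<in> sets M" by measurable
  from integrable_indicator_mult[OF insert.prems(2) this] have \<theta>': "integrable M \<theta>'"
    by (rule Bochner_Integration.integrable_cong[THEN iffD1, rotated -1]) (auto simp: indicator_def \<theta>'_def)
  have "(LINT x|M. \<theta>' x * iexp (\<Sum>j\<in>J. a j * X j x)) = 0" for a
  proof -
    have [measurable]: "X j \<in> borel_measurable M" if "j \<in> J" for j using insert.prems that by simp
    have m: "(\<lambda>x. \<Sum>j\<in>J. a j * X j x) \<in> borel_measurable M" by measurable
    have "(LINT x|M. (\<theta> x * iexp (\<Sum>j\<in>J. a j * X j x)) * indicator {..b k} (X k x)) = 0"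
    proof (rule fourier_uniqueness_1[OF integrable_iexp_mult[OF insert.prems(2) m] Xk])
      fix t
      define a' where "a' = a(k := t)"
      have "(\<Sum>j\<in>insert k J. a' j * X j x) = t * X k x + (\<Sum>j\<in>J. a j * X j x)" for x
        using insert.hyps by (auto simp: a'_def intro!: sum.cong)
      then have "\<theta> x * iexp (\<Sum>j\<in>J. a j * X j x) * iexp (t * X k x) = \<theta> x * iexp (\<Sum>j\<in>insert k J. a' j * X j x)" for x
        by (simp only: mult.assoc exp_add[symmetric] of_real_add distrib_left[symmetric] add.commute)
      then show "(LINT x|M. \<theta> x * iexp (\<Sum>j\<in>J. a j * X j x) * iexp (t * X k x)) = 0"
        using insert.prems(3)[of a'] by (simp only:)
    qed
    then show ?thesis by (simp add: \<theta>'_def mult_ac)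
  qed
  then have "(LINT x|M. \<theta>' x * (\<Prod>j\<in>J. indicator {..b j} (X j x))) = 0"
    using insert.prems by (intro insert.IH \<theta>') auto
  then show ?case using insert.hyps by (simp add: \<theta>'_def mult.assoc)
qed

text \<open>The cylinders given by finitely many conditions \<open>X j x \<le> b j\<close> are
  closed under intersection and generate the sigma-algebra, so Dynkin's argument extends the finite
  case.\<close>

theorem fourier_uniqueness:
  fixes \<theta> :: "'a \<Rightarrow> complex" and X :: "'i \<Rightarrow> 'a \<Rightarrow> real"
  assumes X: "\<And>j. X j \<in> borel_measurable M" and \<theta>: "integrable M \<theta>"
    and zero: "\<And>J a. finite J \<Longrightarrow> (LINT x|M. \<theta> x * iexp (\<Sum>j\<in>J. a j * X j x)) = 0"
    and A: "A \<in> sets (vimage_algebra (space M) (\<lambda>x j. X j x) (Pi\<^sub>M UNIV (\<lambda>_. borel)))"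
  shows "(LINT x|M. indicator A x * \<theta> x) = 0"
proof -
  note [measurable] = X
  define cyl where "cyl J b = {x \<in> space M. \<forall>j\<in>J. X j x \<le> b j}" for J and b :: "'i \<Rightarrow> real"
  define G where "G = {cyl J b | J b. finite J}"
  have G_sub: "G \<subseteq> sets M" unfolding G_def cyl_def by auto
  have G_Pow: "G \<subseteq> Pow (space M)" unfolding G_def cyl_def by auto
  have int: "Int_stable G"
  proof (rule Int_stableI)
    fix A B assume "A \<in> G" "B \<in> G"
    then obtain J b K c where *: "finite J" "A = cyl J b" "finite K" "B = cyl K c" unfolding G_def by blast
    define d where "d j = (if j \<in> J then if j \<in> K then min (b j) (c j) else b j else c j)" for j
    have "A \<inter> B = cyl (J \<union> K) d" unfolding * cyl_def d_def by auto
    then show "A \<inter> B \<in> G" using * unfolding G_def by blast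
  qed
  have "(\<lambda>x j. X j x) \<in> sigma (space M) G \<rightarrow>\<^sub>M Pi\<^sub>M UNIV (\<lambda>_. borel)"
  proof (rule measurable_PiM_single')
    fix j
    show "X j \<in> borel_measurable (sigma (space M) G)"
    proof (rule borel_measurableI_le)
      fix y
      have "{x \<in> space M. X j x \<le> y} = cyl {j} (\<lambda>_. y)" by (auto simp: cyl_def)
      then have "{x \<in> space M. X j x \<le> y} \<in> G" unfolding G_def by blast
      then show "{x \<in> space (sigma (space M) G). X j x \<le> y} \<in> sets (sigma (space M) G)"
        using G_Pow by auto
    qed
  qed auto
  then have "sets (vimage_algebra (space M) (\<lambda>x j. X j x) (Pi\<^sub>M UNIV (\<lambda>_. borel))) \<subseteq> sets (sigma (space M) G)"
    using G_Pow by (intro sets_image_in_sets) auto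
  with A have A': "A \<in> sigma_sets (space M) G" using G_Pow by auto
  have sM: "sigma_sets (space M) G \<subseteq> sets M" using G_sub by (rule sets.sigma_sets_subset)
  have idm: "(\<lambda>x. x) \<in> M \<rightarrow>\<^sub>M M" by simp
  have space_zero: "(LINT x|M. \<theta> x) = 0" using zero[of "{}"] by simp
  show ?thesis
    using int G_Pow A'
  proof (induction rule: sigma_sets_induct_disjoint)
    case (basic A)
    then obtain J b where J: "finite J" "A = cyl J b" unfolding G_def by blast
    have "(LINT x|M. indicator A x * \<theta> x) = (LINT x|M. \<theta> x * (\<Prod>j\<in>J. indicator {..b j} (X j x)))"
      using J(1) by (intro Bochner_Integration.integral_cong) (auto simp: J(2) cyl_def indicator_def prod.neutral)
    also have "\<dots> = 0" using J(1) \<theta> zero by (intro fourier_uniqueness_finite) auto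
    finally show ?case .
  next
    case (compl A)
    then have "A \<in> sets M" using sM by auto
    from integrable_indicator_mult[OF \<theta> this] have "integrable M (\<lambda>x. indicator A x * \<theta> x)" by (simp add: mult.commute)
    moreover have "(LINT x|M. indicator (space M - A) x * \<theta> x) = (LINT x|M. \<theta> x - indicator A x * \<theta> x)"
      by (intro Bochner_Integration.integral_cong) (auto simp: indicator_def)
    ultimately show ?case using \<theta> space_zero compl by simp
  next
    case (union A)
    have "(\<lambda>n. LINT x|M. indicator (A n) x * \<theta> x) sums (LINT x|M. indicator (\<Union>n. A n) x * \<theta> x)"
      using complex_measure_pushforward[OF idm \<theta>] union(1,2) sM unfolding complex_measure_def by blast
    then show ?case using union(3) sums_unique2[OF sums_zero] by auto
  qed simp
qed

text \<open>\<open>\<psi>\<close> must be measurable for the sigma-algebra generated by the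
  \<open>X j\<close>, which may be smaller than that of \<open>M\<close>. This form supplies the
  orthogonality behind Kolmogorov's inequality.\<close>

lemma fourier_uniqueness_integral:
  fixes \<theta> :: "'a \<Rightarrow> complex" and X :: "'i \<Rightarrow> 'a \<Rightarrow> real"
  assumes X: "\<And>j. X j \<in> borel_measurable M" and \<theta>: "integrable M \<theta>"
    and zero: "\<And>J a. finite J \<Longrightarrow> (LINT x|M. \<theta> x * iexp (\<Sum>j\<in>J. a j * X j x)) = 0"
    and \<psi>: "bmeas (vimage_algebra (space M) (\<lambda>x j. X j x) (Pi\<^sub>M UNIV (\<lambda>_. borel))) \<psi>"
  shows "(LINT x|M. \<psi> x * \<theta> x) = 0"
proof -
  let ?V = "vimage_algebra (space M) (\<lambda>x j. X j x) (Pi\<^sub>M UNIV (\<lambda>_. borel))"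
  note [measurable] = X
  have "sets ?V \<subseteq> sets M"
    by (intro sets_image_in_sets) (auto intro!: measurable_PiM_single')
  then have id: "(\<lambda>x. x) \<in> M \<rightarrow>\<^sub>M ?V" unfolding measurable_def by auto
  have l0: "bc_lin ?V (\<lambda>_. 0)" unfolding bc_lin_def by auto
  show ?thesis
    using bc_lin_eqI[OF bc_lin_integral[OF id \<theta>] l0 _ \<psi>] fourier_uniqueness[OF X \<theta> zero] by simp
qed

section \<open>Kolmogorov's inequality\<close>

text \<open>Independence enters only through \<open>orth\<close>: a bounded function of the first variables is
  orthogonal to the later ones.\<close>

locale orthogonal_increments = prob_space W for W :: "'a measure" +
  fixes N :: "nat \<Rightarrow> 'a \<Rightarrow> real"
  assumes N_meas [measurable]: "\<And>j. N j \<in> borel_measurable W"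
    and N_sq: "\<And>j. integrable W (\<lambda>x. (N j x)\<^sup>2)"
    and sum_sq: "\<And>a n. (LINT x|W. (\<Sum>j<n. a j * N j x)\<^sup>2) \<le> (\<Sum>j<n. (a j)\<^sup>2)"
    and orth: "\<And>\<psi> l j. (\<And>x. x \<in> space W \<Longrightarrow> \<bar>\<psi> x\<bar> \<le> 1) \<Longrightarrow>
        \<psi> \<in> borel_measurable (vimage_algebra (space W) (\<lambda>x i. if i < l then N i x else 0) (Pi\<^sub>M UNIV (\<lambda>_. borel))) \<Longrightarrow>
        l \<le> j \<Longrightarrow> (LINT x|W. \<psi> x * N j x) = 0"
begin

text \<open>Later variables are replaced by 0 instead of being dropped, so that all pasts use the
  same index set.\<close>

abbreviation past :: "nat \<Rightarrow> 'a measure" where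
  "past l \<equiv> vimage_algebra (space W) (\<lambda>x i. if i < l then N i x else 0) (Pi\<^sub>M UNIV (\<lambda>_::nat. borel))"

lemma N_past: "i < l \<Longrightarrow> N i \<in> borel_measurable (past l)"
proof -
  assume i: "i < l"
  have "(\<lambda>x i. if i < l then N i x else 0) \<in> past l \<rightarrow>\<^sub>M Pi\<^sub>M UNIV (\<lambda>_::nat. borel)"
    by (intro measurable_vimage_algebra1) (auto simp: space_PiM)
  from measurable_compose[OF this measurable_component_singleton[of i UNIV]] show ?thesis using i by simp
qed

lemma sqi_sumN: "sqi W (\<lambda>x. \<Sum>j\<in>J. a j * N j x)" if "finite J"
  using that N_sq by (intro sqi_sum sqi_cmult) (auto simp: sqi_def)

text \<open>\<open>H\<close> is cut off at \<open>k\<close> and divided by \<open>k + 1\<close> to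
  meet the bound 1 in \<open>orth\<close>; dominated convergence removes the cutoff.\<close>

lemma orth_unbounded:
  assumes H: "H \<in> borel_measurable (past l)" "sqi W H" and Y: "Y = (\<lambda>x. \<Sum>j\<in>{l..<n}. a j * N j x)"
  shows "(LINT x|W. H x * Y x) = 0"
proof -
  have [measurable]: "H \<in> borel_measurable W" using H by auto
  have Ys: "sqi W Y" unfolding Y by (rule sqi_sumN) simp
  then have [measurable]: "Y \<in> borel_measurable W" by auto
  have HY: "integrable W (\<lambda>x. H x * Y x)" by (rule sqi_mult_integrable[OF H(2) Ys])
  define G where "G k x = (if \<bar>H x\<bar> \<le> real k then H x else 0)" for k x
  have G: "(LINT x|W. G k x * Y x) = 0" for k
  proof -
    have [measurable]: "H \<in> borel_measurable (past l)" by fact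
    have "(\<lambda>x. G k x / (real k + 1)) \<in> borel_measurable (past l)" unfolding G_def by measurable
    moreover have "\<bar>G k x / (real k + 1)\<bar> \<le> 1" for x by (auto simp: G_def abs_divide)
    ultimately have o: "(LINT x|W. G k x / (real k + 1) * N j x) = 0" if "l \<le> j" for j
      using that by (intro orth) auto
    have o': "(LINT x|W. G k x * (a j * N j x)) = 0" if "j \<in> {l..<n}" for j
    proof -
      have "(LINT x|W. G k x * (a j * N j x)) = (LINT x|W. (real k + 1) * a j * (G k x / (real k + 1) * N j x))"
        by (intro Bochner_Integration.integral_cong) (auto simp: field_simps)
      then show ?thesis using o[of j] that by simp
    qed
    have "integrable W (\<lambda>x. G k x * (a j * N j x))" for j
    proof (rule sqi_mult_integrable)
      show "sqi W (G k)" unfolding sqi_def G_def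
        by (auto intro!: integrable_const_bound[where B = "(real k)\<^sup>2"] simp: abs_le_square_iff[symmetric])
      show "sqi W (\<lambda>x. a j * N j x)" using N_sq by (intro sqi_cmult) (auto simp: sqi_def)
    qed
    then show ?thesis unfolding Y sum_distrib_left using o' by (subst Bochner_Integration.integral_sum) auto
  qed
  have "(\<lambda>k. LINT x|W. G k x * Y x) \<longlonglongrightarrow> (LINT x|W. H x * Y x)"
  proof (rule integral_dominated_convergence[where w = "\<lambda>x. norm (H x * Y x)"])
    show "AE x in W. (\<lambda>k. G k x * Y x) \<longlonglongrightarrow> H x * Y x"
    proof (intro AE_I2 tendsto_mult tendsto_const)
      fix x
      obtain K :: nat where "\<bar>H x\<bar> \<le> real K" using real_arch_simple by blast
      then have "eventually (\<lambda>k. G k x = H x) sequentially"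
        unfolding G_def eventually_sequentially by (intro exI[of _ K]) auto
      then show "(\<lambda>k. G k x) \<longlonglongrightarrow> H x" by (rule tendsto_eventually)
    qed
  qed (use HY in \<open>auto simp: G_def\<close>)
  then show ?thesis unfolding G by (simp add: LIMSEQ_const_iff)
qed

text \<open>Decomposition by first passage: on \<open>A l\<close> the sum started at
  \<open>k\<close> reaches modulus \<open>e\<close> for the first time at \<open>l\<close>. This
  event depends on the variables before \<open>l\<close> only, so the later increments contribute no
  cross term.\<close>

lemma kolmogorov_inequality:
  assumes e: "e > 0"
  shows "prob {x \<in> space W. \<exists>l\<in>{k..n}. e \<le> \<bar>\<Sum>j\<in>{k..<l}. a j * N j x\<bar>} \<le> (\<Sum>j\<in>{k..<n}. (a j)\<^sup>2) / e\<^sup>2"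
proof -
  define D where "D l x = (\<Sum>j\<in>{k..<l}. a j * N j x)" for l x
  have Dm[measurable]: "D l \<in> borel_measurable W" for l unfolding D_def by measurable
  have Ds: "sqi W (D l)" for l unfolding D_def by (rule sqi_sumN) simp
  define A where "A l = {x \<in> space W. e \<le> \<bar>D l x\<bar> \<and> (\<forall>i\<in>{k..<l}. \<bar>D i x\<bar> < e)}" for l
  have Am[measurable]: "A l \<in> sets W" for l unfolding A_def by measurable
  have Dpast: "D i \<in> borel_measurable (past l)" if "i \<le> l" for i l
  proof -
    have "N j \<in> borel_measurable (past l)" if "j \<in> {k..<i}" for j using that \<open>i \<le> l\<close> by (intro N_past) auto
    then show ?thesis unfolding D_def by (intro borel_measurable_sum borel_measurable_times) auto
  qed
  have disj: "disjoint_family_on A {k..n}"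
    unfolding disjoint_family_on_def A_def
    by (auto simp: disjoint_iff not_le[symmetric]) (metis atLeastLessThan_iff linorder_neqE_nat)
  have UN: "{x \<in> space W. \<exists>l\<in>{k..n}. e \<le> \<bar>D l x\<bar>} = (\<Union>l\<in>{k..n}. A l)"
  proof (intro equalityI subsetI)
    fix x assume x: "x \<in> {x \<in> space W. \<exists>l\<in>{k..n}. e \<le> \<bar>D l x\<bar>}"
    define l where "l = (LEAST l. l \<in> {k..n} \<and> e \<le> \<bar>D l x\<bar>)"
    have l: "l \<in> {k..n} \<and> e \<le> \<bar>D l x\<bar>" unfolding l_def
      by (rule LeastI_ex) (use x in auto)
    moreover have "\<bar>D i x\<bar> < e" if "i \<in> {k..<l}" for i
      using not_less_Least[of i "\<lambda>l. l \<in> {k..n} \<and> e \<le> \<bar>D l x\<bar>"] that l unfolding l_def[symmetric] by force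
    ultimately show "x \<in> (\<Union>l\<in>{k..n}. A l)" using x by (auto simp: A_def)
  qed (auto simp: A_def)
  have key: "e\<^sup>2 * prob (A l) \<le> (LINT x|W. indicator (A l) x * (D n x)\<^sup>2)" if l: "l \<in> {k..n}" for l
  proof -
    \<comment> \<open>On \<open>A l\<close> the square of \<open>D n = D l + Y\<close> is at least
      \<open>e\<^sup>2 + 2 * (H * Y)\<close>, and \<open>H * Y\<close> integrates to 0 because
      \<open>H\<close> belongs to the past of \<open>l\<close>.\<close>
    define H where "H x = indicator (A l) x * D l x" for x
    define Y where "Y x = (\<Sum>j\<in>{l..<n}. a j * N j x)" for x
    have Dn: "D n x = D l x + Y x" for x
      unfolding D_def Y_def using l by (simp add: sum.atLeastLessThan_concat)
    have [measurable]: "Y \<in> borel_measurable W" unfolding Y_def by measurable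
    have Ys: "sqi W Y" unfolding Y_def by (rule sqi_sumN) simp
    have Hs: "sqi W H"
      using Ds[of l] unfolding sqi_def H_def
      by (auto intro!: Bochner_Integration.integrable_bound[of W "\<lambda>x. (D l x)\<^sup>2"] simp: indicator_def)
    have "H \<in> borel_measurable (past l)"
    proof -
      have [measurable]: "D l \<in> borel_measurable (past l)" by (rule Dpast) simp
      have 1: "{x \<in> space (past l). e \<le> \<bar>D l x\<bar>} \<in> sets (past l)" by measurable
      have 2: "{x \<in> space (past l). \<forall>i\<in>{k..<l}. \<bar>D i x\<bar> < e} \<in> sets (past l)"
      proof (rule sets.sets_Collect_finite_All)
        fix i assume "i \<in> {k..<l}"
        then have [measurable]: "D i \<in> borel_measurable (past l)" by (intro Dpast) auto
        show "{x \<in> space (past l). \<bar>D i x\<bar> < e} \<in> sets (past l)" by measurable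
      qed simp
      have "A l = {x \<in> space (past l). e \<le> \<bar>D l x\<bar>} \<inter> {x \<in> space (past l). \<forall>i\<in>{k..<l}. \<bar>D i x\<bar> < e}"
        by (auto simp: A_def)
      with sets.Int[OF 1 2] have [measurable]: "A l \<in> sets (past l)" by simp
      show ?thesis unfolding H_def by measurable
    qed
    from orth_unbounded[OF this Hs] have o: "(LINT x|W. H x * Y x) = 0" unfolding Y_def by simp
    have i1: "integrable W (\<lambda>x. indicator (A l) x * (D n x)\<^sup>2)"
      using Ds[of n] unfolding sqi_def
      by (auto intro!: Bochner_Integration.integrable_bound[of W "\<lambda>x. (D n x)\<^sup>2"] simp: indicator_def)
    have i2: "integrable W (\<lambda>x. e\<^sup>2 * indicator (A l) x + 2 * (H x * Y x))"
      by (intro Bochner_Integration.integrable_add integrable_mult_right sqi_mult_integrable[OF Hs Ys] integrable_real_indicator)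
         (auto simp: less_top[symmetric])
    have "e\<^sup>2 * prob (A l) = (LINT x|W. e\<^sup>2 * indicator (A l) x + 2 * (H x * Y x))"
    proof -
      have "integrable W (indicator (A l) :: _ \<Rightarrow> real)"
        by (intro integrable_real_indicator) (auto simp: less_top[symmetric])
      moreover have "A l \<inter> space W = A l" by (auto simp: A_def)
      ultimately show ?thesis
        using sqi_mult_integrable[OF Hs Ys] o by (subst Bochner_Integration.integral_add) auto
    qed
    also have "\<dots> \<le> (LINT x|W. indicator (A l) x * (D n x)\<^sup>2)"
    proof (rule integral_mono[OF i2 i1])
      fix x assume "x \<in> space W"
      show "e\<^sup>2 * indicator (A l) x + 2 * (H x * Y x) \<le> indicator (A l) x * (D n x)\<^sup>2"
      proof (cases "x \<in> A l")
        case True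
        then have "e\<^sup>2 \<le> (D l x)\<^sup>2" using e by (auto simp: A_def intro: power2_le_iff_abs_le[THEN iffD2] abs_le_square_iff[THEN iffD1])
        then show ?thesis using True by (simp add: Dn H_def power2_sum add_increasing2)
      qed (simp add: H_def)
    qed
    finally show ?thesis .
  qed
  have ind: "(\<Sum>l\<in>{k..n}. indicator (A l) x) * (D n x)\<^sup>2 \<le> (D n x)\<^sup>2" for x
    unfolding indicator_UN_disjoint[OF finite_atLeastAtMost disj, symmetric] by (auto simp: indicator_def)
  have i: "integrable W (\<lambda>x. indicator (A l) x * (D n x)\<^sup>2)" for l
    using Ds[of n] unfolding sqi_def
    by (auto intro!: Bochner_Integration.integrable_bound[of W "\<lambda>x. (D n x)\<^sup>2"] simp: indicator_def)
  have "e\<^sup>2 * prob (\<Union>l\<in>{k..n}. A l) = (\<Sum>l\<in>{k..n}. e\<^sup>2 * prob (A l))"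
    using disj by (subst finite_measure_finite_Union) (auto simp: sum_distrib_left)
  also have "\<dots> \<le> (\<Sum>l\<in>{k..n}. LINT x|W. indicator (A l) x * (D n x)\<^sup>2)" by (intro sum_mono key)
  also have "\<dots> = (LINT x|W. (\<Sum>l\<in>{k..n}. indicator (A l) x) * (D n x)\<^sup>2)"
    unfolding sum_distrib_right using i by (subst Bochner_Integration.integral_sum) auto
  also have "\<dots> \<le> (LINT x|W. (D n x)\<^sup>2)"
  proof (rule integral_mono)
    show "integrable W (\<lambda>x. (\<Sum>l\<in>{k..n}. indicator (A l) x) * (D n x)\<^sup>2)"
      unfolding sum_distrib_right using i by (intro Bochner_Integration.integrable_sum)
  qed (use Ds[of n] ind in auto)
  also have "\<dots> \<le> (\<Sum>j\<in>{k..<n}. (a j)\<^sup>2)"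
  proof -
    \<comment> \<open>\<open>sum_sq\<close> speaks of sums that start at 0; the coefficients below
      \<open>k\<close> are set to 0.\<close>
    have s: "(\<Sum>j<n. (if k \<le> j then f j else 0)) = (\<Sum>j\<in>{k..<n}. f j)" for f :: "nat \<Rightarrow> real"
      by (intro sum.mono_neutral_cong_right) auto
    have "D n x = (\<Sum>j<n. (if k \<le> j then a j else 0) * N j x)" for x
      unfolding D_def s[of "\<lambda>j. a j * N j x", symmetric] by (intro sum.cong) auto
    then have "(LINT x|W. (D n x)\<^sup>2) \<le> (\<Sum>j<n. (if k \<le> j then a j else 0)\<^sup>2)"
      using sum_sq[where n = n and a = "\<lambda>j. if k \<le> j then a j else 0"] by simp
    also have "\<dots> = (\<Sum>j<n. (if k \<le> j then (a j)\<^sup>2 else 0))" by (intro sum.cong) auto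
    finally show ?thesis unfolding s .
  qed
  finally have "e\<^sup>2 * prob (\<Union>l\<in>{k..n}. A l) \<le> (\<Sum>j\<in>{k..<n}. (a j)\<^sup>2)" .
  then show ?thesis using e unfolding UN[symmetric] D_def by (simp add: field_simps)
qed

end

text \<open>The probability that the series ever moves by \<open>e\<close> after index
  \<open>k\<close> is at most \<open>\<tau> k / e\<^sup>2\<close>, which tends to 0. Applied to all
  \<open>e = 1 / Suc m\<close>, this makes almost every sequence of partial sums Cauchy.\<close>

theorem (in orthogonal_increments) AE_convergent_sum:
  assumes a: "summable (\<lambda>j. (a j)\<^sup>2)"
  shows "AE x in W. convergent (\<lambda>n. \<Sum>j<n. a j * N j x)"
proof -
  define \<tau> where "\<tau> k = (\<Sum>j. (a j)\<^sup>2) - (\<Sum>j<k. (a j)\<^sup>2)" for k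
  have \<tau>: "\<tau> \<longlonglongrightarrow> 0"
    unfolding \<tau>_def using tendsto_diff[OF tendsto_const[of "\<Sum>j. (a j)\<^sup>2"] summable_LIMSEQ[OF a]] by simp
  have \<tau>_ge: "(\<Sum>j\<in>{k..<n}. (a j)\<^sup>2) \<le> \<tau> k" for k n
  proof (cases "k \<le> n")
    case True
    have "(\<Sum>j<k. (a j)\<^sup>2) + (\<Sum>j\<in>{k..<n}. (a j)\<^sup>2) = (\<Sum>j<n. (a j)\<^sup>2)"
      using True by (simp add: lessThan_atLeast0 sum.atLeastLessThan_concat)
    moreover have "(\<Sum>j<n. (a j)\<^sup>2) \<le> (\<Sum>j. (a j)\<^sup>2)" by (rule sum_le_suminf[OF a]) auto
    ultimately show ?thesis by (simp add: \<tau>_def)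
  next
    case False
    then show ?thesis using sum_le_suminf[OF a, of "{..<k}"] by (simp add: \<tau>_def)
  qed
  define D where "D k l x = (\<Sum>j\<in>{k..<l}. a j * N j x)" for k l x
  have [measurable]: "D k l \<in> borel_measurable W" for k l unfolding D_def by measurable
  define E where "E e k = {x \<in> space W. \<exists>l\<ge>k. e \<le> \<bar>D k l x\<bar>}" for e :: real and k
  have Em[measurable]: "E e k \<in> sets W" for e k unfolding E_def by measurable
  have PE: "prob (E e k) \<le> \<tau> k / e\<^sup>2" if e: "e > 0" for e k
  proof -
    define F where "F n = {x \<in> space W. \<exists>l\<in>{k..n}. e \<le> \<bar>D k l x\<bar>}" for n
    have "F n \<in> sets W" for n unfolding F_def by measurable
    moreover have "incseq F" unfolding F_def incseq_def by force
    \<comment> \<open>Continuity from below sends the finite horizon of Kolmogorov's inequality to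
      infinity.\<close>
    ultimately have "(\<lambda>n. prob (F n)) \<longlonglongrightarrow> prob (\<Union>n. F n)"
      by (intro finite_Lim_measure_incseq) auto
    moreover have "(\<Union>n. F n) = E e k"
    proof (intro equalityI subsetI)
      fix x assume "x \<in> E e k"
      then obtain l where "x \<in> space W" "l \<ge> k" "e \<le> \<bar>D k l x\<bar>" unfolding E_def by blast
      then have "x \<in> F l" unfolding F_def by auto
      then show "x \<in> (\<Union>n. F n)" by blast
    qed (auto simp: F_def E_def)
    moreover have "prob (F n) \<le> \<tau> k / e\<^sup>2" for n
      unfolding F_def D_def
      by (rule order_trans[OF kolmogorov_inequality[OF e] divide_right_mono[OF \<tau>_ge]]) simp
    ultimately show ?thesis by (intro LIMSEQ_le_const2[of "\<lambda>n. prob (F n)"]) auto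
  qed
  have null: "AE x in W. \<exists>k. x \<notin> E e k" if e: "e > 0" for e
  proof -
    have m: "(\<Inter>k. E e k) \<in> sets W" by measurable
    have "prob (\<Inter>k. E e k) \<le> \<tau> k / e\<^sup>2" for k
    proof -
      have "prob (\<Inter>k. E e k) \<le> prob (E e k)" by (intro finite_measure_mono) auto
      then show ?thesis using PE[OF e, of k] by simp
    qed
    moreover have "(\<lambda>k. \<tau> k / e\<^sup>2) \<longlonglongrightarrow> 0" using tendsto_divide[OF \<tau> tendsto_const[of "e\<^sup>2"]] e by simp
    ultimately have "prob (\<Inter>k. E e k) \<le> 0" by (intro LIMSEQ_le_const[of "\<lambda>k. \<tau> k / e\<^sup>2"]) auto
    then have "prob (\<Inter>k. E e k) = 0" by (simp add: measure_le_0_iff)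
    then have "(\<Inter>k. E e k) \<in> null_sets W"
      using m by (auto simp: null_sets_def emeasure_eq_measure)
    from AE_not_in[OF this] show ?thesis by eventually_elim auto
  qed
  have "AE x in W. \<forall>m::nat. \<exists>k. x \<notin> E (1 / real (Suc m)) k"
    unfolding AE_all_countable using null by auto
  then show ?thesis
    using AE_space
  proof eventually_elim
    case (elim x)
    have "Cauchy (\<lambda>n. \<Sum>j<n. a j * N j x)"
    proof (rule metric_CauchyI)
      fix \<epsilon> :: real assume "\<epsilon> > 0"
      then obtain m where m: "1 / real (Suc m) < \<epsilon> / 2" using nat_approx_posE[of "\<epsilon> / 2"] by auto
      obtain k where "x \<notin> E (1 / real (Suc m)) k" using elim by blast
      then have k: "\<bar>D k l x\<bar> < 1 / real (Suc m)" if "l \<ge> k" for l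
        using that elim(2) unfolding E_def by force
      have "dist (\<Sum>j<l. a j * N j x) (\<Sum>j<k. a j * N j x) < \<epsilon> / 2" if "l \<ge> k" for l
      proof -
        have "(\<Sum>j<l. a j * N j x) - (\<Sum>j<k. a j * N j x) = D k l x"
          unfolding D_def using sum.atLeastLessThan_concat[of 0 k l "\<lambda>j. a j * N j x"] that
          by (simp add: lessThan_atLeast0)
        then show ?thesis using k[OF that] m by (simp add: dist_real_def)
      qed
      then show "\<exists>M. \<forall>m\<ge>M. \<forall>n\<ge>M. dist (\<Sum>j<m. a j * N j x) (\<Sum>j<n. a j * N j x) < \<epsilon>"
        by (meson dist_triangle_half_l)
    qed
    then show ?case by (simp add: Cauchy_convergent_iff)
  qed
qed

section \<open>The Yeh--Wiener law\<close>

text \<open>Written with the second moment in place of a standard deviation, the formula includes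
  the degenerate law.\<close>

lemma centered_normal_char:
  assumes "centered_normal M"
  shows "integrable M (\<lambda>r. r\<^sup>2)" "(LINT r|M. iexp (t * r)) = of_real (exp (- (t\<^sup>2 * (LINT r|M. r\<^sup>2) / 2)))"
proof -
  consider "M = return borel 0" | \<sigma> where "\<sigma> > 0" "M = density lborel (\<lambda>r. ennreal (normal_density 0 \<sigma> r))"
    using assms unfolding centered_normal_def by blast
  then have "integrable M (\<lambda>r. r\<^sup>2) \<and> (LINT r|M. iexp (t * r)) = of_real (exp (- (t\<^sup>2 * (LINT r|M. r\<^sup>2) / 2)))"
  proof cases
    case 1
    have ps: "prob_space (return borel (0::real))" by (intro prob_space_return) simp
    have "integrable (return borel (0::real)) (\<lambda>r. r\<^sup>2)"
      by (rule finite_measure.integrable_const_bound[where B = 0])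
         (use ps in \<open>auto simp: prob_space_def AE_return\<close>)
    then show ?thesis unfolding 1 by (simp add: integral_return)
  next
    case 2
    have m: "has_bochner_integral lborel (\<lambda>r. normal_density 0 \<sigma> r * r\<^sup>2) (\<sigma>\<^sup>2)"
    proof -
      have "fact (2 * 1) / ((2 / \<sigma>\<^sup>2) ^ 1 * fact 1) = \<sigma>\<^sup>2" using 2(1) by (simp add: fact_2)
      then show ?thesis using normal_moment_even[of \<sigma> 0 1] 2(1) by (simp only: diff_zero mult_1_right)
    qed
    have i: "integrable M (\<lambda>r. r\<^sup>2)"
      unfolding 2(2) using m by (subst integrable_density) (auto simp: has_bochner_integral_iff)
    have v: "(LINT r|M. r\<^sup>2) = \<sigma>\<^sup>2"
      unfolding 2(2) using m by (subst integral_density) (auto simp: has_bochner_integral_iff)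
    have "(LINT r|M. iexp (t * r)) = (LINT r|lborel. normal_density 0 \<sigma> r *\<^sub>R iexp (t * r))"
      unfolding 2(2) by (rule integral_density) auto
    \<comment> \<open>Substitution by the factor \<open>\<sigma>\<close> reduces to the standard
      normal law at \<open>t * \<sigma>\<close>.\<close>
    also have "\<dots> = \<bar>\<sigma>\<bar> *\<^sub>R (LINT r|lborel. normal_density 0 \<sigma> (0 + \<sigma> * r) *\<^sub>R iexp (t * (0 + \<sigma> * r)))"
      using 2(1) by (intro lborel_integral_real_affine) auto
    also have "\<dots> = (LINT r|lborel. std_normal_density r *\<^sub>R iexp ((t * \<sigma>) * r))"
      unfolding integral_scaleR_right[symmetric] using 2(1)
      by (intro Bochner_Integration.integral_cong)
         (auto simp: normal_density_def power_mult_distrib real_sqrt_mult field_simps)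
    also have "\<dots> = char std_normal_distribution (t * \<sigma>)"
      unfolding char_def by (subst integral_density) auto
    also have "\<dots> = of_real (exp (- (t\<^sup>2 * \<sigma>\<^sup>2 / 2)))"
      unfolding char_std_normal_distribution by (simp add: power_mult_distrib mult.commute)
    finally show ?thesis using i v by simp
  qed
  then show "integrable M (\<lambda>r. r\<^sup>2)" "(LINT r|M. iexp (t * r)) = of_real (exp (- (t\<^sup>2 * (LINT r|M. r\<^sup>2) / 2)))"
    by auto
qed

lemma bvB_add:
  assumes "bvB S T w B" "bvB S T v C" shows "bvB S T (\<lambda>p. w p + v p) (B + C)"
  unfolding bvB_def
proof (intro conjI allI impI ballI)
  show "0 \<le> B + C" using bvB_nonneg[OF assms(1)] bvB_nonneg[OF assms(2)] by simp
next
  fix m n \<xi> \<eta> assume g: "wgrid S m \<xi>" "wgrid T n \<eta>"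
  have "(\<Sum>i<m. \<Sum>j<n. \<bar>incr (\<lambda>p. w p + v p) (\<xi> i) (\<xi> (Suc i)) (\<eta> j) (\<eta> (Suc j))\<bar>)
     \<le> (\<Sum>i<m. \<Sum>j<n. \<bar>incr w (\<xi> i) (\<xi> (Suc i)) (\<eta> j) (\<eta> (Suc j))\<bar> + \<bar>incr v (\<xi> i) (\<xi> (Suc i)) (\<eta> j) (\<eta> (Suc j))\<bar>)"
    by (intro sum_mono) (simp add: incr_def)
  also have "\<dots> \<le> B + C"
    unfolding sum.distrib by (intro add_mono bvB_vitali[OF assms(1) g] bvB_vitali[OF assms(2) g])
  finally show "(\<Sum>i<m. \<Sum>j<n. \<bar>incr (\<lambda>p. w p + v p) (\<xi> i) (\<xi> (Suc i)) (\<eta> j) (\<eta> (Suc j))\<bar>) \<le> B + C" .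
next
  fix m \<xi> t assume g: "t \<in> {0..T}" "wgrid S m \<xi>"
  have "(\<Sum>i<m. \<bar>w (\<xi> (Suc i), t) + v (\<xi> (Suc i), t) - (w (\<xi> i, t) + v (\<xi> i, t))\<bar>)
    \<le> (\<Sum>i<m. \<bar>w (\<xi> (Suc i), t) - w (\<xi> i, t)\<bar> + \<bar>v (\<xi> (Suc i), t) - v (\<xi> i, t)\<bar>)"
    by (intro sum_mono) simp
  also have "\<dots> \<le> B + C"
    unfolding sum.distrib by (intro add_mono bvB_sec1[OF assms(1) g(2,1)] bvB_sec1[OF assms(2) g(2,1)])
  finally show "(\<Sum>i<m. \<bar>w (\<xi> (Suc i), t) + v (\<xi> (Suc i), t) - (w (\<xi> i, t) + v (\<xi> i, t))\<bar>) \<le> B + C" .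
next
  fix m \<xi> t assume g: "t \<in> {0..S}" "wgrid T m \<xi>"
  have "(\<Sum>i<m. \<bar>w (t, \<xi> (Suc i)) + v (t, \<xi> (Suc i)) - (w (t, \<xi> i) + v (t, \<xi> i))\<bar>)
    \<le> (\<Sum>i<m. \<bar>w (t, \<xi> (Suc i)) - w (t, \<xi> i)\<bar> + \<bar>v (t, \<xi> (Suc i)) - v (t, \<xi> i)\<bar>)"
    by (intro sum_mono) simp
  also have "\<dots> \<le> B + C"
    unfolding sum.distrib by (intro add_mono bvB_sec2[OF assms(1) g(2,1)] bvB_sec2[OF assms(2) g(2,1)])
  finally show "(\<Sum>i<m. \<bar>w (t, \<xi> (Suc i)) + v (t, \<xi> (Suc i)) - (w (t, \<xi> i) + v (t, \<xi> i))\<bar>) \<le> B + C" .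
next
  fix p assume p: "p \<in> rect S T"
  show "\<bar>w p + v p\<bar> \<le> B + C" using bvB_bound[OF assms(1) p] bvB_bound[OF assms(2) p] by linarith
qed

lemma bvB_cmult:
  assumes "bvB S T w B" shows "bvB S T (\<lambda>p. c * w p) (\<bar>c\<bar> * B)"
proof -
  have "incr (\<lambda>p. c * w p) s s' t t' = c * incr w s s' t t'" for s s' t t'
    by (simp add: incr_def algebra_simps)
  then show ?thesis
    using assms unfolding bvB_def
    by (auto simp: abs_mult right_diff_distrib[symmetric] sum_distrib_left[symmetric] intro!: mult_left_mono)
qed

lemma bvB_zero: "bvB S T (\<lambda>_. 0) 0" by (simp add: bvB_def incr_def)

lemma ip_lincomb:
  assumes "finite I" "\<And>p. p \<in> I \<Longrightarrow> sqi M (f p)"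
  shows "ip M (\<lambda>x. \<Sum>p\<in>I. a p * f p x) (\<lambda>x. \<Sum>p\<in>I. a p * f p x) = (\<Sum>p\<in>I. \<Sum>q\<in>I. a p * (a q * ip M (f p) (f q)))"
proof -
  have s: "sqi M (\<lambda>x. \<Sum>p\<in>I. a p * f p x)" using assms by (intro sqi_sum) auto
  have "ip M (\<lambda>x. \<Sum>p\<in>I. a p * f p x) (\<lambda>x. \<Sum>p\<in>I. a p * f p x) = (\<Sum>p\<in>I. a p * ip M (f p) (\<lambda>x. \<Sum>p\<in>I. a p * f p x))"
    using assms s by (subst ip_sum) (auto simp: ip_cmult)
  also have "\<dots> = (\<Sum>p\<in>I. a p * (\<Sum>q\<in>I. a q * ip M (f p) (f q)))"
  proof (intro sum.cong refl)
    fix p assume p: "p \<in> I"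
    have "ip M (f p) (\<lambda>x. \<Sum>p\<in>I. a p * f p x) = (\<Sum>q\<in>I. a q * ip M (f q) (f p))"
      using assms p by (subst ip_commute, subst ip_sum) (auto simp: ip_cmult)
    then show "a p * ip M (f p) (\<lambda>x. \<Sum>p\<in>I. a p * f p x) = a p * (\<Sum>q\<in>I. a q * ip M (f p) (f q))"
      by (simp add: ip_commute[of M _ "f p"])
  qed
  finally show ?thesis by (simp add: sum_distrib_left)
qed

text \<open>The counterpart in \<open>L2\<close> of the evaluation at \<open>p\<close>: inner
  products of corners are the products of minima in the Yeh-Wiener covariance. Open on the left, to
  match \<open>cell\<close>.\<close>

definition corner :: "real \<times> real \<Rightarrow> real \<times> real \<Rightarrow> real" where
  "corner p q = indicator {0<..fst p} (fst q) * indicator {0<..snd p} (snd q)"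

lemma corner_measurable [measurable]: "corner p \<in> borel_measurable borel"
  unfolding corner_def borel_prod[symmetric] by measurable

lemma corner_sqi: "sqi (leb S T) (corner p)"
proof -
  have m: "corner p \<in> borel_measurable (leb S T)" by (rule borel_measurable_leb) measurable
  moreover have "integrable (leb S T) (\<lambda>q. (corner p q)\<^sup>2)"
    by (intro integrable_leb_bounded[where B = 1] borel_measurable_power m) (auto simp: corner_def indicator_def)
  ultimately show ?thesis by (simp add: sqi_def)
qed

lemma corner_ip:
  assumes "p \<in> rect S T" "q \<in> rect S T"
  shows "ip (leb S T) (corner p) (corner q) = min (fst p) (fst q) * min (snd p) (snd q)"
proof -
  have pq: "0 \<le> fst p" "fst p \<le> S" "0 \<le> snd p" "snd p \<le> T" "0 \<le> fst q" "fst q \<le> S" "0 \<le> snd q" "snd q \<le> T"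
    using assms by (auto simp: rect_def mem_Times_iff)
  have i: "integrable lborel (indicator {0<..c} :: real \<Rightarrow> real)" for c :: real
    by (cases "0 \<le> c") (auto intro!: integrable_real_indicator)
  have "ip (leb S T) (corner p) (corner q) = (LINT r|lborel. indicator (rect S T) r * (corner p r * corner q r))"
    unfolding ip_def by (rule integral_leb) measurable
  also have "\<dots> = (LINT r|lborel. indicator {0<..min (fst p) (fst q)} (fst r) * indicator {0<..min (snd p) (snd q)} (snd r))"
    using pq by (intro Bochner_Integration.integral_cong) (auto simp: corner_def indicator_def rect_def mem_Times_iff)
  also have "\<dots> = min (fst p) (fst q) * min (snd p) (snd q)"
    using pq by (subst lborel_product_integral(2)[OF i i]) (simp add: measure_lborel_Ioc)
  finally show ?thesis .
qed

text \<open>The covariance of the Yeh--Wiener law makes \<open>Z \<mapsto> g\<close> an isometry into \<open>L\<^sub>2\<close>.\<close>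

definition eval_comb :: "real \<Rightarrow> real \<Rightarrow> ((real \<times> real \<Rightarrow> real) \<Rightarrow> real) \<Rightarrow> (real \<times> real \<Rightarrow> real) \<Rightarrow> bool" where
  "eval_comb S T Z g \<longleftrightarrow> (\<exists>I a. finite I \<and> I \<subseteq> rect S T \<and> Z = (\<lambda>x. \<Sum>p\<in>I. a p * x p) \<and> g = (\<lambda>q. \<Sum>p\<in>I. a p * corner p q))"

lemma eval_comb_eval: "p \<in> rect S T \<Longrightarrow> eval_comb S T (\<lambda>x. x p) (corner p)"
  unfolding eval_comb_def by (intro exI[of _ "{p}"] exI[of _ "\<lambda>_. 1"]) auto

lemma eval_comb_zero: "eval_comb S T (\<lambda>x. 0) (\<lambda>q. 0)"
  unfolding eval_comb_def by (intro exI[of _ "{}"]) auto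

lemma eval_comb_cmult: "eval_comb S T Z g \<Longrightarrow> eval_comb S T (\<lambda>x. c * Z x) (\<lambda>q. c * g q)"
proof -
  assume "eval_comb S T Z g"
  then obtain I a where I: "finite I" "I \<subseteq> rect S T" "Z = (\<lambda>x. \<Sum>p\<in>I. a p * x p)" "g = (\<lambda>q. \<Sum>p\<in>I. a p * corner p q)"
    unfolding eval_comb_def by blast
  show ?thesis unfolding eval_comb_def
    by (intro exI[of _ I] exI[of _ "\<lambda>p. c * a p"]) (auto simp: I sum_distrib_left mult.assoc)
qed

lemma eval_comb_add:
  assumes "eval_comb S T Z g" "eval_comb S T Z' g'" shows "eval_comb S T (\<lambda>x. Z x + Z' x) (\<lambda>q. g q + g' q)"
proof -
  obtain I a where I: "finite I" "I \<subseteq> rect S T" "Z = (\<lambda>x. \<Sum>p\<in>I. a p * x p)" "g = (\<lambda>q. \<Sum>p\<in>I. a p * corner p q)"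
    using assms(1) unfolding eval_comb_def by blast
  obtain J b where J: "finite J" "J \<subseteq> rect S T" "Z' = (\<lambda>x. \<Sum>p\<in>J. b p * x p)" "g' = (\<lambda>q. \<Sum>p\<in>J. b p * corner p q)"
    using assms(2) unfolding eval_comb_def by blast
  define c where "c p = (if p \<in> I then a p else 0) + (if p \<in> J then b p else 0)" for p
  have "(\<Sum>p\<in>I \<union> J. c p * f p) = (\<Sum>p\<in>I. a p * f p) + (\<Sum>p\<in>J. b p * f p)" for f
  proof -
    have "(\<Sum>p\<in>I \<union> J. c p * f p) = (\<Sum>p\<in>I \<union> J. if p \<in> I then a p * f p else 0) + (\<Sum>p\<in>I \<union> J. if p \<in> J then b p * f p else 0)"
      unfolding sum.distrib[symmetric] by (intro sum.cong) (auto simp: c_def algebra_simps)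
    also have "(\<Sum>p\<in>I \<union> J. if p \<in> I then a p * f p else 0) = (\<Sum>p\<in>I. a p * f p)"
      using I(1) J(1) by (intro sum.mono_neutral_cong_right) auto
    also have "(\<Sum>p\<in>I \<union> J. if p \<in> J then b p * f p else 0) = (\<Sum>p\<in>J. b p * f p)"
      using I(1) J(1) by (intro sum.mono_neutral_cong_right) auto
    finally show ?thesis .
  qed
  then show ?thesis unfolding eval_comb_def using I J
    by (intro exI[of _ "I \<union> J"] exI[of _ c]) auto
qed

lemma eval_comb_sum: "finite K \<Longrightarrow> (\<And>k. k \<in> K \<Longrightarrow> eval_comb S T (Z k) (g k)) \<Longrightarrow> eval_comb S T (\<lambda>x. \<Sum>k\<in>K. Z k x) (\<lambda>q. \<Sum>k\<in>K. g k q)"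
  by (induction K rule: finite_induct) (auto intro: eval_comb_zero eval_comb_add)

text \<open>A rectangular increment of the path corresponds to the indicator of the cell, so the
  isometry sends a Riemann-Stieltjes sum to its step function.\<close>

lemma eval_comb_RS_sum:
  assumes g: "grid S m a" "grid T n b"
  shows "eval_comb S T (\<lambda>x. RS_sum w x m n a b \<xi> \<eta>) (stepf w m n a b \<xi> \<eta>)"
  unfolding RS_sum_def stepf_def[abs_def]
proof (intro eval_comb_sum eval_comb_cmult)
  fix i j assume ij: "i \<in> {..<m}" "j \<in> {..<n}"
  have in1: "a i \<in> {0..S}" "a (Suc i) \<in> {0..S}" "b j \<in> {0..T}" "b (Suc j) \<in> {0..T}" "a i \<le> a (Suc i)" "b j \<le> b (Suc j)"
    using grid_mem[OF g(1), of i] grid_mem[OF g(1), of "Suc i"] grid_mem[OF g(2), of j] grid_mem[OF g(2), of "Suc j"]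
      grid_mono[OF g(1), of i "Suc i"] grid_mono[OF g(2), of j "Suc j"] ij by auto
  have "eval_comb S T (\<lambda>x. ((x (a (Suc i), b (Suc j)) + (-1) * x (a i, b (Suc j))) + (-1) * x (a (Suc i), b j)) + x (a i, b j))
      (\<lambda>q. ((corner (a (Suc i), b (Suc j)) q + (-1) * corner (a i, b (Suc j)) q) + (-1) * corner (a (Suc i), b j) q) + corner (a i, b j) q)"
    using in1 by (intro eval_comb_add eval_comb_cmult eval_comb_eval) (auto simp: rect_def)
  moreover have "((corner (a (Suc i), b (Suc j)) q + (-1) * corner (a i, b (Suc j)) q) + (-1) * corner (a (Suc i), b j) q) + corner (a i, b j) q
      = indicator (cell a i) (fst q) * indicator (cell b j) (snd q)" for q
    using in1 by (auto simp: corner_def cell_def indicator_def)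
  ultimately show "eval_comb S T (\<lambda>x. rect_incr x a b i j) (\<lambda>q. indicator (cell a i) (fst q) * indicator (cell b j) (snd q))"
    by (simp add: rect_incr_def)
qed auto

section \<open>Riemann-Stieltjes integrals as Gaussian variables\<close>

locale yeh_wiener_law = l2_rect S T \<phi> + W: prob_space W
  for S T :: real and \<phi> :: "nat \<Rightarrow> real \<times> real \<Rightarrow> real" and W :: "(real \<times> real \<Rightarrow> real) measure" +
  assumes space_W: "space W = C0 S T"
    and sets_W: "sets W = sets (restrict_space (Pi\<^sub>M UNIV (\<lambda>_. borel)) (C0 S T))"
    and normal_W: "\<And>I a. finite I \<Longrightarrow> I \<subseteq> rect S T \<Longrightarrow> centered_normal (distr W borel (\<lambda>x. \<Sum>p\<in>I. a p * x p))"
    and cov_W: "\<And>s t s' t'. s \<in> {0..S} \<Longrightarrow> t \<in> {0..T} \<Longrightarrow> s' \<in> {0..S} \<Longrightarrow> t' \<in> {0..T} \<Longrightarrow>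
        (LINT x|W. x (s, t) * x (s', t')) = min s s' * min t t'"
begin

lemma eval_measurable [measurable]: "(\<lambda>x. x p) \<in> borel_measurable W"
  unfolding measurable_cong_sets[OF sets_W refl]
  by (rule measurable_restrict_space1) (rule measurable_component_singleton, simp)

lemma eval_sqi: assumes p: "p \<in> rect S T" shows "sqi W (\<lambda>x. x p)"
proof -
  have c: "centered_normal (distr W borel (\<lambda>x. \<Sum>q\<in>{p}. 1 * x q))"
    using p by (intro normal_W) auto
  then have "integrable (distr W borel (\<lambda>x. x p)) (\<lambda>r. r\<^sup>2)"
    using centered_normal_char(1) by simp
  then show ?thesis by (simp add: sqi_def integrable_distr_eq)
qed

lemma eval_ip: "p \<in> rect S T \<Longrightarrow> q \<in> rect S T \<Longrightarrow> ip W (\<lambda>x. x p) (\<lambda>x. x q) = ip \<mu> (corner p) (corner q)"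
  using cov_W[of "fst p" "snd p" "fst q" "snd q"] by (simp add: corner_ip ip_def[of W]) (auto simp: rect_def)

lemma eval_comb_law:
  assumes Z: "eval_comb S T Z g"
  shows "sqi W Z" "ip W Z Z = ip \<mu> g g" "(LINT x|W. iexp (t * Z x)) = of_real (exp (- (t\<^sup>2 * ip \<mu> g g / 2)))"
proof -
  obtain I a where I: "finite I" "I \<subseteq> rect S T" "Z = (\<lambda>x. \<Sum>p\<in>I. a p * x p)" "g = (\<lambda>q. \<Sum>p\<in>I. a p * corner p q)"
    using Z unfolding eval_comb_def by blast
  have s: "sqi W (\<lambda>x. x p)" if "p \<in> I" for p using eval_sqi[of p] I(2) that by blast
  show Zs: "sqi W Z" unfolding I(3) using I(1) s by (intro sqi_sum) auto
  then have [measurable]: "Z \<in> borel_measurable W" by auto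
  have "ip W Z Z = (\<Sum>p\<in>I. \<Sum>q\<in>I. a p * (a q * ip W (\<lambda>x. x p) (\<lambda>x. x q)))"
    unfolding I(3) using I(1) s by (intro ip_lincomb) auto
  also have "\<dots> = (\<Sum>p\<in>I. \<Sum>q\<in>I. a p * (a q * ip \<mu> (corner p) (corner q)))"
    using I(2) by (intro sum.cong refl arg_cong2[where f = "(*)"] eval_ip) blast+
  also have "\<dots> = ip \<mu> g g" unfolding I(4) using I(1) by (intro ip_lincomb[symmetric] corner_sqi)
  finally show eq: "ip W Z Z = ip \<mu> g g" .
  have c: "centered_normal (distr W borel Z)" unfolding I(3) using I by (intro normal_W)
  have "(LINT r|distr W borel Z. r\<^sup>2) = ip W Z Z"
    by (subst integral_distr) (auto simp: ip_self)
  moreover have "(LINT r|distr W borel Z. iexp (t * r)) = (LINT x|W. iexp (t * Z x))"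
    by (rule integral_distr) auto
  ultimately show "(LINT x|W. iexp (t * Z x)) = of_real (exp (- (t\<^sup>2 * ip \<mu> g g / 2)))"
    using centered_normal_char(2)[OF c, of t] eq by simp
qed

lemma C0_continuous: "x \<in> space W \<Longrightarrow> continuous_on (rect S T) x"
  by (simp add: space_W C0_def)

lemma RS_has: "bvB S T w B \<Longrightarrow> x \<in> space W \<Longrightarrow> has_RS_integral S T w x (RS_integral S T w x)"
  using has_RS_integral_exists[OF _ S T C0_continuous] RS_integral_eqI[OF S T] by metis

text \<open>The integral is the pointwise limit of the uniform sums, whose laws are known. Dominated
  convergence passes the characteristic function to the limit; for the second moment Fatou's lemma
  gives the inequality that Kolmogorov's argument requires.\<close>

lemma RS_law:
  assumes w: "bvB S T w B"
  shows "RS_integral S T w \<in> borel_measurable W"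
    and "(LINT x|W. iexp (t * RS_integral S T w x)) = of_real (exp (- (t\<^sup>2 * ip \<mu> w w / 2)))"
    and "integrable W (\<lambda>x. (RS_integral S T w x)\<^sup>2)" "(LINT x|W. (RS_integral S T w x)\<^sup>2) \<le> ip \<mu> w w"
proof -
  define Z where "Z k x = uRS S T w x k" for k x
  define g where "g k = stepf w (Suc k) (Suc k) (ugrid S k) (ugrid T k) (ugrid S k) (ugrid T k)" for k
  define d where "d k = (S + T + 1) / real (Suc k)" for k
  have gr: "grid S (Suc k) (ugrid S k)" "grid T (Suc k) (ugrid T k)" for k
    using ugrid[OF S, of k] ugrid[OF T, of k] by (auto simp: tag_grid_def)
  have Z: "eval_comb S T (Z k) (g k)" for k
    unfolding Z_def[abs_def] uRS_def g_def by (rule eval_comb_RS_sum[OF gr])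
  have lim: "(\<lambda>k. Z k x) \<longlonglongrightarrow> RS_integral S T w x" if "x \<in> space W" for x
    unfolding Z_def by (rule has_RS_uRS[OF S T RS_has[OF w that]])
  have Zm[measurable]: "Z k \<in> borel_measurable W" for k using eval_comb_law(1)[OF Z] by auto
  show m[measurable]: "RS_integral S T w \<in> borel_measurable W"
    by (rule borel_measurable_LIMSEQ_real[OF lim Zm])
  have nlim: "(\<lambda>k. ip \<mu> (g k) (g k)) \<longlonglongrightarrow> ip \<mu> w w"
    unfolding ip_self g_def
  proof (rule stepf_integral_tendsto(2)[OF w S T, of d, where h = "\<lambda>_. 0" and C = 0])
    show "tag_grid S (d k) (Suc k) (ugrid S k) (ugrid S k)" "tag_grid T (d k) (Suc k) (ugrid T k) (ugrid T k)" for k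
      using S T by (auto simp: d_def intro!: tag_grid_mono[OF ugrid] divide_right_mono)
    show "d \<longlonglongrightarrow> 0" unfolding d_def using mesh_tendsto[of "S + T"] .
  qed auto
  have "(\<lambda>k. LINT x|W. iexp (t * Z k x)) \<longlonglongrightarrow> (LINT x|W. iexp (t * RS_integral S T w x))"
  proof (rule integral_dominated_convergence[where w = "\<lambda>_. 1"])
    show "AE x in W. (\<lambda>k. iexp (t * Z k x)) \<longlonglongrightarrow> iexp (t * RS_integral S T w x)"
      using lim by (intro AE_I2 tendsto_intros) auto
  qed auto
  moreover have "(\<lambda>k. LINT x|W. iexp (t * Z k x)) \<longlonglongrightarrow> complex_of_real (exp (- (t\<^sup>2 * ip \<mu> w w / 2)))"
    unfolding eval_comb_law(3)[OF Z] by (intro tendsto_intros nlim) auto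
  ultimately show "(LINT x|W. iexp (t * RS_integral S T w x)) = of_real (exp (- (t\<^sup>2 * ip \<mu> w w / 2)))"
    by (rule LIMSEQ_unique)
  \<comment> \<open>Fatou's lemma needs one bound for all terms. The norms stay below the limit plus
    \<open>e\<close> from some index \<open>K\<close> on; \<open>e\<close> is removed at the
    end.\<close>
  have fat: "integrable W (\<lambda>x. (RS_integral S T w x)\<^sup>2) \<and> (LINT x|W. (RS_integral S T w x)\<^sup>2) \<le> ip \<mu> w w + e" if e: "e > 0" for e
  proof -
    have "eventually (\<lambda>k. ip \<mu> (g k) (g k) < ip \<mu> w w + e) sequentially"
      using order_tendstoD(2)[OF nlim] e by simp
    then obtain K where K: "\<And>k. k \<ge> K \<Longrightarrow> ip \<mu> (g k) (g k) < ip \<mu> w w + e" by (auto simp: eventually_sequentially)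
    have 1: "integrable W (\<lambda>x. (Z (k + K) x)\<^sup>2)" for k using eval_comb_law(1)[OF Z] by auto
    have 2: "AE x in W. (\<lambda>k. (Z (k + K) x)\<^sup>2) \<longlonglongrightarrow> (RS_integral S T w x)\<^sup>2"
      using lim by (intro AE_I2 tendsto_intros LIMSEQ_ignore_initial_segment) auto
    have 3: "(LINT x|W. (Z (k + K) x)\<^sup>2) \<le> ip \<mu> w w + e" for k
      using eval_comb_law(2)[OF Z, of "k + K"] K[of "k + K"] by (simp add: ip_self)
    have 4: "(\<lambda>x. (RS_integral S T w x)\<^sup>2) \<in> borel_measurable W" by measurable
    show ?thesis using fatou_real[OF 1 _ 4 2 3] by simp
  qed
  then show "integrable W (\<lambda>x. (RS_integral S T w x)\<^sup>2)" using zero_less_one by blast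
  show "(LINT x|W. (RS_integral S T w x)\<^sup>2) \<le> ip \<mu> w w"
    by (rule field_le_epsilon) (use fat in auto)
qed

text \<open>Under \<open>W\<close> these are independent standard normal variables:
  \<open>N_char\<close> is the product of their characteristic functions.\<close>

definition N :: "nat \<Rightarrow> (real \<times> real \<Rightarrow> real) \<Rightarrow> real" where "N j = RS_integral S T (\<phi> j)"

lemma basis_bvB: "\<exists>B. bvB S T (\<phi> j) B"
  using basis S T by (intro bv_HK_bvB) (auto simp: bv_complete_orthonormal_def)

lemma comb_bvB: "\<exists>B. bvB S T (comb a n) B"
proof (induction n)
  case 0
  show ?case using bvB_zero by (auto simp: comb_def[abs_def])
next
  case (Suc n)
  obtain B C where "bvB S T (comb a n) B" "bvB S T (\<phi> n) C" using Suc basis_bvB by blast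
  from bvB_add[OF this(1) bvB_cmult[OF this(2), of "a n"]] show ?case
    by (auto simp: comb_def[abs_def])
qed

lemma RS_comb: assumes x: "x \<in> space W" shows "RS_integral S T (comb a n) x = (\<Sum>j<n. a j * N j x)"
proof -
  have "has_RS_integral S T (comb a n) x (\<Sum>j<n. a j * N j x)"
  proof (induction n)
    case 0
    show ?case by (simp add: comb_def[abs_def] has_RS_iff RS_sum_def exI[of _ 1])
  next
    case (Suc n)
    obtain B where "bvB S T (\<phi> n) B" using basis_bvB by blast
    from has_RS_cmult[OF RS_has[OF this x] RS_sum_cmult, of "a n"]
    have "has_RS_integral S T (\<lambda>p. a n * \<phi> n p) x (a n * N n x)" by (simp add: N_def)
    from has_RS_add[OF Suc this RS_sum_add] show ?case by (simp add: comb_def[abs_def])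
  qed
  then show ?thesis by (rule RS_integral_eqI[OF S T])
qed

lemma N_measurable [measurable]: "N j \<in> borel_measurable W"
  using basis_bvB RS_law(1) unfolding N_def by blast

lemma N_char: "(LINT x|W. iexp (\<Sum>j<n. a j * N j x)) = of_real (exp (- ((\<Sum>j<n. (a j)\<^sup>2) / 2)))"
proof -
  obtain B where B: "bvB S T (comb a n) B" using comb_bvB by blast
  have "(LINT x|W. iexp (\<Sum>j<n. a j * N j x)) = (LINT x|W. iexp (1 * RS_integral S T (comb a n) x))"
    by (intro Bochner_Integration.integral_cong) (simp_all add: RS_comb)
  also have "\<dots> = of_real (exp (- (1\<^sup>2 * ip \<mu> (comb a n) (comb a n) / 2)))" by (rule RS_law(2)[OF B])
  finally show ?thesis by (simp add: ip_comb_comb)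
qed

lemma N_sq: "integrable W (\<lambda>x. (N j x)\<^sup>2)"
  using basis_bvB RS_law(3) unfolding N_def by blast

lemma N_sum_sq: "(LINT x|W. (\<Sum>j<n. a j * N j x)\<^sup>2) \<le> (\<Sum>j<n. (a j)\<^sup>2)"
proof -
  obtain B where B: "bvB S T (comb a n) B" using comb_bvB by blast
  have "(LINT x|W. (\<Sum>j<n. a j * N j x)\<^sup>2) = (LINT x|W. (RS_integral S T (comb a n) x)\<^sup>2)"
    by (intro Bochner_Integration.integral_cong) (simp_all add: RS_comb)
  then show ?thesis using RS_law(4)[OF B] by (simp add: ip_comb_comb)
qed

lemma N_integrable: "integrable W (N j)"
proof -
  have "sqi W (N j)" "sqi W (\<lambda>_. 1)" using N_sq by (auto simp: sqi_def)
  from sqi_mult_integrable[OF this] show ?thesis by simp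
qed

text \<open>The joint characteristic function is even in the coefficient of \<open>N j\<close>. Its
  derivative there vanishes at 0, which is the assertion.\<close>

lemma N_iexp_orth:
  assumes l: "l \<le> j"
  shows "(LINT x|W. of_real (N j x) * iexp (\<Sum>i<l. a i * N i x)) = 0"
proof -
  define A where "A x = (\<Sum>i<l. a i * N i x)" for x
  have [measurable]: "A \<in> borel_measurable W" unfolding A_def by measurable
  have ch: "(LINT x|W. iexp (A x + s * N j x)) = of_real (exp (- (((\<Sum>i<l. (a i)\<^sup>2) + s\<^sup>2) / 2)))" for s
  proof -
    define b where "b i = (if i < l then a i else if i = j then s else 0)" for i
    have "(\<Sum>i<Suc j. f (b i) i) = (\<Sum>i<l. f (a i) i) + f s j" if "\<And>i. f 0 i = 0" for f :: "real \<Rightarrow> nat \<Rightarrow> real"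
    proof -
      have "(\<Sum>i<j. f (b i) i) = (\<Sum>i<l. f (a i) i)"
        using l that by (intro sum.mono_neutral_cong_right) (auto simp: b_def)
      then show ?thesis using l by (simp add: b_def)
    qed
    from this[of "\<lambda>r i. r * N i x" for x] this[of "\<lambda>r i. r\<^sup>2"]
    show ?thesis using N_char[of b "Suc j"] unfolding A_def by simp
  qed
  \<comment> \<open>\<open>ch\<close> depends on \<open>s\<close> through its square only, so the
    odd part in \<open>s\<close> integrates to 0.\<close>
  have sin0: "(LINT x|W. of_real (sin (s * N j x)) * iexp (A x)) = 0" for s
  proof -
    have "of_real (sin (s * N j x)) * iexp (A x) = (iexp (A x + s * N j x) - iexp (A x + (- s) * N j x)) / (2 * \<i>)" for x
    proof -
      have "iexp (A x + s * N j x) = iexp (A x) * iexp (s * N j x)" "iexp (A x + (- s) * N j x) = iexp (A x) * iexp (- (s * N j x))"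
        by (simp_all add: algebra_simps flip: exp_add)
      moreover have "iexp (s * N j x) - iexp (- (s * N j x)) = 2 * \<i> * of_real (sin (s * N j x))"
        by (rule complex_eqI) (simp_all add: Re_exp Im_exp)
      ultimately have "iexp (A x + s * N j x) - iexp (A x + (- s) * N j x) = iexp (A x) * (2 * \<i> * of_real (sin (s * N j x)))"
        by (simp only: right_diff_distrib[symmetric])
      then have *: "iexp (A x + s * N j x) - iexp (A x + (- s) * N j x) = iexp (A x) * (2 * \<i> * of_real (sin (s * N j x)))" .
      have "a * b = (b * (2 * \<i> * a)) / (2 * \<i>)" for a b :: complex
      proof -
        have nz: "2 * \<i> \<noteq> 0" by simp
        show ?thesis unfolding nonzero_eq_divide_eq[OF nz] by (simp only: mult_ac)
      qed
      then show ?thesis unfolding * .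
    qed
    then have "(LINT x|W. of_real (sin (s * N j x)) * iexp (A x)) = (LINT x|W. (iexp (A x + s * N j x) - iexp (A x + (- s) * N j x)) / (2 * \<i>))"
      by (simp only:)
    also have "\<dots> = ((LINT x|W. iexp (A x + s * N j x)) - (LINT x|W. iexp (A x + (- s) * N j x))) / (2 * \<i>)"
      unfolding integral_divide_zero
      by (subst Bochner_Integration.integral_diff) (auto intro!: W.integrable_const_bound[where B = 1])
    finally show ?thesis unfolding ch by simp
  qed
  \<comment> \<open>These difference quotients at 0 tend to \<open>N j x\<close> and are bounded by
    \<open>\<bar>N j x\<bar>\<close>, so the derivative is taken by dominated convergence.\<close>
  have "(\<lambda>k. LINT x|W. of_real (real (Suc k) * sin (1 / real (Suc k) * N j x)) * iexp (A x)) \<longlonglongrightarrow> (LINT x|W. of_real (N j x) * iexp (A x))"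
  proof (rule integral_dominated_convergence[where w = "\<lambda>x. \<bar>N j x\<bar>"])
    have lim: "(\<lambda>k. real (Suc k) * sin (1 / real (Suc k) * y)) \<longlonglongrightarrow> y" for y
    proof (cases "y = 0")
      case False
      have "((\<lambda>z. sin z / z) \<longlongrightarrow> 1) (at (0::real))"
        using DERIV_sin[of 0] by (simp add: has_field_derivative_iff)
      moreover have "filterlim (\<lambda>k. 1 / real (Suc k) * y) (at 0) sequentially"
        unfolding filterlim_at using False tendsto_mult[OF mesh_tendsto[of 0] tendsto_const[of y]] by simp
      ultimately have "(\<lambda>k. sin (1 / real (Suc k) * y) / (1 / real (Suc k) * y)) \<longlonglongrightarrow> 1" by (rule filterlim_compose)
      from tendsto_mult[OF this tendsto_const[of y]]
      have "(\<lambda>k. sin (1 / real (Suc k) * y) / (1 / real (Suc k) * y) * y) \<longlonglongrightarrow> y" by simp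
      moreover have "sin (1 / real (Suc k) * y) / (1 / real (Suc k) * y) * y = real (Suc k) * sin (1 / real (Suc k) * y)" for k
        using False by (simp del: of_nat_Suc)
      ultimately show ?thesis by (simp only:)
    qed simp
    show "AE x in W. (\<lambda>k. of_real (real (Suc k) * sin (1 / real (Suc k) * N j x)) * iexp (A x)) \<longlonglongrightarrow> of_real (N j x) * iexp (A x)"
      by (intro AE_I2 tendsto_mult tendsto_of_real lim tendsto_const)
    show "AE x in W. norm (of_real (real (Suc k) * sin (1 / real (Suc k) * N j x)) * iexp (A x)) \<le> \<bar>N j x\<bar>" for k
    proof (rule AE_I2)
      fix x
      have "\<bar>real (Suc k) * sin (1 / real (Suc k) * N j x)\<bar> \<le> real (Suc k) * \<bar>1 / real (Suc k) * N j x\<bar>"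
        unfolding abs_mult[of "real (Suc k)" "sin _"]
        by (rule mult_mono[OF _ abs_sin_x_le_abs_x]) auto
      also have "\<dots> = \<bar>N j x\<bar>" by (simp add: abs_mult)
      finally show "norm (of_real (real (Suc k) * sin (1 / real (Suc k) * N j x)) * iexp (A x)) \<le> \<bar>N j x\<bar>"
        by (simp only: norm_mult norm_of_real norm_exp_i_times mult_1_right)
    qed
  qed (use N_integrable in auto)
  moreover have "(LINT x|W. of_real (real (Suc k) * sin (1 / real (Suc k) * N j x)) * iexp (A x)) = 0" for k
    using sin0[of "1 / real (Suc k)"] by (simp only: of_real_mult mult.assoc integral_mult_right_zero mult_zero_right)
  ultimately show ?thesis unfolding A_def by (simp add: LIMSEQ_const_iff)
qed

text \<open>The condition \<open>orth\<close> is Fourier uniqueness with \<open>N j\<close> as the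
  density: its transforms in the earlier variables vanish by \<open>N_iexp_orth\<close>.\<close>

sublocale OI: orthogonal_increments W N
proof (unfold_locales)
  fix \<psi> :: "_ \<Rightarrow> real" and l j
  let ?X = "\<lambda>i x. if i < l then N i x else 0"
  let ?V = "vimage_algebra (space W) (\<lambda>x i. ?X i x) (Pi\<^sub>M UNIV (\<lambda>_. borel))"
  assume \<psi>: "\<And>x. x \<in> space W \<Longrightarrow> \<bar>\<psi> x\<bar> \<le> 1" "\<psi> \<in> borel_measurable ?V" and l: "l \<le> j"
  have "(LINT x|W. complex_of_real (\<psi> x) * complex_of_real (N j x)) = 0"
  proof (rule fourier_uniqueness_integral[where X = ?X])
    show "?X i \<in> borel_measurable W" for i by simp
    show "integrable W (\<lambda>x. complex_of_real (N j x))" using N_integrable by simp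
    show "bmeas ?V (\<lambda>x. complex_of_real (\<psi> x))"
      using \<psi> by (auto simp: bmeas_def)
    fix J a assume J: "finite (J :: nat set)"
    have "(\<Sum>i\<in>J. a i * ?X i x) = (\<Sum>i<l. (if i \<in> J then a i else 0) * N i x)" for x
    proof -
      have "(\<Sum>i\<in>J. a i * ?X i x) = (\<Sum>i\<in>J \<inter> {..<l}. a i * N i x)"
        using J by (intro sum.mono_neutral_cong_right) auto
      also have "\<dots> = (\<Sum>i<l. (if i \<in> J then a i else 0) * N i x)"
        by (intro sum.mono_neutral_cong_left) auto
      finally show ?thesis .
    qed
    then show "(LINT x|W. complex_of_real (N j x) * iexp (\<Sum>i\<in>J. a i * ?X i x)) = 0"
      using N_iexp_orth[OF l, of "\<lambda>i. if i \<in> J then a i else 0"] by (simp only:)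
  qed
  then have "complex_of_real (LINT x|W. \<psi> x * N j x) = 0"
    by (simp only: integral_complex_of_real[symmetric] of_real_mult)
  then show "(LINT x|W. \<psi> x * N j x) = 0" by simp
qed (auto simp: N_sq N_sum_sq)

section \<open>The Paley--Wiener--Zygmund integral as a limit of Gaussian sums\<close>

definition cvg :: "(nat \<Rightarrow> real) \<Rightarrow> (real \<times> real \<Rightarrow> real) \<Rightarrow> bool" where
  "cvg c x \<longleftrightarrow> convergent (\<lambda>n. \<Sum>j<n. c j * N j x)"

text \<open>The PWZ integral as a function of the coefficient sequence, with the same default 0.
  Linearity and measurability become statements on sequences.\<close>

definition plim :: "(nat \<Rightarrow> real) \<Rightarrow> (real \<times> real \<Rightarrow> real) \<Rightarrow> real" where
  "plim c x = (if cvg c x then lim (\<lambda>n. \<Sum>j<n. c j * N j x) else 0)"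

lemma pwz_plim: "x \<in> space W \<Longrightarrow> pwz S T \<phi> v x = plim (cf v) x"
  unfolding pwz_def plim_def cvg_def Let_def L2_inner_ip cf_def[symmetric]
  by (simp add: RS_comb[unfolded comb_def[abs_def]])

lemma plim_tendsto: "cvg c x \<Longrightarrow> (\<lambda>n. \<Sum>j<n. c j * N j x) \<longlonglongrightarrow> plim c x"
  by (simp add: plim_def cvg_def convergent_LIMSEQ_iff)

lemma plim_eqI: "(\<lambda>n. \<Sum>j<n. c j * N j x) \<longlonglongrightarrow> L \<Longrightarrow> cvg c x \<and> plim c x = L"
  by (auto simp: plim_def cvg_def convergent_def limI)

text \<open>Convergence of both series is assumed because the default 0 can destroy additivity
  elsewhere.\<close>

lemma plim_combine:
  assumes "cvg c x" "cvg d x"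
  shows "cvg (\<lambda>j. \<alpha> * c j + \<beta> * d j) x \<and> plim (\<lambda>j. \<alpha> * c j + \<beta> * d j) x = \<alpha> * plim c x + \<beta> * plim d x"
proof (rule plim_eqI)
  have "(\<lambda>n. \<alpha> * (\<Sum>j<n. c j * N j x) + \<beta> * (\<Sum>j<n. d j * N j x)) \<longlonglongrightarrow> \<alpha> * plim c x + \<beta> * plim d x"
    using assms by (intro tendsto_intros plim_tendsto)
  then show "(\<lambda>n. \<Sum>j<n. (\<alpha> * c j + \<beta> * d j) * N j x) \<longlonglongrightarrow> \<alpha> * plim c x + \<beta> * plim d x"
    by (simp add: sum_distrib_left sum.distrib[symmetric] algebra_simps)
qed

text \<open>Measurability jointly in the coefficients and the path, as Fubini's theorem
  demands.\<close>

lemma plim_pair_measurable [measurable (raw)]: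
  assumes [measurable]: "\<And>j. (\<lambda>z. c z j) \<in> borel_measurable K" "f \<in> K \<rightarrow>\<^sub>M W"
  shows "(\<lambda>z. plim (c z) (f z)) \<in> borel_measurable K" "Measurable.pred K (\<lambda>z. cvg (c z) (f z))"
proof -
  have [measurable]: "(\<lambda>z. \<Sum>j<n. c z j * N j (f z)) \<in> borel_measurable K" for n by measurable
  have "Measurable.pred K (\<lambda>z. Cauchy (\<lambda>n. \<Sum>j<n. c z j * N j (f z)))"
    unfolding pred_def by (rule sets_Collect_Cauchy) measurable
  then show [measurable]: "Measurable.pred K (\<lambda>z. cvg (c z) (f z))" by (simp add: cvg_def Cauchy_convergent_iff)
  show "(\<lambda>z. plim (c z) (f z)) \<in> borel_measurable K" unfolding plim_def by measurable
qed

lemma AE_cvg: "summable (\<lambda>j. (c j)\<^sup>2) \<Longrightarrow> AE x in W. cvg c x"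
  unfolding cvg_def by (rule OI.AE_convergent_sum)

lemma plim_char:
  assumes c: "summable (\<lambda>j. (c j)\<^sup>2)"
  shows "(LINT x|W. iexp (plim c x)) = of_real (exp (- ((\<Sum>j. (c j)\<^sup>2) / 2)))"
proof -
  have "(\<lambda>n. LINT x|W. iexp (\<Sum>j<n. c j * N j x)) \<longlonglongrightarrow> (LINT x|W. iexp (plim c x))"
  proof (rule integral_dominated_convergence[where w = "\<lambda>_. 1"])
    show "AE x in W. (\<lambda>n. iexp (\<Sum>j<n. c j * N j x)) \<longlonglongrightarrow> iexp (plim c x)"
      using AE_cvg[OF c] by eventually_elim (intro tendsto_intros plim_tendsto)
  qed auto
  moreover have "(\<lambda>n. LINT x|W. iexp (\<Sum>j<n. c j * N j x)) \<longlonglongrightarrow> complex_of_real (exp (- ((\<Sum>j. (c j)\<^sup>2) / 2)))"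
    unfolding N_char by (intro tendsto_intros summable_LIMSEQ[OF c]) auto
  ultimately show ?thesis by (rule LIMSEQ_unique)
qed

lemma N_scale: assumes x: "x \<in> space W" shows "N j (\<lambda>p. \<rho> * x p) = \<rho> * N j x"
proof -
  obtain B where B: "bvB S T (\<phi> j) B" using basis_bvB by blast
  show ?thesis
    using RS_integral_eqI[OF S T has_RS_cmult[OF RS_has[OF B x] RS_sum_cmult_integrator]] by (simp add: N_def)
qed

text \<open>Invariance of convergence under scaling of the path is what turns a.e. convergence into
  s-a.e. convergence.\<close>

lemma cvg_scale: assumes "x \<in> space W" "cvg c x"
  shows "cvg c (\<lambda>p. \<rho> * x p)" "plim c (\<lambda>p. \<rho> * x p) = \<rho> * plim c x"
proof -
  have "cvg c (\<lambda>p. \<rho> * x p) \<and> plim c (\<lambda>p. \<rho> * x p) = \<rho> * plim c x"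
  proof (rule plim_eqI)
    have "(\<lambda>n. \<rho> * (\<Sum>j<n. c j * N j x)) \<longlonglongrightarrow> \<rho> * plim c x"
      using assms by (intro tendsto_intros plim_tendsto)
    then show "(\<lambda>n. \<Sum>j<n. c j * N j (\<lambda>p. \<rho> * x p)) \<longlonglongrightarrow> \<rho> * plim c x"
      by (simp add: N_scale[OF assms(1)] sum_distrib_left mult_ac)
  qed
  then show "cvg c (\<lambda>p. \<rho> * x p)" "plim c (\<lambda>p. \<rho> * x p) = \<rho> * plim c x" by auto
qed

end

section \<open>Holomorphic dependence on a parameter\<close>

text \<open>A disc of radius \<open>r / 4\<close> around a point of the half-size disc stays inside
  the ball. Cauchy's inequality on it bounds the derivative by \<open>4 * C / r\<close>, and the
  mean value estimate follows by convexity.\<close>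

lemma holomorphic_difference_quotient_bound:
  fixes f :: "complex \<Rightarrow> complex"
  assumes f: "f holomorphic_on ball z0 r" and C: "\<And>z. z \<in> ball z0 r \<Longrightarrow> norm (f z) \<le> C"
    and r: "r > 0" and z: "z \<in> cball z0 (r / 2)"
  shows "norm (f z - f z0) \<le> (4 * C / r) * norm (z - z0)"
proof (rule field_differentiable_bound[of "cball z0 (r / 2)"])
  fix w assume w: "w \<in> cball z0 (r / 2)"
  have sub: "cball w (r / 4) \<subseteq> ball z0 r"
  proof
    fix v assume "v \<in> cball w (r / 4)"
    then show "v \<in> ball z0 r" using w r dist_triangle[of z0 v w] by simp
  qed
  show "(f has_field_derivative deriv f w) (at w within cball z0 (r / 2))"
    by (rule has_field_derivative_at_within, rule holomorphic_derivI[OF f open_ball]) (use w r in auto)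
  have "norm ((deriv ^^ 1) f w) \<le> fact 1 * C / (r / 4) ^ 1"
  proof (rule Cauchy_inequality)
    show "f holomorphic_on ball w (r / 4)"
      by (rule holomorphic_on_subset[OF f order_trans[OF ball_subset_cball sub]])
    show "continuous_on (cball w (r / 4)) f"
      by (rule continuous_on_subset[OF holomorphic_on_imp_continuous_on[OF f] sub])
    show "norm (f x) \<le> C" if "norm (w - x) = r / 4" for x
      using sub that by (intro C) (auto simp: subset_iff dist_norm)
  qed (use r in auto)
  then show "norm (deriv f w) \<le> 4 * C / r" by (simp add: mult.commute)
qed (use r z in auto)

text \<open>Differentiation under the integral sign: by the preceding bound the difference quotients
  are dominated, uniformly in \<open>u\<close>, by a multiple of
  \<open>norm (\<theta> u)\<close>.\<close>

lemma holomorphic_integral: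
  fixes \<phi> :: "'a \<Rightarrow> complex \<Rightarrow> complex"
  assumes \<Omega>: "open \<Omega>" and m: "\<And>z. z \<in> \<Omega> \<Longrightarrow> (\<lambda>u. \<phi> u z) \<in> borel_measurable M"
    and hol: "\<And>u. u \<in> space M \<Longrightarrow> \<phi> u holomorphic_on \<Omega>"
    and C: "\<And>u z. u \<in> space M \<Longrightarrow> z \<in> \<Omega> \<Longrightarrow> norm (\<phi> u z) \<le> C" and \<theta>: "integrable M \<theta>"
  shows "(\<lambda>z. LINT u|M. \<phi> u z * \<theta> u) holomorphic_on \<Omega>"
  unfolding holomorphic_on_def
proof
  fix z0 assume z0: "z0 \<in> \<Omega>"
  define K where "K z = (LINT u|M. \<phi> u z * \<theta> u)" for z
  obtain r where r: "r > 0" "ball z0 r \<subseteq> \<Omega>" using \<Omega> z0 openE by blast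
  have [measurable]: "\<theta> \<in> borel_measurable M" using \<theta> by auto
  have int: "integrable M (\<lambda>u. \<phi> u z * \<theta> u)" if "z \<in> \<Omega>" for z
    using integrable_bmeas_mult[of M "\<lambda>u. \<phi> u z" "\<lambda>x. x" M \<theta>] m[OF that] C that \<theta>
    by (auto simp: bmeas_def)
  have "(K has_field_derivative (LINT u|M. deriv (\<phi> u) z0 * \<theta> u)) (at z0)"
    unfolding has_field_derivative_iff tendsto_at_iff_sequentially
  proof (intro allI impI)
    fix X :: "nat \<Rightarrow> complex" assume X: "\<forall>i. X i \<in> UNIV - {z0}" "X \<longlonglongrightarrow> z0"
    \<comment> \<open>An initial segment is dropped, so that all points lie in the disc on which the
      bound holds.\<close>
    have "eventually (\<lambda>i. dist (X i) z0 < r / 2) sequentially"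
      by (rule tendstoD[OF X(2)]) (use r in simp)
    then obtain n0 where n0: "\<And>i. i \<ge> n0 \<Longrightarrow> dist (X i) z0 < r / 2" by (auto simp: eventually_sequentially)
    define Y where "Y i = X (i + n0)" for i
    have Y: "Y i \<noteq> z0" "Y i \<in> cball z0 (r / 2)" "Y i \<in> \<Omega>" for i
      using X(1) n0[of "i + n0"] r by (auto simp: Y_def dist_commute subset_iff)
    have Ylim: "filterlim Y (at z0) sequentially"
      unfolding filterlim_at Y_def using LIMSEQ_ignore_initial_segment[OF X(2)] X(1) by auto
    define q where "q i u = (\<phi> u (Y i) - \<phi> u z0) / (Y i - z0)" for i u
    have qm[measurable]: "q i \<in> borel_measurable M" for i
      unfolding q_def using m[OF Y(3)] m[OF z0] by measurable
    have ql: "(\<lambda>i. q i u) \<longlonglongrightarrow> deriv (\<phi> u) z0" if u: "u \<in> space M" for u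
    proof -
      have "((\<lambda>z. (\<phi> u z - \<phi> u z0) / (z - z0)) \<longlongrightarrow> deriv (\<phi> u) z0) (at z0)"
        using holomorphic_derivI[OF hol[OF u] \<Omega> z0] by (simp add: has_field_derivative_iff)
      from filterlim_compose[OF this Ylim] show ?thesis by (simp add: q_def)
    qed
    have dm[measurable]: "(\<lambda>u. deriv (\<phi> u) z0) \<in> borel_measurable M"
      by (rule borel_measurable_LIMSEQ_metric[OF qm ql])
    have qb: "norm (q i u) \<le> 4 * C / r" if u: "u \<in> space M" for i u
    proof -
      have "norm (\<phi> u (Y i) - \<phi> u z0) \<le> (4 * C / r) * norm (Y i - z0)"
        using hol[OF u] r C[OF u] Y(2) by (intro holomorphic_difference_quotient_bound) (auto intro: holomorphic_on_subset)
      then show ?thesis using Y(1)[of i] by (simp add: q_def norm_divide divide_le_eq)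
    qed
    have "(\<lambda>i. LINT u|M. q i u * \<theta> u) \<longlonglongrightarrow> (LINT u|M. deriv (\<phi> u) z0 * \<theta> u)"
    proof (rule integral_dominated_convergence[where w = "\<lambda>u. 4 * C / r * norm (\<theta> u)"])
      show "AE u in M. (\<lambda>i. q i u * \<theta> u) \<longlonglongrightarrow> deriv (\<phi> u) z0 * \<theta> u"
        using ql by (intro AE_I2 tendsto_intros) auto
      show "AE u in M. norm (q i u * \<theta> u) \<le> 4 * C / r * norm (\<theta> u)" for i
        unfolding norm_mult using qb by (intro AE_I2 mult_right_mono) auto
    qed (use \<theta> in auto)
    moreover have "(LINT u|M. q i u * \<theta> u) = (K (Y i) - K z0) / (Y i - z0)" for i
    proof -
      have "(LINT u|M. q i u * \<theta> u) = (LINT u|M. (\<phi> u (Y i) * \<theta> u - \<phi> u z0 * \<theta> u) / (Y i - z0))"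
        by (intro Bochner_Integration.integral_cong) (auto simp: q_def left_diff_distrib)
      then show ?thesis using int[OF Y(3)[of i]] int[OF z0] by (simp add: K_def)
    qed
    ultimately have "(\<lambda>i. (K (X (i + n0)) - K z0) / (X (i + n0) - z0)) \<longlonglongrightarrow> (LINT u|M. deriv (\<phi> u) z0 * \<theta> u)"
      by (simp add: Y_def)
    then show "((\<lambda>y. (K y - K z0) / (y - z0)) \<circ> X) \<longlonglongrightarrow> (LINT u|M. deriv (\<phi> u) z0 * \<theta> u)"
      unfolding o_def by (rule LIMSEQ_offset)
  qed
  then show "(\<lambda>z. LINT u|M. \<phi> u z * \<theta> u) field_differentiable at z0 within \<Omega>"
    unfolding K_def[abs_def] by (meson field_differentiable_def has_field_derivative_at_within)
qed

section \<open>Boundary limits of analytic continuations\<close>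

lemma open_right_half_plane: "open {z. Re z > 0}" and connected_right_half_plane: "connected {z. Re z > 0}"
  by (auto simp: open_halfspace_Re_gt intro: convex_connected convex_halfspace_Re_gt)

lemma boundary_nontrivial: "at (- \<i> * of_real q) within {z. Re z > 0} \<noteq> bot"
proof -
  have "- \<i> * of_real q islimpt {z. Re z > 0}"
    unfolding islimpt_sequential
  proof (intro exI[of _ "\<lambda>n. of_real (1 / real (Suc n)) - \<i> * of_real q"] conjI allI)
    have "(\<lambda>n. complex_of_real (1 / real (Suc n)) - \<i> * of_real q) \<longlonglongrightarrow> of_real 0 - \<i> * of_real q"
      using mesh_tendsto[of 0] by (intro tendsto_intros) simp
    then show "(\<lambda>n. complex_of_real (1 / real (Suc n)) - \<i> * of_real q) \<longlonglongrightarrow> - \<i> * of_real q" by simp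
  qed (auto simp: complex_eq_iff)
  then show ?thesis by (simp add: trivial_limit_within)
qed

text \<open>The continuations agree on the positive reals, which accumulate at 1, and hence on the
  half plane. The point \<open>- \<i> * of_real q\<close> is a limit point of it, so the boundary
  values agree as well.\<close>

lemma analytic_limit_unique:
  assumes "analytic_limit m J q L" "analytic_limit m J q L'" shows "L = L'"
proof -
  let ?H = "{z. Re z > 0}"
  obtain K where K: "K holomorphic_on ?H" "\<And>l. l > 0 \<Longrightarrow> K (of_real l) = (LINT x|m. J l x)"
    "(K \<longlongrightarrow> L) (at (- \<i> * of_real q) within ?H)" using assms(1) unfolding analytic_limit_def by auto
  obtain K' where K': "K' holomorphic_on ?H" "\<And>l. l > 0 \<Longrightarrow> K' (of_real l) = (LINT x|m. J l x)"
    "(K' \<longlongrightarrow> L') (at (- \<i> * of_real q) within ?H)" using assms(2) unfolding analytic_limit_def by auto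
  have "K w - K' w = 0" if w: "w \<in> ?H" for w
  proof (rule analytic_continuation[of "\<lambda>w. K w - K' w" ?H "of_real ` {0<..}" 1])
    show "1 islimpt complex_of_real ` {0<..}"
      unfolding islimpt_sequential
    proof (intro exI[of _ "\<lambda>n. 1 + of_real (1 / real (Suc n))"] conjI allI)
      have "(\<lambda>n. 1 + complex_of_real (1 / real (Suc n))) \<longlonglongrightarrow> 1 + of_real 0"
        using mesh_tendsto[of 0] by (intro tendsto_intros) simp
      then show "(\<lambda>n. 1 + complex_of_real (1 / real (Suc n))) \<longlonglongrightarrow> 1" by simp
      show "1 + complex_of_real (1 / real (Suc n)) \<in> complex_of_real ` {0<..} - {1}" for n
        by (auto simp: image_iff complex_eq_iff intro!: bexI[of _ "1 + 1 / real (Suc n)"] add_pos_pos)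
    qed
  qed (use K K' w open_right_half_plane connected_right_half_plane in \<open>auto intro: holomorphic_on_diff\<close>)
  then have "eventually (\<lambda>w. K w = K' w) (at (- \<i> * of_real q) within ?H)"
    by (auto simp: eventually_at_filter)
  with K(3) have "(K' \<longlongrightarrow> L) (at (- \<i> * of_real q) within ?H)" by (rule Lim_transform_eventually)
  then show ?thesis using K'(3) boundary_nontrivial tendsto_unique by blast
qed

lemma norm_exp_neg_divide_le: assumes "a \<ge> 0" "Re z > 0" shows "norm (exp (- (complex_of_real a / z))) \<le> 1"
proof -
  have "0 \<le> Re (complex_of_real a / z)" using assms by (simp add: Re_divide)
  then show ?thesis by simp
qed

text \<open>The common pattern of transform and convolution product. For \<open>A z \<ge> 0\<close>
  the kernel \<open>exp (- A / \<lambda>)\<close> is holomorphic and bounded by 1 for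
  \<open>\<lambda>\<close> in the right half plane, and at \<open>\<lambda> = - \<i> q\<close> it
  becomes \<open>exp (- \<i> A / q)\<close>.\<close>

lemma analytic_limit_gauss:
  assumes \<Theta>: "integrable Q \<Theta>" and A[measurable]: "A \<in> borel_measurable Q" and A0: "\<And>z. z \<in> space Q \<Longrightarrow> 0 \<le> A z"
    and J: "\<And>l. l > 0 \<Longrightarrow> integrable m (J l)"
      "\<And>l. l > 0 \<Longrightarrow> (LINT x|m. J l x) = (LINT z|Q. of_real (exp (- (A z / l))) * \<Theta> z)"
    and q: "q \<noteq> 0"
  shows "analytic_limit m J q (LINT z|Q. iexp (- (A z / q)) * \<Theta> z)"
proof -
  let ?H = "{z. Re z > 0}"
  define \<phi> where "\<phi> u z = exp (- (complex_of_real (A u) / z))" for u z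
  define K where "K z = (LINT u|Q. \<phi> u z * \<Theta> u)" for z
  have [measurable]: "\<Theta> \<in> borel_measurable Q" using \<Theta> by auto
  have \<phi>m[measurable]: "(\<lambda>u. \<phi> u z) \<in> borel_measurable Q" for z unfolding \<phi>_def by measurable
  have \<phi>b: "norm (\<phi> u z) \<le> 1" if "u \<in> space Q" "z \<in> ?H" for u z
    unfolding \<phi>_def using A0 that by (intro norm_exp_neg_divide_le) auto
  have "K holomorphic_on ?H"
    unfolding K_def
  proof (rule holomorphic_integral[OF open_right_half_plane \<phi>m _ \<phi>b \<Theta>])
    show "\<phi> u holomorphic_on ?H" for u unfolding \<phi>_def by (intro holomorphic_intros) auto
  qed
  moreover have "K (of_real l) = (LINT x|m. J l x)" if "l > 0" for l
    unfolding J(2)[OF that] K_def \<phi>_def by (simp add: exp_of_real[symmetric])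
  moreover have "(K \<longlongrightarrow> (LINT z|Q. iexp (- (A z / q)) * \<Theta> z)) (at (- \<i> * of_real q) within ?H)"
    unfolding tendsto_at_iff_sequentially
  proof (intro allI impI)
    fix X assume X: "\<forall>i. X i \<in> ?H - {- \<i> * of_real q}" "X \<longlonglongrightarrow> - \<i> * of_real q"
    have "(\<lambda>i. LINT u|Q. \<phi> u (X i) * \<Theta> u) \<longlonglongrightarrow> (LINT z|Q. iexp (- (A z / q)) * \<Theta> z)"
    proof (rule integral_dominated_convergence[where w = "\<lambda>u. norm (\<Theta> u)"])
      show "AE u in Q. (\<lambda>i. \<phi> u (X i) * \<Theta> u) \<longlonglongrightarrow> iexp (- (A u / q)) * \<Theta> u"
      proof (intro AE_I2 tendsto_mult tendsto_const)
        fix u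
        have "(\<lambda>i. \<phi> u (X i)) \<longlonglongrightarrow> exp (- (complex_of_real (A u) / (- \<i> * of_real q)))"
          unfolding \<phi>_def using q by (intro tendsto_intros X(2)) auto
        also have "- (complex_of_real (A u) / (- \<i> * of_real q)) = \<i> * of_real (- (A u / q))"
          using q by (simp add: field_simps)
        finally show "(\<lambda>i. \<phi> u (X i)) \<longlonglongrightarrow> iexp (- (A u / q))" .
      qed
      show "AE u in Q. norm (\<phi> u (X i) * \<Theta> u) \<le> norm (\<Theta> u)" for i
        unfolding norm_mult using \<phi>b X(1) by (intro AE_I2 mult_left_le_one_le) auto
    qed (use \<Theta> in auto)
    then show "(K \<circ> X) \<longlonglongrightarrow> (LINT z|Q. iexp (- (A z / q)) * \<Theta> z)" by (simp add: K_def o_def)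
  qed
  ultimately show ?thesis using J(1) unfolding analytic_limit_def by blast
qed

lemma product_integral:
  fixes f :: "'a \<Rightarrow> complex" and g :: "'b \<Rightarrow> complex"
  assumes "finite_measure P" "finite_measure Q" and f: "integrable P f" and g: "integrable Q g"
  shows "integrable (P \<Otimes>\<^sub>M Q) (\<lambda>z. f (fst z) * g (snd z))"
    and "(LINT z|(P \<Otimes>\<^sub>M Q). f (fst z) * g (snd z)) = (LINT u|P. f u) * (LINT v|Q. g v)"
proof -
  interpret P: finite_measure P by fact
  interpret Q: finite_measure Q by fact
  interpret pair_sigma_finite P Q ..
  have [measurable]: "f \<in> borel_measurable P" "g \<in> borel_measurable Q" using f g by auto
  show i: "integrable (P \<Otimes>\<^sub>M Q) (\<lambda>z. f (fst z) * g (snd z))"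
    using f g by (intro Fubini_integrable) (auto simp: norm_mult)
  show "(LINT z|(P \<Otimes>\<^sub>M Q). f (fst z) * g (snd z)) = (LINT u|P. f u) * (LINT v|Q. g v)"
    using integral_fst'[OF i] by simp
qed

text \<open>Multiplying by \<open>exp w\<close> would undo the weight but is unbounded. It is cut
  off to the set where \<open>w u \<le> real k\<close>, and \<open>k\<close> tends to
  infinity.\<close>

lemma zero_density_if_weighted_zero:
  fixes \<theta> :: "'a \<Rightarrow> complex" and w :: "'a \<Rightarrow> real"
  assumes \<theta>: "integrable M \<theta>" and w[measurable]: "w \<in> borel_measurable M"
    and zero: "\<And>A. A \<in> sets M \<Longrightarrow> (LINT u|M. indicator A u * (of_real (exp (- w u)) * \<theta> u)) = 0"
    and w0: "\<And>u. u \<in> space M \<Longrightarrow> 0 \<le> w u" and A[measurable]: "A \<in> sets M"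
  shows "(LINT u|M. indicator A u * \<theta> u) = 0"
proof -
  have [measurable]: "\<theta> \<in> borel_measurable M" using \<theta> by auto
  have \<theta>': "integrable M (\<lambda>u. of_real (exp (- w u)) * \<theta> u)"
    by (rule Bochner_Integration.integrable_bound[OF \<theta>])
       (use w0 in \<open>auto simp: norm_mult intro!: AE_I2 mult_left_le_one_le\<close>)
  have id: "(\<lambda>u. u) \<in> M \<rightarrow>\<^sub>M M" by simp
  have l0: "bc_lin M (\<lambda>_. 0)" unfolding bc_lin_def by auto
  define \<psi> where "\<psi> k u = indicator A u * complex_of_real (if w u \<le> real k then exp (w u) else 0)" for k u
  have \<psi>b: "bmeas M (\<psi> k)" for k
    unfolding bmeas_def \<psi>_def
    by (intro conjI exI[of _ "exp (real k)"]) (auto simp: norm_mult indicator_def)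
  have z: "(LINT u|M. \<psi> k u * (of_real (exp (- w u)) * \<theta> u)) = 0" for k
    using bc_lin_eqI[OF bc_lin_integral[OF id \<theta>'] l0 _ \<psi>b[of k]] zero by simp
  have "(\<lambda>k. LINT u|M. \<psi> k u * (of_real (exp (- w u)) * \<theta> u)) \<longlonglongrightarrow> (LINT u|M. indicator A u * \<theta> u)"
  proof (rule integral_dominated_convergence[where w = "\<lambda>u. norm (\<theta> u)"])
    have \<psi>': "\<psi> k u * (of_real (exp (- w u)) * \<theta> u) = (if w u \<le> real k then indicator A u * \<theta> u else 0)" for k u
      by (simp add: \<psi>_def exp_minus)
    show "(\<lambda>u. \<psi> k u * (of_real (exp (- w u)) * \<theta> u)) \<in> borel_measurable M" for k unfolding \<psi>' by measurable
    show "AE u in M. (\<lambda>k. \<psi> k u * (of_real (exp (- w u)) * \<theta> u)) \<longlonglongrightarrow> indicator A u * \<theta> u"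
    proof (rule AE_I2)
      fix u
      obtain K :: nat where "w u \<le> real K" using real_arch_simple by blast
      then have "eventually (\<lambda>k. \<psi> k u * (of_real (exp (- w u)) * \<theta> u) = indicator A u * \<theta> u) sequentially"
        unfolding \<psi>' eventually_sequentially by (intro exI[of _ K]) auto
      then show "(\<lambda>k. \<psi> k u * (of_real (exp (- w u)) * \<theta> u)) \<longlonglongrightarrow> indicator A u * \<theta> u" by (rule tendsto_eventually)
    qed
    show "AE u in M. norm (\<psi> k u * (of_real (exp (- w u)) * \<theta> u)) \<le> norm (\<theta> u)" for k
      unfolding \<psi>' by (intro AE_I2) (auto simp: indicator_def)
  qed (use \<theta> in auto)
  then show ?thesis unfolding z by (simp add: LIMSEQ_const_iff)
qed

text \<open>The property through which the functions of \<open>Supp_BV\<close> act as multipliers.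
  Its closure under scaling covers \<open>s1 / sqrt 2\<close> and \<open>sqrt 2 * h\<close>.\<close>

definition bdd_meas :: "real \<Rightarrow> real \<Rightarrow> (real \<times> real \<Rightarrow> real) \<Rightarrow> bool" where
  "bdd_meas S T h \<longleftrightarrow> h \<in> borel_measurable (leb S T) \<and> (\<exists>C. \<forall>p\<in>rect S T. \<bar>h p\<bar> \<le> C)"

lemma bdd_meas_cmult: "bdd_meas S T h \<Longrightarrow> bdd_meas S T (\<lambda>p. c * h p)"
proof -
  assume "bdd_meas S T h"
  then obtain C where m: "h \<in> borel_measurable (leb S T)" and C: "\<And>p. p \<in> rect S T \<Longrightarrow> \<bar>h p\<bar> \<le> C"
    unfolding bdd_meas_def by blast
  have "\<bar>c * h p\<bar> \<le> \<bar>c\<bar> * C" if "p \<in> rect S T" for p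
    unfolding abs_mult using C[OF that] by (rule mult_left_mono) simp
  then show ?thesis using m unfolding bdd_meas_def by (intro conjI exI[of _ "\<bar>c\<bar> * C"]) auto
qed

section \<open>Scale-invariant null sets and Gaussian expectations\<close>

context yeh_wiener_law
begin

lemma Supp_BV_bdd_meas: assumes "h \<in> Supp_BV S T" shows "bdd_meas S T h"
proof -
  obtain B where "bvB S T h B"
    using bv_HK_bvB[of S T h] assms S T by (auto simp: Supp_BV_def)
  then show ?thesis
    using bvB_measurable[OF _ S T] bvB_bound unfolding bdd_meas_def by blast
qed

abbreviation m :: "(real \<times> real \<Rightarrow> real) measure" where "m \<equiv> completion W"

abbreviation L2 :: "(real \<times> real \<Rightarrow> real) measure" where "L2 \<equiv> L2_borel S T"

lemma C0_scale: "x \<in> space W \<Longrightarrow> (\<lambda>p. c * x p) \<in> space W"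
  unfolding space_W C0_def by (auto intro!: continuous_intros)

text \<open>If \<open>P\<close> held at a multiple of \<open>x\<close>, scaling back would give
  \<open>P x\<close>. The exceptional set is thus mapped into itself by every positive factor, and
  completeness makes all its multiples null.\<close>

lemma sae_AE:
  assumes ae: "AE x in W. P x" and scale: "\<And>x \<rho>. x \<in> space W \<Longrightarrow> \<rho> > 0 \<Longrightarrow> P x \<Longrightarrow> P (\<lambda>p. \<rho> * x p)"
  shows "sae m P"
  unfolding sae_def
proof (intro exI[of _ "{x \<in> space m. \<not> P x}"] conjI)
  have N: "{x \<in> space m. \<not> P x} \<in> null_sets m"
    using AE_completion[OF ae] by (simp add: completion.AE_iff_null_sets)
  show "scale_null m {x \<in> space m. \<not> P x}"
    unfolding scale_null_def
  proof (intro allI impI)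
    fix \<rho> :: real assume \<rho>: "\<rho> > 0"
    have "(\<lambda>x p. \<rho> * x p) ` {x \<in> space m. \<not> P x} \<subseteq> {x \<in> space m. \<not> P x}"
    proof safe
      fix x assume x: "x \<in> space m" "\<not> P x"
      then show "(\<lambda>p. \<rho> * x p) \<in> space m" using C0_scale by simp
      assume "P (\<lambda>p. \<rho> * x p)"
      then have "P (\<lambda>p. 1 / \<rho> * (\<rho> * x p))"
        using scale[of "\<lambda>p. \<rho> * x p" "1 / \<rho>"] C0_scale x \<rho> by simp
      moreover have "(\<lambda>p. 1 / \<rho> * (\<rho> * x p)) = x" using \<rho> by auto
      ultimately show False using x by simp
    qed
    then show "(\<lambda>x p. \<rho> * x p) ` {x \<in> space m. \<not> P x} \<in> null_sets m"
      by (rule completion.complete2[OF _ N])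
  qed
qed auto

lemma sae_all: "(\<And>x. x \<in> space W \<Longrightarrow> P x) \<Longrightarrow> sae m P"
  unfolding sae_def scale_null_def by (intro exI[of _ "{}"]) auto

lemma sae_mono: "sae m P \<Longrightarrow> (\<And>x. x \<in> space W \<Longrightarrow> P x \<Longrightarrow> Q x) \<Longrightarrow> sae m Q"
  unfolding sae_def by auto

lemma sae_conj: assumes "sae m P" "sae m Q" shows "sae m (\<lambda>x. P x \<and> Q x)"
proof -
  obtain N where N: "scale_null m N" "\<forall>x\<in>space m - N. P x" using assms(1) unfolding sae_def by blast
  obtain N' where N': "scale_null m N'" "\<forall>x\<in>space m - N'. Q x" using assms(2) unfolding sae_def by blast
  have "scale_null m (N \<union> N')"
    using N(1) N'(1) unfolding scale_null_def image_Un by blast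
  then show ?thesis using N(2) N'(2) unfolding sae_def by (intro exI[of _ "N \<union> N'"]) auto
qed

lemma sae_rescale:
  assumes "sae m P" "c > 0" shows "sae m (\<lambda>x. P (\<lambda>p. x p / c))"
proof -
  obtain N where N: "scale_null m N" "\<forall>x\<in>space m - N. P x" using assms(1) unfolding sae_def by blast
  define N' where "N' = (\<lambda>x p. c * x p) ` N"
  have "scale_null m N'"
    unfolding scale_null_def
  proof (intro allI impI)
    fix \<rho> :: real assume "\<rho> > 0"
    then have "(\<lambda>x p. (\<rho> * c) * x p) ` N \<in> null_sets m" using N(1) assms(2) unfolding scale_null_def by simp
    then show "(\<lambda>x p. \<rho> * x p) ` N' \<in> null_sets m" unfolding N'_def image_image by (simp add: mult.assoc)
  qed
  moreover have "P (\<lambda>p. x p / c)" if x: "x \<in> space m - N'" for x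
  proof -
    have "(\<lambda>p. x p / c) \<notin> N"
    proof
      assume "(\<lambda>p. x p / c) \<in> N"
      then have "(\<lambda>p. c * (x p / c)) \<in> N'" unfolding N'_def by (rule rev_image_eqI) simp
      then show False using x assms(2) by simp
    qed
    moreover have "(\<lambda>p. x p / c) \<in> space m" using C0_scale[of x "1 / c"] x by simp
    ultimately show ?thesis using N(2) by blast
  qed
  ultimately show ?thesis unfolding sae_def by blast
qed

lemma sae_imp_AE: assumes "sae m P" shows "AE x in W. P x"
proof -
  obtain N where N: "scale_null m N" "\<forall>x\<in>space m - N. P x" using assms unfolding sae_def by blast
  have "(\<lambda>x p. 1 * x p) ` N \<in> null_sets m" using N(1) unfolding scale_null_def by (metis zero_less_one)
  then have "N \<in> null_sets m" by simp
  then have "AE x in m. x \<notin> N" by (rule AE_not_in)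
  then have "AE x in m. P x" using AE_space by eventually_elim (use N(2) in auto)
  then show ?thesis by (simp add: AE_completion_iff)
qed

lemma summable_cf_mult:
  assumes "sqi \<mu> u" "bdd_meas S T h"
  shows "sqi \<mu> (\<lambda>p. u p * h p)" "summable (\<lambda>j. (cf (\<lambda>p. u p * h p) j)\<^sup>2)"
proof -
  obtain C where m: "h \<in> borel_measurable \<mu>" and C: "\<And>p. p \<in> rect S T \<Longrightarrow> \<bar>h p\<bar> \<le> C"
    using assms(2) unfolding bdd_meas_def by blast
  have C': "\<And>p. p \<in> space \<mu> \<Longrightarrow> \<bar>h p\<bar> \<le> C" using C by simp
  show "sqi \<mu> (\<lambda>p. u p * h p)" by (rule sqi_mult_bounded(1)[OF assms(1) m C'])
  then show "summable (\<lambda>j. (cf (\<lambda>p. u p * h p) j)\<^sup>2)" by (rule summable_cf)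
qed

lemma measurable_cf_h: "bdd_meas S T h \<Longrightarrow> (\<lambda>u. cf (\<lambda>p. u p * h p) j) \<in> borel_measurable L2"
  unfolding bdd_meas_def using measurable_cf_mult by blast

text \<open>The two-term form serves the difference of two vectors in the uniqueness proof and the
  pair of \<open>u k1\<close> and \<open>v k2\<close> in the convolution product.\<close>

lemma plim_combine_char:
  assumes c: "summable (\<lambda>j. (c j)\<^sup>2)" and d: "summable (\<lambda>j. (d j)\<^sup>2)"
  shows "(LINT x|W. iexp (\<alpha> * plim c x + \<beta> * plim d x)) = of_real (exp (- ((\<Sum>j. (\<alpha> * c j + \<beta> * d j)\<^sup>2) / 2)))"
proof -
  have cd: "summable (\<lambda>j. (\<alpha> * c j + \<beta> * d j)\<^sup>2)"
  proof (rule summable_comparison_test')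
    show "summable (\<lambda>j. 2 * \<alpha>\<^sup>2 * (c j)\<^sup>2 + 2 * \<beta>\<^sup>2 * (d j)\<^sup>2)" using c d by (intro summable_add summable_mult)
    show "norm ((\<alpha> * c j + \<beta> * d j)\<^sup>2) \<le> 2 * \<alpha>\<^sup>2 * (c j)\<^sup>2 + 2 * \<beta>\<^sup>2 * (d j)\<^sup>2" for j
    proof -
      have "(\<alpha> * c j + \<beta> * d j)\<^sup>2 + (\<alpha> * c j - \<beta> * d j)\<^sup>2 = 2 * \<alpha>\<^sup>2 * (c j)\<^sup>2 + 2 * \<beta>\<^sup>2 * (d j)\<^sup>2"
        by (simp add: power2_sum power2_diff power_mult_distrib)
      then have "(\<alpha> * c j + \<beta> * d j)\<^sup>2 \<le> 2 * \<alpha>\<^sup>2 * (c j)\<^sup>2 + 2 * \<beta>\<^sup>2 * (d j)\<^sup>2"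
        using zero_le_power2[of "\<alpha> * c j - \<beta> * d j"] by linarith
      then show ?thesis by simp
    qed
  qed
  have mc: "plim e \<in> borel_measurable W" for e
    using plim_pair_measurable(1)[where c = "\<lambda>_. e" and f = "\<lambda>x. x" and K = W] by simp
  note [measurable] = mc
  have "(LINT x|W. iexp (\<alpha> * plim c x + \<beta> * plim d x)) = (LINT x|W. iexp (plim (\<lambda>j. \<alpha> * c j + \<beta> * d j) x))"
  proof (rule integral_cong_AE)
    show "AE x in W. iexp (\<alpha> * plim c x + \<beta> * plim d x) = iexp (plim (\<lambda>j. \<alpha> * c j + \<beta> * d j) x)"
      using AE_cvg[OF c] AE_cvg[OF d] by eventually_elim (simp only: plim_combine)
  qed measurable
  also have "\<dots> = of_real (exp (- ((\<Sum>j. (\<alpha> * c j + \<beta> * d j)\<^sup>2) / 2)))" by (rule plim_char[OF cd])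
  finally show ?thesis .
qed

text \<open>The integrand has modulus \<open>norm (\<Theta> z)\<close>, which is integrable on the
  product because \<open>W\<close> is a probability measure.\<close>

lemma fubini_expectation:
  assumes "finite_measure Q" and R[measurable]: "R \<in> borel_measurable (Q \<Otimes>\<^sub>M W)" and \<Theta>: "integrable Q \<Theta>"
  shows "integrable W (\<lambda>x. LINT z|Q. iexp (R (z, x)) * \<Theta> z)"
    and "(LINT x|W. LINT z|Q. iexp (R (z, x)) * \<Theta> z) = (LINT z|Q. (LINT x|W. iexp (R (z, x))) * \<Theta> z)"
proof -
  interpret Q: finite_measure Q by fact
  interpret QW: pair_sigma_finite Q W ..
  have [measurable]: "\<Theta> \<in> borel_measurable Q" using \<Theta> by auto
  have "integrable (Q \<Otimes>\<^sub>M W) (\<lambda>p. \<Theta> (fst p) * (1 :: complex))"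
    using product_integral(1)[OF assms(1) W.finite_measure_axioms \<Theta>, of "\<lambda>_. 1"] by simp
  then have i: "integrable (Q \<Otimes>\<^sub>M W) (\<lambda>(z, x). iexp (R (z, x)) * \<Theta> z)"
    by (rule Bochner_Integration.integrable_bound) (auto simp: norm_mult split: prod.split)
  show "integrable W (\<lambda>x. LINT z|Q. iexp (R (z, x)) * \<Theta> z)" by (rule QW.integrable_snd[OF i])
  show "(LINT x|W. LINT z|Q. iexp (R (z, x)) * \<Theta> z) = (LINT z|Q. (LINT x|W. iexp (R (z, x))) * \<Theta> z)"
    using QW.Fubini_integral[OF i] by simp
qed

lemma bmeas_wave:
  assumes "bdd_meas S T h" "x \<in> space W" "y \<in> space W"
  shows "bmeas L2 (\<lambda>u. exp (\<i> * of_real b * of_real (pwz S T \<phi> u y) + \<i> * of_real c * of_real (pwz S T \<phi> (\<lambda>p. u p * h p) x)))"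
proof -
  have [measurable]: "(\<lambda>u. cf (\<lambda>p. u p * h p) j) \<in> borel_measurable L2" for j by (rule measurable_cf_h[OF assms(1)])
  have "(\<lambda>u. plim (cf u) y) \<in> borel_measurable L2"
    by (rule plim_pair_measurable(1)) (use assms in auto)
  moreover have "(\<lambda>u. plim (cf (\<lambda>p. u p * h p)) x) \<in> borel_measurable L2"
    by (rule plim_pair_measurable(1)) (use assms in auto)
  ultimately show ?thesis
    unfolding bmeas_def pwz_plim[OF assms(2)] pwz_plim[OF assms(3)]
    by (intro conjI exI[of _ 1]) (auto simp flip: of_real_mult distrib_left of_real_add)
qed

lemma bdd_meas_one: "bdd_meas S T (\<lambda>_. 1)" by (auto simp: bdd_meas_def)

lemma bmeas_pwz: assumes "x \<in> space W" shows "bmeas L2 (\<lambda>u. iexp (pwz S T \<phi> u x))"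
  using bmeas_wave[OF bdd_meas_one assms assms, of 1 0] by simp

section \<open>Uniqueness of the representing measure\<close>

text \<open>
  Multiplying by \<open>exp (- i \<langle>v, x\<rangle>)\<close> and integrating over \<open>x\<close> turns the hypothesis into
  \<open>\<integral> exp (- \<parallel>u - v\<parallel>\<^sup>2 / 2) \<theta> d\<nu> = 0\<close>, the vanishing of a Laplace transform in \<open>v\<close>. Analytic continuation
  replaces it by a Fourier transform.
\<close>

lemma density_zero_if_transform_zero:
  assumes \<nu>: "finite_measure \<nu>" "sets \<nu> = sets L2" and \<theta>: "integrable \<nu> \<theta>"
    and ae: "AE x in W. (LINT u|\<nu>. iexp (plim (cf u) x) * \<theta> u) = 0" and A: "A \<in> sets L2"
  shows "(LINT u|\<nu>. indicator A u * \<theta> u) = 0"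
proof -
  interpret \<nu>: finite_measure \<nu> by fact
  note sets_\<nu> [measurable_cong] = \<nu>(2)
  have sp: "space \<nu> = L2_set S T" using sets_eq_imp_space_eq[OF \<nu>(2)] by simp
  have [measurable]: "(\<lambda>u. cf u j) \<in> borel_measurable \<nu>" for j
    using measurable_cf by (simp add: measurable_cong_sets[OF \<nu>(2) refl])
  have [measurable]: "\<theta> \<in> borel_measurable \<nu>" using \<theta> by auto
  have sq: "sqi \<mu> u" if "u \<in> space \<nu>" for u using that by (simp add: sp L2_set_iff)
  define w where "w u = ip \<mu> u u / 2" for u
  have [measurable]: "w \<in> borel_measurable \<nu>"
    unfolding w_def using measurable_ip_L2[of \<nu> "\<lambda>u. u"] sq by simp
  have w0: "0 \<le> w u" for u using ip_self_nonneg[of \<mu> u] by (simp add: w_def)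
  define \<theta>' where "\<theta>' u = of_real (exp (- w u)) * \<theta> u" for u
  have \<theta>': "integrable \<nu> \<theta>'"
    unfolding \<theta>'_def
    by (rule Bochner_Integration.integrable_bound[OF \<theta>])
       (use w0 in \<open>auto simp: norm_mult intro!: AE_I2 mult_left_le_one_le\<close>)
  have laplace: "(LINT u|\<nu>. of_real (exp (\<Sum>j\<in>J. a j * cf u j)) * \<theta>' u) = 0" if J: "finite J" for J a
  proof -
    \<comment> \<open>The coefficients of a finite combination \<open>v\<close> of basis functions;
      such \<open>v\<close> suffice.\<close>
    define d where "d j = (if j \<in> J then a j else 0)" for j
    have dsum: "(\<lambda>j. f j) sums (\<Sum>j\<in>J. f j)" if "\<And>j. j \<notin> J \<Longrightarrow> f j = 0" for f :: "nat \<Rightarrow> real"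
      by (rule sums_finite[OF J that])
    have ds: "summable (\<lambda>j. (d j)\<^sup>2)"
      using dsum[of "\<lambda>j. (d j)\<^sup>2"] by (auto simp: d_def intro: sums_summable)
    define R where "R z = (case z of (u, x) \<Rightarrow> 1 * plim (cf u) x + (-1) * plim d x)" for z
    have [measurable]: "(\<lambda>z. plim (cf (fst z)) (snd z)) \<in> borel_measurable (\<nu> \<Otimes>\<^sub>M W)"
      "(\<lambda>z. plim d (snd z)) \<in> borel_measurable (\<nu> \<Otimes>\<^sub>M W)"
      by (rule plim_pair_measurable(1); measurable)+
    have Rm: "R \<in> borel_measurable (\<nu> \<Otimes>\<^sub>M W)"
      unfolding R_def case_prod_beta by measurable
    have "0 = (LINT x|W. LINT u|\<nu>. iexp (R (u, x)) * \<theta> u)"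
    proof -
      have "AE x in W. (LINT u|\<nu>. iexp (R (u, x)) * \<theta> u) = 0"
        using ae
      proof eventually_elim
        case (elim x)
        have "iexp (R (u, x)) * \<theta> u = iexp (- plim d x) * (iexp (plim (cf u) x) * \<theta> u)" for u
        proof -
          have "iexp (R (u, x)) = iexp (- plim d x) * iexp (plim (cf u) x)"
            unfolding R_def exp_add[symmetric] by (simp add: algebra_simps)
          then show ?thesis by (simp only: mult.assoc)
        qed
        then have "(LINT u|\<nu>. iexp (R (u, x)) * \<theta> u) = (LINT u|\<nu>. iexp (- plim d x) * (iexp (plim (cf u) x) * \<theta> u))"
          by (simp only:)
        also have "\<dots> = iexp (- plim d x) * (LINT u|\<nu>. iexp (plim (cf u) x) * \<theta> u)"
          by (rule integral_mult_right_zero)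
        finally show ?case using elim by simp
      qed
      then have "(LINT x|W. LINT u|\<nu>. iexp (R (u, x)) * \<theta> u) = 0" by (rule integral_eq_zero_AE)
      then show ?thesis ..
    qed
    also have "\<dots> = (LINT u|\<nu>. (LINT x|W. iexp (R (u, x))) * \<theta> u)"
      by (rule fubini_expectation(2)[OF \<nu>(1) Rm \<theta>])
    also have "\<dots> = (LINT u|\<nu>. of_real (exp (- ((\<Sum>j\<in>J. (a j)\<^sup>2) / 2))) * (of_real (exp (\<Sum>j\<in>J. a j * cf u j)) * \<theta>' u))"
    proof (intro Bochner_Integration.integral_cong refl)
      fix u assume u: "u \<in> space \<nu>"
      have s1: "(\<lambda>j. (cf u j)\<^sup>2) sums ip \<mu> u u" by (rule parseval[OF sq[OF u]])
      have s2: "(\<lambda>j. d j * cf u j) sums (\<Sum>j\<in>J. a j * cf u j)"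
        using dsum[of "\<lambda>j. d j * cf u j"] by (auto simp: d_def cong: sum.cong)
      have s3: "(\<lambda>j. (d j)\<^sup>2) sums (\<Sum>j\<in>J. (a j)\<^sup>2)"
        using dsum[of "\<lambda>j. (d j)\<^sup>2"] by (auto simp: d_def cong: sum.cong)
      \<comment> \<open>Expands the squared distance from \<open>u\<close> to \<open>v\<close>, so
        that the Gaussian kernel splits into a constant, the Laplace kernel and the weight
        \<open>exp (- w u)\<close>.\<close>
      have "(\<lambda>j. (cf u j)\<^sup>2 - 2 * (d j * cf u j) + (d j)\<^sup>2) sums (ip \<mu> u u - 2 * (\<Sum>j\<in>J. a j * cf u j) + (\<Sum>j\<in>J. (a j)\<^sup>2))"
        by (intro sums_add sums_diff sums_mult s1 s2 s3)
      moreover have "(cf u j)\<^sup>2 - 2 * (d j * cf u j) + (d j)\<^sup>2 = (1 * cf u j + (-1) * d j)\<^sup>2" for j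
        by (simp add: power2_diff)
      ultimately have s: "(\<Sum>j. (1 * cf u j + (-1) * d j)\<^sup>2) = ip \<mu> u u - 2 * (\<Sum>j\<in>J. a j * cf u j) + (\<Sum>j\<in>J. (a j)\<^sup>2)"
        by (simp only: sums_iff)
      have "(LINT x|W. iexp (R (u, x))) = of_real (exp (- ((\<Sum>j. (1 * cf u j + (-1) * d j)\<^sup>2) / 2)))"
        unfolding R_def prod.case by (rule plim_combine_char[OF summable_cf[OF sq[OF u]] ds])
      also have "- ((\<Sum>j. (1 * cf u j + (-1) * d j)\<^sup>2) / 2) = - ((\<Sum>j\<in>J. (a j)\<^sup>2) / 2) + ((\<Sum>j\<in>J. a j * cf u j) + - w u)"
        unfolding s w_def by (simp add: field_simps)
      finally show "(LINT x|W. iexp (R (u, x))) * \<theta> u = of_real (exp (- ((\<Sum>j\<in>J. (a j)\<^sup>2) / 2))) * (of_real (exp (\<Sum>j\<in>J. a j * cf u j)) * \<theta>' u)"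
        unfolding \<theta>'_def exp_add of_real_mult by (simp only: mult.assoc)
    qed
    also have "\<dots> = of_real (exp (- ((\<Sum>j\<in>J. (a j)\<^sup>2) / 2))) * (LINT u|\<nu>. of_real (exp (\<Sum>j\<in>J. a j * cf u j)) * \<theta>' u)"
      by (rule integral_mult_right_zero)
    finally show ?thesis by simp
  qed
  have fourier: "(LINT u|\<nu>. \<theta>' u * iexp (\<Sum>j\<in>J. a j * cf u j)) = 0" if J: "finite J" for J a
  proof -
    define s where "s u = (\<Sum>j\<in>J. a j * cf u j)" for u
    have [measurable]: "s \<in> borel_measurable \<nu>" unfolding s_def by measurable
    define \<phi>' where "\<phi>' u z = exp (z * of_real (s u) - of_real (w u))" for u and z :: complex
    define K where "K z = (LINT u|\<nu>. \<phi>' u z * \<theta> u)" for z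
    \<comment> \<open>Young's inequality in each coordinate and Bessel's inequality: the Gaussian
      weight absorbs the exponential of \<open>2 * \<bar>s u\<bar>\<close>, which bounds the
      integrand on the disc of radius 2.\<close>
    have sb: "2 * \<bar>s u\<bar> \<le> w u + 2 * (\<Sum>j\<in>J. (a j)\<^sup>2)" if u: "u \<in> space \<nu>" for u
    proof -
      have "2 * \<bar>s u\<bar> \<le> (\<Sum>j\<in>J. 2 * \<bar>a j * cf u j\<bar>)"
        unfolding s_def sum_distrib_left[symmetric] by simp
      also have "\<dots> \<le> (\<Sum>j\<in>J. (cf u j)\<^sup>2 / 2 + 2 * (a j)\<^sup>2)"
      proof (rule sum_mono)
        fix j
        have "0 \<le> (\<bar>cf u j\<bar> - 2 * \<bar>a j\<bar>)\<^sup>2" by simp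
        also have "\<dots> = (cf u j)\<^sup>2 + 4 * (a j)\<^sup>2 - 4 * \<bar>a j * cf u j\<bar>"
          by (simp add: power2_diff abs_mult power_mult_distrib mult.commute[of "\<bar>a j\<bar>"])
        finally show "2 * \<bar>a j * cf u j\<bar> \<le> (cf u j)\<^sup>2 / 2 + 2 * (a j)\<^sup>2" by simp
      qed
      also have "\<dots> = (\<Sum>j\<in>J. (cf u j)\<^sup>2) / 2 + 2 * (\<Sum>j\<in>J. (a j)\<^sup>2)"
        by (simp add: sum.distrib sum_divide_distrib sum_distrib_left)
      also have "(\<Sum>j\<in>J. (cf u j)\<^sup>2) \<le> ip \<mu> u u"
        using sum_le_suminf[OF summable_cf[OF sq[OF u]] J] parseval[OF sq[OF u]] by (simp add: sums_iff)
      finally show ?thesis by (simp add: w_def)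
    qed
    have hol: "K holomorphic_on ball 0 2"
      unfolding K_def
    proof (rule holomorphic_integral[OF open_ball _ _ _ \<theta>, where C = "exp (2 * (\<Sum>j\<in>J. (a j)\<^sup>2))"])
      show "(\<lambda>u. \<phi>' u z) \<in> borel_measurable \<nu>" for z unfolding \<phi>'_def by measurable
      show "\<phi>' u holomorphic_on ball 0 2" for u unfolding \<phi>'_def by (intro holomorphic_intros)
      show "norm (\<phi>' u z) \<le> exp (2 * (\<Sum>j\<in>J. (a j)\<^sup>2))" if u: "u \<in> space \<nu>" and z: "z \<in> ball 0 2" for u z
      proof -
        have "Re z * s u \<le> \<bar>Re z\<bar> * \<bar>s u\<bar>" by (simp add: abs_mult[symmetric])
        also have "\<dots> \<le> 2 * \<bar>s u\<bar>"
          using z abs_Re_le_cmod[of z] by (intro mult_right_mono) auto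
        finally show ?thesis using sb[OF u] by (simp add: \<phi>'_def)
      qed
    qed
    have real0: "K (of_real t) = 0" for t
    proof -
      have "K (of_real t) = (LINT u|\<nu>. of_real (exp (\<Sum>j\<in>J. (t * a j) * cf u j)) * \<theta>' u)"
        unfolding K_def
      proof (intro Bochner_Integration.integral_cong refl)
        fix u
        have "\<phi>' u (of_real t) = of_real (exp (t * s u + - w u))"
          by (simp add: \<phi>'_def exp_of_real[symmetric])
        also have "\<dots> = of_real (exp (\<Sum>j\<in>J. (t * a j) * cf u j)) * of_real (exp (- w u))"
          unfolding exp_add of_real_mult by (simp add: s_def sum_distrib_left mult.assoc)
        finally show "\<phi>' u (of_real t) * \<theta> u = of_real (exp (\<Sum>j\<in>J. (t * a j) * cf u j)) * \<theta>' u"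
          unfolding \<theta>'_def by (simp only: mult.assoc)
      qed
      then show ?thesis using laplace[OF J] by simp
    qed
    \<comment> \<open>\<open>K\<close> vanishes on the real interval from -1 to 1, hence on the disc
      of radius 2. This disc contains \<open>\<i>\<close>, where the Laplace kernel has become the
      Fourier kernel.\<close>
    have "K \<i> = 0"
    proof (rule analytic_continuation[OF hol open_ball connected_ball, of "of_real ` {-1<..<1}" 0])
      show "0 islimpt complex_of_real ` {- 1<..<1}"
        unfolding islimpt_sequential
      proof (intro exI[of _ "\<lambda>n. of_real (1 / real (Suc (Suc n)))"] conjI allI)
        have "(\<lambda>n. complex_of_real (1 / real (Suc (Suc n)))) \<longlonglongrightarrow> of_real 0"
          using LIMSEQ_Suc[OF mesh_tendsto[of 0]] by (intro tendsto_intros) simp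
        then show "(\<lambda>n. complex_of_real (1 / real (Suc (Suc n)))) \<longlonglongrightarrow> 0" by simp
        show "complex_of_real (1 / real (Suc (Suc n))) \<in> complex_of_real ` {- 1<..<1} - {0}" for n
        proof -
          have "1 / real (Suc (Suc n)) \<in> {- 1<..<1}" "1 / real (Suc (Suc n)) \<noteq> 0"
            by (auto intro: less_trans[of _ 0])
          then show ?thesis by (metis DiffI imageI of_real_eq_0_iff singletonD)
        qed
      qed
      show "complex_of_real ` {- 1<..<1} \<subseteq> ball 0 2" by auto
    qed (use real0 in auto)
    then show ?thesis
      unfolding K_def \<phi>'_def \<theta>'_def exp_diff s_def
      by (simp add: exp_minus divide_inverse exp_of_real[symmetric] mult_ac)
  qed
  have z': "(LINT u|\<nu>. indicator B u * \<theta>' u) = 0" if B: "B \<in> sets L2" for B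
  proof (rule fourier_uniqueness[OF _ \<theta>' fourier])
    show "B \<in> sets (vimage_algebra (space \<nu>) (\<lambda>x j. cf x j) (Pi\<^sub>M UNIV (\<lambda>_. borel)))"
      using B unfolding sets_L2_borel sp by simp
  qed auto
  \<comment> \<open>So far the weighted density is zero; now the weight is removed.\<close>
  show ?thesis
    by (rule zero_density_if_weighted_zero[OF \<theta>, of w])
       (use z' w0 A sets_\<nu> in \<open>auto simp: \<theta>'_def\<close>)
qed

text \<open>The difference of two representing measures has vanishing PWZ transform for almost every
  path; its density is then zero on every Borel set.\<close>

theorem represents_unique:
  assumes f: "represents S T \<phi> m f F" and g: "represents S T \<phi> m g F" and A: "A \<in> sets L2"
  shows "f A = g A"
proof -
  have cf: "complex_measure L2 f" and cg: "complex_measure L2 g"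
    using f g by (auto simp: represents_def)
  have d: "complex_measure L2 (\<lambda>A. f A - g A)"
    using cf cg by (simp add: complex_measure_cadd cadd_diff)
  obtain \<nu> \<theta> where \<nu>: "finite_measure \<nu>" "sets \<nu> = sets L2" "integrable \<nu> \<theta>"
     and d1: "\<And>A. A \<in> sets L2 \<Longrightarrow> f A - g A = (LINT u|\<nu>. indicator A u * \<theta> u)"
     and d2: "\<And>\<psi>. bmeas L2 \<psi> \<Longrightarrow> cm_integral L2 (\<lambda>A. f A - g A) \<psi> = (LINT u|\<nu>. \<psi> u * \<theta> u)"
    using complex_measure_density[OF d] by blast
  have "AE x in W. F x = cm_integral L2 f (\<lambda>u. iexp (pwz S T \<phi> u x))"
    "AE x in W. F x = cm_integral L2 g (\<lambda>u. iexp (pwz S T \<phi> u x))"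
    using f g by (auto simp: represents_def intro!: sae_imp_AE)
  then have "AE x in W. (LINT u|\<nu>. iexp (plim (cf u) x) * \<theta> u) = 0"
    using AE_space
  proof eventually_elim
    case (elim x)
    then have "cm_integral L2 (\<lambda>A. f A - g A) (\<lambda>u. iexp (pwz S T \<phi> u x)) = 0"
      using cm_integral_diff[OF cf cg bmeas_pwz[OF elim(3)]] by simp
    then show ?case using d2[OF bmeas_pwz[OF elim(3)]] by (simp add: pwz_plim[OF elim(3)])
  qed
  from density_zero_if_transform_zero[OF \<nu> this A] show ?thesis using d1[OF A] by simp
qed

end

section \<open>Transform and convolution of represented functionals\<close>

text \<open>The bracketing is the one in which \<open>conv_rep\<close>, applied to two transforms,
  delivers its integrand.\<close>

lemma iexp_sum4:
  "iexp a * ((iexp c * (iexp b * s)) * (iexp e * (iexp d * t))) = iexp (a + b + c + d + e) * (s * t)"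
  by (simp add: distrib_left exp_add mult_ac)

lemma iexp_sum2: "iexp a * (iexp b * t) = iexp (a + b) * t"
  by (simp add: distrib_left exp_add mult_ac)

lemma powr_neg_half_sq: "l > 0 \<Longrightarrow> (l powr (- 1 / 2))\<^sup>2 = 1 / (l :: real)"
  by (simp add: power2_eq_square powr_add[symmetric] powr_minus_divide)

context yeh_wiener_law
begin

text \<open>\<open>F\<close> is the Fourier transform of the image under \<open>\<pi>\<close> of the complex measure \<open>\<Theta> Q\<close>.\<close>

definition rep :: "((real \<times> real \<Rightarrow> real) \<Rightarrow> complex) \<Rightarrow> 'q measure \<Rightarrow> ('q \<Rightarrow> real \<times> real \<Rightarrow> real) \<Rightarrow> ('q \<Rightarrow> complex) \<Rightarrow> bool" where
  "rep F Q \<pi> \<Theta> \<longleftrightarrow> finite_measure Q \<and> \<pi> \<in> Q \<rightarrow>\<^sub>M L2 \<and> integrable Q \<Theta> \<and>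
     sae m (\<lambda>x. F x = (LINT z|Q. iexp (pwz S T \<phi> (\<pi> z) x) * \<Theta> z))"

lemma rep_represents:
  assumes "rep F Q \<pi> \<Theta>"
  shows "represents S T \<phi> m (\<lambda>A. LINT z|Q. indicator A (\<pi> z) * \<Theta> z) F"
  unfolding represents_def
proof
  have r: "\<pi> \<in> Q \<rightarrow>\<^sub>M L2" "integrable Q \<Theta>"
    "sae m (\<lambda>x. F x = (LINT z|Q. iexp (pwz S T \<phi> (\<pi> z) x) * \<Theta> z))" using assms by (auto simp: rep_def)
  show c: "complex_measure L2 (\<lambda>A. LINT z|Q. indicator A (\<pi> z) * \<Theta> z)"
    by (rule complex_measure_pushforward[OF r(1,2)])
  show "sae m (\<lambda>x. F x = cm_integral L2 (\<lambda>A. LINT z|Q. indicator A (\<pi> z) * \<Theta> z) (\<lambda>u. iexp (pwz S T \<phi> u x)))"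
    using r(3)
  proof (rule sae_mono)
    fix x assume x: "x \<in> space W" "F x = (LINT z|Q. iexp (pwz S T \<phi> (\<pi> z) x) * \<Theta> z)"
    show "F x = cm_integral L2 (\<lambda>A. LINT z|Q. indicator A (\<pi> z) * \<Theta> z) (\<lambda>u. iexp (pwz S T \<phi> u x))"
      unfolding x(2) by (rule cm_integral_pushforward[OF r(1,2) c refl bmeas_pwz[OF x(1)], symmetric])
  qed
qed

lemma rep_S_class: "rep F Q \<pi> \<Theta> \<Longrightarrow> F \<in> S_class S T \<phi> m"
  unfolding S_class_def using rep_represents by blast

text \<open>Uniqueness enters here: whatever measure \<open>SOME\<close> selects, its integrals are
  those of the given description.\<close>

lemma rep_S_measure:
  assumes r: "rep F Q \<pi> \<Theta>" and \<psi>: "bmeas L2 \<psi>"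
  shows "cm_integral L2 (S_measure S T \<phi> m F) \<psi> = (LINT z|Q. \<psi> (\<pi> z) * \<Theta> z)"
proof -
  let ?f = "\<lambda>A. LINT z|Q. indicator A (\<pi> z) * \<Theta> z"
  have f: "represents S T \<phi> m ?f F" by (rule rep_represents[OF r])
  then have s: "represents S T \<phi> m (S_measure S T \<phi> m F) F"
    unfolding S_measure_def by (rule someI[of "\<lambda>f. represents S T \<phi> m f F"])
  have "cm_integral L2 (S_measure S T \<phi> m F) \<psi> = cm_integral L2 ?f \<psi>"
    using represents_unique[OF s f] by (rule cm_integral_cong)
  also have "\<dots> = (LINT z|Q. \<psi> (\<pi> z) * \<Theta> z)"
    using r f \<psi> by (intro cm_integral_pushforward) (auto simp: rep_def represents_def)
  finally show ?thesis .
qed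

lemma represents_rep:
  assumes f: "represents S T \<phi> m f F"
  obtains \<nu> \<theta> where "rep F \<nu> (\<lambda>u. u) \<theta>"
proof -
  have c: "complex_measure L2 f" using f by (simp add: represents_def)
  obtain \<nu> \<theta> where *: "finite_measure \<nu>" "sets \<nu> = sets L2" "integrable \<nu> \<theta>"
     "\<And>\<psi>. bmeas L2 \<psi> \<Longrightarrow> cm_integral L2 f \<psi> = (LINT u|\<nu>. \<psi> u * \<theta> u)"
    using complex_measure_density[OF c] by blast
  have "sae m (\<lambda>x. F x = (LINT u|\<nu>. iexp (pwz S T \<phi> u x) * \<theta> u))"
  proof (rule sae_mono)
    show "sae m (\<lambda>x. F x = cm_integral L2 f (\<lambda>u. iexp (pwz S T \<phi> u x)))"
      using f by (simp add: represents_def)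
  qed (simp only: *(4)[OF bmeas_pwz])
  then have "rep F \<nu> (\<lambda>u. u) \<theta>"
    unfolding rep_def by (intro conjI measurable_ident_sets *(1,2,3))
  then show ?thesis by (rule that)
qed

lemma rep_sqi: "rep F Q \<pi> \<Theta> \<Longrightarrow> z \<in> space Q \<Longrightarrow> sqi \<mu> (\<pi> z)"
  unfolding rep_def using measurable_space[of \<pi> Q L2 z] by (auto simp: L2_set_iff)

lemma rep_measurable_cf: "rep F Q \<pi> \<Theta> \<Longrightarrow> bdd_meas S T h \<Longrightarrow> (\<lambda>z. cf (\<lambda>p. \<pi> z p * h p) j) \<in> borel_measurable Q"
  unfolding rep_def using measurable_compose[OF _ measurable_cf_h] by blast

lemma eval_path_rep:
  assumes r: "rep F Q \<pi> \<Theta>" and h: "bdd_meas S T h" and x: "x \<in> space W" "y \<in> space W"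
  shows "eval_path S T \<phi> m F b y c h x
    = (LINT z|Q. iexp (c * plim (cf (\<lambda>p. \<pi> z p * h p)) x) * (iexp (b * plim (cf (\<pi> z)) y) * \<Theta> z))"
proof -
  have "eval_path S T \<phi> m F b y c h x = (LINT z|Q. exp (\<i> * of_real b * of_real (pwz S T \<phi> (\<pi> z) y)
      + \<i> * of_real c * of_real (pwz S T \<phi> (\<lambda>p. \<pi> z p * h p) x)) * \<Theta> z)"
    unfolding eval_path_def by (rule rep_S_measure[OF r bmeas_wave[OF h x]])
  also have "\<dots> = (LINT z|Q. iexp (c * plim (cf (\<lambda>p. \<pi> z p * h p)) x) * (iexp (b * plim (cf (\<pi> z)) y) * \<Theta> z))"
    by (intro Bochner_Integration.integral_cong refl)
       (simp add: pwz_plim[OF x(1)] pwz_plim[OF x(2)] exp_add mult_ac)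
  finally show ?thesis .
qed

lemma integrable_wave:
  assumes r: "rep F Q \<pi> \<Theta>" and h: "bdd_meas S T h" and x: "x \<in> space W"
  shows "integrable Q \<theta> \<Longrightarrow> integrable Q (\<lambda>z. iexp (c * plim (cf (\<lambda>p. \<pi> z p * h p)) x) * \<theta> z)"
proof -
  assume \<theta>: "integrable Q \<theta>"
  have "(\<lambda>z. plim (cf (\<lambda>p. \<pi> z p * h p)) x) \<in> borel_measurable Q"
    by (rule plim_pair_measurable(1)) (use rep_measurable_cf[OF r h] x in auto)
  then have "(\<lambda>z. c * plim (cf (\<lambda>p. \<pi> z p * h p)) x) \<in> borel_measurable Q" by measurable
  from integrable_iexp_mult[OF \<theta> this] show ?thesis by (simp only: mult.commute)
qed

text \<open>Moves the Gaussian expectation inside the integral over \<open>Q\<close> and passes from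
  \<open>W\<close> to its completion, on which \<open>analytic_limit\<close> is stated.\<close>

lemma path_integral:
  assumes "finite_measure Q" and R: "R \<in> borel_measurable (Q \<Otimes>\<^sub>M W)" and \<Theta>: "integrable Q \<Theta>"
    and J: "\<And>x. x \<in> space W \<Longrightarrow> J x = (LINT z|Q. iexp (R (z, x)) * \<Theta> z)"
    and E: "\<And>z. z \<in> space Q \<Longrightarrow> (LINT x|W. iexp (R (z, x))) = of_real (E z)"
  shows "integrable m J" "(LINT x|m. J x) = (LINT z|Q. of_real (E z) * \<Theta> z)"
proof -
  let ?J = "\<lambda>x. LINT z|Q. iexp (R (z, x)) * \<Theta> z"
  have i: "integrable W ?J" by (rule fubini_expectation(1)[OF assms(1) R \<Theta>])
  then have jm: "?J \<in> borel_measurable W" by auto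
  have "integrable m ?J" using i jm by (simp add: integrable_completion)
  then show "integrable m J"
    by (rule Bochner_Integration.integrable_cong[THEN iffD1, rotated -1]) (use J in auto)
  have "(LINT x|m. J x) = (LINT x|m. ?J x)"
    by (intro Bochner_Integration.integral_cong refl) (use J in auto)
  also have "\<dots> = (LINT x|W. ?J x)" using jm by (rule integral_completion)
  also have "\<dots> = (LINT z|Q. (LINT x|W. iexp (R (z, x))) * \<Theta> z)"
    by (rule fubini_expectation(2)[OF assms(1) R \<Theta>])
  also have "\<dots> = (LINT z|Q. of_real (E z) * \<Theta> z)"
    by (intro Bochner_Integration.integral_cong refl) (simp add: E)
  finally show "(LINT x|m. J x) = (LINT z|Q. of_real (E z) * \<Theta> z)" .
qed

definition qf :: "(real \<times> real \<Rightarrow> real) \<Rightarrow> real" where "qf u = ip \<mu> u u"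

lemma qf_nonneg: "0 \<le> qf u" by (simp add: qf_def ip_self_nonneg)

lemma rep_measurable_qf:
  assumes r: "rep F Q \<pi> \<Theta>" and h: "bdd_meas S T h"
  shows "(\<lambda>z. qf (\<lambda>p. \<pi> z p * h p)) \<in> borel_measurable Q"
  unfolding qf_def
  by (rule measurable_ip_L2[OF summable_cf_mult(1)[OF rep_sqi[OF r] h] rep_measurable_cf[OF r h]])

text \<open>For \<open>l > 0\<close> the phase is centered normal with variance
  \<open>qf (\<lambda>p. \<pi> z p * h p) / l\<close>, so its expectation has the form required by
  \<open>analytic_limit_gauss\<close>.\<close>

theorem transform_rep:
  assumes r: "rep F Q \<pi> \<Theta>" and h: "bdd_meas S T h" and q: "q \<noteq> 0" and y: "y \<in> space W"
  shows "has_transform S T \<phi> m q h F y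
     (LINT z|Q. iexp (- (qf (\<lambda>p. \<pi> z p * h p) / 2 / q)) * (iexp (1 * plim (cf (\<pi> z)) y) * \<Theta> z))"
  unfolding has_transform_def
proof
  show "F \<in> S_class S T \<phi> m" by (rule rep_S_class[OF r])
  have Q: "finite_measure Q" "integrable Q \<Theta>" using r by (auto simp: rep_def)
  define \<Theta>' where "\<Theta>' z = iexp (1 * plim (cf (\<pi> z)) y) * \<Theta> z" for z
  have \<Theta>': "integrable Q \<Theta>'"
    unfolding \<Theta>'_def using integrable_wave[OF r bdd_meas_one y Q(2), of 1] by simp
  note [measurable] = rep_measurable_cf[OF r h]
  show "analytic_limit m (\<lambda>l x. eval_path S T \<phi> m F 1 y (l powr (-1/2)) h x) q
     (LINT z|Q. iexp (- (qf (\<lambda>p. \<pi> z p * h p) / 2 / q)) * (iexp (1 * plim (cf (\<pi> z)) y) * \<Theta> z))"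
    unfolding \<Theta>'_def[symmetric]
  proof (rule analytic_limit_gauss[OF \<Theta>' _ _ _ _ q])
    show "(\<lambda>z. qf (\<lambda>p. \<pi> z p * h p) / 2) \<in> borel_measurable Q"
      using rep_measurable_qf[OF r h] by measurable
    show "0 \<le> qf (\<lambda>p. \<pi> z p * h p) / 2" for z using qf_nonneg by simp
    fix l :: real assume l: "l > 0"
    define c where "c = l powr (- 1 / 2)"
    \<comment> \<open>The summand with coefficient 0 brings the phase into the two-term form of
      \<open>plim_combine_char\<close>.\<close>
    define R where "R zx = c * plim (cf (\<lambda>p. \<pi> (fst zx) p * h p)) (snd zx) + 0 * plim (cf (\<lambda>p. \<pi> (fst zx) p * h p)) (snd zx)" for zx
    have [measurable]: "(\<lambda>zx. plim (cf (\<lambda>p. \<pi> (fst zx) p * h p)) (snd zx)) \<in> borel_measurable (Q \<Otimes>\<^sub>M W)"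
      by (rule plim_pair_measurable(1)) measurable
    have Rm: "R \<in> borel_measurable (Q \<Otimes>\<^sub>M W)" unfolding R_def by measurable
    have J: "eval_path S T \<phi> m F 1 y (l powr (-1/2)) h x = (LINT z|Q. iexp (R (z, x)) * \<Theta>' z)" if "x \<in> space W" for x
      unfolding eval_path_rep[OF r h that y] R_def \<Theta>'_def c_def by simp
    have E: "(LINT x|W. iexp (R (z, x))) = of_real (exp (- (qf (\<lambda>p. \<pi> z p * h p) / 2 / l)))" if z: "z \<in> space Q" for z
    proof -
      note s = summable_cf_mult[OF rep_sqi[OF r z] h]
      have "(\<lambda>j. c\<^sup>2 * (cf (\<lambda>p. \<pi> z p * h p) j)\<^sup>2) sums (c\<^sup>2 * qf (\<lambda>p. \<pi> z p * h p))"
        unfolding qf_def by (intro sums_mult parseval s)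
      then have "(\<Sum>j. (c * cf (\<lambda>p. \<pi> z p * h p) j + 0 * cf (\<lambda>p. \<pi> z p * h p) j)\<^sup>2) = c\<^sup>2 * qf (\<lambda>p. \<pi> z p * h p)"
        by (simp add: power_mult_distrib sums_iff)
      moreover have "c\<^sup>2 = 1 / l" unfolding c_def using l by (rule powr_neg_half_sq)
      ultimately show ?thesis
        unfolding R_def fst_conv snd_conv plim_combine_char[OF s(2) s(2)] by (simp add: mult.commute)
    qed
    show "integrable m (\<lambda>x. eval_path S T \<phi> m F 1 y (l powr (-1/2)) h x)"
      by (rule path_integral(1)[OF Q(1) Rm \<Theta>' J E])
    show "(LINT x|m. eval_path S T \<phi> m F 1 y (l powr (-1/2)) h x)
       = (LINT z|Q. of_real (exp (- (qf (\<lambda>p. \<pi> z p * h p) / 2 / l))) * \<Theta>' z)"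
      by (rule path_integral(2)[OF Q(1) Rm \<Theta>' J E])
  qed
qed

lemma has_transform_unique: "has_transform S T \<phi> m q h F y L \<Longrightarrow> transform S T \<phi> m q h F y = L"
  unfolding transform_def has_transform_def by (rule the_equality) (auto intro: analytic_limit_unique)

lemma has_conv_product_unique: "has_conv_product S T \<phi> m q k1 k2 F G y L \<Longrightarrow> conv_product S T \<phi> m q k1 k2 F G y = L"
  unfolding conv_product_def has_conv_product_def by (rule the_equality) (auto intro: analytic_limit_unique)

text \<open>The transform keeps \<open>Q\<close> and \<open>\<pi>\<close> and multiplies the density
  by a factor of modulus 1. It is therefore again in the class, and \<open>conv_rep\<close> can be
  applied to it.\<close>

lemma rep_transform:
  assumes r: "rep F Q \<pi> \<Theta>" and h: "bdd_meas S T h" and q: "q \<noteq> 0"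
  shows "rep (transform S T \<phi> m q h F) Q \<pi> (\<lambda>z. iexp (- (qf (\<lambda>p. \<pi> z p * h p) / 2 / q)) * \<Theta> z)"
  unfolding rep_def
proof (intro conjI)
  have "(\<lambda>z. - (qf (\<lambda>p. \<pi> z p * h p) / 2 / q)) \<in> borel_measurable Q"
    using rep_measurable_qf[OF r h] by measurable
  moreover have "integrable Q \<Theta>" using r by (simp add: rep_def)
  ultimately have "integrable Q (\<lambda>z. \<Theta> z * iexp (- (qf (\<lambda>p. \<pi> z p * h p) / 2 / q)))"
    by (intro integrable_iexp_mult)
  then show "integrable Q (\<lambda>z. iexp (- (qf (\<lambda>p. \<pi> z p * h p) / 2 / q)) * \<Theta> z)"
    by (simp only: mult.commute[of "\<Theta> _"])
  show "sae m (\<lambda>y. transform S T \<phi> m q h F y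
     = (LINT z|Q. iexp (pwz S T \<phi> (\<pi> z) y) * (iexp (- (qf (\<lambda>p. \<pi> z p * h p) / 2 / q)) * \<Theta> z)))"
  proof (rule sae_all)
    fix y assume y: "y \<in> space W"
    show "transform S T \<phi> m q h F y
     = (LINT z|Q. iexp (pwz S T \<phi> (\<pi> z) y) * (iexp (- (qf (\<lambda>p. \<pi> z p * h p) / 2 / q)) * \<Theta> z))"
      unfolding has_transform_unique[OF transform_rep[OF r h q y]] pwz_plim[OF y]
      by (intro Bochner_Integration.integral_cong refl) (simp only: mult_1_left mult.left_commute)
  qed
qed (use r in \<open>auto simp: rep_def\<close>)

text \<open>For every \<open>z\<close> the series converges for almost every path. Joint
  measurability allows the exchange of the two quantifiers, and scaling gives the s-a.e.
  form.\<close>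

lemma sae_cvg:
  assumes "finite_measure Q" and \<pi>: "\<pi> \<in> Q \<rightarrow>\<^sub>M L2"
  shows "sae m (\<lambda>x. AE z in Q. cvg (cf (\<pi> z)) x)"
proof (rule sae_AE)
  interpret Q: finite_measure Q by fact
  interpret QW: pair_sigma_finite Q W ..
  have [measurable]: "(\<lambda>z. cf (\<pi> z) j) \<in> borel_measurable Q" for j
    by (rule measurable_compose[OF \<pi> measurable_cf])
  have "Measurable.pred (Q \<Otimes>\<^sub>M W) (\<lambda>p. cvg (cf (\<pi> (fst p))) (snd p))"
    by (rule plim_pair_measurable(2)) measurable
  then have "{p \<in> space (Q \<Otimes>\<^sub>M W). cvg (cf (\<pi> (fst p))) (snd p)} \<in> sets (Q \<Otimes>\<^sub>M W)" by (simp add: pred_def)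
  moreover have "AE z in Q. AE x in W. cvg (cf (\<pi> z)) x"
    using measurable_space[OF \<pi>] by (intro AE_I2 AE_cvg summable_cf) (auto simp: L2_set_iff)
  ultimately show "AE x in W. AE z in Q. cvg (cf (\<pi> z)) x" by (subst QW.AE_commute[symmetric])
next
  fix x and \<rho> :: real assume x: "x \<in> space W" "AE z in Q. cvg (cf (\<pi> z)) x"
  show "AE z in Q. cvg (cf (\<pi> z)) (\<lambda>p. \<rho> * x p)"
    using x(2) by eventually_elim (rule cvg_scale(1)[OF x(1)])
qed

text \<open>Two PWZ integrals along the path divided by \<open>sqrt 2\<close> add up to that of this
  function along the path itself; this describes \<open>scaled_product\<close>.\<close>

definition avg :: "('a \<Rightarrow> real \<times> real \<Rightarrow> real) \<Rightarrow> ('b \<Rightarrow> real \<times> real \<Rightarrow> real) \<Rightarrow> 'a \<times> 'b \<Rightarrow> real \<times> real \<Rightarrow> real" where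
  "avg \<pi> \<pi>' z p = 1 / sqrt 2 * \<pi> (fst z) p + 1 / sqrt 2 * \<pi>' (snd z) p"

lemma cf_avg:
  assumes "sqi \<mu> (\<pi> (fst z))" "sqi \<mu> (\<pi>' (snd z))"
  shows "cf (avg \<pi> \<pi>' z) = (\<lambda>j. 1 / sqrt 2 * cf (\<pi> (fst z)) j + 1 / sqrt 2 * cf (\<pi>' (snd z)) j)" "sqi \<mu> (avg \<pi> \<pi>' z)"
  using assms unfolding avg_def[abs_def]
  by (auto simp: cf_add cf_cmult sqi_cmult simp del: times_divide_eq_left mult_1_left)

lemma AE_pair_fst_snd:
  assumes "finite_measure Q" "finite_measure Q'"
    and P: "AE u in Q. P u" "Measurable.pred Q P" and P': "AE v in Q'. P' v" "Measurable.pred Q' P'"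
  shows "AE z in Q \<Otimes>\<^sub>M Q'. P (fst z) \<and> P' (snd z)"
proof -
  interpret Q: finite_measure Q by fact
  interpret Q': finite_measure Q' by fact
  interpret QQ: pair_sigma_finite Q Q' ..
  note [measurable] = P(2) P'(2)
  show ?thesis
  proof (rule QQ.AE_pair_measure)
    show "{x \<in> space (Q \<Otimes>\<^sub>M Q'). P (fst x) \<and> P' (snd x)} \<in> sets (Q \<Otimes>\<^sub>M Q')" by measurable
    show "AE x in Q. AE y in Q'. P (fst (x, y)) \<and> P' (snd (x, y))"
      using P(1) by eventually_elim (use P'(1) in auto)
  qed
qed

lemma plim_avg_AE:
  assumes r: "rep F Q \<pi> \<Theta>" and r': "rep G Q' \<pi>' \<Theta>'" and y: "y \<in> space W"
    and c: "AE u in Q. cvg (cf (\<pi> u)) y" and c': "AE v in Q'. cvg (cf (\<pi>' v)) y"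
  shows "AE z in Q \<Otimes>\<^sub>M Q'. cvg (cf (\<pi> (fst z))) y \<and> cvg (cf (\<pi>' (snd z))) y \<and>
     plim (cf (avg \<pi> \<pi>' z)) y = 1 / sqrt 2 * plim (cf (\<pi> (fst z))) y + 1 / sqrt 2 * plim (cf (\<pi>' (snd z))) y"
proof -
  have Q: "finite_measure Q" "finite_measure Q'" "\<pi> \<in> Q \<rightarrow>\<^sub>M L2" "\<pi>' \<in> Q' \<rightarrow>\<^sub>M L2" using r r' by (auto simp: rep_def)
  have "Measurable.pred Q (\<lambda>u. cvg (cf (\<pi> u)) y)" "Measurable.pred Q' (\<lambda>v. cvg (cf (\<pi>' v)) y)"
    using y by (auto intro!: plim_pair_measurable(2) measurable_compose[OF Q(3) measurable_cf] measurable_compose[OF Q(4) measurable_cf])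
  from AE_pair_fst_snd[OF Q(1,2) c this(1) c' this(2)] AE_space show ?thesis
  proof eventually_elim
    case (elim z)
    then have s: "sqi \<mu> (\<pi> (fst z))" "sqi \<mu> (\<pi>' (snd z))"
      using rep_sqi[OF r] rep_sqi[OF r'] by (auto simp: space_pair_measure)
    show ?case unfolding cf_avg(1)[where \<pi> = \<pi> and \<pi>' = \<pi>', OF s] using elim plim_combine by blast
  qed
qed

text \<open>The product of two integrals is an integral over the product measure. Its exponentials
  merge into the one for \<open>avg\<close> where both series converge, and for s-a.e. path that is
  almost every pair.\<close>

lemma rep_scaled_product:
  assumes r: "rep F Q \<pi> \<Theta>" and r': "rep G Q' \<pi>' \<Theta>'"
  shows "rep (scaled_product F G) (Q \<Otimes>\<^sub>M Q') (avg \<pi> \<pi>') (\<lambda>z. \<Theta> (fst z) * \<Theta>' (snd z))"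
  unfolding rep_def
proof (intro conjI)
  have Q: "finite_measure Q" "finite_measure Q'" "\<pi> \<in> Q \<rightarrow>\<^sub>M L2" "\<pi>' \<in> Q' \<rightarrow>\<^sub>M L2"
    "integrable Q \<Theta>" "integrable Q' \<Theta>'" using r r' by (auto simp: rep_def)
  show "finite_measure (Q \<Otimes>\<^sub>M Q')" by (rule finite_measure_pair_measure[OF Q(2,1)])
  show "integrable (Q \<Otimes>\<^sub>M Q') (\<lambda>z. \<Theta> (fst z) * \<Theta>' (snd z))" by (rule product_integral(1)[OF Q(1,2,5,6)])
  have s: "sqi \<mu> (\<pi> (fst z))" "sqi \<mu> (\<pi>' (snd z))" if "z \<in> space (Q \<Otimes>\<^sub>M Q')" for z
    using rep_sqi[OF r] rep_sqi[OF r'] that by (auto simp: space_pair_measure)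
  have [measurable]: "(\<lambda>z. cf (\<pi> z) j) \<in> borel_measurable Q" "(\<lambda>z. cf (\<pi>' z) j) \<in> borel_measurable Q'" for j
    by (rule measurable_compose[OF Q(3) measurable_cf], rule measurable_compose[OF Q(4) measurable_cf])
  show avg_m: "avg \<pi> \<pi>' \<in> Q \<Otimes>\<^sub>M Q' \<rightarrow>\<^sub>M L2"
  proof (rule measurable_L2_borelI)
    show "sqi \<mu> (avg \<pi> \<pi>' z)" if "z \<in> space (Q \<Otimes>\<^sub>M Q')" for z by (rule cf_avg(2)[where \<pi> = \<pi> and \<pi>' = \<pi>', OF s[OF that]])
    have "(\<lambda>z. 1 / sqrt 2 * cf (\<pi> (fst z)) j + 1 / sqrt 2 * cf (\<pi>' (snd z)) j) \<in> borel_measurable (Q \<Otimes>\<^sub>M Q')" for j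
      by measurable
    then show "(\<lambda>z. cf (avg \<pi> \<pi>' z) j) \<in> borel_measurable (Q \<Otimes>\<^sub>M Q')" for j
      by (rule measurable_cong[THEN iffD1, rotated]) (simp add: cf_avg(1)[where \<pi> = \<pi> and \<pi>' = \<pi>', OF s])
  qed
  have "sae m (\<lambda>x. F (\<lambda>p. x p / sqrt 2) = (LINT z|Q. iexp (pwz S T \<phi> (\<pi> z) (\<lambda>p. x p / sqrt 2)) * \<Theta> z))"
    "sae m (\<lambda>x. G (\<lambda>p. x p / sqrt 2) = (LINT z|Q'. iexp (pwz S T \<phi> (\<pi>' z) (\<lambda>p. x p / sqrt 2)) * \<Theta>' z))"
    using r r' by (auto simp: rep_def intro: sae_rescale[where c = "sqrt 2"])
  from sae_conj[OF sae_conj[OF this] sae_conj[OF sae_cvg[OF Q(1,3)] sae_cvg[OF Q(2,4)]]]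
  show "sae m (\<lambda>x. scaled_product F G x = (LINT z|(Q \<Otimes>\<^sub>M Q'). iexp (pwz S T \<phi> (avg \<pi> \<pi>' z) x) * (\<Theta> (fst z) * \<Theta>' (snd z))))"
  proof (rule sae_mono)
    fix x assume x: "x \<in> space W"
    assume *: "(F (\<lambda>p. x p / sqrt 2) = (LINT z|Q. iexp (pwz S T \<phi> (\<pi> z) (\<lambda>p. x p / sqrt 2)) * \<Theta> z) \<and>
      G (\<lambda>p. x p / sqrt 2) = (LINT z|Q'. iexp (pwz S T \<phi> (\<pi>' z) (\<lambda>p. x p / sqrt 2)) * \<Theta>' z)) \<and>
      (AE z in Q. cvg (cf (\<pi> z)) x) \<and> (AE z in Q'. cvg (cf (\<pi>' z)) x)"
    define x' where "x' = (\<lambda>p. x p / sqrt 2)"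
    have x': "x' \<in> space W" using C0_scale[OF x, of "1 / sqrt 2"] by (simp add: x'_def)
    have sc: "plim c x' = 1 / sqrt 2 * plim c x" if "cvg c x" for c
      using cvg_scale(2)[OF x that, of "1 / sqrt 2"] by (simp add: x'_def)
    have i: "integrable Q (\<lambda>z. iexp (plim (cf (\<pi> z)) x') * \<Theta> z)" "integrable Q' (\<lambda>z. iexp (plim (cf (\<pi>' z)) x') * \<Theta>' z)"
      using integrable_wave[OF r bdd_meas_one x' Q(5), of 1] integrable_wave[OF r' bdd_meas_one x' Q(6), of 1] by simp_all
    have "scaled_product F G x = (LINT z|Q. iexp (plim (cf (\<pi> z)) x') * \<Theta> z) * (LINT z|Q'. iexp (plim (cf (\<pi>' z)) x') * \<Theta>' z)"
      using * unfolding scaled_product_def x'_def[symmetric] pwz_plim[OF x'] by simp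
    also have "\<dots> = (LINT z|(Q \<Otimes>\<^sub>M Q'). (iexp (plim (cf (\<pi> (fst z))) x') * \<Theta> (fst z)) * (iexp (plim (cf (\<pi>' (snd z))) x') * \<Theta>' (snd z)))"
      by (rule product_integral(2)[OF Q(1,2) i, symmetric])
    also have "\<dots> = (LINT z|(Q \<Otimes>\<^sub>M Q'). iexp (plim (cf (avg \<pi> \<pi>' z)) x) * (\<Theta> (fst z) * \<Theta>' (snd z)))"
    proof (rule integral_cong_AE)
      show "AE z in Q \<Otimes>\<^sub>M Q'. (iexp (plim (cf (\<pi> (fst z))) x') * \<Theta> (fst z)) * (iexp (plim (cf (\<pi>' (snd z))) x') * \<Theta>' (snd z))
         = iexp (plim (cf (avg \<pi> \<pi>' z)) x) * (\<Theta> (fst z) * \<Theta>' (snd z))"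
        using plim_avg_AE[OF r r' x conjunct1[OF conjunct2[OF *]] conjunct2[OF conjunct2[OF *]]]
      proof (rule eventually_mono, elim conjE)
        fix z assume e: "cvg (cf (\<pi> (fst z))) x" "cvg (cf (\<pi>' (snd z))) x"
          "plim (cf (avg \<pi> \<pi>' z)) x = 1 / sqrt 2 * plim (cf (\<pi> (fst z))) x + 1 / sqrt 2 * plim (cf (\<pi>' (snd z))) x"
        show "(iexp (plim (cf (\<pi> (fst z))) x') * \<Theta> (fst z)) * (iexp (plim (cf (\<pi>' (snd z))) x') * \<Theta>' (snd z))
         = iexp (plim (cf (avg \<pi> \<pi>' z)) x) * (\<Theta> (fst z) * \<Theta>' (snd z))"
          unfolding e(3) sc[OF e(1)] sc[OF e(2)] of_real_add distrib_left exp_add by (simp only: mult_ac)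
      qed
      show "(\<lambda>z. (iexp (plim (cf (\<pi> (fst z))) x') * \<Theta> (fst z)) * (iexp (plim (cf (\<pi>' (snd z))) x') * \<Theta>' (snd z))) \<in> borel_measurable (Q \<Otimes>\<^sub>M Q')"
        using product_integral(1)[OF Q(1,2) i] by auto
      have [measurable]: "(\<lambda>z. plim (cf (avg \<pi> \<pi>' z)) x) \<in> borel_measurable (Q \<Otimes>\<^sub>M Q')"
        by (rule plim_pair_measurable(1)) (use x measurable_compose[OF avg_m measurable_cf] in auto)
      have [measurable]: "\<Theta> \<in> borel_measurable Q" "\<Theta>' \<in> borel_measurable Q'" using Q by auto
      show "(\<lambda>z. iexp (plim (cf (avg \<pi> \<pi>' z)) x) * (\<Theta> (fst z) * \<Theta>' (snd z))) \<in> borel_measurable (Q \<Otimes>\<^sub>M Q')" by measurable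
    qed
    finally show "scaled_product F G x = (LINT z|(Q \<Otimes>\<^sub>M Q'). iexp (pwz S T \<phi> (avg \<pi> \<pi>' z) x) * (\<Theta> (fst z) * \<Theta>' (snd z)))"
      unfolding pwz_plim[OF x] .
  qed
qed

lemma rep_measurable_qf_diff:
  assumes r: "rep F Q \<pi> \<Theta>" and r': "rep G Q' \<pi>' \<Theta>'" and k: "bdd_meas S T k1" "bdd_meas S T k2"
  shows "(\<lambda>z. qf (\<lambda>p. \<pi> (fst z) p * k1 p - \<pi>' (snd z) p * k2 p)) \<in> borel_measurable (Q \<Otimes>\<^sub>M Q')"
  unfolding qf_def
proof (rule measurable_ip_L2)
  have s: "sqi \<mu> (\<lambda>p. \<pi> (fst z) p * k1 p)" "sqi \<mu> (\<lambda>p. \<pi>' (snd z) p * k2 p)" if "z \<in> space (Q \<Otimes>\<^sub>M Q')" for z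
    using summable_cf_mult[OF rep_sqi[OF r] k(1)] summable_cf_mult[OF rep_sqi[OF r'] k(2)] that
    by (auto simp: space_pair_measure)
  note [measurable] = rep_measurable_cf[OF r k(1)] rep_measurable_cf[OF r' k(2)]
  show "sqi \<mu> (\<lambda>p. \<pi> (fst z) p * k1 p - \<pi>' (snd z) p * k2 p)" if "z \<in> space (Q \<Otimes>\<^sub>M Q')" for z
    using s[OF that] by (rule sqi_diff)
  have "(\<lambda>z. cf (\<lambda>p. \<pi> (fst z) p * k1 p) j - cf (\<lambda>p. \<pi>' (snd z) p * k2 p) j) \<in> borel_measurable (Q \<Otimes>\<^sub>M Q')" for j
    by measurable
  then show "(\<lambda>z. cf (\<lambda>p. \<pi> (fst z) p * k1 p - \<pi>' (snd z) p * k2 p) j) \<in> borel_measurable (Q \<Otimes>\<^sub>M Q')" for j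
    by (rule measurable_cong[THEN iffD1, rotated]) (simp add: cf_diff[OF s])
qed

text \<open>For fixed \<open>x\<close> the two path evaluations combine to one integral over the
  product space. With \<open>c = l powr (- 1 / 2) / sqrt 2\<close> the phase has variance
  \<open>qf\<close> of the difference over \<open>2 * l\<close>; the further half in the exponent of
  the Gaussian characteristic function gives the 4.\<close>

theorem conv_rep:
  assumes r: "rep F Q \<pi> \<Theta>" and r': "rep G Q' \<pi>' \<Theta>'" and k: "bdd_meas S T k1" "bdd_meas S T k2" and q: "q \<noteq> 0" and y: "y \<in> space W"
  shows "has_conv_product S T \<phi> m q k1 k2 F G y
     (LINT z|(Q \<Otimes>\<^sub>M Q'). iexp (- (qf (\<lambda>p. \<pi> (fst z) p * k1 p - \<pi>' (snd z) p * k2 p) / 4 / q)) *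
        ((iexp (1 / sqrt 2 * plim (cf (\<pi> (fst z))) y) * \<Theta> (fst z)) * (iexp (1 / sqrt 2 * plim (cf (\<pi>' (snd z))) y) * \<Theta>' (snd z))))"
  unfolding has_conv_product_def
proof (intro conjI rep_S_class[OF r] rep_S_class[OF r'])
  let ?Q = "Q \<Otimes>\<^sub>M Q'"
  have Q: "finite_measure Q" "finite_measure Q'" "integrable Q \<Theta>" "integrable Q' \<Theta>'" using r r' by (auto simp: rep_def)
  have QQ: "finite_measure ?Q" by (rule finite_measure_pair_measure[OF Q(2,1)])
  define \<theta> where "\<theta> u = iexp (1 / sqrt 2 * plim (cf (\<pi> u)) y) * \<Theta> u" for u
  define \<theta>' where "\<theta>' u = iexp (1 / sqrt 2 * plim (cf (\<pi>' u)) y) * \<Theta>' u" for u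
  have \<theta>: "integrable Q \<theta>" "integrable Q' \<theta>'"
    unfolding \<theta>_def \<theta>'_def
    using integrable_wave[OF r bdd_meas_one y Q(3), of "1 / sqrt 2"] integrable_wave[OF r' bdd_meas_one y Q(4), of "1 / sqrt 2"] by simp_all
  have \<theta>\<theta>: "integrable ?Q (\<lambda>z. \<theta> (fst z) * \<theta>' (snd z))" by (rule product_integral(1)[OF Q(1,2) \<theta>])
  have s: "sqi \<mu> (\<lambda>p. \<pi> (fst z) p * k1 p)" "sqi \<mu> (\<lambda>p. \<pi>' (snd z) p * k2 p)"
    "summable (\<lambda>j. (cf (\<lambda>p. \<pi> (fst z) p * k1 p) j)\<^sup>2)" "summable (\<lambda>j. (cf (\<lambda>p. \<pi>' (snd z) p * k2 p) j)\<^sup>2)"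
    if "z \<in> space ?Q" for z
    using summable_cf_mult[OF rep_sqi[OF r] k(1)] summable_cf_mult[OF rep_sqi[OF r'] k(2)] that
    by (auto simp: space_pair_measure)
  note [measurable] = rep_measurable_cf[OF r k(1)] rep_measurable_cf[OF r' k(2)]
  define A where "A z = qf (\<lambda>p. \<pi> (fst z) p * k1 p - \<pi>' (snd z) p * k2 p) / 4" for z
  have cfd: "cf (\<lambda>p. \<pi> (fst z) p * k1 p - \<pi>' (snd z) p * k2 p) j
     = cf (\<lambda>p. \<pi> (fst z) p * k1 p) j - cf (\<lambda>p. \<pi>' (snd z) p * k2 p) j" if "z \<in> space ?Q" for z j
    using s[OF that] by (intro cf_diff)
  show "analytic_limit m
       (\<lambda>l x. eval_path S T \<phi> m F (1 / sqrt 2) y (l powr (-1/2) / sqrt 2) k1 x *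
              eval_path S T \<phi> m G (1 / sqrt 2) y (- (l powr (-1/2)) / sqrt 2) k2 x) q
     (LINT z|?Q. iexp (- (qf (\<lambda>p. \<pi> (fst z) p * k1 p - \<pi>' (snd z) p * k2 p) / 4 / q)) *
        ((iexp (1 / sqrt 2 * plim (cf (\<pi> (fst z))) y) * \<Theta> (fst z)) * (iexp (1 / sqrt 2 * plim (cf (\<pi>' (snd z))) y) * \<Theta>' (snd z))))"
    unfolding \<theta>_def[symmetric] \<theta>'_def[symmetric] A_def[symmetric]
  proof (rule analytic_limit_gauss[OF \<theta>\<theta> _ _ _ _ q])
    show "A \<in> borel_measurable ?Q" unfolding A_def using rep_measurable_qf_diff[OF r r' k] by measurable
    show "0 \<le> A z" for z using qf_nonneg by (simp add: A_def)
    fix l :: real assume l: "l > 0"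
    define c where "c = l powr (- 1 / 2) / sqrt 2"
    have c2: "c\<^sup>2 = 1 / l / 2" unfolding c_def using powr_neg_half_sq[OF l] by (simp add: power_divide)
    define R where "R zx = c * plim (cf (\<lambda>p. \<pi> (fst (fst zx)) p * k1 p)) (snd zx)
        + (- c) * plim (cf (\<lambda>p. \<pi>' (snd (fst zx)) p * k2 p)) (snd zx)" for zx
    have [measurable]: "(\<lambda>zx. plim (cf (\<lambda>p. \<pi> (fst (fst zx)) p * k1 p)) (snd zx)) \<in> borel_measurable (?Q \<Otimes>\<^sub>M W)"
      "(\<lambda>zx. plim (cf (\<lambda>p. \<pi>' (snd (fst zx)) p * k2 p)) (snd zx)) \<in> borel_measurable (?Q \<Otimes>\<^sub>M W)"
      by (rule plim_pair_measurable(1); measurable)+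
    have Rm: "R \<in> borel_measurable (?Q \<Otimes>\<^sub>M W)" unfolding R_def by measurable
    have J: "eval_path S T \<phi> m F (1 / sqrt 2) y (l powr (-1/2) / sqrt 2) k1 x * eval_path S T \<phi> m G (1 / sqrt 2) y (- (l powr (-1/2)) / sqrt 2) k2 x
       = (LINT z|?Q. iexp (R (z, x)) * (\<theta> (fst z) * \<theta>' (snd z)))" if x: "x \<in> space W" for x
    proof -
      have c': "- (l powr (-1/2)) / sqrt 2 = - c" "l powr (-1/2) / sqrt 2 = c" by (simp_all add: c_def)
      have "eval_path S T \<phi> m F (1 / sqrt 2) y c k1 x * eval_path S T \<phi> m G (1 / sqrt 2) y (- c) k2 x
        = (LINT z|?Q. (iexp (c * plim (cf (\<lambda>p. \<pi> (fst z) p * k1 p)) x) * \<theta> (fst z)) * (iexp ((- c) * plim (cf (\<lambda>p. \<pi>' (snd z) p * k2 p)) x) * \<theta>' (snd z)))"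
        unfolding eval_path_rep[OF r k(1) x y] eval_path_rep[OF r' k(2) x y] \<theta>_def[symmetric] \<theta>'_def[symmetric]
        by (rule product_integral(2)[OF Q(1,2) integrable_wave[OF r k(1) x \<theta>(1)] integrable_wave[OF r' k(2) x \<theta>(2)], symmetric])
      also have "\<dots> = (LINT z|?Q. iexp (R (z, x)) * (\<theta> (fst z) * \<theta>' (snd z)))"
        unfolding R_def fst_conv snd_conv of_real_add distrib_left exp_add
        by (intro Bochner_Integration.integral_cong refl) (simp only: mult_ac)
      finally show ?thesis unfolding c' .
    qed
    have E: "(LINT x|W. iexp (R (z, x))) = of_real (exp (- (A z / l)))" if z: "z \<in> space ?Q" for z
    proof -
      let ?d = "\<lambda>p. \<pi> (fst z) p * k1 p - \<pi>' (snd z) p * k2 p"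
      have "(\<lambda>j. c\<^sup>2 * (cf ?d j)\<^sup>2) sums (c\<^sup>2 * qf ?d)"
        unfolding qf_def using s[OF z] by (intro sums_mult parseval sqi_diff)
      moreover have "c\<^sup>2 * (cf ?d j)\<^sup>2 = (c * cf (\<lambda>p. \<pi> (fst z) p * k1 p) j + (- c) * cf (\<lambda>p. \<pi>' (snd z) p * k2 p) j)\<^sup>2" for j
        unfolding cfd[OF z] power_mult_distrib[symmetric] by (simp add: right_diff_distrib)
      ultimately have "(\<Sum>j. (c * cf (\<lambda>p. \<pi> (fst z) p * k1 p) j + (- c) * cf (\<lambda>p. \<pi>' (snd z) p * k2 p) j)\<^sup>2) = c\<^sup>2 * qf ?d"
        by (simp only: sums_iff)
      moreover have "c\<^sup>2 * qf ?d / 2 = A z / l" unfolding c2 A_def by simp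
      ultimately show ?thesis
        unfolding R_def fst_conv snd_conv plim_combine_char[OF s(3,4)[OF z]] by (simp only:)
    qed
    show "integrable m (\<lambda>x. eval_path S T \<phi> m F (1 / sqrt 2) y (l powr (-1/2) / sqrt 2) k1 x * eval_path S T \<phi> m G (1 / sqrt 2) y (- (l powr (-1/2)) / sqrt 2) k2 x)"
      by (rule path_integral(1)[OF QQ Rm \<theta>\<theta> J E])
    show "(LINT x|m. eval_path S T \<phi> m F (1 / sqrt 2) y (l powr (-1/2) / sqrt 2) k1 x * eval_path S T \<phi> m G (1 / sqrt 2) y (- (l powr (-1/2)) / sqrt 2) k2 x)
       = (LINT z|?Q. of_real (exp (- (A z / l))) * (\<theta> (fst z) * \<theta>' (snd z)))"
      by (rule path_integral(2)[OF QQ Rm \<theta>\<theta> J E])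
  qed
qed

text \<open>Pointwise, the squares of \<open>k1\<close> and \<open>k2\<close> cancel against those
  in \<open>s1\<close> and \<open>s2\<close>, and \<open>k1 p * k2 p = (h p)\<^sup>2\<close> turns
  the mixed term into the one needed for
  \<open>(u p + v p)\<^sup>2 * (h p)\<^sup>2 / 4\<close>.\<close>

lemma qf_identity:
  assumes u: "sqi \<mu> u" and v: "sqi \<mu> v"
    and b: "bdd_meas S T h" "bdd_meas S T k1" "bdd_meas S T k2" "bdd_meas S T s1" "bdd_meas S T s2"
    and ae: "AE p in \<mu>. (h p)\<^sup>2 = k1 p * k2 p" "AE p in \<mu>. (s1 p)\<^sup>2 = (h p)\<^sup>2 + (k1 p)\<^sup>2" "AE p in \<mu>. (s2 p)\<^sup>2 = (h p)\<^sup>2 + (k2 p)\<^sup>2"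
  shows "qf (\<lambda>p. u p * (s1 p / sqrt 2)) / 2 + qf (\<lambda>p. v p * (s2 p / sqrt 2)) / 2 - qf (\<lambda>p. u p * k1 p - v p * k2 p) / 4
     = qf (\<lambda>p. (1 / sqrt 2 * u p + 1 / sqrt 2 * v p) * h p) / 2"
proof -
  have b': "bdd_meas S T (\<lambda>p. s1 p / sqrt 2)" "bdd_meas S T (\<lambda>p. s2 p / sqrt 2)"
    using bdd_meas_cmult[OF b(4), of "1 / sqrt 2"] bdd_meas_cmult[OF b(5), of "1 / sqrt 2"] by simp_all
  define a1 where "a1 p = u p * (s1 p / sqrt 2)" for p
  define a2 where "a2 p = v p * (s2 p / sqrt 2)" for p
  define a3 where "a3 p = u p * k1 p - v p * k2 p" for p
  define a4 where "a4 p = (1 / sqrt 2 * u p + 1 / sqrt 2 * v p) * h p" for p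
  have s: "sqi \<mu> a1" "sqi \<mu> a2" "sqi \<mu> a3" "sqi \<mu> a4"
    unfolding a1_def[abs_def] a2_def[abs_def] a3_def[abs_def] a4_def[abs_def]
    by (rule summable_cf_mult(1)[OF u b'(1)], rule summable_cf_mult(1)[OF v b'(2)],
        rule sqi_diff[OF summable_cf_mult(1)[OF u b(2)] summable_cf_mult(1)[OF v b(3)]],
        rule summable_cf_mult(1)[OF sqi_add[OF sqi_cmult[OF u] sqi_cmult[OF v]] b(1)])
  note i = s[THEN sqiD(2)] and [measurable] = s[THEN sqiD(1)]
  have "qf a1 / 2 + qf a2 / 2 - qf a3 / 4 = (LINT p|\<mu>. (a1 p)\<^sup>2 / 2 + (a2 p)\<^sup>2 / 2 - (a3 p)\<^sup>2 / 4)"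
    using i by (simp add: qf_def ip_self)
  also have "\<dots> = (LINT p|\<mu>. (a4 p)\<^sup>2 / 2)"
  proof (rule integral_cong_AE)
    show "AE p in \<mu>. (a1 p)\<^sup>2 / 2 + (a2 p)\<^sup>2 / 2 - (a3 p)\<^sup>2 / 4 = (a4 p)\<^sup>2 / 2"
      using ae
    proof eventually_elim
      case (elim p)
      have "(a1 p)\<^sup>2 = (u p)\<^sup>2 * ((h p)\<^sup>2 + (k1 p)\<^sup>2) / 2" "(a2 p)\<^sup>2 = (v p)\<^sup>2 * ((h p)\<^sup>2 + (k2 p)\<^sup>2) / 2"
        unfolding a1_def a2_def by (simp_all add: power_mult_distrib power_divide elim(2,3))
      moreover have "(a3 p)\<^sup>2 = (u p)\<^sup>2 * (k1 p)\<^sup>2 + (v p)\<^sup>2 * (k2 p)\<^sup>2 - 2 * (u p * v p) * (h p)\<^sup>2"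
        unfolding a3_def elim(1) by (simp add: power2_eq_square algebra_simps)
      moreover have "(a4 p)\<^sup>2 = ((u p)\<^sup>2 + (v p)\<^sup>2 + 2 * (u p * v p)) * (h p)\<^sup>2 / 2"
      proof -
        have "a4 p = ((u p + v p) * h p) / sqrt 2" by (simp add: a4_def add_divide_distrib distrib_right)
        then have "(a4 p)\<^sup>2 = ((u p + v p) * h p)\<^sup>2 / 2" by (simp add: power_divide)
        then show ?thesis by (simp add: power_mult_distrib power2_sum)
      qed
      ultimately show ?case by (simp add: field_simps)
    qed
  qed measurable
  also have "\<dots> = qf a4 / 2" by (simp add: qf_def ip_self)
  finally show ?thesis unfolding a1_def[abs_def] a2_def[abs_def] a3_def[abs_def] a4_def[abs_def] .
qed

theorem convolution_of_transforms:
  assumes F: "represents S T \<phi> m f F" and G: "represents S T \<phi> m g G"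
    and b: "bdd_meas S T h" "bdd_meas S T k1" "bdd_meas S T k2" "bdd_meas S T s1" "bdd_meas S T s2"
    and ae: "AE p in \<mu>. (h p)\<^sup>2 = k1 p * k2 p" "AE p in \<mu>. (s1 p)\<^sup>2 = (h p)\<^sup>2 + (k1 p)\<^sup>2" "AE p in \<mu>. (s2 p)\<^sup>2 = (h p)\<^sup>2 + (k2 p)\<^sup>2"
    and q: "q \<noteq> 0"
  shows "sae m (transform_exists S T \<phi> m q (\<lambda>p. s1 p / sqrt 2) F) \<and>
          sae m (transform_exists S T \<phi> m q (\<lambda>p. s2 p / sqrt 2) G) \<and>
          sae m (\<lambda>y.
            conv_product_exists S T \<phi> m (- q) k1 k2
              (transform S T \<phi> m q (\<lambda>p. s1 p / sqrt 2) F)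
              (transform S T \<phi> m q (\<lambda>p. s2 p / sqrt 2) G) y \<and>
            transform_exists S T \<phi> m q h (scaled_product F G) y \<and>
            conv_product S T \<phi> m (- q) k1 k2
              (transform S T \<phi> m q (\<lambda>p. s1 p / sqrt 2) F)
              (transform S T \<phi> m q (\<lambda>p. s2 p / sqrt 2) G) y
            = transform S T \<phi> m q h (scaled_product F G) y)"
proof -
  obtain Q \<Theta> where r: "rep F Q (\<lambda>u. u) \<Theta>" using represents_rep[OF F] .
  obtain Q' \<Theta>' where r': "rep G Q' (\<lambda>u. u) \<Theta>'" using represents_rep[OF G] .
  let ?Q = "Q \<Otimes>\<^sub>M Q'"
  have Q: "finite_measure Q" "finite_measure Q'" "(\<lambda>u. u) \<in> Q \<rightarrow>\<^sub>M L2" "(\<lambda>u. u) \<in> Q' \<rightarrow>\<^sub>M L2"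
    using r r' by (auto simp: rep_def)
  have b': "bdd_meas S T (\<lambda>p. s1 p / sqrt 2)" "bdd_meas S T (\<lambda>p. s2 p / sqrt 2)"
    using bdd_meas_cmult[OF b(4), of "1 / sqrt 2"] bdd_meas_cmult[OF b(5), of "1 / sqrt 2"] by simp_all
  have q': "- q \<noteq> 0" using q by simp
  note conv = conv_rep[OF rep_transform[OF r b'(1) q] rep_transform[OF r' b'(2) q] b(2,3) q']
  note trans = transform_rep[OF rep_scaled_product[OF r r'] b(1) q]
  have "sae m (\<lambda>y. (AE u in Q. cvg (cf u) y) \<and> (AE u in Q'. cvg (cf u) y))"
    by (rule sae_conj[OF sae_cvg[OF Q(1,3)] sae_cvg[OF Q(2,4)]])
  then have "sae m (\<lambda>y.
            conv_product_exists S T \<phi> m (- q) k1 k2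
              (transform S T \<phi> m q (\<lambda>p. s1 p / sqrt 2) F)
              (transform S T \<phi> m q (\<lambda>p. s2 p / sqrt 2) G) y \<and>
            transform_exists S T \<phi> m q h (scaled_product F G) y \<and>
            conv_product S T \<phi> m (- q) k1 k2
              (transform S T \<phi> m q (\<lambda>p. s1 p / sqrt 2) F)
              (transform S T \<phi> m q (\<lambda>p. s2 p / sqrt 2) G) y
            = transform S T \<phi> m q h (scaled_product F G) y)"
  proof (rule sae_mono, elim conjE, intro conjI)
    fix y assume y: "y \<in> space W" and c: "AE u in Q. cvg (cf u) y" "AE u in Q'. cvg (cf u) y"
    show "conv_product_exists S T \<phi> m (- q) k1 k2 (transform S T \<phi> m q (\<lambda>p. s1 p / sqrt 2) F)
              (transform S T \<phi> m q (\<lambda>p. s2 p / sqrt 2) G) y"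
      unfolding conv_product_exists_def using conv[OF y] by blast
    show "transform_exists S T \<phi> m q h (scaled_product F G) y"
      unfolding transform_exists_def using trans[OF y] by blast
    have i1: "integrable ?Q (\<lambda>z. \<Theta> (fst z) * \<Theta>' (snd z))"
      using rep_scaled_product[OF r r'] by (simp add: rep_def)
    show "conv_product S T \<phi> m (- q) k1 k2 (transform S T \<phi> m q (\<lambda>p. s1 p / sqrt 2) F)
              (transform S T \<phi> m q (\<lambda>p. s2 p / sqrt 2) G) y = transform S T \<phi> m q h (scaled_product F G) y"
      \<comment> \<open>All phases are collected, so that both sides carry the same density and only
        the real exponents remain to be compared.\<close>
      unfolding has_conv_product_unique[OF conv[OF y]] has_transform_unique[OF trans[OF y]] iexp_sum4
      unfolding iexp_sum2
    proof (rule integral_cong_AE)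
      have [measurable]: "\<Theta> \<in> borel_measurable Q" "\<Theta>' \<in> borel_measurable Q'" using r r' by (auto simp: rep_def)
      note [measurable] = rep_measurable_qf[OF r b'(1)] rep_measurable_qf[OF r' b'(2)]
        rep_measurable_qf_diff[OF r r' b(2,3)] rep_measurable_qf[OF rep_scaled_product[OF r r'] b(1)]
      have pm: "(\<lambda>z. plim (cf (\<pi> z)) y) \<in> borel_measurable K" if "\<pi> \<in> K \<rightarrow>\<^sub>M L2" for K and \<pi> :: "'k \<Rightarrow> _"
        by (rule plim_pair_measurable(1)) (use y measurable_compose[OF that measurable_cf] in auto)
      have [measurable]: "(\<lambda>u. plim (cf u) y) \<in> borel_measurable Q" "(\<lambda>u. plim (cf u) y) \<in> borel_measurable Q'"
        by (rule pm[OF Q(3)], rule pm[OF Q(4)])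
      have [measurable]: "(\<lambda>z. plim (cf (avg (\<lambda>u. u) (\<lambda>u. u) z)) y) \<in> borel_measurable ?Q"
        using rep_scaled_product[OF r r'] by (intro pm) (simp add: rep_def)
      show "(\<lambda>z. iexp (- (qf (\<lambda>p. fst z p * k1 p - snd z p * k2 p) / 4 / - q) + - (qf (\<lambda>p. fst z p * (s1 p / sqrt 2)) / 2 / q)
          + 1 / sqrt 2 * plim (cf (fst z)) y + - (qf (\<lambda>p. snd z p * (s2 p / sqrt 2)) / 2 / q) + 1 / sqrt 2 * plim (cf (snd z)) y)
          * (\<Theta> (fst z) * \<Theta>' (snd z))) \<in> borel_measurable ?Q" by measurable
      show "(\<lambda>z. iexp (- (qf (\<lambda>p. avg (\<lambda>u. u) (\<lambda>u. u) z p * h p) / 2 / q) + 1 * plim (cf (avg (\<lambda>u. u) (\<lambda>u. u) z)) y)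
          * (\<Theta> (fst z) * \<Theta>' (snd z))) \<in> borel_measurable ?Q" by measurable
      show "AE z in ?Q. iexp (- (qf (\<lambda>p. fst z p * k1 p - snd z p * k2 p) / 4 / - q) + - (qf (\<lambda>p. fst z p * (s1 p / sqrt 2)) / 2 / q)
          + 1 / sqrt 2 * plim (cf (fst z)) y + - (qf (\<lambda>p. snd z p * (s2 p / sqrt 2)) / 2 / q) + 1 / sqrt 2 * plim (cf (snd z)) y)
          * (\<Theta> (fst z) * \<Theta>' (snd z))
        = iexp (- (qf (\<lambda>p. avg (\<lambda>u. u) (\<lambda>u. u) z p * h p) / 2 / q) + 1 * plim (cf (avg (\<lambda>u. u) (\<lambda>u. u) z)) y)
          * (\<Theta> (fst z) * \<Theta>' (snd z))"
        using plim_avg_AE[OF r r' y c] AE_space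
      proof eventually_elim
        case (elim z)
        have sz: "sqi \<mu> (fst z)" "sqi \<mu> (snd z)"
          using elim(2) rep_sqi[OF r] rep_sqi[OF r'] by (auto simp: space_pair_measure)
        define X where "X = qf (\<lambda>p. fst z p * (s1 p / sqrt 2))"
        define Y where "Y = qf (\<lambda>p. snd z p * (s2 p / sqrt 2))"
        define Z where "Z = qf (\<lambda>p. fst z p * k1 p - snd z p * k2 p)"
        define V where "V = qf (\<lambda>p. avg (\<lambda>u. u) (\<lambda>u. u) z p * h p)"
        have "X / 2 + Y / 2 - Z / 4 = V / 2"
          unfolding X_def Y_def Z_def V_def avg_def by (rule qf_identity[OF sz b ae])
        then have "Z / 4 - X / 2 - Y / 2 = - (V / 2)" by linarith
        moreover have "- (Z / 4 / - q) + - (X / 2 / q) + - (Y / 2 / q) = (Z / 4 - X / 2 - Y / 2) / q"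
          by (simp add: diff_divide_distrib)
        ultimately have "- (Z / 4 / - q) + - (X / 2 / q) + - (Y / 2 / q) = - (V / 2 / q)" by simp
        then have "- (Z / 4 / - q) + - (X / 2 / q) + 1 / sqrt 2 * plim (cf (fst z)) y + - (Y / 2 / q) + 1 / sqrt 2 * plim (cf (snd z)) y
           = - (V / 2 / q) + 1 * plim (cf (avg (\<lambda>u. u) (\<lambda>u. u) z)) y"
          using elim(1) by linarith
        then show ?case unfolding X_def Y_def Z_def V_def by (simp only:)
      qed
    qed
  qed
  moreover have "sae m (transform_exists S T \<phi> m q (\<lambda>p. s1 p / sqrt 2) F)"
    by (rule sae_all, unfold transform_exists_def, rule exI, rule transform_rep[OF r b'(1) q])
  moreover have "sae m (transform_exists S T \<phi> m q (\<lambda>p. s2 p / sqrt 2) G)"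
    by (rule sae_all, unfold transform_exists_def, rule exI, rule transform_rep[OF r' b'(2) q])
  ultimately show ?thesis by blast
qed

end

theorem theorem6p10:
  fixes S T :: real
    and \<phi> :: "nat \<Rightarrow> real \<times> real \<Rightarrow> real"
    and m :: "(real \<times> real \<Rightarrow> real) measure"
    and h :: "real \<times> real \<Rightarrow> real"
    and F G :: "(real \<times> real \<Rightarrow> real) \<Rightarrow> complex"
    and f g :: "(real \<times> real \<Rightarrow> real) set \<Rightarrow> complex"
  assumes "S > 0" and "T > 0"
    and "bv_complete_orthonormal S T \<phi>"
    and "yeh_wiener S T m"
    and "h \<in> Supp_BV S T"
    and "represents S T \<phi> m f F" and "represents S T \<phi> m g G"
  shows
    "(\<forall>k1 \<in> Supp_BV S T. \<forall>k2 \<in> Supp_BV S T. \<forall>s1 \<in> Supp_BV S T. \<forall>s2 \<in> Supp_BV S T.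
        (AE p in leb S T. (h p)\<^sup>2 = k1 p * k2 p) \<longrightarrow>
        (AE p in leb S T. (s1 p)\<^sup>2 = (h p)\<^sup>2 + (k1 p)\<^sup>2) \<longrightarrow>
        (AE p in leb S T. (s2 p)\<^sup>2 = (h p)\<^sup>2 + (k2 p)\<^sup>2) \<longrightarrow>
        (\<forall>q::real. q \<noteq> 0 \<longrightarrow>
          sae m (transform_exists S T \<phi> m q (\<lambda>p. s1 p / sqrt 2) F) \<and>
          sae m (transform_exists S T \<phi> m q (\<lambda>p. s2 p / sqrt 2) G) \<and>
          sae m (\<lambda>y.
            conv_product_exists S T \<phi> m (- q) k1 k2
              (transform S T \<phi> m q (\<lambda>p. s1 p / sqrt 2) F)
              (transform S T \<phi> m q (\<lambda>p. s2 p / sqrt 2) G) y \<and>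
            transform_exists S T \<phi> m q h (scaled_product F G) y \<and>
            conv_product S T \<phi> m (- q) k1 k2
              (transform S T \<phi> m q (\<lambda>p. s1 p / sqrt 2) F)
              (transform S T \<phi> m q (\<lambda>p. s2 p / sqrt 2) G) y
            = transform S T \<phi> m q h (scaled_product F G) y))) \<and>
     (\<forall>q::real. q \<noteq> 0 \<longrightarrow>
          sae m (transform_exists S T \<phi> m q h F) \<and>
          sae m (transform_exists S T \<phi> m q h G) \<and>
          sae m (\<lambda>y.
            conv_product_exists S T \<phi> m (- q) h h
              (transform S T \<phi> m q h F) (transform S T \<phi> m q h G) y \<and>
            transform_exists S T \<phi> m q h (scaled_product F G) y \<and>
            conv_product S T \<phi> m (- q) h h
              (transform S T \<phi> m q h F) (transform S T \<phi> m q h G) y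
            = transform S T \<phi> m q h (scaled_product F G) y))"
proof -
  obtain W where W: "m = completion W" "prob_space W" "space W = C0 S T"
     "sets W = sets (restrict_space (Pi\<^sub>M UNIV (\<lambda>_. borel)) (C0 S T))"
     "\<forall>I a. finite I \<longrightarrow> I \<subseteq> rect S T \<longrightarrow> centered_normal (distr W borel (\<lambda>x. \<Sum>p\<in>I. a p * x p))"
     "\<forall>s\<in>{0..S}. \<forall>t\<in>{0..T}. \<forall>s'\<in>{0..S}. \<forall>t'\<in>{0..T}. (LINT x|W. x (s, t) * x (s', t')) = min s s' * min t t'"
    using assms(4) unfolding yeh_wiener_def by (elim exE conjE) (rule that)
  interpret yeh_wiener_law S T \<phi> W
  proof (intro yeh_wiener_law.intro l2_rect.intro yeh_wiener_law_axioms.intro)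
    show "centered_normal (distr W borel (\<lambda>x. \<Sum>p\<in>I. a p * x p))" if "finite I" "I \<subseteq> rect S T" for I a
      using W(5) that by blast
    show "(LINT x|W. x (s, t) * x (s', t')) = min s s' * min t t'"
      if "s \<in> {0..S}" "t \<in> {0..T}" "s' \<in> {0..S}" "t' \<in> {0..T}" for s t s' t'
      using W(6) that by blast
  qed (use assms W in auto)
  have hb: "bdd_meas S T h" using assms(5) by (rule Supp_BV_bdd_meas)
  note main = convolution_of_transforms[OF assms(6)[unfolded W(1)] assms(7)[unfolded W(1)]]
  \<comment> \<open>The special case takes \<open>k1 = k2 = h\<close> and
    \<open>s1 = s2 = sqrt 2 * h\<close>; division by \<open>sqrt 2\<close> returns
    \<open>h\<close>.\<close>
  have hh: "(\<lambda>p. sqrt 2 * h p / sqrt 2) = h" by auto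
  have hb2: "bdd_meas S T (\<lambda>p. sqrt 2 * h p)" using hb by (rule bdd_meas_cmult)
  show ?thesis
    unfolding W(1)
  proof (intro conjI allI ballI impI; (elim conjE)?)
    fix k1 k2 s1 s2 and q :: real
    assume "k1 \<in> Supp_BV S T" "k2 \<in> Supp_BV S T" "s1 \<in> Supp_BV S T" "s2 \<in> Supp_BV S T"
      and ae: "AE p in leb S T. (h p)\<^sup>2 = k1 p * k2 p" "AE p in leb S T. (s1 p)\<^sup>2 = (h p)\<^sup>2 + (k1 p)\<^sup>2"
        "AE p in leb S T. (s2 p)\<^sup>2 = (h p)\<^sup>2 + (k2 p)\<^sup>2" and q: "q \<noteq> 0"
    then have b: "bdd_meas S T k1" "bdd_meas S T k2" "bdd_meas S T s1" "bdd_meas S T s2"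
      by (auto intro: Supp_BV_bdd_meas)
    note * = main[OF hb b ae q]
    show "sae (completion W) (transform_exists S T \<phi> (completion W) q (\<lambda>p. s1 p / sqrt 2) F)"
      by (rule conjunct1[OF *])
    show "sae (completion W) (transform_exists S T \<phi> (completion W) q (\<lambda>p. s2 p / sqrt 2) G)"
      by (rule conjunct1[OF conjunct2[OF *]])
    show "sae (completion W) (\<lambda>y.
            conv_product_exists S T \<phi> (completion W) (- q) k1 k2
              (transform S T \<phi> (completion W) q (\<lambda>p. s1 p / sqrt 2) F)
              (transform S T \<phi> (completion W) q (\<lambda>p. s2 p / sqrt 2) G) y \<and>
            transform_exists S T \<phi> (completion W) q h (scaled_product F G) y \<and>
            conv_product S T \<phi> (completion W) (- q) k1 k2
              (transform S T \<phi> (completion W) q (\<lambda>p. s1 p / sqrt 2) F)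
              (transform S T \<phi> (completion W) q (\<lambda>p. s2 p / sqrt 2) G) y
            = transform S T \<phi> (completion W) q h (scaled_product F G) y)"
      by (rule conjunct2[OF conjunct2[OF *]])
  next
    fix q :: real assume q: "q \<noteq> 0"
    have ae: "AE p in leb S T. (h p)\<^sup>2 = h p * h p" "AE p in leb S T. (sqrt 2 * h p)\<^sup>2 = (h p)\<^sup>2 + (h p)\<^sup>2"
      by (auto simp: power_mult_distrib power2_eq_square)
    note * = main[OF hb hb hb hb2 hb2 ae ae(2) q, unfolded hh]
    show "sae (completion W) (transform_exists S T \<phi> (completion W) q h F)"
      by (rule conjunct1[OF *])
    show "sae (completion W) (transform_exists S T \<phi> (completion W) q h G)"
      by (rule conjunct1[OF conjunct2[OF *]])
    show "sae (completion W) (\<lambda>y.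
            conv_product_exists S T \<phi> (completion W) (- q) h h
              (transform S T \<phi> (completion W) q h F) (transform S T \<phi> (completion W) q h G) y \<and>
            transform_exists S T \<phi> (completion W) q h (scaled_product F G) y \<and>
            conv_product S T \<phi> (completion W) (- q) h h
              (transform S T \<phi> (completion W) q h F) (transform S T \<phi> (completion W) q h G) y
            = transform S T \<phi> (completion W) q h (scaled_product F G) y)"
      by (rule conjunct2[OF conjunct2[OF *]])
  qed
qed

end
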